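(* For $(S,s)\in\mathcal{E}$ let $\beta_s:S\to S^s$ be the basepoint changing isomorphism. Both the basepoint changing isomorphism and its inverse are jointly continuous in $s$ and in the point to which they are applied. That is, with respect to the immersive topology on $\mathcal{E}$ (and the subspace topologies from $\mathcal{E}\times\mathcal{E}$), the maps $$\{(s,s')\in\mathcal{E}\times\mathcal{E}:\pi(s)=\pi(s')\}\to\mathcal{E};\quad (s,s')\mapsto\beta_s(s')$$ and $$\{(s,t)\in\mathcal{E}\times\mathcal{E}:\pi(t)=S^s\text{ where }S=\pi(s)\}\to\mathcal{E};\quad (s,t)\mapsto\beta_s^{-1}(t)$$ are continuous.
   Context: Surfaces and translation structures. A surface is a connected oriented 2-manifold without boundary (possibly non-compact). A translation atlas on a surface $X$ is a collection of pairs $(U_j,\phi_j)$ with the $U_j$ open and covering $X$, and $\phi_j:U_j\to\mathbb{R}^2$ orientation preserving local homeomorphisms, such that on overlaps $U_i\cap U_j$ the transition functions $\phi_i\circ\phi_j^{-1}$ are locally restrictions of translations (i.e. $\phi_i-\phi_j$ is locally constant on $U_i\cap U_j$). A translation structure is a pair $(X,\mathcal{A})$ with $\mathcal{A}$ a maximal translation atlas on $X$. A translation isomorphism $(X,\mathcal{A})\to(Y,\mathcal{B})$ is a homeomorphism $h:X\to Y$ with $\mathcal{B}=\{(h(U),\phi\circ h^{-1}):(U,\phi)\in\mathcal{A}\}$. A pointed translation structure is $(X,x_0,\mathcal{A})$ with basepoint $x_0\in X$; an isomorphism of pointed translation structures is a translation isomorphism respecting basepoints. The spaces. $\mathcal{M}$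 is the set of all isomorphism classes $[X,x_0,\mathcal{A}]$ of pointed translation structures. $\mathcal{E}$ is the set of isomorphism classes $[X,x_0,\mathcal{A};x]$ of pointed translation structures with an additional point $x\in X$ (isomorphisms must also carry the additional point to the additional point). The projection $\pi:\mathcal{E}\to\mathcal{M}$ forgets $x$. The fiber of $\pi$ over $[X,x_0,\mathcal{A}]$ is in canonical bijection with $X$ via $x\mapsto[X,x_0,\mathcal{A};x]$ and thus is itself a translation surface $S$ isomorphic to $(X,x_0,\mathcal{A})$, with basepoint denoted $o_S$. One identifies a point of $\mathcal{M}$ with the translation surface $S$ above it; points $s\in S$ are points of $\mathcal{E}$, also written as pairs $(S,s)$. Basepoint change. For $(S,s)\in\mathcal{E}$, $S^s\in\mathcal{M}$ is the translation surface isomorphic to $S$ but with the basepoint relocated to $s$; i.e. if $(S,s)=[X,x_0,\mathcal{A};x]$ then $S^s=[X,x,\mathcal{A}]$. The basepoint changing isomorphism $\beta_s:S\to S^s$ is the translation isomorphism which sends $s\in S$ to the basepoint of $S^s$; i.e. $\beta_s([X,x_0,\mathcal{A};y])=[X,x,\mathcal{A};y]$. Immersions. $PC(S)$ is the collection of path-connected subsets of $S$ containing $o_S$. For $A\in PC(S)$ and $B\subset T$ (with $S,T$ translation surfaces), an immersion of $A$ into $B$ is a continuous map $\iota:A\to B$ with $\iota(o_S)=o_T$ such that each $s\in A$ has a chart $(U,\phi)$ of $S$ with $s\in U$, a chart $(V,\psi)$ of $T$, and a vector $v\in\mathbb{R}^2$ with $\iota(U\cap A)\subset V$ and $\psi\circ\iota(s')=v+\phi(s')$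 for all $s'\in U\cap A$ (charts from the maximal atlases). Immersions are unique when they exist. Write $A\rightsquigarrow B$ if an immersion exists and $A\not\rightsquigarrow B$ otherwise. Disks. An open disk is a path-connected subset of a translation surface, containing the basepoint, homeomorphic to an open disk. A closed disk is a subset of a translation surface homeomorphic to a closed disk and containing the basepoint in its interior; $D^\circ$ denotes the interior of $D$. Immersive topology on $\mathcal{M}$: the coarsest topology in which all the following sets are open: $\{S: D\rightsquigarrow S\}$ for $D$ a closed disk; $\{S: U\not\rightsquigarrow S\}$ for $U$ an open disk; $\mathcal{M}_+(D,U)=\{S:\exists\,\iota:D\rightsquigarrow S\text{ and }o_S\in\iota(U)\}$ for $D$ a closed disk and $U\subset D^\circ$ open; $\mathcal{M}_-(D,K)=\{S:\exists\,\iota:D\rightsquigarrow S\text{ and }o_S\notin\iota(K)\}$ for $D$ a closed disk and $K\subset D$ closed. Immersive topology on $\mathcal{E}$: the coarsest topology such that $\pi:\mathcal{E}\to\mathcal{M}$ is continuous and $\mathcal{E}_+(D,U)=\{(S,s):\exists\,\iota:D\rightsquigarrow S\text{ and }s\in\iota(U)\}$ is open for every closed disk $D$ and open $U\subset D^\circ$. *)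

theory Defs
  imports "HOL-Analysis.Analysis"
begin

section \<open>Translation structures\<close>

type_synonym plane = "real ^ 2"

definition surface :: "'a topology \<Rightarrow> bool" where
  "surface X \<longleftrightarrow>
     topspace X \<noteq> {} \<and> connected_space X \<and> Hausdorff_space X \<and> second_countable X \<and>
     (\<forall>p \<in> topspace X. \<exists>U V. openin X U \<and> p \<in> U \<and> open (V :: plane set) \<and>
        subtopology X U homeomorphic_space top_of_set V)"

text \<open>
  A chart is a pair of an open set and a local homeomorphism from it to the plane; it need not
  be injective. The map is made extensional (it is \<^const>\<open>undefined\<close> off its domain), so that
  charts, and hence atlases, that agree as partial maps are equal.
\<close>

type_synonym 'a chart = "'a set \<times> ('a \<Rightarrow> plane)"

definition is_chart :: "'a topology \<Rightarrow> 'a chart \<Rightarrow> bool" where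
  "is_chart X = (\<lambda>(U, \<phi>).
     openin X U \<and> \<phi> \<in> extensional U \<and>
     (\<forall>p \<in> U. \<exists>W. openin X W \<and> p \<in> W \<and> W \<subseteq> U \<and> open (\<phi> ` W) \<and>
        homeomorphic_map (subtopology X W) (top_of_set (\<phi> ` W)) \<phi>))"

definition charts_compatible :: "'a topology \<Rightarrow> 'a chart \<Rightarrow> 'a chart \<Rightarrow> bool" where
  "charts_compatible X = (\<lambda>(U, \<phi>) (V, \<psi>).
     \<forall>p \<in> U \<inter> V. \<exists>W. openin X W \<and> p \<in> W \<and> W \<subseteq> U \<inter> V \<and>
       (\<forall>q \<in> W. \<phi> q - \<psi> q = \<phi> p - \<psi> p))"

definition translation_atlas :: "'a topology \<Rightarrow> 'a chart set \<Rightarrow> bool" where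
  "translation_atlas X A \<longleftrightarrow>
     (\<forall>c \<in> A. is_chart X c) \<and> (\<Union>c\<in>A. fst c) = topspace X \<and>
     (\<forall>c \<in> A. \<forall>d \<in> A. charts_compatible X c d)"

text \<open>
  No orientation is recorded. Translations preserve orientation, so a translation atlas
  determines exactly one orientation for which its charts preserve orientation, a chart
  compatible with the atlas preserves it too, and a translation isomorphism respects it. Hence
  an oriented surface with an atlas of orientation preserving charts is the same thing as a
  surface with a translation atlas.
\<close>

definition translation_structure :: "'a topology \<Rightarrow> 'a chart set \<Rightarrow> bool" where
  "translation_structure X A \<longleftrightarrow>
     surface X \<and> translation_atlas X A \<and>
     (\<forall>B. translation_atlas X B \<and> A \<subseteq> B \<longrightarrow> B = A)"

text \<open>The chart \<open>(h(U), \<phi> \<circ> h\<^sup>-\<^sup>1)\<close>, for \<open>h\<close> injective on \<open>X\<close>.\<close>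

definition push_chart :: "'a set \<Rightarrow> ('a \<Rightarrow> 'b) \<Rightarrow> 'a chart \<Rightarrow> 'b chart" where
  "push_chart X h = (\<lambda>(U, \<phi>). (h ` U, restrict (\<phi> \<circ> inv_into X h) (h ` U)))"

definition translation_isomorphism ::
    "'a topology \<Rightarrow> 'a chart set \<Rightarrow> 'b topology \<Rightarrow> 'b chart set \<Rightarrow> ('a \<Rightarrow> 'b) \<Rightarrow> bool" where
  "translation_isomorphism X A Y B h \<longleftrightarrow>
     homeomorphic_map X Y h \<and> B = push_chart (topspace X) h ` A"

record 'a pointed_surface =
  top_of :: "'a topology"
  basept :: 'a
  atlas :: "'a chart set"

abbreviation points :: "'a pointed_surface \<Rightarrow> 'a set" where
  "points P \<equiv> topspace (top_of P)"

definition pointed_translation_structure :: "'a pointed_surface \<Rightarrow> bool" where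
  "pointed_translation_structure P \<longleftrightarrow>
     translation_structure (top_of P) (atlas P) \<and> basept P \<in> points P"

definition pointed_isomorphism ::
    "'a pointed_surface \<Rightarrow> 'b pointed_surface \<Rightarrow> ('a \<Rightarrow> 'b) \<Rightarrow> bool" where
  "pointed_isomorphism P Q h \<longleftrightarrow>
     translation_isomorphism (top_of P) (atlas P) (top_of Q) (atlas Q) h \<and>
     h (basept P) = basept Q"

section \<open>The spaces of isomorphism classes\<close>

text \<open>
  A second countable Hausdorff space has at most continuum many points, so every pointed
  translation structure is isomorphic to one whose points are real numbers. The type
  \<^typ>\<open>real\<close> serves only as a universe of labels: the topology on the set of labels is part of
  the structure and has nothing to do with the usual topology of the real line.
\<close>

type_synonym mpoint = "real pointed_surface set"
type_synonym epoint = "(real pointed_surface \<times> real) set"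

definition iso_class :: "real pointed_surface \<Rightarrow> mpoint" where
  "iso_class P = {Q. pointed_translation_structure Q \<and> (\<exists>h. pointed_isomorphism P Q h)}"

definition marked_class :: "real pointed_surface \<Rightarrow> real \<Rightarrow> epoint" where
  "marked_class P x =
     {(Q, y). pointed_translation_structure Q \<and> y \<in> points Q \<and>
        (\<exists>h. pointed_isomorphism P Q h \<and> h x = y)}"

definition moduli :: "mpoint set" where
  "moduli = {iso_class P |P. pointed_translation_structure P}"

definition universal :: "epoint set" where
  "universal = {marked_class P x |P x. pointed_translation_structure P \<and> x \<in> points P}"

text \<open>
  The next three maps are defined by acting on all representatives of a class at once. What
  they do to a class given by a representative is stated in \<open>proj_marked_class\<close>,
  \<open>relocate_marked_class\<close> and \<open>basepoint_change_marked_class\<close> below.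
\<close>

definition proj :: "epoint \<Rightarrow> mpoint" where
  "proj e = fst ` e"

definition relocate :: "epoint \<Rightarrow> mpoint" where
  "relocate e = (\<lambda>(Q, y). Q\<lparr>basept := y\<rparr>) ` e"

definition basepoint_change :: "epoint \<Rightarrow> epoint \<Rightarrow> epoint" where
  "basepoint_change s t = {(Q\<lparr>basept := x\<rparr>, y) |Q x y. (Q, x) \<in> s \<and> (Q, y) \<in> t}"

definition fiber :: "mpoint \<Rightarrow> epoint set" where
  "fiber S = {e \<in> universal. proj e = S}"

definition basepoint_change_inv :: "epoint \<Rightarrow> epoint \<Rightarrow> epoint" where
  "basepoint_change_inv s = inv_into (fiber (proj s)) (basepoint_change s)"

definition transport :: "('a \<Rightarrow> 'b) \<Rightarrow> 'a pointed_surface \<Rightarrow> 'b pointed_surface" where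
  "transport h P =
     \<lparr>top_of = pullback_topology (h ` points P) (inv_into (points P) h) (top_of P),
      basept = h (basept P),
      atlas = push_chart (points P) h ` atlas P\<rparr>"

text \<open>
  The fiber over \<open>S\<close> as a pointed translation surface. The structure does not depend on the
  choice of the representative \<open>P\<close>: see \<open>marked_class_pointed_isomorphism\<close> below. That its points
  are the points of the fiber is \<open>points_surface_over\<close>.
\<close>

definition surface_over :: "mpoint \<Rightarrow> epoint pointed_surface" where
  "surface_over S = (let P = SOME P. P \<in> S in transport (marked_class P) P)"

section \<open>Immersions and disks\<close>

definition PC :: "'a pointed_surface \<Rightarrow> 'a set set" where
  "PC S = {A. path_connectedin (top_of S) A \<and> basept S \<in> A}"

definition is_immersion ::
    "'a pointed_surface \<Rightarrow> 'a set \<Rightarrow> 'b pointed_surface \<Rightarrow> 'b set \<Rightarrow> ('a \<Rightarrow> 'b) \<Rightarrow> bool" where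
  "is_immersion S A T B \<iota> \<longleftrightarrow>
     A \<in> PC S \<and> B \<subseteq> points T \<and>
     continuous_map (subtopology (top_of S) A) (subtopology (top_of T) B) \<iota> \<and>
     \<iota> (basept S) = basept T \<and>
     (\<forall>s \<in> A. \<exists>(U, \<phi>) \<in> atlas S. \<exists>(V, \<psi>) \<in> atlas T. \<exists>v.
        s \<in> U \<and> \<iota> ` (U \<inter> A) \<subseteq> V \<and> (\<forall>s' \<in> U \<inter> A. \<psi> (\<iota> s') = v + \<phi> s'))"

definition open_disk :: "'a pointed_surface \<Rightarrow> 'a set \<Rightarrow> bool" where
  "open_disk S U \<longleftrightarrow>
     U \<in> PC S \<and> subtopology (top_of S) U homeomorphic_space top_of_set (ball (0 :: plane) 1)"

definition closed_disk :: "'a pointed_surface \<Rightarrow> 'a set \<Rightarrow> bool" where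
  "closed_disk S D \<longleftrightarrow>
     D \<subseteq> points S \<and> subtopology (top_of S) D homeomorphic_space top_of_set (cball (0 :: plane) 1) \<and>
     basept S \<in> top_of S interior_of D"

section \<open>The immersive topologies\<close>

text \<open>
  In this section a subset \<open>A\<close> of a translation surface is given together with the point \<open>R\<close> of
  the moduli space whose fiber contains it.
\<close>

abbreviation immerses :: "mpoint \<Rightarrow> epoint set \<Rightarrow> mpoint \<Rightarrow> (epoint \<Rightarrow> epoint) \<Rightarrow> bool" where
  "immerses R A S \<iota> \<equiv>
     is_immersion (surface_over R) A (surface_over S) (points (surface_over S)) \<iota>"

definition M_disk :: "mpoint \<Rightarrow> epoint set \<Rightarrow> mpoint set" where
  "M_disk R D = {S \<in> moduli. \<exists>\<iota>. immerses R D S \<iota>}"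

definition M_not_disk :: "mpoint \<Rightarrow> epoint set \<Rightarrow> mpoint set" where
  "M_not_disk R U = {S \<in> moduli. \<not> (\<exists>\<iota>. immerses R U S \<iota>)}"

definition M_plus :: "mpoint \<Rightarrow> epoint set \<Rightarrow> epoint set \<Rightarrow> mpoint set" where
  "M_plus R D U =
     {S \<in> moduli. \<exists>\<iota>. immerses R D S \<iota> \<and> basept (surface_over S) \<in> \<iota> ` U}"

definition M_minus :: "mpoint \<Rightarrow> epoint set \<Rightarrow> epoint set \<Rightarrow> mpoint set" where
  "M_minus R D K =
     {S \<in> moduli. \<exists>\<iota>. immerses R D S \<iota> \<and> basept (surface_over S) \<notin> \<iota> ` K}"

definition E_plus :: "mpoint \<Rightarrow> epoint set \<Rightarrow> epoint set \<Rightarrow> epoint set" where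
  "E_plus R D U =
     {s \<in> universal. \<exists>\<iota>. immerses R D (proj s) \<iota> \<and> s \<in> \<iota> ` U}"

definition moduli_topology :: "mpoint topology" where
  "moduli_topology = topology_generated_by
     (insert moduli
       ({M_disk R D |R D. R \<in> moduli \<and> closed_disk (surface_over R) D} \<union>
        {M_not_disk R U |R U. R \<in> moduli \<and> open_disk (surface_over R) U} \<union>
        {M_plus R D U |R D U. R \<in> moduli \<and> closed_disk (surface_over R) D \<and>
           openin (top_of (surface_over R)) U \<and> U \<subseteq> top_of (surface_over R) interior_of D} \<union>
        {M_minus R D K |R D K. R \<in> moduli \<and> closed_disk (surface_over R) D \<and>
           closedin (top_of (surface_over R)) K \<and> K \<subseteq> D}))"

definition universal_topology :: "epoint topology" where
  "universal_topology = topology_generated_by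
     ({{e \<in> universal. proj e \<in> W} |W. openin moduli_topology W} \<union>
      {E_plus R D U |R D U. R \<in> moduli \<and> closed_disk (surface_over R) D \<and>
         openin (top_of (surface_over R)) U \<and> U \<subseteq> top_of (surface_over R) interior_of D})"

section \<open>The maps on representatives\<close>

lemma translation_isomorphism_id:
  assumes "translation_atlas X A"
  shows "translation_isomorphism X A X A id"
proof -
  have "push_chart (topspace X) id c = c" if "c \<in> A" for c
  proof -
    obtain U \<phi> where c: "c = (U, \<phi>)" by (cases c)
    have "is_chart X c" using assms that unfolding translation_atlas_def by blast
    then have U: "U \<subseteq> topspace X" and e: "\<phi> \<in> extensional U"
      by (simp_all add: is_chart_def c openin_subset)
    have "restrict (\<phi> \<circ> inv_into (topspace X) id) U = \<phi>"
    proof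
      fix x show "restrict (\<phi> \<circ> inv_into (topspace X) id) U x = \<phi> x"
        using U e inv_into_f_f[of id "topspace X" x]
        by (auto simp: extensional_def restrict_def)
    qed
    then show ?thesis by (simp add: push_chart_def c)
  qed
  then have "push_chart (topspace X) id ` A = A" by force
  then show ?thesis
    unfolding translation_isomorphism_def by (simp add: homeomorphic_map_id)
qed

lemma pointed_isomorphism_id:
  "pointed_translation_structure P \<Longrightarrow> pointed_isomorphism P P id"
  by (simp add: pointed_isomorphism_def pointed_translation_structure_def
      translation_structure_def translation_isomorphism_id)

lemma pointed_isomorphism_points:
  "pointed_isomorphism P Q h \<Longrightarrow> h ` points P = points Q"
  by (simp add: pointed_isomorphism_def translation_isomorphism_def homeomorphic_imp_surjective_map)

lemma pointed_isomorphism_inj: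
  "pointed_isomorphism P Q h \<Longrightarrow> inj_on h (points P)"
  by (auto simp: pointed_isomorphism_def translation_isomorphism_def
      dest: homeomorphic_imp_injective_map)

lemma translation_structure_point_chart:
  assumes "translation_structure X A" "p \<in> topspace X"
  obtains U \<phi> where "(U, \<phi>) \<in> A" "p \<in> U"
  using assms unfolding translation_structure_def translation_atlas_def by force

lemma pointed_isomorphism_unique:
  assumes P: "pointed_translation_structure P"
    and g: "pointed_isomorphism P Q g" and h: "pointed_isomorphism P Q h"
    and Q: "pointed_translation_structure Q" and x: "x \<in> points P"
  shows "g x = h x"
proof -
  define X where "X = top_of P"
  define Y where "Y = top_of Q"
  have cg: "continuous_map X Y g" and ch: "continuous_map X Y h"
    using g h unfolding pointed_isomorphism_def translation_isomorphism_def X_def Y_def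
    by (auto dest: homeomorphic_imp_continuous_map)
  have hm: "homeomorphic_map X Y g" "homeomorphic_map X Y h"
    using g h unfolding pointed_isomorphism_def translation_isomorphism_def X_def Y_def by auto
  have ig: "inj_on g (topspace X)" and ih: "inj_on h (topspace X)"
    using pointed_isomorphism_inj[OF g] pointed_isomorphism_inj[OF h] unfolding X_def by auto
  have tX: "translation_structure X (atlas P)" and tY: "translation_structure Y (atlas Q)"
    using P Q unfolding pointed_translation_structure_def X_def Y_def by auto
  have conn: "connected_space X" and haus: "Hausdorff_space Y"
    using tX tY unfolding translation_structure_def surface_def by auto
  define F where "F = {p \<in> topspace X. g p = h p}"
  have "closedin X F"
    unfolding F_def by (rule closedin_continuous_maps_eq[OF haus cg ch])
  moreover have "openin X F"
  proof (subst openin_subopen, intro ballI)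
    fix p assume "p \<in> F"
    then have p: "p \<in> topspace X" "g p = h p" by (auto simp: F_def)
    obtain U \<phi> where U: "(U, \<phi>) \<in> atlas P" "p \<in> U"
      using translation_structure_point_chart[OF tX p(1)] .
    have at: "translation_atlas X (atlas P)" and atY: "translation_atlas Y (atlas Q)"
      using tX tY unfolding translation_structure_def by auto
    have "is_chart X (U, \<phi>)" using at U unfolding translation_atlas_def by blast
    then have oU: "openin X U" by (simp add: is_chart_def)
    have UX: "U \<subseteq> topspace X" using oU openin_subset by blast
    obtain W where W: "openin X W" "p \<in> W" "W \<subseteq> U" "inj_on \<phi> W"
    proof -
      have "is_chart X (U, \<phi>)" using at U unfolding translation_atlas_def by auto
      then obtain W where "openin X W" "p \<in> W" "W \<subseteq> U"
        "homeomorphic_map (subtopology X W) (top_of_set (\<phi> ` W)) \<phi>"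
        using U unfolding is_chart_def by blast
      moreover from this have "inj_on \<phi> W"
        using homeomorphic_imp_injective_map[of "subtopology X W"] openin_subset[of X W]
        by (simp add: Int_absorb1)
      ultimately show thesis using that by blast
    qed
    have "push_chart (topspace X) g (U, \<phi>) \<in> atlas Q" "push_chart (topspace X) h (U, \<phi>) \<in> atlas Q"
      using g h U unfolding pointed_isomorphism_def translation_isomorphism_def X_def by auto
    then have "charts_compatible Y (push_chart (topspace X) g (U, \<phi>)) (push_chart (topspace X) h (U, \<phi>))"
      using atY unfolding translation_atlas_def by blast
    moreover define \<phi>g where "\<phi>g = restrict (\<phi> \<circ> inv_into (topspace X) g) (g ` U)"
    moreover define \<phi>h where "\<phi>h = restrict (\<phi> \<circ> inv_into (topspace X) h) (h ` U)"
    ultimately have "charts_compatible Y (g ` U, \<phi>g) (h ` U, \<phi>h)"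
      by (simp add: push_chart_def)
    then have "\<forall>p \<in> g ` U \<inter> h ` U. \<exists>V. openin Y V \<and> p \<in> V \<and> V \<subseteq> g ` U \<inter> h ` U \<and>
        (\<forall>q \<in> V. \<phi>g q - \<phi>h q = \<phi>g p - \<phi>h p)"
      by (simp add: charts_compatible_def)
    moreover have gp: "g p \<in> g ` U \<inter> h ` U"
      using imageI[OF U(2), of g] imageI[OF U(2), of h] p(2) by simp
    ultimately have "\<exists>V. openin Y V \<and> g p \<in> V \<and> V \<subseteq> g ` U \<inter> h ` U \<and>
        (\<forall>q \<in> V. \<phi>g q - \<phi>h q = \<phi>g (g p) - \<phi>h (g p))"
      by (rule bspec)
    then obtain V where V: "openin Y V" "g p \<in> V" "V \<subseteq> g ` U \<inter> h ` U"
      and eq: "\<And>q. q \<in> V \<Longrightarrow> \<phi>g q - \<phi>h q = \<phi>g (g p) - \<phi>h (g p)"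
      by blast
    have inv: "inv_into (topspace X) g (g q) = q" "inv_into (topspace X) h (h q) = q"
      if "q \<in> topspace X" for q
      using that ig ih by (auto simp: inv_into_f_f)
    define N where "N = {q \<in> W. g q \<in> V \<inter> h ` W}"
    have oh: "openin Y (h ` W)"
      using hm(2) W(1) homeomorphic_imp_open_map open_map_def by blast
    have "openin X {q \<in> topspace X. g q \<in> V \<inter> h ` W}"
      using openin_continuous_map_preimage[OF cg] oh V(1) by blast
    then have "openin X (W \<inter> {q \<in> topspace X. g q \<in> V \<inter> h ` W})" using W(1) by blast
    moreover have "W \<inter> {q \<in> topspace X. g q \<in> V \<inter> h ` W} = N"
      using W(3) UX unfolding N_def by auto
    ultimately have "openin X N" by simp
    moreover have "p \<in> N" using W V p unfolding N_def by auto
    moreover have "N \<subseteq> F"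
    proof
      fix q assume "q \<in> N"
      then obtain r where q: "q \<in> W" "g q \<in> V" "r \<in> W" "g q = h r" unfolding N_def by blast
      have X: "q \<in> topspace X" "r \<in> topspace X" "q \<in> U" "r \<in> U" using q W UX by auto
      have "g q \<in> g ` U" "g q \<in> h ` U" "g p \<in> g ` U" "g p \<in> h ` U" using X q V by auto
      then have "\<phi> (inv_into (topspace X) g (g q)) - \<phi> (inv_into (topspace X) h (g q)) =
        \<phi> (inv_into (topspace X) g (g p)) - \<phi> (inv_into (topspace X) h (g p))"
        using eq[OF q(2)] unfolding \<phi>g_def \<phi>h_def by simp
      moreover have "inv_into (topspace X) h (g q) = r" "inv_into (topspace X) h (g p) = p"
        using inv(2)[OF X(2)] inv(2)[OF p(1)] q(4) p(2) by auto
      ultimately have "\<phi> q = \<phi> r" using inv(1)[OF X(1)] inv(1)[OF p(1)] by simp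
      then have "q = r" using W(4) q by (meson inj_onD)
      then show "q \<in> F" using q X unfolding F_def by auto
    qed
    ultimately show "\<exists>T. openin X T \<and> p \<in> T \<and> T \<subseteq> F" by blast
  qed
  ultimately have "F = {} \<or> F = topspace X"
    using conn connected_space_clopen_in by blast
  moreover have "basept P \<in> F"
    using P g h unfolding F_def X_def pointed_translation_structure_def pointed_isomorphism_def by auto
  ultimately show ?thesis using x unfolding F_def X_def by auto
qed

lemma pointed_translation_structure_relocate:
  assumes "pointed_translation_structure P" "x \<in> points P"
  shows "pointed_translation_structure (P\<lparr>basept := x\<rparr>)"
  using assms by (simp add: pointed_translation_structure_def)

lemma pointed_isomorphism_relocate:
  assumes "pointed_isomorphism P Q h"
  shows "pointed_isomorphism (P\<lparr>basept := x\<rparr>) (Q\<lparr>basept := h x\<rparr>) h"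
  using assms by (simp add: pointed_isomorphism_def)

lemma proj_marked_class:
  assumes "x \<in> points P"
  shows "proj (marked_class P x) = iso_class P"
proof -
  have "h x \<in> points Q" if "pointed_isomorphism P Q h" for Q :: "real pointed_surface" and h
    using pointed_isomorphism_points[OF that] assms by blast
  then show ?thesis
    unfolding proj_def marked_class_def iso_class_def by (force simp: image_iff)
qed

lemma relocate_pointed_isomorphism_cases:
  assumes P: "pointed_translation_structure P" and x: "x \<in> points P"
    and R: "pointed_translation_structure R" and h: "pointed_isomorphism (P\<lparr>basept := x\<rparr>) R h"
  obtains Q where "pointed_translation_structure Q" "pointed_isomorphism P Q h"
    "R = Q\<lparr>basept := h x\<rparr>" "points Q = points R"
proof
  let ?Q = "R\<lparr>basept := h (basept P)\<rparr>"
  have "h ` points P = points R" using pointed_isomorphism_points[OF h] by simp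
  then have "h (basept P) \<in> points R"
    using P by (auto simp: pointed_translation_structure_def)
  then show "pointed_translation_structure ?Q"
    using R by (rule pointed_translation_structure_relocate[rotated])
  show "pointed_isomorphism P ?Q h" "R = ?Q\<lparr>basept := h x\<rparr>" "points ?Q = points R"
    using h by (auto simp: pointed_isomorphism_def)
qed

lemma relocate_marked_class:
  assumes P: "pointed_translation_structure P" and x: "x \<in> points P"
  shows "relocate (marked_class P x) = iso_class (P\<lparr>basept := x\<rparr>)"
proof
  show "relocate (marked_class P x) \<subseteq> iso_class (P\<lparr>basept := x\<rparr>)"
    unfolding relocate_def marked_class_def iso_class_def
    by (auto intro: pointed_translation_structure_relocate pointed_isomorphism_relocate)
next
  show "iso_class (P\<lparr>basept := x\<rparr>) \<subseteq> relocate (marked_class P x)"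
  proof
    fix R assume "R \<in> iso_class (P\<lparr>basept := x\<rparr>)"
    then obtain h where R: "pointed_translation_structure R"
      and h: "pointed_isomorphism (P\<lparr>basept := x\<rparr>) R h"
      unfolding iso_class_def by auto
    obtain Q where Q: "pointed_translation_structure Q" "pointed_isomorphism P Q h"
      "R = Q\<lparr>basept := h x\<rparr>"
      using relocate_pointed_isomorphism_cases[OF P x R h] .
    have "h x \<in> points Q" using pointed_isomorphism_points[OF Q(2)] x by blast
    then have "(Q, h x) \<in> marked_class P x" using Q unfolding marked_class_def by auto
    then show "R \<in> relocate (marked_class P x)"
      unfolding relocate_def using Q(3) by force
  qed
qed

lemma basepoint_change_marked_class:
  assumes P: "pointed_translation_structure P" and x: "x \<in> points P" and y: "y \<in> points P"
  shows "basepoint_change (marked_class P x) (marked_class P y) =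
    marked_class (P\<lparr>basept := x\<rparr>) y"
proof (intro set_eqI iffI)
  fix c assume "c \<in> basepoint_change (marked_class P x) (marked_class P y)"
  then obtain Q h k where c: "c = (Q\<lparr>basept := h x\<rparr>, k y)" and Q: "pointed_translation_structure Q"
    and h: "pointed_isomorphism P Q h" "h x \<in> points Q"
    and k: "pointed_isomorphism P Q k" "k y \<in> points Q"
    unfolding basepoint_change_def marked_class_def by auto
  have "k y = h y" using pointed_isomorphism_unique[OF P k(1) h(1) Q y] .
  then show "c \<in> marked_class (P\<lparr>basept := x\<rparr>) y"
    using c k h Q pointed_isomorphism_relocate[OF h(1), of x]
      pointed_translation_structure_relocate[OF Q h(2)]
    unfolding marked_class_def by auto
next
  fix c assume "c \<in> marked_class (P\<lparr>basept := x\<rparr>) y"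
  then obtain R h where c: "c = (R, h y)" and R: "pointed_translation_structure R"
    and h: "pointed_isomorphism (P\<lparr>basept := x\<rparr>) R h" and hy: "h y \<in> points R"
    unfolding marked_class_def by auto
  obtain Q where Q: "pointed_translation_structure Q" "pointed_isomorphism P Q h"
    "R = Q\<lparr>basept := h x\<rparr>"
    using relocate_pointed_isomorphism_cases[OF P x R h] .
  have "h x \<in> points Q" "h y \<in> points Q"
    using pointed_isomorphism_points[OF Q(2)] x y by blast+
  then have "(Q, h x) \<in> marked_class P x" "(Q, h y) \<in> marked_class P y"
    using Q unfolding marked_class_def by auto
  then show "c \<in> basepoint_change (marked_class P x) (marked_class P y)"
    unfolding basepoint_change_def c using Q(3) by blast
qed

lemma push_chart_compose:
  assumes "inj_on h X" "h ` X = Y" "inj_on k Y" "fst c \<subseteq> X"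
  shows "push_chart Y k (push_chart X h c) = push_chart X (k \<circ> h) c"
proof -
  obtain U \<phi> where c: "c = (U, \<phi>)" by (cases c)
  have U: "U \<subseteq> X" using assms(4) c by simp
  have inj: "inj_on (k \<circ> h) X" using assms by (auto intro: comp_inj_on)
  have "inv_into Y k (k (h x)) = h x" "inv_into X h (h x) = x"
    "inv_into X (k \<circ> h) (k (h x)) = x" if "x \<in> U" for x
  proof -
    have x: "x \<in> X" "h x \<in> Y" using that U assms(2) by auto
    show "inv_into Y k (k (h x)) = h x" "inv_into X h (h x) = x"
      using x assms by (auto simp: inv_into_f_f)
    show "inv_into X (k \<circ> h) (k (h x)) = x"
      using inv_into_f_f[OF inj x(1)] by simp
  qed
  then show ?thesis
    unfolding push_chart_def c by (auto simp: image_comp fun_eq_iff restrict_def)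
qed

lemma translation_atlas_chart_subset:
  "translation_atlas X A \<Longrightarrow> c \<in> A \<Longrightarrow> fst c \<subseteq> topspace X"
  unfolding translation_atlas_def by blast

lemma pointed_isomorphism_compose:
  assumes P: "pointed_translation_structure P"
    and h: "pointed_isomorphism P Q h" and k: "pointed_isomorphism Q R k"
  shows "pointed_isomorphism P R (k \<circ> h)"
proof -
  have "push_chart (points Q) k (push_chart (points P) h c) = push_chart (points P) (k \<circ> h) c"
    if "c \<in> atlas P" for c
  proof (rule push_chart_compose)
    show "fst c \<subseteq> points P"
      using P that translation_atlas_chart_subset
      unfolding pointed_translation_structure_def translation_structure_def by blast
  qed (use pointed_isomorphism_points[OF h] pointed_isomorphism_inj[OF h]
      pointed_isomorphism_inj[OF k] in auto)
  then show ?thesis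
    using h k unfolding pointed_isomorphism_def translation_isomorphism_def
    by (auto simp: image_image intro: homeomorphic_map_compose)
qed

lemma pointed_isomorphism_inverse:
  assumes P: "pointed_translation_structure P" and h: "pointed_isomorphism P Q h"
  shows "pointed_isomorphism Q P (inv_into (points P) h)"
proof -
  let ?g = "inv_into (points P) h"
  have inj: "inj_on h (points P)" and img: "h ` points P = points Q"
    using pointed_isomorphism_inj[OF h] pointed_isomorphism_points[OF h] by auto
  have inv: "?g (h x) = x" if "x \<in> points P" for x
    using that inj by (simp add: inv_into_f_f)
  have at: "translation_atlas (top_of P) (atlas P)"
    using P unfolding pointed_translation_structure_def translation_structure_def by blast
  have "push_chart (points Q) ?g (push_chart (points P) h c) = c" if c: "c \<in> atlas P" for c
  proof -
    obtain U \<phi> where U: "c = (U, \<phi>)" by (cases c)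
    have sub: "fst c \<subseteq> points P" using translation_atlas_chart_subset[OF at c] .
    have "is_chart (top_of P) c" using at c unfolding translation_atlas_def by blast
    then have e: "\<phi> \<in> extensional U" unfolding is_chart_def U by simp
    have ig: "inj_on (?g \<circ> h) (points P)" using inv by (auto intro!: inj_onI)
    have "inv_into (points P) (?g \<circ> h) x = x" if "x \<in> points P" for x
      using inv_into_f_f[OF ig that] inv[OF that] by simp
    moreover have "(?g \<circ> h) ` U = U" using sub inv U by force
    ultimately have "push_chart (points P) (?g \<circ> h) c = c"
      using e sub unfolding push_chart_def U
      by (auto simp: fun_eq_iff restrict_def extensional_def)
    moreover have "push_chart (points Q) ?g (push_chart (points P) h c) = push_chart (points P) (?g \<circ> h) c"
      by (rule push_chart_compose[OF inj img _ sub]) (simp add: img[symmetric] inj_on_inv_into)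
    ultimately show ?thesis by simp
  qed
  then have "push_chart (points Q) ?g ` push_chart (points P) h ` atlas P = atlas P"
    by (force simp: image_image)
  moreover have "homeomorphic_map (top_of Q) (top_of P) ?g"
  proof -
    have "homeomorphic_map (top_of P) (top_of Q) h"
      using h unfolding pointed_isomorphism_def translation_isomorphism_def by blast
    then obtain g where g: "homeomorphic_maps (top_of P) (top_of Q) h g"
      using homeomorphic_map_maps by blast
    have "?g y = g y" if "y \<in> points Q" for y
    proof -
      have "y \<in> h ` points P" using that img by simp
      then obtain x where x: "x \<in> points P" "y = h x" by (rule imageE)
      then have "g y = x" using g unfolding homeomorphic_maps_def by simp
      then show ?thesis using inv x by simp
    qed
    moreover have "homeomorphic_map (top_of Q) (top_of P) g"
      using g homeomorphic_maps_map by blast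
    ultimately show ?thesis using homeomorphic_map_eq[of "top_of Q" "top_of P" g ?g] by simp
  qed
  moreover have "?g (basept Q) = basept P"
    using h P inv[of "basept P"]
    unfolding pointed_isomorphism_def pointed_translation_structure_def by simp
  ultimately show ?thesis
    using h unfolding pointed_isomorphism_def translation_isomorphism_def by auto
qed

lemma marked_class_pointed_isomorphism:
  assumes P: "pointed_translation_structure P" and Q: "pointed_translation_structure Q"
    and h: "pointed_isomorphism P Q h" and x: "x \<in> points P"
  shows "marked_class Q (h x) = marked_class P x"
proof -
  let ?g = "inv_into (points P) h"
  have g: "pointed_isomorphism Q P ?g" using pointed_isomorphism_inverse[OF P h] .
  have gx: "?g (h x) = x" using x pointed_isomorphism_inj[OF h] by (simp add: inv_into_f_f)
  show ?thesis
  proof (intro set_eqI iffI)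
    fix c assume "c \<in> marked_class Q (h x)"
    then obtain R k where "c = (R, k (h x))" "pointed_translation_structure R"
      "k (h x) \<in> points R" "pointed_isomorphism Q R k"
      unfolding marked_class_def by auto
    then show "c \<in> marked_class P x"
      using pointed_isomorphism_compose[OF P h] unfolding marked_class_def by fastforce
  next
    fix c assume "c \<in> marked_class P x"
    then obtain R k where "c = (R, k x)" "pointed_translation_structure R"
      "k x \<in> points R" "pointed_isomorphism P R k"
      unfolding marked_class_def by auto
    then show "c \<in> marked_class Q (h x)"
      using pointed_isomorphism_compose[OF Q g, of R k] gx unfolding marked_class_def by fastforce
  qed
qed

lemma inj_on_marked_class:
  assumes P: "pointed_translation_structure P"
  shows "inj_on (marked_class P) (points P)"
proof (rule inj_onI)
  fix x y assume x: "x \<in> points P" and y: "y \<in> points P"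
    and eq: "marked_class P x = marked_class P y"
  have id: "pointed_isomorphism P P id" using pointed_isomorphism_id[OF P] .
  then have "(P, x) \<in> marked_class P x" using P x unfolding marked_class_def by auto
  then obtain h where h: "pointed_isomorphism P P h" "h y = x"
    unfolding eq unfolding marked_class_def by auto
  then show "x = y" using pointed_isomorphism_unique[OF P h(1) id P y] by simp
qed

section \<open>The fiber as a translation surface\<close>

lemma pointed_isomorphism_transport:
  assumes "inj_on h (points P)"
  shows "pointed_isomorphism P (transport h P) h"
proof -
  let ?X = "top_of P" and ?Y = "top_of (transport h P)"
  let ?g = "inv_into (points P) h"
  have Y: "openin ?Y V \<longleftrightarrow> (\<exists>U. openin ?X U \<and> V = ?g -` U \<inter> h ` points P)" for V
    by (simp add: transport_def openin_pullback_topology)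
  have inv: "?g (h x) = x" if "x \<in> points P" for x
    using that assms by (simp add: inv_into_f_f)
  have YX: "topspace ?Y = h ` points P"
    by (auto simp: transport_def topspace_pullback_topology inv)
  have img: "?g -` U \<inter> h ` points P = h ` U" if "U \<subseteq> points P" for U
    using that inv by force
  have "homeomorphic_map ?X ?Y h"
  proof (rule bijective_open_imp_homeomorphic_map)
    show "continuous_map ?X ?Y h"
      unfolding continuous_map
    proof (intro conjI allI impI)
      show "h ` points P \<subseteq> topspace ?Y" using YX by simp
      fix V assume "openin ?Y V"
      then obtain U where U: "openin ?X U" "V = ?g -` U \<inter> h ` points P"
        unfolding Y by blast
      have sub: "U \<subseteq> points P" using U(1) openin_subset by blast
      have "h x \<in> V \<longleftrightarrow> x \<in> U" if "x \<in> points P" for x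
        using that by (simp add: U(2) inv)
      then have "{x \<in> points P. h x \<in> V} = U" using sub by blast
      then show "openin ?X {x \<in> points P. h x \<in> V}" using U by simp
    qed
    show "open_map ?X ?Y h"
      unfolding open_map_def
    proof (intro allI impI)
      fix U assume U: "openin ?X U"
      then have "h ` U = ?g -` U \<inter> h ` points P" using img[OF openin_subset] by simp
      then show "openin ?Y (h ` U)" unfolding Y using U by blast
    qed
    show "h ` points P = topspace ?Y" using YX by simp
    show "inj_on h (points P)" using assms .
  qed
  then show ?thesis
    by (simp add: pointed_isomorphism_def translation_isomorphism_def transport_def)
qed

lemma surface_over_isomorphic:
  assumes S: "S \<in> moduli"
  obtains P where "P \<in> S" "pointed_translation_structure P" "S = iso_class P"
    "pointed_isomorphism P (surface_over S) (marked_class P)"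
proof -
  define P where "P = (SOME P. P \<in> S)"
  obtain Q where Q: "pointed_translation_structure Q" "S = iso_class Q"
    using S unfolding moduli_def by auto
  then have "Q \<in> S" using pointed_isomorphism_id unfolding iso_class_def by blast
  then have PS: "P \<in> S" unfolding P_def by (rule someI)
  then obtain h where P: "pointed_translation_structure P" and h: "pointed_isomorphism Q P h"
    using Q unfolding iso_class_def by auto
  have "S = iso_class P"
    unfolding Q(2) iso_class_def
    using pointed_isomorphism_compose[OF Q(1) h]
      pointed_isomorphism_compose[OF P pointed_isomorphism_inverse[OF Q(1) h]] by blast
  moreover have "surface_over S = transport (marked_class P) P"
    unfolding surface_over_def P_def by (simp add: Let_def)
  ultimately show thesis
    using that PS P pointed_isomorphism_transport[OF inj_on_marked_class[OF P]] by metis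
qed

lemma points_surface_over:
  assumes S: "S \<in> moduli"
  shows "points (surface_over S) = fiber S"
proof -
  obtain P where P: "P \<in> S" "pointed_translation_structure P" "S = iso_class P"
    "pointed_isomorphism P (surface_over S) (marked_class P)"
    using surface_over_isomorphic[OF S] .
  have "points (surface_over S) = marked_class P ` points P"
    using pointed_isomorphism_points[OF P(4)] by simp
  also have "\<dots> = fiber S"
  proof
    show "marked_class P ` points P \<subseteq> fiber S"
      using P unfolding fiber_def universal_def by (auto simp: proj_marked_class)
  next
    show "fiber S \<subseteq> marked_class P ` points P"
    proof
      fix e assume "e \<in> fiber S"
      then obtain Q y where Q: "pointed_translation_structure Q" and y: "y \<in> points Q"
        and e: "e = marked_class Q y" and "iso_class Q = S"
        unfolding fiber_def universal_def by (auto simp: proj_marked_class)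
      then obtain h where h: "pointed_isomorphism Q P h"
        using P(1) unfolding iso_class_def by auto
      have "e = marked_class P (h y)"
        using marked_class_pointed_isomorphism[OF Q P(2) h y] e by simp
      moreover have "h y \<in> points P" using pointed_isomorphism_points[OF h] y by blast
      ultimately show "e \<in> marked_class P ` points P" by blast
    qed
  qed
  finally show ?thesis .
qed

lemma basepoint_change_bij:
  assumes "s \<in> universal"
  shows "bij_betw (basepoint_change s) (fiber (proj s)) (fiber (relocate s))"
proof -
  obtain P x where P: "pointed_translation_structure P" and x: "x \<in> points P"
    and s: "s = marked_class P x"
    using assms unfolding universal_def by blast
  let ?Px = "P\<lparr>basept := x\<rparr>"
  have Px: "pointed_translation_structure ?Px"
    using pointed_translation_structure_relocate[OF P x] .
  have fib: "fiber (iso_class Q) = marked_class Q ` points Q"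
    if Q: "pointed_translation_structure Q" for Q
  proof
    show "marked_class Q ` points Q \<subseteq> fiber (iso_class Q)"
      using Q unfolding fiber_def universal_def by (auto simp: proj_marked_class)
    show "fiber (iso_class Q) \<subseteq> marked_class Q ` points Q"
    proof
      fix e assume "e \<in> fiber (iso_class Q)"
      then obtain R y where R: "pointed_translation_structure R" and y: "y \<in> points R"
        and e: "e = marked_class R y" and eq: "iso_class R = iso_class Q"
        unfolding fiber_def universal_def by (auto simp: proj_marked_class)
      have "Q \<in> iso_class Q" using pointed_isomorphism_id[OF Q] Q unfolding iso_class_def by blast
      then obtain h where h: "pointed_isomorphism R Q h"
        unfolding eq[symmetric] unfolding iso_class_def by blast
      have "e = marked_class Q (h y)"
        using marked_class_pointed_isomorphism[OF R Q h y] e by simp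
      moreover have "h y \<in> points Q" using pointed_isomorphism_points[OF h] y by blast
      ultimately show "e \<in> marked_class Q ` points Q" by blast
    qed
  qed
  have ch: "basepoint_change s (marked_class P y) = marked_class ?Px y" if "y \<in> points P" for y
    unfolding s using basepoint_change_marked_class[OF P x that] .
  have "inj_on (marked_class ?Px) (points P)" using inj_on_marked_class[OF Px] by simp
  then have "inj_on (basepoint_change s) (marked_class P ` points P)"
    unfolding inj_on_def by (auto simp: ch)
  moreover have "basepoint_change s ` marked_class P ` points P = marked_class ?Px ` points P"
    by (simp add: image_image ch)
  ultimately show ?thesis
    unfolding bij_betw_def s proj_marked_class[OF x] relocate_marked_class[OF P x]
      fib[OF P] fib[OF Px] by simp
qed

end

theory Submission
  imports Defs "HOL-Complex_Analysis.Riemann_Mapping"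
begin

text \<open>
  Whether a disk immerses in a surface can be decided along finitely many paths in it. Cover a path from the basepoint by
  round balls on which the translation structure is that of the plane: the path becomes a
  \<^emph>\<open>chain\<close>, a list of displacements, each with the radius of a ball around the point where it starts
  (\<open>chain\<close>, \<open>dev\<close>). Reading a chain on a translation surface either ends at a unique point or
  fails, because a ball of the required radius does not exist. All conditions
  that define the immersive topologies are translated into conditions on finitely many chains, and
  there the change of basepoint is harmless: a chain read from \<open>s\<close> is the end of a longer chain that is read
  from the old basepoint and runs through \<open>s\<close>.

  \<^emph>\<open>From disks to chains\<close> (\<open>immersion_chain\<close>, \<open>chains_immersion\<close>). Join the basepoint to the points of a
  fine finite net of a closed disk \<open>D\<close> by subdivided segments. An immersion of \<open>D\<close> carries the resulting
  chains to the target. Conversely, if all these chains can be read on the target, with radii halved, then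
  their final balls fit together and \<open>D\<close> immerses. The halving is the slack that allows the target and the starting
  point of the chains to vary. An open disk that does not immerse contains a single chain that
  is responsible for that (\<open>open_disk_chain\<close>).

  \<^emph>\<open>From chains to disks\<close> (\<open>live_open\<close>, \<open>not_live_open\<close>, \<open>end_open\<close>, \<open>not_closed_open\<close>). That a chain can be read, that it cannot,
  where it ends, and that it does not close up are open conditions in the immersive topologies, up to a change
  of the radii. The chain has to be thickened to a disk for this, although its balls may overlap in a
  complicated way. The thickening is an abstract one: a star-shaped open subset \<open>N\<close> of the plane with a locally injective map
  \<open>F\<close> to the plane (\<open>model\<close>), which is a translation surface with \<open>F\<close> as a chart. It is homeomorphic to a disk,
  and its immersions are the maps that translate along \<open>F\<close> (\<open>tm\<close>). A chain is followed by a thin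
  strip (\<open>tube_exists\<close>), which takes care of the end of the chain. The last
  ball of the chain cannot simply be attached to it: a large ball around the end of the strip overlaps the earlier part of the strip,
  where \<open>F\<close> and the maps to surfaces have other values. Remove from the ball a thin slit along the incoming strip: then the union is a disk and the two maps agree
  where they have to. Two such slits, along strips that end at points a small vertical displacement apart, are disjoint, so the two slit balls cover
  the whole ball (\<open>two_models\<close>).

  \<^emph>\<open>Conclusion.\<close> Fix \<open>s\<close> and a chain \<open>\<Gamma>\<close> from the basepoint to \<open>s\<close>. For \<open>s\<^sub>1\<close> near \<open>s\<close> the chain \<open>\<Gamma>\<close> ends close to \<open>s\<^sub>1\<close>, and
  whatever can be read after \<open>\<Gamma>\<close> can be read, with smaller radii, from \<open>s\<^sub>1\<close> (\<open>relocated_live\<close>). Hence the four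
  kinds of conditions on the surface based at \<open>s\<close> persist at \<open>s\<^sub>1\<close> (\<open>relocate_plus\<close>, \<open>relocate_minus\<close>, \<open>relocate_not\<close>), which makes
  \<open>relocate\<close> continuous. With a second marked point, \<open>relocate_plus\<close> gives the continuity of the first map of
  the theorem. For the inverse, chains are read from \<open>s\<close> that first run back to the old basepoint along \<open>\<Gamma>\<close> (\<open>unrelocate_plus\<close>).
\<close>

section \<open>Transport of translation structures\<close>

lemma homeomorphic_maps_inv_into:
  assumes "homeomorphic_map X Y h"
  shows "homeomorphic_maps X Y h (inv_into (topspace X) h)"
proof -
  obtain g where g: "homeomorphic_maps X Y h g" using assms homeomorphic_map_maps by blast
  have img: "h ` topspace X = topspace Y" using assms homeomorphic_imp_surjective_map by blast
  have inj: "inj_on h (topspace X)" using assms homeomorphic_imp_injective_map by blast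
  have "inv_into (topspace X) h y = g y" if y: "y \<in> topspace Y" for y
  proof -
    from y img obtain x where "x \<in> topspace X" "y = h x" by blast
    then show ?thesis using g inj by (simp add: homeomorphic_maps_def)
  qed
  then show ?thesis by (intro homeomorphic_maps_eq[OF g]) simp_all
qed

lemma push_chart_value:
  assumes "inj_on h X" "U \<subseteq> X" "q \<in> U"
  shows "restrict (\<phi> \<circ> inv_into X h) (h ` U) (h q) = \<phi> q"
  using assms by (simp add: inv_into_f_f subsetD)

lemma is_chart_push:
  assumes h: "homeomorphic_map X Y h" and c: "is_chart X c"
  shows "is_chart Y (push_chart (topspace X) h c)"
proof -
  obtain U \<phi> where cc: "c = (U, \<phi>)" by (cases c)
  let ?g = "inv_into (topspace X) h"
  let ?\<phi> = "restrict (\<phi> \<circ> ?g) (h ` U)"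
  have hg: "homeomorphic_maps X Y h ?g" using homeomorphic_maps_inv_into[OF h] .
  have g: "homeomorphic_map Y X ?g" using hg homeomorphic_maps_map by blast
  have inj: "inj_on h (topspace X)" using h homeomorphic_imp_injective_map by blast
  have oh: "openin Y (h ` W)" if "openin X W" for W
    using h that homeomorphic_map_openness_eq by blast
  have U: "openin X U" and ex: "\<And>p. p \<in> U \<Longrightarrow> \<exists>W. openin X W \<and> p \<in> W \<and> W \<subseteq> U \<and> open (\<phi> ` W) \<and>
        homeomorphic_map (subtopology X W) (top_of_set (\<phi> ` W)) \<phi>"
    using c unfolding cc is_chart_def by auto
  have UX: "U \<subseteq> topspace X" using U openin_subset by blast
  have val: "?\<phi> (h q) = \<phi> q" if "q \<in> U" for q using push_chart_value[OF inj UX that] .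
  have "\<exists>W. openin Y W \<and> p \<in> W \<and> W \<subseteq> h ` U \<and> open (?\<phi> ` W) \<and>
        homeomorphic_map (subtopology Y W) (top_of_set (?\<phi> ` W)) ?\<phi>" if p: "p \<in> h ` U" for p
  proof -
    obtain q where q: "q \<in> U" "p = h q" using p by blast
    obtain W where W: "openin X W" "q \<in> W" "W \<subseteq> U" "open (\<phi> ` W)"
      "homeomorphic_map (subtopology X W) (top_of_set (\<phi> ` W)) \<phi>" using ex[OF q(1)] by blast
    have im: "?\<phi> ` h ` W = \<phi> ` W"
      unfolding image_image by (intro image_cong refl val) (use W(3) in blast)
    have "?g (h x) = x" if "x \<in> W" for x using inv_into_f_f[OF inj] that W(3) UX by blast
    then have gW: "?g ` (h ` W) = W" by (simp add: image_image cong: image_cong)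
    have "homeomorphic_map (subtopology Y (h ` W)) (subtopology X W) ?g"
      using homeomorphic_map_subtopologies[OF g, of "h ` W" W] W(3) UX gW oh[OF W(1)] openin_subset
      by (metis Int_absorb1 subset_trans)
    then have "homeomorphic_map (subtopology Y (h ` W)) (top_of_set (\<phi> ` W)) (\<phi> \<circ> ?g)"
      using homeomorphic_map_compose[OF _ W(5)] by blast
    then have "homeomorphic_map (subtopology Y (h ` W)) (top_of_set (\<phi> ` W)) ?\<phi>"
      by (rule homeomorphic_map_eq) (use W(3) in auto)
    then show ?thesis using oh[OF W(1)] W im q by (intro exI[of _ "h ` W"]) auto
  qed
  then show ?thesis using oh[OF U] unfolding cc by (auto simp: is_chart_def push_chart_def)
qed

lemma charts_compatible_push:
  assumes h: "homeomorphic_map X Y h" and c: "is_chart X c" and d: "is_chart X d"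
    and cd: "charts_compatible X c d"
  shows "charts_compatible Y (push_chart (topspace X) h c) (push_chart (topspace X) h d)"
proof -
  obtain U \<phi> where cc: "c = (U, \<phi>)" by (cases c)
  obtain V \<psi> where dd: "d = (V, \<psi>)" by (cases d)
  have inj: "inj_on h (topspace X)" using h homeomorphic_imp_injective_map by blast
  have UX: "U \<subseteq> topspace X" "V \<subseteq> topspace X"
    using c d openin_subset unfolding cc dd is_chart_def by auto
  have im: "h ` U \<inter> h ` V = h ` (U \<inter> V)" using inj UX by (simp add: inj_on_image_Int)
  show ?thesis unfolding cc dd push_chart_def charts_compatible_def split im
  proof
    fix p assume "p \<in> h ` (U \<inter> V)"
    then obtain q where q: "q \<in> U \<inter> V" "p = h q" by blast
    then obtain W where W: "openin X W" "q \<in> W" "W \<subseteq> U \<inter> V"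
      and e: "\<And>r. r \<in> W \<Longrightarrow> \<phi> r - \<psi> r = \<phi> q - \<psi> q"
      using cd unfolding cc dd charts_compatible_def split by meson
    show "\<exists>W. openin Y W \<and> p \<in> W \<and> W \<subseteq> h ` (U \<inter> V) \<and>
       (\<forall>q\<in>W. restrict (\<phi> \<circ> inv_into (topspace X) h) (h ` U) q - restrict (\<psi> \<circ> inv_into (topspace X) h) (h ` V) q
         = restrict (\<phi> \<circ> inv_into (topspace X) h) (h ` U) p - restrict (\<psi> \<circ> inv_into (topspace X) h) (h ` V) p)"
    proof (intro exI[of _ "h ` W"] conjI ballI)
      show "openin Y (h ` W)" using h W homeomorphic_map_openness_eq by blast
      show "p \<in> h ` W" "h ` W \<subseteq> h ` (U \<inter> V)" using W q by auto
      fix x assume "x \<in> h ` W"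
      then obtain r where r: "r \<in> W" "x = h r" by blast
      then have rq: "r \<in> U" "r \<in> V" "q \<in> U" "q \<in> V" using W q by auto
      show "restrict (\<phi> \<circ> inv_into (topspace X) h) (h ` U) x - restrict (\<psi> \<circ> inv_into (topspace X) h) (h ` V) x
         = restrict (\<phi> \<circ> inv_into (topspace X) h) (h ` U) p - restrict (\<psi> \<circ> inv_into (topspace X) h) (h ` V) p"
        unfolding r(2) q(2) push_chart_value[OF inj UX(1) rq(1)] push_chart_value[OF inj UX(1) rq(3)]
          push_chart_value[OF inj UX(2) rq(2)] push_chart_value[OF inj UX(2) rq(4)]
        by (rule e[OF r(1)])
    qed
  qed
qed

lemma translation_atlas_push:
  assumes h: "homeomorphic_map X Y h" and A: "translation_atlas X A"
  shows "translation_atlas Y (push_chart (topspace X) h ` A)"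
proof -
  have "(\<Union>c\<in>A. fst (push_chart (topspace X) h c)) = h ` (\<Union>c\<in>A. fst c)"
    by (auto simp: push_chart_def split_beta)
  also have "\<dots> = topspace Y" using A h homeomorphic_imp_surjective_map
    unfolding translation_atlas_def by fastforce
  finally show ?thesis using A is_chart_push[OF h] charts_compatible_push[OF h]
    unfolding translation_atlas_def by auto
qed

lemma push_chart_inverse:
  assumes hg: "homeomorphic_maps X Y h g" and c: "is_chart X c"
  shows "push_chart (topspace Y) g (push_chart (topspace X) h c) = c"
proof -
  obtain U \<phi> where cc: "c = (U, \<phi>)" by (cases c)
  have UX: "U \<subseteq> topspace X" and e: "\<phi> \<in> extensional U"
    using c openin_subset unfolding cc is_chart_def by auto
  have hm: "homeomorphic_map X Y h" "homeomorphic_map Y X g"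
    using hg unfolding homeomorphic_maps_map by blast+
  note inj = homeomorphic_imp_injective_map[OF hm(1)] homeomorphic_imp_injective_map[OF hm(2)]
  have gh: "g (h x) = x" "h x \<in> topspace Y" if "x \<in> topspace X" for x
    using hg that by (auto simp: homeomorphic_maps_def continuous_map_def)
  have "g (h x) = x" if "x \<in> U" for x using gh that UX by blast
  then have gU: "g ` h ` U = U" by (simp add: image_image cong: image_cong)
  have v: "inv_into (topspace Y) g x = h x" if "x \<in> topspace X" for x
    using gh[OF that] inj(2) inv_into_f_f by metis
  have "restrict (restrict (\<phi> \<circ> inv_into (topspace X) h) (h ` U) \<circ> inv_into (topspace Y) g) U = \<phi>"
  proof
    fix x show "restrict (restrict (\<phi> \<circ> inv_into (topspace X) h) (h ` U) \<circ> inv_into (topspace Y) g) U x = \<phi> x"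
    proof (cases "x \<in> U")
      case True
      then show ?thesis using push_chart_value[OF inj(1) UX True] v UX by (simp add: subset_iff)
    next
      case False
      then show ?thesis using e by (simp add: extensional_def)
    qed
  qed
  then show ?thesis unfolding cc push_chart_def by (simp add: gU)
qed

lemma surface_homeomorphic:
  assumes h: "homeomorphic_map X Y h" and X: "surface X"
  shows "surface Y"
proof -
  have XY: "X homeomorphic_space Y" using h homeomorphic_map_imp_homeomorphic_space by blast
  have im: "h ` topspace X = topspace Y" using h homeomorphic_imp_surjective_map by blast
  have "\<exists>U V. openin Y U \<and> p \<in> U \<and> open (V :: plane set) \<and> subtopology Y U homeomorphic_space top_of_set V"
    if p: "p \<in> topspace Y" for p
  proof -
    obtain q where q: "q \<in> topspace X" "p = h q" using p im by blast
    then obtain U and V :: "plane set" where U: "openin X U" "q \<in> U" "open V"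
      "subtopology X U homeomorphic_space top_of_set V"
      using X unfolding surface_def by blast
    have oU: "openin Y (h ` U)" using h U homeomorphic_map_openness_eq by blast
    have "homeomorphic_map (subtopology X U) (subtopology Y (h ` U)) h"
      using homeomorphic_map_subtopologies[OF h, of U "h ` U"] oU U(1) openin_subset
      by (metis Int_absorb1)
    then have "subtopology X U homeomorphic_space subtopology Y (h ` U)"
      using homeomorphic_map_imp_homeomorphic_space by blast
    then have "subtopology Y (h ` U) homeomorphic_space top_of_set V"
      using U(4) homeomorphic_space_sym homeomorphic_space_trans by blast
    then show ?thesis using oU U q by blast
  qed
  moreover have "topspace Y \<noteq> {}" using X im unfolding surface_def by auto
  moreover have "connected_space Y" using X XY homeomorphic_connected_space unfolding surface_def by blast
  moreover have "Hausdorff_space Y" using X XY homeomorphic_Hausdorff_space unfolding surface_def by blast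
  moreover have "second_countable Y" using X XY homeomorphic_space_second_countability
    unfolding surface_def by blast
  ultimately show ?thesis unfolding surface_def by blast
qed

lemma pointed_translation_structure_iso:
  assumes P: "pointed_translation_structure P" and h: "pointed_isomorphism P Q h"
  shows "pointed_translation_structure Q"
proof -
  let ?X = "top_of P" and ?Y = "top_of Q"
  have hm: "homeomorphic_map ?X ?Y h" and at: "atlas Q = push_chart (points P) h ` atlas P"
    and b: "basept Q = h (basept P)"
    using h unfolding pointed_isomorphism_def translation_isomorphism_def by auto
  have TP: "surface ?X" "translation_atlas ?X (atlas P)"
    and mx: "\<And>B. translation_atlas ?X B \<Longrightarrow> atlas P \<subseteq> B \<Longrightarrow> B = atlas P"
    and bP: "basept P \<in> points P"
    using P unfolding pointed_translation_structure_def translation_structure_def by auto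
  define g where "g = inv_into (points P) h"
  have hg: "homeomorphic_maps ?X ?Y h g" using homeomorphic_maps_inv_into[OF hm] unfolding g_def .
  then have gh: "homeomorphic_maps ?Y ?X g h" using homeomorphic_maps_sym by blast
  have gm: "homeomorphic_map ?Y ?X g" using gh homeomorphic_maps_map by blast
  have "B = atlas Q" if B: "translation_atlas ?Y B" and sub: "atlas Q \<subseteq> B" for B
  proof -
    have "push_chart (points Q) g (push_chart (points P) h c) = c" if "c \<in> atlas P" for c
      using push_chart_inverse[OF hg] TP(2) that unfolding translation_atlas_def by blast
    then have "push_chart (points Q) g ` push_chart (points P) h ` atlas P = atlas P"
      by (simp add: image_image cong: image_cong)
    then have "atlas P \<subseteq> push_chart (points Q) g ` B" using sub unfolding at by blast
    then have eq: "push_chart (points Q) g ` B = atlas P"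
      using mx translation_atlas_push[OF gm B] by blast
    have "push_chart (points P) h (push_chart (points Q) g c) = c" if "c \<in> B" for c
      using push_chart_inverse[OF gh] B that unfolding translation_atlas_def by blast
    then have "push_chart (points P) h ` push_chart (points Q) g ` B = B"
      by (simp add: image_image cong: image_cong)
    then show ?thesis unfolding at eq by simp
  qed
  moreover have "basept Q \<in> points Q"
    using bP b hm homeomorphic_imp_surjective_map by blast
  ultimately show ?thesis
    using surface_homeomorphic[OF hm TP(1)] translation_atlas_push[OF hm TP(2)]
    unfolding pointed_translation_structure_def translation_structure_def at by auto
qed

lemma pointed_translation_structure_surface_over:
  assumes "S \<in> moduli"
  shows "pointed_translation_structure (surface_over S)"
  using surface_over_isomorphic[OF assms] pointed_translation_structure_iso by metis

section \<open>Charts\<close>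

lemma is_chart_restrict:
  assumes c: "is_chart X (U, \<phi>)" and O: "openin X U'" "U' \<subseteq> U"
  shows "is_chart X (U', restrict \<phi> U')"
proof -
  have "\<exists>W. openin X W \<and> p \<in> W \<and> W \<subseteq> U' \<and> open (restrict \<phi> U' ` W) \<and>
        homeomorphic_map (subtopology X W) (top_of_set (restrict \<phi> U' ` W)) (restrict \<phi> U')"
    if p: "p \<in> U'" for p
  proof -
    obtain W where W: "openin X W" "p \<in> W" "W \<subseteq> U" "open (\<phi> ` W)"
      "homeomorphic_map (subtopology X W) (top_of_set (\<phi> ` W)) \<phi>"
      using c O p unfolding is_chart_def by blast
    let ?W = "W \<inter> U'"
    have tW: "topspace (subtopology X W) = W" using W(1) openin_subset by fastforce
    have "openin (subtopology X W) ?W" using O(1) by (simp add: openin_subtopology_Int2)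
    then have "openin (top_of_set (\<phi> ` W)) (\<phi> ` ?W)"
      using homeomorphic_map_openness_eq[OF W(5)] by blast
    then have op: "open (\<phi> ` ?W)" using W(4) openin_open_trans by blast
    have "homeomorphic_map (subtopology (subtopology X W) ?W) (subtopology (top_of_set (\<phi> ` W)) (\<phi> ` ?W)) \<phi>"
      by (rule homeomorphic_map_subtopologies[OF W(5)]) (use tW in auto)
    then have "homeomorphic_map (subtopology X ?W) (top_of_set (\<phi> ` ?W)) \<phi>"
      by (simp add: subtopology_subtopology Int_absorb1 image_mono)
    then have "homeomorphic_map (subtopology X ?W) (top_of_set (\<phi> ` ?W)) (restrict \<phi> U')"
      by (rule homeomorphic_map_eq) auto
    moreover have "restrict \<phi> U' ` ?W = \<phi> ` ?W" by auto
    ultimately show ?thesis using W O p op by (intro exI[of _ ?W]) auto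
  qed
  then show ?thesis using O by (auto simp: is_chart_def)
qed

text \<open>A maximal atlas contains every restriction of its charts, since adding one preserves compatibility.\<close>

lemma chart_restrict_mem:
  assumes T: "translation_structure X A" and c: "(U, \<phi>) \<in> A" and O: "openin X U'" "U' \<subseteq> U"
  shows "(U', restrict \<phi> U') \<in> A"
proof -
  have at: "translation_atlas X A" and mx: "\<And>B. translation_atlas X B \<Longrightarrow> A \<subseteq> B \<Longrightarrow> B = A"
    using T unfolding translation_structure_def by auto
  let ?c = "(U', restrict \<phi> U')"
  have ch: "is_chart X ?c"
    using is_chart_restrict[OF _ O] at c unfolding translation_atlas_def by blast
  have comp: "charts_compatible X ?c (V, \<psi>) \<and> charts_compatible X (V, \<psi>) ?c" if d: "(V, \<psi>) \<in> A" for V \<psi>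
  proof -
    have cd: "charts_compatible X (U, \<phi>) (V, \<psi>)" using at c d unfolding translation_atlas_def by blast
    have "\<exists>W. openin X W \<and> p \<in> W \<and> W \<subseteq> U' \<inter> V \<and> (\<forall>q\<in>W. \<phi> q - \<psi> q = \<phi> p - \<psi> p)"
      if p: "p \<in> U' \<inter> V" for p
    proof -
      obtain W where "openin X W" "p \<in> W" "W \<subseteq> U \<inter> V" "\<forall>q\<in>W. \<phi> q - \<psi> q = \<phi> p - \<psi> p"
        using cd p O unfolding charts_compatible_def by blast
      then show ?thesis using O p by (intro exI[of _ "W \<inter> U'"]) blast
    qed
    note E = this
    have 1: "charts_compatible X ?c (V, \<psi>)"
      unfolding charts_compatible_def split
    proof
      fix p assume p: "p \<in> U' \<inter> V"
      obtain W where W: "openin X W" "p \<in> W" "W \<subseteq> U' \<inter> V" "\<forall>q\<in>W. \<phi> q - \<psi> q = \<phi> p - \<psi> p"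
        using E[OF p] by blast
      have r: "restrict \<phi> U' q = \<phi> q" if "q \<in> W" for q using that W(3) by auto
      have "restrict \<phi> U' q - \<psi> q = restrict \<phi> U' p - \<psi> p" if "q \<in> W" for q
        unfolding r[OF that] r[OF W(2)] by (rule W(4)[rule_format, OF that])
      then show "\<exists>W. openin X W \<and> p \<in> W \<and> W \<subseteq> U' \<inter> V \<and>
        (\<forall>q\<in>W. restrict \<phi> U' q - \<psi> q = restrict \<phi> U' p - \<psi> p)"
        using W(1-3) by blast
    qed
    have 2: "charts_compatible X (V, \<psi>) ?c"
      unfolding charts_compatible_def split
    proof
      fix p assume p: "p \<in> V \<inter> U'"
      obtain W where W: "openin X W" "p \<in> W" "W \<subseteq> U' \<inter> V" "\<forall>q\<in>W. \<phi> q - \<psi> q = \<phi> p - \<psi> p"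
        using E p by blast
      have r: "restrict \<phi> U' q = \<phi> q" if "q \<in> W" for q using that W(3) by auto
      have "\<psi> q - restrict \<phi> U' q = \<psi> p - restrict \<phi> U' p" if "q \<in> W" for q
        unfolding r[OF that] r[OF W(2)] using W(4)[rule_format, OF that] by (metis minus_diff_eq)
      then show "\<exists>W. openin X W \<and> p \<in> W \<and> W \<subseteq> V \<inter> U' \<and>
        (\<forall>q\<in>W. \<psi> q - restrict \<phi> U' q = \<psi> p - restrict \<phi> U' p)"
        using W(1-3) by (intro exI[of _ W]) blast
    qed
    show ?thesis using 1 2 by blast
  qed
  have self: "charts_compatible X ?c ?c"
    unfolding charts_compatible_def split using O by (intro ballI exI[of _ U']) simp
  have "translation_atlas X (insert ?c A)"
    unfolding translation_atlas_def
  proof (intro conjI ballI)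
    show "(\<Union>c\<in>insert ?c A. fst c) = topspace X"
      using at openin_subset[OF O(1)] unfolding translation_atlas_def by auto
    fix d assume d: "d \<in> insert ?c A"
    show "is_chart X d" using d ch at unfolding translation_atlas_def by blast
    fix d' assume d': "d' \<in> insert ?c A"
    show "charts_compatible X d d'"
    proof (cases "d \<in> A \<and> d' \<in> A")
      case True then show ?thesis using at unfolding translation_atlas_def by blast
    next
      case False
      then show ?thesis using d d' self comp by (cases d; cases d') auto
    qed
  qed
  then show ?thesis using mx by blast
qed

lemma nice_chart:
  assumes T: "translation_structure X A" and p: "p \<in> G" "openin X G"
  obtains V \<psi> where "(V, \<psi>) \<in> A" "p \<in> V" "V \<subseteq> G" "openin X V" "inj_on \<psi> V" "open (\<psi> ` V)"
    "homeomorphic_map (subtopology X V) (top_of_set (\<psi> ` V)) \<psi>"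
proof -
  have at: "translation_atlas X A" using T unfolding translation_structure_def by auto
  have "p \<in> topspace X" using p openin_subset by blast
  then obtain U \<phi> where U: "(U, \<phi>) \<in> A" "p \<in> U" using translation_structure_point_chart[OF T] by blast
  have chU: "is_chart X (U, \<phi>)" using at U unfolding translation_atlas_def by blast
  have oU: "openin X (U \<inter> G)" using chU p unfolding is_chart_def by auto
  have "(U \<inter> G, restrict \<phi> (U \<inter> G)) \<in> A" using chart_restrict_mem[OF T U(1) oU] by blast
  then have "is_chart X (U \<inter> G, restrict \<phi> (U \<inter> G))" using at unfolding translation_atlas_def by blast
  moreover have "p \<in> U \<inter> G" using U p by blast
  ultimately obtain W where W: "openin X W" "p \<in> W" "W \<subseteq> U \<inter> G" "open (restrict \<phi> (U \<inter> G) ` W)"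
    "homeomorphic_map (subtopology X W) (top_of_set (restrict \<phi> (U \<inter> G) ` W)) (restrict \<phi> (U \<inter> G))"
    unfolding is_chart_def by blast
  have im: "restrict \<phi> (U \<inter> G) ` W = restrict \<phi> W ` W" using W(3) by auto
  have tW: "topspace (subtopology X W) = W" using W(1) openin_subset by fastforce
  have hm: "homeomorphic_map (subtopology X W) (top_of_set (restrict \<phi> W ` W)) (restrict \<phi> W)"
    using W(5)[unfolded im] by (rule homeomorphic_map_eq) (use W(3) in auto)
  have "(W, restrict \<phi> W) \<in> A" using chart_restrict_mem[OF T U(1) W(1)] W(3) by blast
  then show ?thesis
    using that[of W "restrict \<phi> W"] W hm im homeomorphic_imp_injective_map[OF hm] tW by auto
qed

section \<open>Lifts to a translation surface\<close>

text \<open>The map \<open>f\<close> lifts \<open>F\<close> to the surface: in the charts of \<open>Q\<close>, \<open>f\<close> is \<open>F\<close> up to a translation that may depend on the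
  chart and on the component. The set \<open>J\<close> may be a segment, a ball or a compact set. For \<open>F\<close> the identity, \<open>f\<close> is a translation map from a plane set to \<open>Q\<close>.\<close>

definition tm :: "'b pointed_surface \<Rightarrow> 'x::topological_space set \<Rightarrow> ('x \<Rightarrow> plane) \<Rightarrow> ('x \<Rightarrow> 'b) \<Rightarrow> bool" where
  "tm Q J F f \<longleftrightarrow> continuous_map (top_of_set J) (top_of Q) f \<and>
     (\<forall>z\<in>J. \<exists>(V, \<psi>)\<in>atlas Q. f z \<in> V \<and>
        (\<exists>G. open G \<and> z \<in> G \<and> (\<forall>z'\<in>G \<inter> J. f z' \<in> V \<and> \<psi> (f z') - F z' = \<psi> (f z) - F z)))"

lemma tm_continuous: "tm Q J F f \<Longrightarrow> continuous_map (top_of_set J) (top_of Q) f"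
  by (simp add: tm_def)

lemma tm_point: "tm Q J F f \<Longrightarrow> z \<in> J \<Longrightarrow> f z \<in> points Q"
  unfolding tm_def continuous_map_def by (simp add: Pi_iff)

lemma tm_preimage:
  assumes "tm Q J F f" "openin (top_of Q) V"
  obtains G where "open G" "{z \<in> J. f z \<in> V} = G \<inter> J"
proof -
  have "openin (top_of_set J) {z \<in> J. f z \<in> V}"
    using openin_continuous_map_preimage[OF tm_continuous[OF assms(1)] assms(2)] by simp
  then obtain G where "open G" "{z \<in> J. f z \<in> V} = J \<inter> G" using openin_open by blast
  then show ?thesis using that by blast
qed

lemma pts_translation_structure:
  "pointed_translation_structure Q \<Longrightarrow> translation_structure (top_of Q) (atlas Q)"
  by (simp add: pointed_translation_structure_def)

lemma pts_basept: "pointed_translation_structure Q \<Longrightarrow> basept Q \<in> points Q"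
  by (simp add: pointed_translation_structure_def)

lemma pts_atlas_open:
  assumes "pointed_translation_structure Q" "(V, \<psi>) \<in> atlas Q"
  shows "openin (top_of Q) V"
  using assms unfolding pointed_translation_structure_def translation_structure_def
    translation_atlas_def is_chart_def by fast

lemma pts_compatible:
  assumes "pointed_translation_structure Q" "(U, \<phi>) \<in> atlas Q" "(V, \<psi>) \<in> atlas Q" "p \<in> U" "p \<in> V"
  obtains W where "openin (top_of Q) W" "p \<in> W" "W \<subseteq> U \<inter> V"
    "\<And>q. q \<in> W \<Longrightarrow> \<phi> q - \<psi> q = \<phi> p - \<psi> p"
proof -
  have "charts_compatible (top_of Q) (U, \<phi>) (V, \<psi>)"
    using assms unfolding pointed_translation_structure_def translation_structure_def
      translation_atlas_def by blast
  then show ?thesis using assms that unfolding charts_compatible_def split by (meson IntI)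
qed

lemma tmE:
  assumes f: "tm Q J F f" and z: "z \<in> J"
  obtains V \<psi> G where "(V, \<psi>) \<in> atlas Q" "f z \<in> V" "open G" "z \<in> G"
    "\<And>z'. z' \<in> G \<Longrightarrow> z' \<in> J \<Longrightarrow> f z' \<in> V \<and> \<psi> (f z') - F z' = \<psi> (f z) - F z"
proof -
  obtain c where c: "c \<in> atlas Q" "case c of (V, \<psi>) \<Rightarrow> f z \<in> V \<and>
        (\<exists>G. open G \<and> z \<in> G \<and> (\<forall>z'\<in>G \<inter> J. f z' \<in> V \<and> \<psi> (f z') - F z' = \<psi> (f z) - F z))"
    using f z unfolding tm_def by blast
  obtain V \<psi> where Vp: "c = (V, \<psi>)" by (cases c)
  obtain G where "open G" "z \<in> G" "\<forall>z'\<in>G \<inter> J. f z' \<in> V \<and> \<psi> (f z') - F z' = \<psi> (f z) - F z"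
    using c(2) unfolding Vp split by blast
  then show ?thesis using that[of V \<psi> G] c unfolding Vp split by (meson IntI)
qed

lemma tmI:
  assumes "continuous_map (top_of_set J) (top_of Q) f"
    and "\<And>z. z \<in> J \<Longrightarrow> \<exists>V \<psi> G. (V, \<psi>) \<in> atlas Q \<and> open G \<and> z \<in> G \<and>
      (\<forall>z'. z' \<in> G \<longrightarrow> z' \<in> J \<longrightarrow> f z' \<in> V \<and> \<psi> (f z') - F z' = \<psi> (f z) - F z)"
  shows "tm Q J F f"
  unfolding tm_def
proof (intro conjI ballI)
  fix z assume z: "z \<in> J"
  obtain V \<psi> G where V: "(V, \<psi>) \<in> atlas Q" "open G" "z \<in> G"
    and e: "\<forall>z'. z' \<in> G \<longrightarrow> z' \<in> J \<longrightarrow> f z' \<in> V \<and> \<psi> (f z') - F z' = \<psi> (f z) - F z"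
    using assms(2)[OF z] by blast
  show "\<exists>(V, \<psi>)\<in>atlas Q. f z \<in> V \<and>
        (\<exists>G. open G \<and> z \<in> G \<and> (\<forall>z'\<in>G \<inter> J. f z' \<in> V \<and> \<psi> (f z') - F z' = \<psi> (f z) - F z))"
    by (rule bexI[OF _ V(1)], unfold split) (use e V z in blast)
qed (rule assms(1))

lemma tm_chart:
  assumes Q: "pointed_translation_structure Q" and f: "tm Q J F f" and z: "z \<in> J"
    and V: "(V, \<psi>) \<in> atlas Q" "f z \<in> V"
  obtains G where "open G" "z \<in> G" "\<And>z'. z' \<in> G \<Longrightarrow> z' \<in> J \<Longrightarrow> f z' \<in> V \<and> \<psi> (f z') - F z' = \<psi> (f z) - F z"
proof -
  obtain U \<phi> G where U: "(U, \<phi>) \<in> atlas Q" "f z \<in> U" and G: "open G" "z \<in> G"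
    and e: "\<And>z'. z' \<in> G \<Longrightarrow> z' \<in> J \<Longrightarrow> \<phi> (f z') - F z' = \<phi> (f z) - F z"
    using tmE[OF f z] by metis
  obtain W where W: "openin (top_of Q) W" "f z \<in> W" "W \<subseteq> U \<inter> V"
    and c: "\<And>q. q \<in> W \<Longrightarrow> \<phi> q - \<psi> q = \<phi> (f z) - \<psi> (f z)"
    using pts_compatible[OF Q U(1) V(1) U(2) V(2)] by metis
  obtain G' where G': "open G'" "{z \<in> J. f z \<in> W} = G' \<inter> J" using tm_preimage[OF f W(1)] .
  show ?thesis
  proof (rule that[of "G \<inter> G'"])
    show "open (G \<inter> G')" using G G' by blast
    show "z \<in> G \<inter> G'" using G G' z W by blast
    fix z' assume z': "z' \<in> G \<inter> G'" "z' \<in> J"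
    then have w: "f z' \<in> W" using G' by blast
    have "\<psi> (f z') - F z' = (\<phi> (f z') - F z') - (\<phi> (f z') - \<psi> (f z'))" by simp
    also have "\<dots> = \<psi> (f z) - F z" using e[of z'] c[OF w] z' by simp
    finally show "f z' \<in> V \<and> \<psi> (f z') - F z' = \<psi> (f z) - F z" using w W(3) by blast
  qed
qed

text \<open>The lifting property is local, continuity included; pieces on open sets can therefore be glued.\<close>

lemma tm_local:
  assumes loc: "\<And>z. z \<in> J \<Longrightarrow> \<exists>G. open G \<and> z \<in> G \<and> tm Q (G \<inter> J) F f"
  shows "tm Q J F f"
proof (rule tmI)
  show "continuous_map (top_of_set J) (top_of Q) f"
    unfolding continuous_map
  proof (intro conjI allI impI)
    show "f ` topspace (top_of_set J) \<subseteq> points Q"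
    proof
      fix y assume "y \<in> f ` topspace (top_of_set J)"
      then obtain z where "z \<in> J" "y = f z" by auto
      then show "y \<in> points Q" using loc[of z] tm_point by (metis IntI)
    qed
    fix V assume V: "openin (top_of Q) V"
    show "openin (top_of_set J) {x \<in> topspace (top_of_set J). f x \<in> V}"
    proof (subst openin_subopen, intro ballI)
      fix z assume "z \<in> {x \<in> topspace (top_of_set J). f x \<in> V}"
      then have z: "z \<in> J" "f z \<in> V" by auto
      obtain G where G: "open G" "z \<in> G" "tm Q (G \<inter> J) F f" using loc[OF z(1)] by blast
      obtain G' where G': "open G'" "{z \<in> G \<inter> J. f z \<in> V} = G' \<inter> (G \<inter> J)"
        using tm_preimage[OF G(3) V] .
      have "openin (top_of_set J) (J \<inter> (G' \<inter> G))" using G G' by (simp add: openin_open_Int open_Int)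
      moreover have "z \<in> J \<inter> (G' \<inter> G)" using G G' z by blast
      moreover have "J \<inter> (G' \<inter> G) \<subseteq> {x \<in> topspace (top_of_set J). f x \<in> V}" using G' by auto
      ultimately show "\<exists>T. openin (top_of_set J) T \<and> z \<in> T \<and> T \<subseteq> {x \<in> topspace (top_of_set J). f x \<in> V}"
        by blast
    qed
  qed
  fix z assume z: "z \<in> J"
  obtain G where G: "open G" "z \<in> G" "tm Q (G \<inter> J) F f" using loc[OF z] by blast
  have zG: "z \<in> G \<inter> J" using z G by blast
  obtain V \<psi> G' where V: "(V, \<psi>) \<in> atlas Q" "f z \<in> V" "open G'" "z \<in> G'"
    "\<And>z'. z' \<in> G' \<Longrightarrow> z' \<in> G \<inter> J \<Longrightarrow> f z' \<in> V \<and> \<psi> (f z') - F z' = \<psi> (f z) - F z"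
    using tmE[OF G(3) zG] by metis
  show "\<exists>V \<psi> G. (V, \<psi>) \<in> atlas Q \<and> open G \<and> z \<in> G \<and>
      (\<forall>z'. z' \<in> G \<longrightarrow> z' \<in> J \<longrightarrow> f z' \<in> V \<and> \<psi> (f z') - F z' = \<psi> (f z) - F z)"
    by (intro exI[of _ V] exI[of _ \<psi>] exI[of _ "G' \<inter> G"] conjI allI impI) (use V G in blast)+
qed

lemma tm_compose:
  assumes f: "tm Q J F f" and g: "continuous_on J' g" "g ` J' \<subseteq> J"
  shows "tm Q J' (\<lambda>x. F (g x)) (\<lambda>x. f (g x))"
proof (rule tmI)
  have "continuous_map (top_of_set J') (top_of_set J) g"
    using g by (auto simp: continuous_map_subtopology_eu)
  from continuous_map_compose[OF this tm_continuous[OF f]]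
  show "continuous_map (top_of_set J') (top_of Q) (\<lambda>x. f (g x))" by (simp add: o_def)
  fix z assume z: "z \<in> J'"
  then have gz: "g z \<in> J" using g by blast
  obtain V \<psi> G where V: "(V, \<psi>) \<in> atlas Q" "f (g z) \<in> V" "open G" "g z \<in> G"
    "\<And>z'. z' \<in> G \<Longrightarrow> z' \<in> J \<Longrightarrow> f z' \<in> V \<and> \<psi> (f z') - F z' = \<psi> (f (g z)) - F (g z)"
    using tmE[OF f gz] by metis
  obtain G' where G': "open G'" "G' \<inter> J' = g -` G \<inter> J'"
    using g(1) V(3) unfolding continuous_on_open_invariant by metis
  have 1: "z \<in> G'" using V(4) G' z by blast
  have 2: "g z' \<in> G" "g z' \<in> J" if "z' \<in> G'" "z' \<in> J'" for z' using G' g(2) that by auto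
  show "\<exists>V \<psi> G. (V, \<psi>) \<in> atlas Q \<and> open G \<and> z \<in> G \<and>
      (\<forall>z'. z' \<in> G \<longrightarrow> z' \<in> J' \<longrightarrow> f (g z') \<in> V \<and> \<psi> (f (g z')) - F (g z') = \<psi> (f (g z)) - F (g z))"
    by (intro exI[of _ V] exI[of _ \<psi>] exI[of _ G'] conjI allI impI V(1) G'(1) 1)
      (use V(5) 2 in blast)+
qed

lemma tm_subset: "tm Q J F f \<Longrightarrow> J' \<subseteq> J \<Longrightarrow> tm Q J' F f"
  using tm_compose[of Q J F f J' "\<lambda>x. x"] by simp

lemma tm_cong:
  assumes f: "tm Q J F f" and e: "\<And>z. z \<in> J \<Longrightarrow> f' z = f z" "\<And>z. z \<in> J \<Longrightarrow> F' z = F z + c"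
  shows "tm Q J F' f'"
proof (rule tmI)
  show "continuous_map (top_of_set J) (top_of Q) f'"
    using continuous_map_eq[OF tm_continuous[OF f], of f'] e by simp
  fix z assume z: "z \<in> J"
  obtain V \<psi> G where V: "(V, \<psi>) \<in> atlas Q" "f z \<in> V" "open G" "z \<in> G"
    "\<And>z'. z' \<in> G \<Longrightarrow> z' \<in> J \<Longrightarrow> f z' \<in> V \<and> \<psi> (f z') - F z' = \<psi> (f z) - F z"
    using tmE[OF f z] by metis
  have "f' z' \<in> V \<and> \<psi> (f' z') - F' z' = \<psi> (f' z) - F' z" if "z' \<in> G" "z' \<in> J" for z'
  proof -
    have "\<psi> (f z') - F z' - c = \<psi> (f z) - F z - c" using V(5)[OF that] by simp
    then show ?thesis using V(5)[OF that] unfolding e(1)[OF that(2)] e(2)[OF that(2)] e(1)[OF z] e(2)[OF z]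
      by (simp add: diff_diff_eq)
  qed
  then show "\<exists>V \<psi> G. (V, \<psi>) \<in> atlas Q \<and> open G \<and> z \<in> G \<and>
      (\<forall>z'. z' \<in> G \<longrightarrow> z' \<in> J \<longrightarrow> f' z' \<in> V \<and> \<psi> (f' z') - F' z' = \<psi> (f' z) - F' z)"
    using V(1,3,4) by blast
qed

lemma tm_glue:
  assumes f: "tm Q J F f" and g: "tm Q K F g" and JK: "open J" "open K"
    and eq: "\<And>z. z \<in> J \<Longrightarrow> z \<in> K \<Longrightarrow> f z = g z"
  shows "tm Q (J \<union> K) F (\<lambda>z. if z \<in> J then f z else g z)"
proof (rule tm_local)
  fix z assume "z \<in> J \<union> K"
  then consider "z \<in> J" | "z \<in> K" by blast
  then show "\<exists>G. open G \<and> z \<in> G \<and> tm Q (G \<inter> (J \<union> K)) F (\<lambda>z. if z \<in> J then f z else g z)"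
  proof cases
    case 1
    have "J \<inter> (J \<union> K) = J" by blast
    then show ?thesis using JK 1 tm_cong[OF f, of "\<lambda>z. if z \<in> J then f z else g z" F 0]
      by (intro exI[of _ J]) simp
  next
    case 2
    have "K \<inter> (J \<union> K) = K" by blast
    then show ?thesis using JK 2 eq tm_cong[OF g, of "\<lambda>z. if z \<in> J then f z else g z" F 0]
      by (intro exI[of _ K]) simp
  qed
qed

text \<open>Analytic continuation: the set of agreement is closed, since \<open>Q\<close> is Hausdorff, and open, since a chart
  around a common value is locally injective and both maps equal \<open>F\<close> there up to the same constant.\<close>

lemma tm_unique:
  assumes Q: "pointed_translation_structure Q" and f: "tm Q J F f" and g: "tm Q J F g"
    and J: "connected J" and a: "a \<in> J" "f a = g a" and z: "z \<in> J"
  shows "f z = g z"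
proof -
  let ?E = "{z \<in> J. f z = g z}"
  have H: "Hausdorff_space (top_of Q)"
    using Q unfolding pointed_translation_structure_def translation_structure_def surface_def by blast
  have "closedin (top_of_set J) ?E"
    using closedin_continuous_maps_eq[OF H tm_continuous[OF f] tm_continuous[OF g]] by simp
  moreover have "openin (top_of_set J) ?E"
  proof (subst openin_subopen, intro ballI)
    fix x assume "x \<in> ?E"
    then have x: "x \<in> J" "f x = g x" by auto
    obtain V \<psi> where V: "(V, \<psi>) \<in> atlas Q" "f x \<in> V" "inj_on \<psi> V"
      using nice_chart[OF pts_translation_structure[OF Q], of "f x" "points Q"] tm_point[OF f x(1)]
      by (metis openin_topspace)
    obtain G1 where G1: "open G1" "x \<in> G1"
      "\<And>z'. z' \<in> G1 \<Longrightarrow> z' \<in> J \<Longrightarrow> f z' \<in> V \<and> \<psi> (f z') - F z' = \<psi> (f x) - F x"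
      using tm_chart[OF Q f x(1) V(1,2)] by metis
    obtain G2 where G2: "open G2" "x \<in> G2"
      "\<And>z'. z' \<in> G2 \<Longrightarrow> z' \<in> J \<Longrightarrow> g z' \<in> V \<and> \<psi> (g z') - F z' = \<psi> (g x) - F x"
      using tm_chart[OF Q g x(1) V(1)] V(2) x(2) by metis
    have "f z' = g z'" if z': "z' \<in> G1" "z' \<in> G2" "z' \<in> J" for z'
    proof -
      have "\<psi> (f z') = \<psi> (g z')" using G1(3)[of z'] G2(3)[of z'] z' x(2)
        by (metis diff_add_cancel)
      then show ?thesis using G1(3)[of z'] G2(3)[of z'] z' V(3) by (meson inj_onD)
    qed
    then have "J \<inter> (G1 \<inter> G2) \<subseteq> ?E" by blast
    moreover have "openin (top_of_set J) (J \<inter> (G1 \<inter> G2))" using G1 G2 by (simp add: openin_open_Int open_Int)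
    moreover have "x \<in> J \<inter> (G1 \<inter> G2)" using G1 G2 x by blast
    ultimately show "\<exists>T. openin (top_of_set J) T \<and> x \<in> T \<and> T \<subseteq> ?E" by blast
  qed
  ultimately have "?E = {} \<or> ?E = J" using J unfolding connected_clopen by blast
  then show ?thesis using a z by blast
qed

lemma ball_tm_exists:
  assumes Q: "pointed_translation_structure Q" and p: "p \<in> G" "openin (top_of Q) G"
  obtains r e where "0 < r" "tm Q (ball 0 r) (\<lambda>v. v) e" "e 0 = p" "e ` ball 0 r \<subseteq> G" "inj_on e (ball 0 r)"
proof -
  obtain V \<psi> where V: "(V, \<psi>) \<in> atlas Q" "p \<in> V" "V \<subseteq> G" "openin (top_of Q) V" "inj_on \<psi> V" "open (\<psi> ` V)"
    "homeomorphic_map (subtopology (top_of Q) V) (top_of_set (\<psi> ` V)) \<psi>"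
    using nice_chart[OF pts_translation_structure[OF Q] p] .
  have tV: "topspace (subtopology (top_of Q) V) = V" using V(4) openin_subset by fastforce
  obtain r where r: "0 < r" "ball (\<psi> p) r \<subseteq> \<psi> ` V"
    using V(2,6) by (meson imageI open_contains_ball)
  let ?g = "inv_into V \<psi>"
  define e where "e = (\<lambda>v. ?g (\<psi> p + v))"
  have "homeomorphic_maps (subtopology (top_of Q) V) (top_of_set (\<psi> ` V)) \<psi> ?g"
    using homeomorphic_maps_inv_into[OF V(7)] unfolding tV .
  then have "continuous_map (top_of_set (\<psi> ` V)) (subtopology (top_of Q) V) ?g"
    unfolding homeomorphic_maps_def by blast
  then have cg: "continuous_map (top_of_set (\<psi> ` V)) (top_of Q) ?g"
    by (simp add: continuous_map_in_subtopology)
  have sub: "\<psi> p + v \<in> \<psi> ` V" if "v \<in> ball 0 r" for v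
    using r(2) that by (auto simp: dist_norm subset_iff)
  have ev: "e v \<in> V" "\<psi> (e v) = \<psi> p + v" if "v \<in> ball 0 r" for v
    using sub[OF that] unfolding e_def by (simp_all add: inv_into_into f_inv_into_f)
  have e0: "e 0 = p" using V(2,5) unfolding e_def by simp
  have "continuous_map (top_of_set (ball 0 r)) (top_of_set (\<psi> ` V)) (\<lambda>v. \<psi> p + v)"
    using sub by (auto simp: continuous_map_subtopology_eu intro!: continuous_intros)
  from continuous_map_compose[OF this cg]
  have "continuous_map (top_of_set (ball 0 r)) (top_of Q) e" by (simp add: e_def o_def)
  then have "tm Q (ball 0 r) (\<lambda>v. v) e"
  proof (rule tmI)
    fix z :: plane assume z: "z \<in> ball 0 r"
    show "\<exists>V \<psi> G. (V, \<psi>) \<in> atlas Q \<and> open G \<and> z \<in> G \<and>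
      (\<forall>z'. z' \<in> G \<longrightarrow> z' \<in> ball 0 r \<longrightarrow> e z' \<in> V \<and> \<psi> (e z') - z' = \<psi> (e z) - z)"
      by (rule exI[of _ V], rule exI[of _ \<psi>], rule exI[of _ UNIV]) (use ev z V(1) in simp)
  qed
  moreover have "inj_on e (ball 0 r)" by (rule inj_onI) (metis ev(2) add_left_cancel)
  ultimately show ?thesis using that[OF r(1)] e0 ev(1) V(3) by blast
qed

text \<open>Charts are local homeomorphisms, and \<open>e\<close> is locally the inverse of one after a translation.\<close>

lemma tm_open:
  assumes Q: "pointed_translation_structure Q" and e: "tm Q G (\<lambda>v. v) e" and G: "open (G :: plane set)"
  shows "openin (top_of Q) (e ` G)"
proof (subst openin_subopen, intro ballI)
  fix y assume "y \<in> e ` G"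
  then obtain a where a: "a \<in> G" "y = e a" by blast
  obtain V \<psi> where V: "(V, \<psi>) \<in> atlas Q" "e a \<in> V" "openin (top_of Q) V" "inj_on \<psi> V" "open (\<psi> ` V)"
    "homeomorphic_map (subtopology (top_of Q) V) (top_of_set (\<psi> ` V)) \<psi>"
    using nice_chart[OF pts_translation_structure[OF Q], of "e a" "points Q"] tm_point[OF e a(1)]
    by (metis openin_topspace)
  obtain G1 where G1: "open G1" "a \<in> G1"
      "\<And>z'. z' \<in> G1 \<Longrightarrow> z' \<in> G \<Longrightarrow> e z' \<in> V \<and> \<psi> (e z') - z' = \<psi> (e a) - a"
    using tm_chart[OF Q e a(1) V(1,2)] by metis
  let ?B = "(\<lambda>z. z + (\<psi> (e a) - a)) ` (G1 \<inter> G)"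
  have oB: "open ?B" using open_translation[of "G1 \<inter> G" "\<psi> (e a) - a"] G1(1) G
    by (simp add: open_Int add.commute)
  have cont: "continuous_map (subtopology (top_of Q) V) euclidean \<psi>"
    using homeomorphic_imp_continuous_map[OF V(6)] continuous_map_into_fulltopology by blast
  have "openin (subtopology (top_of Q) V) {q \<in> topspace (subtopology (top_of Q) V). \<psi> q \<in> ?B}"
    using openin_continuous_map_preimage[OF cont] oB by simp
  then have o: "openin (top_of Q) {q \<in> V. \<psi> q \<in> ?B}"
    using V(3) openin_subset[OF V(3)] by (simp add: openin_trans_full Int_absorb1)
  have eB: "\<psi> (e z) = z + (\<psi> (e a) - a)" "e z \<in> V" if "z \<in> G1 \<inter> G" for z
    using G1(3)[of z] that by (auto simp: algebra_simps)
  have "{q \<in> V. \<psi> q \<in> ?B} \<subseteq> e ` G"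
  proof clarify
    fix q z assume q: "q \<in> V" "\<psi> q = z + (\<psi> (e a) - a)" "z \<in> G1" "z \<in> G"
    then have "\<psi> q = \<psi> (e z)" using eB[of z] by simp
    then have "q = e z" using V(4) q(1) eB(2)[of z] q by (meson IntI inj_onD)
    then show "q \<in> e ` G" using q by blast
  qed
  moreover have "\<psi> (e a) \<in> ?B" using a(1) G1(2) by (intro image_eqI[of _ _ a]) simp_all
  then have "y \<in> {q \<in> V. \<psi> q \<in> ?B}" using a(2) V(2) by simp
  ultimately show "\<exists>T. openin (top_of Q) T \<and> y \<in> T \<and> T \<subseteq> e ` G" using o by blast
qed

lemma immersion_tm:
  assumes S: "pointed_translation_structure S" and T: "pointed_translation_structure T"
    and i: "is_immersion S A T B \<iota>" and e: "tm S J F e" and J: "e ` J \<subseteq> A"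
  shows "tm T J F (\<lambda>z. \<iota> (e z))"
proof (rule tmI)
  have "continuous_map (subtopology (top_of S) A) (top_of T) \<iota>"
    using i unfolding is_immersion_def by (simp add: continuous_map_in_subtopology)
  moreover have "continuous_map (top_of_set J) (subtopology (top_of S) A) e"
    using tm_continuous[OF e] J by (simp add: continuous_map_in_subtopology image_subset_iff_funcset)
  ultimately show "continuous_map (top_of_set J) (top_of T) (\<lambda>z. \<iota> (e z))"
    using continuous_map_compose[of "top_of_set J" "subtopology (top_of S) A" e "top_of T" \<iota>]
    by (simp add: o_def)
  fix z assume z: "z \<in> J"
  then have "e z \<in> A" using J by blast
  then have "\<exists>(U, \<phi>) \<in> atlas S. \<exists>(V, \<psi>) \<in> atlas T. \<exists>v.
        e z \<in> U \<and> \<iota> ` (U \<inter> A) \<subseteq> V \<and> (\<forall>s' \<in> U \<inter> A. \<psi> (\<iota> s') = v + \<phi> s')"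
    using i unfolding is_immersion_def by blast
  then obtain U \<phi> V \<psi> v where c: "(U, \<phi>) \<in> atlas S" "(V, \<psi>) \<in> atlas T" "e z \<in> U"
    "\<iota> ` (U \<inter> A) \<subseteq> V" "\<forall>s' \<in> U \<inter> A. \<psi> (\<iota> s') = v + \<phi> s'"
    by blast
  obtain G where G: "open G" "z \<in> G"
    "\<And>z'. z' \<in> G \<Longrightarrow> z' \<in> J \<Longrightarrow> e z' \<in> U \<and> \<phi> (e z') - F z' = \<phi> (e z) - F z"
    using tm_chart[OF S e z c(1,3)] by metis
  have "\<iota> (e z') \<in> V \<and> \<psi> (\<iota> (e z')) - F z' = \<psi> (\<iota> (e z)) - F z" if z': "z' \<in> G" "z' \<in> J" for z'
  proof -
    have m: "e z' \<in> U \<inter> A" "e z \<in> U \<inter> A" using G(3)[OF z'] z' J z c(3) by auto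
    then have "\<psi> (\<iota> (e z')) = v + \<phi> (e z')" "\<psi> (\<iota> (e z)) = v + \<phi> (e z)" using c(5) by blast+
    moreover have "\<iota> (e z') \<in> V" using m c(4) by blast
    ultimately show ?thesis using G(3)[OF z'] by (simp add: add_diff_eq[symmetric])
  qed
  then show "\<exists>V \<psi> G. (V, \<psi>) \<in> atlas T \<and> open G \<and> z \<in> G \<and>
      (\<forall>z'. z' \<in> G \<longrightarrow> z' \<in> J \<longrightarrow> \<iota> (e z') \<in> V \<and> \<psi> (\<iota> (e z')) - F z' = \<psi> (\<iota> (e z)) - F z)"
    using c(2) G(1,2) by blast
qed

text \<open>Immersions are defined through charts of the domain. It is more convenient to check them along translation
  maps \<open>e\<close> from plane sets: injectivity of \<open>e\<close> makes its inverse a chart.\<close>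

lemma immersionI_tm:
  assumes S: "pointed_translation_structure S" and T: "pointed_translation_structure T"
    and A: "A \<in> PC S" and b: "\<iota> (basept S) = basept T"
    and loc: "\<And>s. s \<in> A \<Longrightarrow> \<exists>G e e' a. open G \<and> a \<in> G \<and> e a = s \<and> tm S G (\<lambda>v. v) e \<and> inj_on e G \<and>
      tm T G (\<lambda>v. v) e' \<and> (\<forall>w\<in>G. e w \<in> A \<longrightarrow> \<iota> (e w) = e' w)"
  shows "is_immersion S A T (points T) \<iota>"
proof -
  have AS: "A \<subseteq> points S" using A unfolding PC_def path_connectedin_def by blast
  have img: "\<iota> ` A \<subseteq> points T"
  proof clarify
    fix s assume s: "s \<in> A"
    from loc[OF s] obtain G e e' a where l: "open G" "a \<in> G" "e a = s" "tm T G (\<lambda>v. v) e'"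
      "\<forall>w\<in>G. e w \<in> A \<longrightarrow> \<iota> (e w) = e' w" by blast
    then show "\<iota> s \<in> points T" using tm_point s by metis
  qed
  have cont: "continuous_map (subtopology (top_of S) A) (top_of T) \<iota>"
    unfolding continuous_map
  proof (intro conjI allI impI)
    show "\<iota> ` topspace (subtopology (top_of S) A) \<subseteq> points T" using img by auto
    fix V assume V: "openin (top_of T) V"
    show "openin (subtopology (top_of S) A) {x \<in> topspace (subtopology (top_of S) A). \<iota> x \<in> V}"
    proof (subst openin_subopen, intro ballI)
      fix s assume "s \<in> {x \<in> topspace (subtopology (top_of S) A). \<iota> x \<in> V}"
      then have s: "s \<in> A" "\<iota> s \<in> V" by auto
      obtain G e e' a where l: "open G" "a \<in> G" "e a = s" "tm S G (\<lambda>v. v) e" "tm T G (\<lambda>v. v) e'"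
        "\<forall>w\<in>G. e w \<in> A \<longrightarrow> \<iota> (e w) = e' w" using loc[OF s(1)] by blast
      obtain G' where G': "open G'" "{z \<in> G. e' z \<in> V} = G' \<inter> G" using tm_preimage[OF l(5) V] .
      have "e' a \<in> V" using l s by metis
      then have a: "a \<in> G' \<inter> G" using G' l by blast
      have "openin (top_of S) (e ` (G' \<inter> G))"
        by (rule tm_open[OF S tm_subset[OF l(4)]]) (use G' l in auto)
      then have o: "openin (subtopology (top_of S) A) (A \<inter> e ` (G' \<inter> G))"
        by (simp add: openin_subtopology_Int2)
      moreover have "s \<in> A \<inter> e ` (G' \<inter> G)" using a l s by blast
      moreover have "A \<inter> e ` (G' \<inter> G) \<subseteq> {x \<in> topspace (subtopology (top_of S) A). \<iota> x \<in> V}"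
      proof
        fix x assume "x \<in> A \<inter> e ` (G' \<inter> G)"
        then obtain w where w: "x = e w" "e w \<in> A" "w \<in> G'" "w \<in> G" by blast
        then have "\<iota> (e w) = e' w" "e' w \<in> V" using l(6) G'(2) by auto
        then show "x \<in> {x \<in> topspace (subtopology (top_of S) A). \<iota> x \<in> V}" using w AS by auto
      qed
      ultimately show "\<exists>T. openin (subtopology (top_of S) A) T \<and> s \<in> T \<and>
        T \<subseteq> {x \<in> topspace (subtopology (top_of S) A). \<iota> x \<in> V}" by blast
    qed
  qed
  have "\<exists>(U, \<phi>) \<in> atlas S. \<exists>(V, \<psi>) \<in> atlas T. \<exists>v.
        s \<in> U \<and> \<iota> ` (U \<inter> A) \<subseteq> V \<and> (\<forall>s' \<in> U \<inter> A. \<psi> (\<iota> s') = v + \<phi> s')" if s: "s \<in> A" for s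
  proof -
    obtain G e e' a where l: "open G" "a \<in> G" "e a = s" "tm S G (\<lambda>v. v) e" "tm T G (\<lambda>v. v) e'"
      "\<forall>w\<in>G. e w \<in> A \<longrightarrow> \<iota> (e w) = e' w" using loc[OF s] by blast
    obtain V \<psi> G1 where V: "(V, \<psi>) \<in> atlas T" "open G1" "a \<in> G1"
      "\<And>z'. z' \<in> G1 \<Longrightarrow> z' \<in> G \<Longrightarrow> e' z' \<in> V \<and> \<psi> (e' z') - z' = \<psi> (e' a) - a"
      using tmE[OF l(5,2)] by metis
    obtain U \<phi> G2 where U: "(U, \<phi>) \<in> atlas S" "e a \<in> U" "open G2" "a \<in> G2"
      "\<And>z'. z' \<in> G2 \<Longrightarrow> z' \<in> G \<Longrightarrow> e z' \<in> U \<and> \<phi> (e z') - z' = \<phi> (e a) - a"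
      using tmE[OF l(4,2)] by metis
    let ?G = "G \<inter> G1 \<inter> G2"
    let ?U = "e ` ?G"
    have oU: "openin (top_of S) ?U"
      by (rule tm_open[OF S tm_subset[OF l(4)]]) (use V U l in auto)
    have UU: "?U \<subseteq> U" using U(5) by blast
    have c: "(?U, restrict \<phi> ?U) \<in> atlas S"
      using chart_restrict_mem[OF pts_translation_structure[OF S] U(1) oU UU] .
    have sU: "s \<in> ?U" using l V U by blast
    define v where "v = (\<psi> (e' a) - a) - (\<phi> (e a) - a)"
    have k: "\<iota> s' \<in> V \<and> \<psi> (\<iota> s') = v + restrict \<phi> ?U s'" if s': "s' \<in> ?U \<inter> A" for s'
    proof -
      obtain w where w: "w \<in> ?G" "s' = e w" using s' by blast
      have i: "\<iota> s' = e' w" using l(6) w s' by blast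
      have 1: "e' w \<in> V" "\<psi> (e' w) - w = \<psi> (e' a) - a" using V(4)[of w] w by auto
      have 2: "\<phi> (e w) - w = \<phi> (e a) - a" using U(5)[of w] w by auto
      have "\<psi> (e' w) = (\<psi> (e' w) - w) - (\<phi> (e w) - w) + \<phi> (e w)" by simp
      also have "\<dots> = v + \<phi> (e w)" unfolding 1 2 v_def ..
      finally show ?thesis using 1 i s' w(2) by simp
    qed
    show ?thesis
      by (rule bexI[OF _ c], unfold split, rule bexI[OF _ V(1)], unfold split, rule exI[of _ v])
        (use sU k in blast)
  qed
  then show ?thesis unfolding is_immersion_def
    using A b cont img by (simp add: continuous_map_in_subtopology subset_refl image_subset_iff_funcset)
qed

lemma immersion_subset:
  assumes i: "is_immersion S A T B \<iota>" and A': "A' \<in> PC S" "A' \<subseteq> A"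
  shows "is_immersion S A' T B \<iota>"
proof -
  have "continuous_map (subtopology (top_of S) A') (subtopology (top_of T) B) \<iota>"
    by (rule continuous_map_from_subtopology_mono[OF _ A'(2)]) (use i in \<open>simp add: is_immersion_def\<close>)
  moreover have "\<exists>(U, \<phi>) \<in> atlas S. \<exists>(V, \<psi>) \<in> atlas T. \<exists>v.
        s \<in> U \<and> \<iota> ` (U \<inter> A') \<subseteq> V \<and> (\<forall>s' \<in> U \<inter> A'. \<psi> (\<iota> s') = v + \<phi> s')" if s: "s \<in> A'" for s
  proof -
    have "\<exists>(U, \<phi>) \<in> atlas S. \<exists>(V, \<psi>) \<in> atlas T. \<exists>v.
        s \<in> U \<and> \<iota> ` (U \<inter> A) \<subseteq> V \<and> (\<forall>s' \<in> U \<inter> A. \<psi> (\<iota> s') = v + \<phi> s')"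
      using i s A' unfolding is_immersion_def by blast
    then obtain U \<phi> V \<psi> v where c: "(U, \<phi>) \<in> atlas S" "(V, \<psi>) \<in> atlas T" "s \<in> U"
      "\<iota> ` (U \<inter> A) \<subseteq> V" "\<forall>s' \<in> U \<inter> A. \<psi> (\<iota> s') = v + \<phi> s'"
      by blast
    show ?thesis
      by (rule bexI[OF _ c(1)], unfold split, rule bexI[OF _ c(2)], unfold split, rule exI[of _ v])
        (use c A' in blast)
  qed
  ultimately show ?thesis using i A' unfolding is_immersion_def by blast
qed

lemma tm_isomorphism:
  assumes h: "translation_isomorphism (top_of P) (atlas P) (top_of Q) (atlas Q) h"
    and P: "pointed_translation_structure P" and f: "tm P J F f"
  shows "tm Q J F (\<lambda>z. h (f z))"
proof (rule tmI)
  have hm: "homeomorphic_map (top_of P) (top_of Q) h" and at: "atlas Q = push_chart (points P) h ` atlas P"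
    using h unfolding translation_isomorphism_def by auto
  have inj: "inj_on h (points P)" using homeomorphic_imp_injective_map[OF hm] .
  show "continuous_map (top_of_set J) (top_of Q) (\<lambda>z. h (f z))"
    using continuous_map_compose[OF tm_continuous[OF f] homeomorphic_imp_continuous_map[OF hm]]
    by (simp add: o_def)
  fix z assume z: "z \<in> J"
  obtain V \<psi> G where V: "(V, \<psi>) \<in> atlas P" "f z \<in> V" "open G" "z \<in> G"
    "\<And>z'. z' \<in> G \<Longrightarrow> z' \<in> J \<Longrightarrow> f z' \<in> V \<and> \<psi> (f z') - F z' = \<psi> (f z) - F z"
    using tmE[OF f z] by metis
  have sub: "V \<subseteq> points P" using openin_subset[OF pts_atlas_open[OF P V(1)]] .
  let ?\<psi> = "restrict (\<psi> \<circ> inv_into (points P) h) (h ` V)"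
  have val: "?\<psi> (h q) = \<psi> q" if "q \<in> V" for q using push_chart_value[OF inj sub that] .
  have mem: "(h ` V, ?\<psi>) \<in> atlas Q" unfolding at using V(1) by (force simp: push_chart_def)
  have "h (f z') \<in> h ` V \<and> ?\<psi> (h (f z')) - F z' = ?\<psi> (h (f z)) - F z" if "z' \<in> G" "z' \<in> J" for z'
    using V(5)[OF that] val[OF V(2)] val[of "f z'"] by simp
  then show "\<exists>V \<psi> G. (V, \<psi>) \<in> atlas Q \<and> open G \<and> z \<in> G \<and>
      (\<forall>z'. z' \<in> G \<longrightarrow> z' \<in> J \<longrightarrow> h (f z') \<in> V \<and> \<psi> (h (f z')) - F z' = \<psi> (h (f z)) - F z)"
    using mem V(3,4) by blast
qed

section \<open>Chains of balls\<close>

text \<open>The exponential map at \<open>p\<close> is defined on the ball of radius \<open>\<rho>\<close>. It need not be injective, so nothing prevents the ball from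
  overlapping itself.\<close>

definition exp_ball :: "'b pointed_surface \<Rightarrow> real \<Rightarrow> 'b \<Rightarrow> (plane \<Rightarrow> 'b) \<Rightarrow> bool" where
  "exp_ball Q \<rho> p e \<longleftrightarrow> 0 < \<rho> \<and> tm Q (ball 0 \<rho>) (\<lambda>v. v) e \<and> e 0 = p"

definition step :: "'b pointed_surface \<Rightarrow> real \<Rightarrow> plane \<Rightarrow> 'b \<Rightarrow> 'b \<Rightarrow> bool" where
  "step Q \<rho> v p q \<longleftrightarrow> norm v < \<rho> \<and> (\<exists>e. exp_ball Q \<rho> p e \<and> e v = q)"

type_synonym chain = "(plane \<times> real) list"

text \<open>A chain can fail to be read, but its end is unique (\<open>dev_det\<close>). So \<open>dev Q p C\<close> is a partial function of \<open>p\<close>,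
  written as a relation.\<close>

fun dev :: "'b pointed_surface \<Rightarrow> 'b \<Rightarrow> chain \<Rightarrow> 'b \<Rightarrow> bool" where
  "dev Q p [] q \<longleftrightarrow> p = q"
| "dev Q p ((v, \<rho>) # C) q \<longleftrightarrow> (\<exists>p'. step Q \<rho> v p p' \<and> dev Q p' C q)"

definition shrink :: "real \<Rightarrow> chain \<Rightarrow> chain" where
  "shrink \<delta> = map (\<lambda>(v, \<rho>). (v, \<rho> - \<delta>))"

text \<open>Slack \<open>\<delta>\<close> is what allows radii to be reduced by \<open>\<delta>\<close>, or the starting point to be displaced by less than \<open>\<delta>\<close>, without leaving any of the
  balls.\<close>

definition slack :: "real \<Rightarrow> chain \<Rightarrow> bool" where
  "slack \<delta> C \<longleftrightarrow> (\<forall>(v, \<rho>)\<in>set C. norm v + \<delta> < \<rho>)"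

text \<open>The way back. The ball of radius \<open>\<rho>\<close> around the old point contains the one of radius \<open>\<rho> - norm v\<close> around the new point.\<close>

definition retrace :: "chain \<Rightarrow> chain" where
  "retrace C = rev (map (\<lambda>(v, \<rho>). (- v, \<rho> - norm v)) C)"

lemma shrink_simps [simp]:
  "shrink \<delta> [] = []" "shrink \<delta> ((v, \<rho>) # C) = (v, \<rho> - \<delta>) # shrink \<delta> C"
  "shrink \<delta> (C @ C') = shrink \<delta> C @ shrink \<delta> C'"
  by (simp_all add: shrink_def)

lemma shrink_0 [simp]: "shrink 0 C = C"
  by (induction C) auto

lemma shrink_shrink: "shrink \<delta> (shrink \<epsilon> C) = shrink (\<epsilon> + \<delta>) C"
  by (induction C) (auto simp: algebra_simps)

lemma slack_simps [simp]:
  "slack \<delta> []" "slack \<delta> ((v, \<rho>) # C) \<longleftrightarrow> norm v + \<delta> < \<rho> \<and> slack \<delta> C"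
  "slack \<delta> (C @ C') \<longleftrightarrow> slack \<delta> C \<and> slack \<delta> C'"
  by (auto simp: slack_def)

lemma slack_shrink: "slack \<delta> (shrink \<epsilon> C) \<longleftrightarrow> slack (\<epsilon> + \<delta>) C"
  by (induction C) auto

lemma slack_mono: "slack \<delta> C \<Longrightarrow> \<epsilon> \<le> \<delta> \<Longrightarrow> slack \<epsilon> C"
  by (induction C) auto

lemma exp_ball_shift:
  assumes e: "exp_ball Q \<rho> p e" and s: "0 < \<sigma>" "\<sigma> + norm v \<le> \<rho>"
  shows "exp_ball Q \<sigma> (e v) (\<lambda>w. e (v + w))"
proof -
  have "(\<lambda>w. v + w) ` ball 0 \<sigma> \<subseteq> ball 0 \<rho>"
  proof clarify
    fix w :: plane assume "w \<in> ball 0 \<sigma>"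
    then show "v + w \<in> ball 0 \<rho>" using norm_triangle_ineq[of v w] s by simp
  qed
  moreover have "continuous_on (ball 0 \<sigma>) (\<lambda>w. v + w)" by (intro continuous_intros)
  moreover have "tm Q (ball 0 \<rho>) (\<lambda>v. v) e" using e unfolding exp_ball_def by blast
  ultimately have "tm Q (ball 0 \<sigma>) (\<lambda>w. v + w) (\<lambda>w. e (v + w))"
    using tm_compose[of Q "ball 0 \<rho>" "\<lambda>v. v" e "ball 0 \<sigma>" "\<lambda>w. v + w"] by blast
  from tm_cong[OF this, of "\<lambda>w. e (v + w)" "\<lambda>w. w" "- v"]
  show ?thesis unfolding exp_ball_def using s by simp
qed

lemma exp_ball_mono: "exp_ball Q \<rho> p e \<Longrightarrow> 0 < \<sigma> \<Longrightarrow> \<sigma> \<le> \<rho> \<Longrightarrow> exp_ball Q \<sigma> p e"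
  unfolding exp_ball_def by (meson subset_ball tm_subset)

lemma exp_ball_unique:
  assumes Q: "pointed_translation_structure Q" and e: "exp_ball Q \<rho> p e" "exp_ball Q \<sigma> p e'"
    and w: "norm w < \<rho>" "norm w < \<sigma>"
  shows "e w = e' w"
proof -
  let ?r = "min \<rho> \<sigma>"
  have r: "0 < ?r" using e unfolding exp_ball_def by simp
  have "exp_ball Q ?r p e" "exp_ball Q ?r p e'" using e r exp_ball_mono by force+
  then show ?thesis unfolding exp_ball_def
    using tm_unique[OF Q, of "ball 0 ?r" "\<lambda>v. v" e e' 0 w] r w by simp
qed

lemma exp_ball_points: "exp_ball Q \<rho> p e \<Longrightarrow> norm w < \<rho> \<Longrightarrow> e w \<in> points Q"
  unfolding exp_ball_def using tm_point by (metis mem_ball_0)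

lemma step_points: "step Q \<rho> v p q \<Longrightarrow> q \<in> points Q"
  by (metis exp_ball_points step_def)

lemma step_det:
  assumes "pointed_translation_structure Q" "step Q \<rho> v p q" "step Q \<sigma> v p q'"
  shows "q = q'"
  using assms by (metis exp_ball_unique step_def)

lemma step_value:
  assumes "pointed_translation_structure Q" "exp_ball Q \<sigma> p e" "step Q \<rho> v p q" "norm v < \<sigma>"
  shows "q = e v"
  using assms by (metis exp_ball_unique step_def)

lemma step_mono: "step Q \<rho> v p q \<Longrightarrow> norm v < \<sigma> \<Longrightarrow> \<sigma> \<le> \<rho> \<Longrightarrow> step Q \<sigma> v p q"
  by (metis exp_ball_mono norm_ge_zero order_le_less_trans step_def)

lemma step_add:
  assumes e: "exp_ball Q \<rho> p e" and n: "norm v + \<sigma> \<le> \<rho>" "norm w < \<sigma>"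
  shows "step Q \<sigma> w (e v) (e (v + w))"
proof -
  have "0 < \<sigma>" using n norm_ge_zero[of w] by linarith
  then show ?thesis using exp_ball_shift[OF e, of \<sigma> v] n unfolding step_def by (metis add.commute)
qed

lemma step_back:
  assumes s: "step Q \<rho> v p q" and n: "2 * norm v < \<rho>"
  shows "step Q (\<rho> - norm v) (- v) q p"
proof -
  obtain e where e: "exp_ball Q \<rho> p e" "e v = q" using s unfolding step_def by blast
  then show ?thesis using step_add[OF e(1), of v "\<rho> - norm v" "- v"] n
    unfolding exp_ball_def by simp
qed

text \<open>Both displacements are made inside the same ball around \<open>p\<close>, and there they commute.\<close>

lemma step_perturb:
  assumes Q: "pointed_translation_structure Q" and s: "step Q \<rho> v p q" and n: "norm v + \<delta> < \<rho>"
    and w: "step Q \<delta> w p p1"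
  obtains q1 where "step Q (\<rho> - \<delta>) v p1 q1" "step Q \<delta> w q q1"
proof -
  obtain e where e: "exp_ball Q \<rho> p e" "e v = q" using s unfolding step_def by blast
  have nw: "norm w < \<delta>" using w unfolding step_def by blast
  have p1: "p1 = e w" using step_value[OF Q e(1) w] n nw norm_ge_zero[of v] by linarith
  have "step Q (\<rho> - \<delta>) v p1 (e (w + v))"
    unfolding p1 by (rule step_add[OF e(1)]) (use n nw in auto)
  moreover have "step Q \<delta> w q (e (v + w))"
    unfolding e(2)[symmetric] by (rule step_add[OF e(1)]) (use n nw in auto)
  ultimately show ?thesis using that by (simp add: add.commute)
qed

lemma dev_append: "dev Q p (C @ C') q \<longleftrightarrow> (\<exists>m. dev Q p C m \<and> dev Q m C' q)"
proof (induction C arbitrary: p)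
  case (Cons a C)
  then show ?case by (cases a) (simp, metis)
qed simp

lemma dev_det:
  assumes Q: "pointed_translation_structure Q"
  shows "dev Q p C q \<Longrightarrow> dev Q p C q' \<Longrightarrow> q = q'"
proof (induction C arbitrary: p)
  case (Cons a C)
  obtain v \<rho> where a: "a = (v, \<rho>)" by (cases a)
  from Cons.prems a obtain m m' where "step Q \<rho> v p m" "dev Q m C q" "step Q \<rho> v p m'" "dev Q m' C q'"
    by auto
  then show ?case using Cons.IH step_det[OF Q] by blast
qed simp

lemma dev_shrink: "dev Q p C q \<Longrightarrow> slack \<delta> C \<Longrightarrow> 0 \<le> \<delta> \<Longrightarrow> dev Q p (shrink \<delta> C) q"
proof (induction C arbitrary: p)
  case (Cons a C)
  obtain v \<rho> where a: "a = (v, \<rho>)" by (cases a)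
  obtain m where m: "step Q \<rho> v p m" "dev Q m C q" using Cons.prems a by auto
  have "step Q (\<rho> - \<delta>) v p m" using step_mono[OF m(1), of "\<rho> - \<delta>"] Cons.prems a by auto
  then show ?case using Cons.IH[OF m(2)] Cons.prems a by auto
qed simp

text \<open>A chain that starts at a displaced point runs parallel to the original one and ends at a point displaced by the same vector.\<close>

lemma dev_perturb:
  assumes Q: "pointed_translation_structure Q"
  shows "dev Q p C q \<Longrightarrow> slack \<delta> C \<Longrightarrow> step Q \<delta> w p p1 \<Longrightarrow>
    \<exists>q1. dev Q p1 (shrink \<delta> C) q1 \<and> step Q \<delta> w q q1"
proof (induction C arbitrary: p p1)
  case (Cons a C)
  obtain v \<rho> where a: "a = (v, \<rho>)" by (cases a)
  obtain m where m: "step Q \<rho> v p m" "dev Q m C q" using Cons.prems a by auto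
  obtain m1 where m1: "step Q (\<rho> - \<delta>) v p1 m1" "step Q \<delta> w m m1"
    using step_perturb[OF Q m(1) _ Cons.prems(3)] Cons.prems(2) a by auto
  then show ?case using Cons.IH[OF m(2) _ m1(2)] Cons.prems(2) a by auto
qed auto

lemma retrace_Cons: "retrace ((v, \<rho>) # C) = retrace C @ [(- v, \<rho> - norm v)]"
  by (simp add: retrace_def)

lemma dev_back:
  "dev Q p C q \<Longrightarrow> \<forall>(v, \<rho>)\<in>set C. 2 * norm v < \<rho> \<Longrightarrow> dev Q q (retrace C) p"
proof (induction C arbitrary: p)
  case Nil then show ?case by (simp add: retrace_def)
next
  case (Cons a C)
  obtain v \<rho> where a: "a = (v, \<rho>)" by (cases a)
  obtain m where m: "step Q \<rho> v p m" "dev Q m C q" using Cons.prems a by auto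
  have "step Q (\<rho> - norm v) (- v) m p" using step_back[OF m(1)] Cons.prems a by auto
  then show ?case using Cons.IH[OF m(2)] Cons.prems a by (auto simp: retrace_Cons dev_append)
qed

lemma dev_isomorphism:
  assumes h: "translation_isomorphism (top_of P) (atlas P) (top_of Q) (atlas Q) h"
    and P: "pointed_translation_structure P"
  shows "dev P p C q \<Longrightarrow> dev Q (h p) C (h q)"
proof (induction C arbitrary: p)
  case (Cons a C)
  obtain v \<rho> where a: "a = (v, \<rho>)" by (cases a)
  obtain m where m: "step P \<rho> v p m" "dev P m C q" using Cons.prems a by auto
  obtain e where e: "exp_ball P \<rho> p e" "e v = m" "norm v < \<rho>" using m unfolding step_def by blast
  have "exp_ball Q \<rho> (h p) (\<lambda>z. h (e z))"
    using tm_isomorphism[OF h P, of "ball 0 \<rho>" "\<lambda>v. v" e] e unfolding exp_ball_def by simp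
  then have "step Q \<rho> v (h p) (h m)" using e unfolding step_def by blast
  then show ?case using Cons.IH[OF m(2)] a by auto
qed simp

lemma exp_ball_exists:
  assumes Q: "pointed_translation_structure Q" and p: "p \<in> G" "openin (top_of Q) G"
  obtains r e where "exp_ball Q r p e" "e ` ball 0 r \<subseteq> G" "inj_on e (ball 0 r)"
  using ball_tm_exists[OF Q p] unfolding exp_ball_def by metis

text \<open>The points that can be reached in this way form a set that is open and closed. The bound \<open>4 * norm v < \<rho>\<close> leaves enough room to
  run the chain back after its radii have been reduced.\<close>

lemma chain_exists:
  assumes Q: "pointed_translation_structure Q" and p: "p \<in> points Q" and q: "q \<in> points Q"
  shows "\<exists>C. dev Q p C q \<and> (\<forall>(v, \<rho>)\<in>set C. 4 * norm v < \<rho>)"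
proof -
  define E where "E = {q \<in> points Q. \<exists>C. dev Q p C q \<and> (\<forall>(v, \<rho>)\<in>set C. 4 * norm v < \<rho>)}"
  have ext: "q' \<in> E" if s: "q \<in> E" "step Q \<rho> v q q'" "4 * norm v < \<rho>" for q q' \<rho> v
  proof -
    obtain C where C: "dev Q p C q" "\<forall>(v, \<rho>)\<in>set C. 4 * norm v < \<rho>" using s unfolding E_def by blast
    have "dev Q p (C @ [(v, \<rho>)]) q'" unfolding dev_append using C s by auto
    moreover have "\<forall>(v, \<rho>)\<in>set (C @ [(v, \<rho>)]). 4 * norm v < \<rho>"
      using C s by auto
    ultimately show ?thesis using step_points[OF s(2)] unfolding E_def by blast
  qed
  have "openin (top_of Q) E"
  proof (subst openin_subopen, intro ballI)
    fix x assume x: "x \<in> E"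
    then have "x \<in> points Q" unfolding E_def by blast
    then obtain r e where e: "exp_ball Q r x e" using exp_ball_exists[OF Q _ openin_topspace] by metis
    have r: "0 < r" using e unfolding exp_ball_def by blast
    have "openin (top_of Q) (e ` ball 0 (r/4))"
      using tm_open[OF Q tm_subset, of "ball 0 r" e "ball 0 (r/4)"] e r
      unfolding exp_ball_def by (auto simp: subset_ball)
    moreover have "x \<in> e ` ball 0 (r/4)" using e r unfolding exp_ball_def by force
    moreover have "e ` ball 0 (r/4) \<subseteq> E"
    proof clarify
      fix v :: plane assume "v \<in> ball 0 (r/4)"
      then show "e v \<in> E" using ext[OF x, of r v "e v"] e r unfolding step_def by auto
    qed
    ultimately show "\<exists>T. openin (top_of Q) T \<and> x \<in> T \<and> T \<subseteq> E" by blast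
  qed
  moreover have "openin (top_of Q) (points Q - E)"
  proof (subst openin_subopen, intro ballI)
    fix x assume x: "x \<in> points Q - E"
    then obtain r e where e: "exp_ball Q r x e" using exp_ball_exists[OF Q _ openin_topspace] by (metis DiffD1)
    have r: "0 < r" using e unfolding exp_ball_def by blast
    have "openin (top_of Q) (e ` ball 0 (r/6))"
      using tm_open[OF Q tm_subset, of "ball 0 r" e "ball 0 (r/6)"] e r
      unfolding exp_ball_def by (auto simp: subset_ball)
    moreover have "x \<in> e ` ball 0 (r/6)" using e r unfolding exp_ball_def by force
    moreover have "e ` ball 0 (r/6) \<subseteq> points Q - E"
    proof clarify
      fix v :: plane assume v: "v \<in> ball 0 (r/6)"
      have s: "step Q r v x (e v)" using e r v unfolding step_def by auto
      have v6: "norm v * 6 < r" using v by simp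
      then have "2 * norm v < r" using norm_ge_zero[of v] by linarith
      then have sb: "step Q (r - norm v) (- v) (e v) x" by (rule step_back[OF s])
      have "4 * norm (- v) < r - norm v" using v6 norm_ge_zero[of v] unfolding norm_minus_cancel by linarith
      then have "e v \<notin> E" using ext[OF _ sb] x by blast
      then show "e v \<in> points Q - E" using step_points[OF s] by blast
    qed
    ultimately show "\<exists>T. openin (top_of Q) T \<and> x \<in> T \<and> T \<subseteq> points Q - E" by blast
  qed
  moreover have "E \<subseteq> points Q" unfolding E_def by blast
  moreover have "connected_space (top_of Q)"
    using Q unfolding pointed_translation_structure_def translation_structure_def surface_def by blast
  ultimately have "E = {} \<or> E = points Q"
    unfolding connected_space_clopen_in closedin_def by blast
  moreover have "p \<in> E" unfolding E_def using p by (auto intro!: exI[of _ "[]"])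
  ultimately show ?thesis using q unfolding E_def by blast
qed

section \<open>Chains in a disk\<close>

text \<open>On an open set an injective translation map is a homeomorphism onto its image.\<close>

lemma lift_continuous:
  assumes Q: "pointed_translation_structure Q" and e: "tm Q G (\<lambda>v. v) e" "open (G :: plane set)" "inj_on e G"
    and g: "continuous_map (top_of_set A) (top_of Q) g" "g ` A \<subseteq> e ` G"
  shows "continuous_on A (\<lambda>x. inv_into G e (g x))"
  unfolding continuous_on_open_invariant
proof (intro allI impI)
  fix B :: "plane set" assume B: "open B"
  have "openin (top_of Q) (e ` (B \<inter> G))"
    by (rule tm_open[OF Q tm_subset[OF e(1)]]) (use B e(2) in auto)
  then have "openin (top_of_set A) {x \<in> A. g x \<in> e ` (B \<inter> G)}"
    using openin_continuous_map_preimage[OF g(1)] by fastforce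
  then obtain A' where A': "open A'" "{x \<in> A. g x \<in> e ` (B \<inter> G)} = A \<inter> A'" using openin_open by blast
  have "inv_into G e (g x) \<in> B \<longleftrightarrow> g x \<in> e ` (B \<inter> G)" if x: "x \<in> A" for x
  proof -
    obtain w where w: "w \<in> G" "g x = e w" using x g(2) by blast
    have i: "inv_into G e (g x) = w" using w e(3) by simp
    show ?thesis unfolding i unfolding w(2) using w(1) e(3) by (auto dest: inj_onD)
  qed
  then have "A' \<inter> A = (\<lambda>x. inv_into G e (g x)) -` B \<inter> A" using A'(2) by blast
  then show "\<exists>A'. open A' \<and> A' \<inter> A = (\<lambda>x. inv_into G e (g x)) -` B \<inter> A" using A'(1) by blast
qed

text \<open>A Lebesgue number argument: an exponential ball at a point contains smaller ones, of a common radius, at all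
  nearby points, and \<open>A\<close> is compact.\<close>

lemma uniform_exp_ball:
  fixes A :: "plane set"
  assumes Q: "pointed_translation_structure Q" and A: "compact A"
    and g: "continuous_map (top_of_set A) (top_of Q) g" "g ` A \<subseteq> U" and U: "openin (top_of Q) U"
  obtains r where "0 < r"
    "\<And>y. y \<in> A \<Longrightarrow> \<exists>e. exp_ball Q r (g y) e \<and> inj_on e (ball 0 r) \<and> e ` ball 0 r \<subseteq> U"
proof -
  have "\<exists>\<rho> e W. exp_ball Q \<rho> (g y) e \<and> e ` ball 0 \<rho> \<subseteq> U \<and> inj_on e (ball 0 \<rho>) \<and>
      open W \<and> y \<in> W \<and> (\<forall>y'\<in>A. y' \<in> W \<longrightarrow> g y' \<in> e ` ball 0 (\<rho>/2))" if y: "y \<in> A" for y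
  proof -
    have "g y \<in> U" using y g by blast
    then obtain \<rho> e where e: "exp_ball Q \<rho> (g y) e" "e ` ball 0 \<rho> \<subseteq> U" "inj_on e (ball 0 \<rho>)"
      using exp_ball_exists[OF Q _ U] by metis
    have r: "0 < \<rho>" using e unfolding exp_ball_def by blast
    have "openin (top_of Q) (e ` ball 0 (\<rho>/2))"
      by (rule tm_open[OF Q tm_subset, of "ball 0 \<rho>"]) (use e r in \<open>auto simp: exp_ball_def subset_ball\<close>)
    then have "openin (top_of_set A) {x \<in> A. g x \<in> e ` ball 0 (\<rho>/2)}"
      using openin_continuous_map_preimage[OF g(1)] by fastforce
    then obtain W where W: "open W" "{x \<in> A. g x \<in> e ` ball 0 (\<rho>/2)} = A \<inter> W" using openin_open by blast
    have "e 0 = g y" "0 \<in> ball (0::plane) (\<rho>/2)" using e r unfolding exp_ball_def by auto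
    then have "g y \<in> e ` ball 0 (\<rho>/2)" by (metis imageI)
    then have "y \<in> W" using W y by blast
    then show ?thesis using e W by blast
  qed
  then have "\<forall>y\<in>A. \<exists>\<rho> e W. exp_ball Q \<rho> (g y) e \<and> e ` ball 0 \<rho> \<subseteq> U \<and> inj_on e (ball 0 \<rho>) \<and>
      open W \<and> y \<in> W \<and> (\<forall>y'\<in>A. y' \<in> W \<longrightarrow> g y' \<in> e ` ball 0 (\<rho>/2))" by blast
  then obtain \<rho> e W where h: "\<And>y. y \<in> A \<Longrightarrow> exp_ball Q (\<rho> y) (g y) (e y) \<and> e y ` ball 0 (\<rho> y) \<subseteq> U \<and>
      inj_on (e y) (ball 0 (\<rho> y)) \<and>
      open (W y) \<and> y \<in> W y \<and> (\<forall>y'\<in>A. y' \<in> W y \<longrightarrow> g y' \<in> e y ` ball 0 (\<rho> y/2))"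
    by metis
  have "\<And>y. y \<in> A \<Longrightarrow> open (W y)" "A \<subseteq> (\<Union>y\<in>A. W y)" using h by blast+
  then obtain C where C: "C \<subseteq> A" "finite C" "A \<subseteq> (\<Union>y\<in>C. W y)"
    using compactE_image[OF A, of A W] by metis
  define r where "r = Min (insert 1 ((\<lambda>y. \<rho> y / 2) ` C))"
  have pos: "0 < \<rho> y" if "y \<in> A" for y using h[OF that] unfolding exp_ball_def by blast
  have r: "0 < r" unfolding r_def using C pos by (subst Min_gr_iff) auto
  have rle: "r \<le> \<rho> y / 2" if "y \<in> C" for y unfolding r_def using C that by (intro Min_le) auto
  show ?thesis
  proof (rule that[OF r])
    fix y assume y: "y \<in> A"
    then obtain c where c: "c \<in> C" "y \<in> W c" using C by blast
    then have cA: "c \<in> A" using C by blast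
    obtain a where a: "norm a < \<rho> c / 2" "g y = e c a" using h[OF cA] y c(2) by force
    have 1: "exp_ball Q r (g y) (\<lambda>w. e c (a + w))"
      unfolding a(2) by (rule exp_ball_shift[of Q "\<rho> c"]) (use h[OF cA] r a rle[OF c(1)] in auto)
    have sub: "a + w \<in> ball 0 (\<rho> c)" if "w \<in> ball 0 r" for w
      using norm_triangle_ineq[of a w] that a rle[OF c(1)] by simp
    have 2: "inj_on (\<lambda>w. e c (a + w)) (ball 0 r)"
    proof (rule inj_onI)
      fix x y assume "x \<in> ball 0 r" "y \<in> ball 0 r" "e c (a + x) = e c (a + y)"
      then have "a + x = a + y" using h[OF cA] sub by (meson inj_onD)
      then show "x = y" by simp
    qed
    have 3: "(\<lambda>w. e c (a + w)) ` ball 0 r \<subseteq> U" using h[OF cA] sub by blast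
    show "\<exists>e. exp_ball Q r (g y) e \<and> inj_on e (ball 0 r) \<and> e ` ball 0 r \<subseteq> U" using 1 2 3 by blast
  qed
qed

text \<open>A disk with exponential balls of one radius \<open>r\<close> around all its points. The radius is a parameter, so that it can be taken small enough for the
  image of the disk under an immersion as well. The set \<open>A\<close> is convex in order to contain the segments from \<open>b0\<close>.\<close>

locale disk_param =
  fixes R :: "'b pointed_surface" and A :: "plane set" and g :: "plane \<Rightarrow> 'b" and b0 :: plane
    and r :: real and E :: "plane \<Rightarrow> plane \<Rightarrow> 'b"
  assumes R: "pointed_translation_structure R"
    and A: "compact A" "convex A"
    and g: "continuous_map (top_of_set A) (top_of R) g" "inj_on g A"
    and b0: "b0 \<in> A" "g b0 = basept R"
    and E: "\<And>y. y \<in> A \<Longrightarrow> exp_ball R r (g y) (E y)"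
    and E_inj: "\<And>y. y \<in> A \<Longrightarrow> inj_on (E y) (ball 0 r)"
begin

lemma r_pos: "0 < r" using E[OF b0(1)] unfolding exp_ball_def by blast

lemma E0: "y \<in> A \<Longrightarrow> E y 0 = g y" using E unfolding exp_ball_def by blast

lemma E_tm: "y \<in> A \<Longrightarrow> tm R (ball 0 r) (\<lambda>v. v) (E y)" using E unfolding exp_ball_def by blast

lemma E_open:
  assumes "y \<in> A" "\<sigma> \<le> r"
  shows "openin (top_of R) (E y ` ball 0 \<sigma>)"
  by (rule tm_open[OF R tm_subset[OF E_tm]]) (use assms in \<open>auto simp: subset_ball\<close>)

lemma E_shift:
  assumes "y \<in> A" "y' \<in> A" "norm a < r" "g y' = E y a" "norm w + norm a < r"
  shows "E y' w = E y (a + w)"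
proof -
  have p: "0 < r - norm a" using assms(3) by simp
  have "exp_ball R (r - norm a) (E y a) (\<lambda>w. E y (a + w))"
    by (rule exp_ball_shift[OF E[OF assms(1)]]) (use p in auto)
  from exp_ball_unique[OF R E[OF assms(2), unfolded assms(4)] this, of w] show ?thesis
    using assms(5) norm_ge_zero[of a] by linarith
qed

text \<open>Uniform continuity of \<open>g\<close>, in a form that does not mention a metric on the surface.\<close>

lemma mesh_exists: "\<exists>\<eta>>0. \<forall>y\<in>A. \<forall>y'\<in>A. dist y y' < \<eta> \<longrightarrow> g y' \<in> E y ` ball 0 (r/8)"
proof -
  have "\<exists>W. open W \<and> y \<in> W \<and> (\<forall>y'\<in>A. y' \<in> W \<longrightarrow> g y' \<in> E y ` ball 0 (r/16))" if y: "y \<in> A" for y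
  proof -
    have "openin (top_of_set A) {x \<in> A. g x \<in> E y ` ball 0 (r/16)}"
      using openin_continuous_map_preimage[OF g(1) E_open[OF y, of "r/16"]] r_pos by fastforce
    then obtain W where W: "open W" "{x \<in> A. g x \<in> E y ` ball 0 (r/16)} = A \<inter> W" using openin_open by blast
    have "g y \<in> E y ` ball 0 (r/16)" using E0[OF y] r_pos by (intro image_eqI[of _ _ 0]) auto
    then show ?thesis using W y by blast
  qed
  then obtain W where W: "\<And>y. y \<in> A \<Longrightarrow> open (W y) \<and> y \<in> W y \<and> (\<forall>y'\<in>A. y' \<in> W y \<longrightarrow> g y' \<in> E y ` ball 0 (r/16))"
    by metis
  have "A \<subseteq> \<Union>(W ` A)" "\<And>G. G \<in> W ` A \<Longrightarrow> open G" using W by blast+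
  then obtain \<eta> where \<eta>: "0 < \<eta>" "\<And>x. x \<in> A \<Longrightarrow> \<exists>G\<in>W ` A. ball x \<eta> \<subseteq> G"
    using Heine_Borel_lemma[OF A(1)] by metis
  have "g y' \<in> E y ` ball 0 (r/8)" if y: "y \<in> A" "y' \<in> A" "dist y y' < \<eta>" for y y'
  proof -
    obtain z where z: "z \<in> A" "ball y \<eta> \<subseteq> W z" using \<eta>(2)[OF y(1)] by blast
    then have "y \<in> W z" "y' \<in> W z" using \<eta>(1) y(3) by (auto simp: subset_iff)
    then have "g y \<in> E z ` ball 0 (r/16)" "g y' \<in> E z ` ball 0 (r/16)" using W[OF z(1)] y by blast+
    then obtain a b where "a \<in> ball 0 (r/16)" "g y = E z a" "b \<in> ball 0 (r/16)" "g y' = E z b" by blast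
    then have a: "norm a < r/16" "g y = E z a" and b: "norm b < r/16" "g y' = E z b" by auto
    have n: "norm (b - a) < r/8" using norm_triangle_ineq4[of b a] a b by simp
    have "norm (b - a) + norm a < r" "norm a < r" using n a r_pos by linarith+
    then have "E y (b - a) = E z (a + (b - a))" using E_shift[OF z(1) y(1) _ a(2)] by blast
    then have "g y' = E y (b - a)" using b by simp
    then show ?thesis using n by auto
  qed
  then show ?thesis using \<eta>(1) by blast
qed

definition \<eta> :: real where
  "\<eta> = (SOME \<eta>. 0 < \<eta> \<and> (\<forall>y\<in>A. \<forall>y'\<in>A. dist y y' < \<eta> \<longrightarrow> g y' \<in> E y ` ball 0 (r/8)))"

lemma \<eta>: "0 < \<eta>" "\<And>y y'. y \<in> A \<Longrightarrow> y' \<in> A \<Longrightarrow> dist y y' < \<eta> \<Longrightarrow> g y' \<in> E y ` ball 0 (r/8)"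
  using someI_ex[OF mesh_exists] unfolding \<eta>_def[symmetric] by blast+

text \<open>The vector by which the surface point with parameter \<open>y'\<close> lies off that with parameter \<open>y\<close>, as seen in the ball around the
  latter. It is meaningful only for \<open>y\<close> and \<open>y'\<close> closer than \<open>\<eta>\<close>.\<close>

definition disp :: "plane \<Rightarrow> plane \<Rightarrow> plane" where
  "disp y y' = inv_into (ball 0 r) (E y) (g y')"

lemma disp_eqI:
  assumes "y \<in> A" "norm w < r" "E y w = g y'"
  shows "disp y y' = w"
  unfolding disp_def assms(3)[symmetric] using E_inj[OF assms(1)] assms(2) by (simp add: inv_into_f_f)

lemma disp:
  assumes "y \<in> A" "y' \<in> A" "dist y y' < \<eta>"
  shows "norm (disp y y') < r/8" "E y (disp y y') = g y'"
proof -
  obtain w where w: "norm w < r/8" "g y' = E y w" using \<eta>(2)[OF assms] by auto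
  then have "disp y y' = w" using disp_eqI[of y w y'] assms r_pos by auto
  then show "norm (disp y y') < r/8" "E y (disp y y') = g y'" using w by auto
qed

lemma disp_self: "y \<in> A \<Longrightarrow> disp y y = 0"
  using disp_eqI[of y 0 y] E0 r_pos by simp

lemma disp_add:
  assumes y: "y \<in> A" "y' \<in> A" "y'' \<in> A" and d: "dist y y' < \<eta>" "dist y' y'' < \<eta>"
  shows "E y (disp y y' + disp y' y'') = g y''"
proof -
  note 1 = disp[OF y(1,2) d(1)] and 2 = disp[OF y(2,3) d(2)]
  have "E y' (disp y' y'') = E y (disp y y' + disp y' y'')"
    by (rule E_shift[OF y(1,2)]) (use 1 2 r_pos in auto)
  then show ?thesis using 2 by simp
qed

text \<open>Both sides are the vector to \<open>z'\<close> in the ball around \<open>y\<close>, on which \<open>E y\<close> is injective.\<close>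

lemma disp_square:
  assumes y: "y \<in> A" "y' \<in> A" "z \<in> A" "z' \<in> A"
    and d: "dist y y' < \<eta>" "dist y' z' < \<eta>" "dist y z < \<eta>" "dist z z' < \<eta>"
  shows "disp y y' + disp y' z' = disp y z + disp z z'"
proof -
  have 1: "E y (disp y y' + disp y' z') = E y (disp y z + disp z z')"
    using disp_add[OF y(1,2,4) d(1,2)] disp_add[OF y(1,3,4) d(3,4)] by simp
  have "norm (disp y y' + disp y' z') < r" "norm (disp y z + disp z z') < r"
    using norm_triangle_ineq[of "disp y y'" "disp y' z'"] norm_triangle_ineq[of "disp y z" "disp z z'"]
      disp(1)[OF y(1,2) d(1)] disp(1)[OF y(2,4) d(2)] disp(1)[OF y(1,3) d(3)] disp(1)[OF y(3,4) d(4)] r_pos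
    by linarith+
  then show ?thesis using 1 E_inj[OF y(1)] by (meson inj_onD mem_ball_0)
qed

lemma disp_continuous:
  assumes y: "y \<in> A"
  shows "continuous_on (A \<inter> ball y \<eta>) (disp y)"
proof -
  have "g ` (A \<inter> ball y \<eta>) \<subseteq> E y ` ball 0 r"
  proof
    fix x assume "x \<in> g ` (A \<inter> ball y \<eta>)"
    then obtain y' where y': "y' \<in> A" "dist y y' < \<eta>" "x = g y'" by auto
    have "ball (0::plane) (r/8) \<subseteq> ball 0 r" using r_pos by (intro subset_ball) simp
    then show "x \<in> E y ` ball 0 r" using \<eta>(2)[OF y y'(1,2)] y'(3) by blast
  qed
  moreover have "continuous_map (top_of_set (A \<inter> ball y \<eta>)) (top_of R) g"
    using continuous_map_from_subtopology_mono[OF g(1)] by blast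
  ultimately show ?thesis unfolding disp_def
    by (intro lift_continuous[OF R E_tm[OF y] _ E_inj[OF y]]) auto
qed

lemma disp_small:
  assumes y: "y \<in> A" and e: "0 < \<epsilon>"
  obtains \<kappa> where "0 < \<kappa>" "\<And>y'. y' \<in> A \<Longrightarrow> dist y y' < \<kappa> \<Longrightarrow> norm (disp y y') < \<epsilon>"
proof -
  have "y \<in> A \<inter> ball y \<eta>" using y \<eta> by simp
  then obtain d where d: "0 < d" "\<And>x. x \<in> A \<inter> ball y \<eta> \<Longrightarrow> dist x y < d \<Longrightarrow> dist (disp y x) (disp y y) < \<epsilon>"
    using disp_continuous[OF y] e unfolding continuous_on_iff by metis
  show ?thesis
  proof (rule that[of "min d \<eta>"])
    show "0 < min d \<eta>" using d \<eta> by simp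
    fix y' assume y': "y' \<in> A" "dist y y' < min d \<eta>"
    then have "y' \<in> A \<inter> ball y \<eta>" "dist y' y < d" by (auto simp: dist_commute)
    from d(2)[OF this] show "norm (disp y y') < \<epsilon>" using disp_self[OF y] by simp
  qed
qed

lemma image_closed:
  assumes "closed K"
  shows "closedin (top_of R) (g ` (A \<inter> K))"
proof -
  have "compact (A \<inter> K)" using A assms by (simp add: compact_Int_closed)
  then have "compactin (top_of_set A) (A \<inter> K)" by (simp add: compactin_subtopology)
  then have "compactin (top_of R) (g ` (A \<inter> K))" using image_compactin g(1) by blast
  moreover have "Hausdorff_space (top_of R)"
    using R unfolding pointed_translation_structure_def translation_structure_def surface_def by blast
  ultimately show ?thesis using compactin_imp_closedin by blast
qed

text \<open>The inverse of \<open>g\<close> is continuous, as \<open>A\<close> is compact: the image of the parameters at distance at least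
  \<open>\<kappa>\<close> from \<open>y1\<close> is closed and misses \<open>g y1\<close>.\<close>

lemma near_param:
  assumes y: "y \<in> A" and a: "norm a < r" "E y a = g y1" "y1 \<in> A" and k: "0 < \<kappa>"
  obtains G where "open G" "a \<in> G" "G \<subseteq> ball 0 r"
    "\<And>w. w \<in> G \<Longrightarrow> E y w \<in> g ` A \<Longrightarrow> \<exists>y'\<in>A. dist y1 y' < \<kappa> \<and> E y w = g y'"
proof -
  let ?K = "g ` (A \<inter> - ball y1 \<kappa>)"
  have "closedin (top_of R) ?K" by (rule image_closed) auto
  then have op: "openin (top_of R) (points R - ?K)" by blast
  obtain G where G: "open G" "{z \<in> ball 0 r. E y z \<in> points R - ?K} = G \<inter> ball 0 r"
    using tm_preimage[OF E_tm[OF y] op] .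
  have "g y1 \<notin> ?K"
  proof
    assume "g y1 \<in> ?K"
    then obtain x where "x \<in> A" "x \<notin> ball y1 \<kappa>" "g y1 = g x" by blast
    then show False using g(2) a(3) k by (metis centre_in_ball inj_onD)
  qed
  moreover have "g y1 \<in> points R"
    using a tm_point[OF E_tm[OF y], of a] by simp
  ultimately have "a \<in> {z \<in> ball 0 r. E y z \<in> points R - ?K}" using a by simp
  then have aG: "a \<in> G \<inter> ball 0 r" using G by blast
  show ?thesis
  proof (rule that[of "G \<inter> ball 0 r"])
    show "open (G \<inter> ball 0 r)" using G by blast
    show "a \<in> G \<inter> ball 0 r" "G \<inter> ball 0 r \<subseteq> ball 0 r" using aG by auto
    fix w assume w: "w \<in> G \<inter> ball 0 r" "E y w \<in> g ` A"
    then obtain y' where y': "y' \<in> A" "E y w = g y'" by blast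
    have "E y w \<notin> ?K" using w G by blast
    then have "y' \<in> ball y1 \<kappa>" using y' by blast
    then show "\<exists>y'\<in>A. dist y1 y' < \<kappa> \<and> E y w = g y'" using y' by auto
  qed
qed

definition m :: nat where
  "m = (SOME m. 0 < m \<and> (\<forall>y\<in>A. dist b0 y < real m * \<eta>))"

lemma m: "0 < m" "\<And>y. y \<in> A \<Longrightarrow> dist b0 y < real m * \<eta>"
proof -
  have "bounded A" using A compact_imp_bounded by blast
  then obtain B where B: "\<And>y. y \<in> A \<Longrightarrow> dist b0 y \<le> B" using bounded_any_center by blast
  obtain n :: nat where n: "B / \<eta> < real n" using reals_Archimedean2 by blast
  have "dist b0 y < real (Suc n) * \<eta>" if "y \<in> A" for y
  proof -
    have "B < real n * \<eta>" using n \<eta>(1) by (simp add: pos_divide_less_eq)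
    then show ?thesis using B[OF that] \<eta>(1) by (simp add: algebra_simps)
  qed
  then have "\<exists>m. 0 < m \<and> (\<forall>y\<in>A. dist b0 y < real m * \<eta>)" by blast
  from someI_ex[OF this] show "0 < m" "\<And>y. y \<in> A \<Longrightarrow> dist b0 y < real m * \<eta>"
    unfolding m_def[symmetric] by blast+
qed

definition node :: "nat \<Rightarrow> plane \<Rightarrow> plane" where
  "node j y = b0 + (real j / real m) *\<^sub>R (y - b0)"

lemma node_0 [simp]: "node 0 y = b0" by (simp add: node_def)

lemma node_m [simp]: "node m y = y" using m(1) by (simp add: node_def)

lemma node_mem: "y \<in> A \<Longrightarrow> j \<le> m \<Longrightarrow> node j y \<in> A"
proof -
  assume y: "y \<in> A" and j: "j \<le> m"
  let ?t = "real j / real m"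
  have t: "0 \<le> ?t" "?t \<le> 1" using j m(1) by auto
  have "node j y = (1 - ?t) *\<^sub>R b0 + ?t *\<^sub>R y"
    by (simp add: node_def scaleR_diff_right scaleR_diff_left)
  then show "node j y \<in> A" using convexD[OF A(2) b0(1) y, of "1 - ?t" ?t] t by simp
qed

lemma node_step: "y \<in> A \<Longrightarrow> dist (node j y) (node (Suc j) y) < \<eta>"
proof -
  assume y: "y \<in> A"
  have "node j y - node (Suc j) y = (real j / real m - real (Suc j) / real m) *\<^sub>R (y - b0)"
    by (simp add: node_def scaleR_diff_left)
  also have "real j / real m - real (Suc j) / real m = - (1 / real m)"
    using m(1) by (simp add: field_simps)
  finally have "dist (node j y) (node (Suc j) y) = dist b0 y / real m"
    by (simp add: dist_norm norm_minus_commute)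
  then show "dist (node j y) (node (Suc j) y) < \<eta>"
    using m(2)[OF y] m(1) by (simp add: pos_divide_less_eq mult.commute)
qed

lemma node_dist: "j \<le> m \<Longrightarrow> dist (node j y) (node j z) \<le> dist y z"
proof -
  assume j: "j \<le> m"
  have "node j y - node j z = (real j / real m) *\<^sub>R (y - z)"
    by (simp add: node_def scaleR_diff_right)
  then have "dist (node j y) (node j z) = (real j / real m) * dist y z" by (simp add: dist_norm)
  also have "\<dots> \<le> 1 * dist y z" using j m(1) by (intro mult_right_mono) auto
  finally show "dist (node j y) (node j z) \<le> dist y z" by simp
qed

text \<open>The chain along the segment from \<open>b0\<close> to \<open>y\<close>, subdivided into \<open>m\<close> steps, of which the first \<open>n\<close> are taken.
  The number \<open>m\<close> is the same for all \<open>y\<close>, so that the nodes of different chains can be compared.\<close>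

definition chain_to :: "nat \<Rightarrow> plane \<Rightarrow> chain" where
  "chain_to n y = map (\<lambda>j. (disp (node j y) (node (Suc j) y), r)) [0..<n]"

lemma chain_to_Suc: "chain_to (Suc n) y = chain_to n y @ [(disp (node n y) (node (Suc n) y), r)]"
  by (simp add: chain_to_def)

lemma chain_to_0 [simp]: "chain_to 0 y = []"
  by (simp add: chain_to_def)

lemma chain_to_slack:
  assumes "y \<in> A" "n \<le> m"
  shows "slack (7/8 * r) (chain_to n y)"
proof -
  have "norm (disp (node j y) (node (Suc j) y)) < r/8" if "j < n" for j
    using disp(1)[OF node_mem[OF assms(1)] node_mem[OF assms(1)] node_step[OF assms(1)], of j] that assms by simp
  then show ?thesis unfolding chain_to_def slack_def by fastforce
qed

text \<open>On the curve of the displacements \<open>disp y x\<close>, for \<open>x\<close> on the segment from \<open>y\<close> to \<open>y'\<close>, both \<open>\<iota> \<circ> E y\<close> and \<open>e\<close> lift the identity, and they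
  agree at \<open>0\<close>. The curve is needed because the disk need not contain the whole ball around \<open>g y\<close>.\<close>

lemma immersion_disp:
  assumes T: "pointed_translation_structure T" and i: "is_immersion R (g ` A) T B \<iota>"
    and e: "exp_ball T r (\<iota> (g y)) e" and y: "y \<in> A" "y' \<in> A" "dist y y' < \<eta>"
  shows "e (disp y y') = \<iota> (g y')"
proof -
  let ?S = "closed_segment y y'"
  have SA: "?S \<subseteq> A" using y A(2) by (simp add: closed_segment_subset)
  have Sn: "?S \<subseteq> ball y \<eta>" using y(3) \<eta>(1) by (intro closed_segment_subset) (auto simp: dist_commute)
  let ?J = "disp y ` ?S"
  have "continuous_on ?S (disp y)"
    using continuous_on_subset[OF disp_continuous[OF y(1)]] SA Sn by blast
  then have J: "connected ?J" by (intro connected_continuous_image) auto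
  have Jr: "?J \<subseteq> ball 0 r"
  proof clarify
    fix x assume "x \<in> ?S"
    then have "x \<in> A" "x \<in> ball y \<eta>" using SA Sn by blast+
    then have "norm (disp y x) < r/8" using disp(1)[OF y(1)] by simp
    then show "disp y x \<in> ball 0 r" using r_pos by simp
  qed
  have EJ: "E y ` ?J \<subseteq> g ` A"
  proof clarify
    fix x assume "x \<in> ?S"
    then have "x \<in> A" "x \<in> ball y \<eta>" using SA Sn by blast+
    then have "E y (disp y x) = g x" "x \<in> A" using disp(2)[OF y(1)] by simp_all
    then show "E y (disp y x) \<in> g ` A" by blast
  qed
  have 1: "tm T ?J (\<lambda>v. v) (\<lambda>v. \<iota> (E y v))"
    by (rule immersion_tm[OF R T i tm_subset[OF E_tm[OF y(1)] Jr] EJ])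
  have 2: "tm T ?J (\<lambda>v. v) e" using tm_subset[OF _ Jr] e unfolding exp_ball_def by blast
  have 3: "0 \<in> ?J" using disp_self[OF y(1)] by (metis ends_in_segment(1) imageI)
  have 4: "disp y y' \<in> ?J" by simp
  have "e 0 = \<iota> (E y 0)" using e E0[OF y(1)] unfolding exp_ball_def by simp
  from tm_unique[OF T 2 1 J 3 this 4] show ?thesis using disp(2)[OF y] by simp
qed

lemma immersion_chain:
  assumes T: "pointed_translation_structure T" and i: "is_immersion R (g ` A) T B \<iota>"
    and e: "\<And>y. y \<in> A \<Longrightarrow> \<exists>e. exp_ball T r (\<iota> (g y)) e" and y: "y \<in> A"
  shows "n \<le> m \<Longrightarrow> dev T (basept T) (chain_to n y) (\<iota> (g (node n y)))"
proof (induction n)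
  case 0
  then show ?case using i b0 unfolding is_immersion_def by simp
next
  case (Suc n)
  have N: "node n y \<in> A" "node (Suc n) y \<in> A" "dist (node n y) (node (Suc n) y) < \<eta>"
    using node_mem[OF y] node_step[OF y] Suc.prems by auto
  obtain e' where e': "exp_ball T r (\<iota> (g (node n y))) e'" using e[OF N(1)] by blast
  have "step T r (disp (node n y) (node (Suc n) y)) (\<iota> (g (node n y))) (\<iota> (g (node (Suc n) y)))"
    using e' immersion_disp[OF T i e' N] disp(1)[OF N] r_pos unfolding step_def by force
  then show ?case using Suc unfolding chain_to_Suc dev_append by auto
qed

text \<open>Two chains with nearby ends stay
  near one another, because a small square closes up.\<close>

lemma chains_near:
  assumes T: "pointed_translation_structure T" and y: "y \<in> A" "z \<in> A" "dist y z < \<eta>"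
    and o: "\<exists>e. exp_ball T (r/2) p e"
  shows "n \<le> m \<Longrightarrow> dev T p (shrink (r/2) (chain_to n y)) q \<Longrightarrow> dev T p (shrink (r/2) (chain_to n z)) q' \<Longrightarrow>
    step T (r/4) (disp (node n y) (node n z)) q q'"
proof (induction n arbitrary: q q')
  case 0
  then have "q = p" "q' = p" by auto
  moreover have "disp b0 b0 = 0" using disp_self[OF b0(1)] .
  moreover obtain e where "exp_ball T (r/4) p e" using o exp_ball_mono[of T "r/2" p _ "r/4"] r_pos by auto
  ultimately show ?case using r_pos unfolding step_def exp_ball_def by auto
next
  case (Suc n)
  let ?v = "disp (node n y) (node (Suc n) y)" and ?v' = "disp (node n z) (node (Suc n) z)"
  let ?u = "disp (node n y) (node n z)" and ?u' = "disp (node (Suc n) y) (node (Suc n) z)"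
  have n: "n \<le> m" using Suc.prems by simp
  have N: "node n y \<in> A" "node (Suc n) y \<in> A" "node n z \<in> A" "node (Suc n) z \<in> A"
    using node_mem y Suc.prems by auto
  have D: "dist (node n y) (node (Suc n) y) < \<eta>" "dist (node n z) (node (Suc n) z) < \<eta>"
    "dist (node n y) (node n z) < \<eta>" "dist (node (Suc n) y) (node (Suc n) z) < \<eta>"
    using node_step y node_dist[OF n, of y z] node_dist[OF Suc.prems(1), of y z] by auto
  have sq: "?v + ?u' = ?u + ?v'" using disp_square[OF N(1,2,3,4) D(1,4,3,2)] .
  have nm: "norm ?v < r/8" "norm ?v' < r/8" "norm ?u < r/8" "norm ?u' < r/8"
    using disp(1) N D by blast+
  obtain p1 where p1: "dev T p (shrink (r/2) (chain_to n y)) p1" "step T (r/2) ?v p1 q"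
    using Suc.prems(2) unfolding chain_to_Suc by (auto simp: dev_append)
  obtain p2 where p2: "dev T p (shrink (r/2) (chain_to n z)) p2" "step T (r/2) ?v' p2 q'"
    using Suc.prems(3) unfolding chain_to_Suc by (auto simp: dev_append)
  have s: "step T (r/4) ?u p1 p2" using Suc.IH[OF n p1(1) p2(1)] .
  obtain e where e: "exp_ball T (r/2) p1 e" "e ?v = q" using p1(2) unfolding step_def by blast
  have "p2 = e ?u" by (rule step_value[OF T e(1) s]) (use nm r_pos in simp)
  moreover have "step T (r/4) ?v' (e ?u) (e (?u + ?v'))"
    by (rule step_add[OF e(1)]) (use nm r_pos in auto)
  ultimately have "q' = e (?u + ?v')" using step_det[OF T p2(2)] by blast
  moreover have "step T (r/4) ?u' (e ?v) (e (?v + ?u'))"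
    by (rule step_add[OF e(1)]) (use nm r_pos in auto)
  ultimately show ?case unfolding e(2) sq by simp
qed

text \<open>Define \<open>\<iota>\<close> near \<open>g z\<close>, for \<open>z\<close> in the net, by the ball at the end of the chain to \<open>z\<close>. Two of these pieces agree
  where they meet, because the ends of the two chains differ by the displacement of their parameters (\<open>chains_near\<close>).\<close>

lemma chains_immersion:
  assumes T: "pointed_translation_structure T" and Y: "Y \<subseteq> A" "b0 \<in> Y"
    and net: "\<And>y. y \<in> A \<Longrightarrow> \<exists>z\<in>Y. dist z y < \<eta>/2"
    and q: "\<And>z. z \<in> Y \<Longrightarrow> dev T (basept T) (shrink (r/2) (chain_to m z)) (q z)"
    and e: "\<And>z. z \<in> Y \<Longrightarrow> \<exists>e. exp_ball T (r/2) (q z) e"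
  obtains \<iota> where "is_immersion R (g ` A) T (points T) \<iota>"
    "\<And>z y. z \<in> Y \<Longrightarrow> y \<in> A \<Longrightarrow> dist z y < \<eta>/2 \<Longrightarrow> step T (r/2) (disp z y) (q z) (\<iota> (g y))"
proof -
  obtain ee where ee: "\<And>z. z \<in> Y \<Longrightarrow> exp_ball T (r/2) (q z) (ee z)" using e by metis
  obtain c where c: "\<And>y. y \<in> A \<Longrightarrow> c y \<in> Y \<and> dist (c y) y < \<eta>/2" using net by metis
  have zero: "dev T p (shrink (r/2) (chain_to n b0)) p' \<Longrightarrow> p' = p" for p p' n
  proof (induction n arbitrary: p')
    case (Suc n)
    have "node n b0 = b0" "node (Suc n) b0 = b0" by (simp_all add: node_def)
    then have d0: "disp (node n b0) (node (Suc n) b0) = 0" using disp_self[OF b0(1)] by simp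
    then obtain p1 where p1: "dev T p (shrink (r/2) (chain_to n b0)) p1" "step T (r/2) 0 p1 p'"
      using Suc.prems unfolding chain_to_Suc by (auto simp: dev_append)
    then have "p' = p1" unfolding step_def exp_ball_def by auto
    then show ?case using Suc.IH[OF p1(1)] by simp
  qed simp
  have qb: "q b0 = basept T" using zero q Y(2) by blast
  have ob: "\<exists>e. exp_ball T (r/2) (basept T) e" using e[OF Y(2)] unfolding qb .
  have agree: "ee z (disp z y) = ee z' (disp z' y)"
    if z: "z \<in> Y" "z' \<in> Y" "y \<in> A" "dist z y < \<eta>/2" "dist z' y < \<eta>/2" for z z' y
  proof -
    have zA: "z \<in> A" "z' \<in> A" using z Y by auto
    have d: "dist z z' < \<eta>" using dist_triangle2[of z z' y] z by linarith
    have dz: "dist z y < \<eta>" "dist z' y < \<eta>" using z zero_le_dist[of z y] zero_le_dist[of z' y] by linarith+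
    have s: "step T (r/4) (disp z z') (q z) (q z')"
      using chains_near[OF T zA d ob order_refl q[OF z(1)] q[OF z(2)]] by simp
    have n: "norm (disp z z') < r/8" "norm (disp z' y) < r/8" "norm (disp z y) < r/8"
      using disp(1) zA d dz z(3) by blast+
    have sq: "disp z z' + disp z' y = disp z y + disp y y"
      by (rule disp_square) (use zA z(3) d dz \<eta> in auto)
    have 1: "q z' = ee z (disp z z')"
      by (rule step_value[OF T ee[OF z(1)] s]) (use n r_pos in simp)
    have 2: "step T (r/4) (disp z' y) (ee z (disp z z')) (ee z (disp z z' + disp z' y))"
      by (rule step_add[OF ee[OF z(1)]]) (use n r_pos in auto)
    have "ee z (disp z z' + disp z' y) = ee z' (disp z' y)"
      by (rule step_value[OF T ee[OF z(2)] 2[folded 1]]) (use n r_pos in simp)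
    then show ?thesis using sq disp_self[OF z(3)] by simp
  qed
  define \<iota> where "\<iota> = (\<lambda>x. let y = inv_into A g x in ee (c y) (disp (c y) y))"
  have iv: "\<iota> (g y) = ee z (disp z y)" if "z \<in> Y" "y \<in> A" "dist z y < \<eta>/2" for z y
  proof -
    have "\<iota> (g y) = ee (c y) (disp (c y) y)" using g(2) that(2) by (simp add: \<iota>_def)
    also have "\<dots> = ee z (disp z y)"
      by (rule agree) (use c[OF that(2)] that in auto)
    finally show ?thesis .
  qed
  show ?thesis
  proof (rule that[of \<iota>])
    show "step T (r/2) (disp z y) (q z) (\<iota> (g y))" if "z \<in> Y" "y \<in> A" "dist z y < \<eta>/2" for z y
    proof -
      have "dist z y < \<eta>" using that \<eta>(1) by linarith
      then have "norm (disp z y) < r/8" using disp(1) that Y by blast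
      then have "norm (disp z y) < r/2" using r_pos by linarith
      then show ?thesis unfolding step_def iv[OF that] using ee[OF that(1)] by blast
    qed
    show "is_immersion R (g ` A) T (points T) \<iota>"
    proof (rule immersionI_tm[OF R T])
      have "path_connectedin (top_of_set A) A"
        using convex_imp_path_connected[OF A(2)] by (simp add: path_connectedin_subtopology)
      then have "path_connectedin (top_of R) (g ` A)"
        using path_connectedin_continuous_map_image g(1) by blast
      moreover have "basept R \<in> g ` A" using b0 by (metis imageI)
      ultimately show "g ` A \<in> PC R" unfolding PC_def by blast
      have "\<iota> (g b0) = ee b0 (disp b0 b0)" by (rule iv) (use Y b0 \<eta> in auto)
      also have "\<dots> = basept T" using disp_self[OF b0(1)] ee[OF Y(2)] qb unfolding exp_ball_def by simp
      finally show "\<iota> (basept R) = basept T" using b0 by simp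
      fix s assume "s \<in> g ` A"
      then obtain y where y: "y \<in> A" "s = g y" by blast
      define z where "z = c y"
      have z: "z \<in> Y" "dist z y < \<eta>/2" "z \<in> A" using c[OF y(1)] Y unfolding z_def by auto
      have dz: "dist z y < \<eta>" using z(2) zero_le_dist[of z y] by linarith
      define \<kappa> where "\<kappa> = \<eta>/2 - dist z y"
      have k: "0 < \<kappa>" using z unfolding \<kappa>_def by simp
      note D = disp[OF z(3) y(1) dz]
      have Dr: "norm (disp z y) < r/2" "norm (disp z y) < r" using D(1) r_pos by linarith+
      obtain G where G: "open G" "disp z y \<in> G" "G \<subseteq> ball 0 r"
        "\<And>w. w \<in> G \<Longrightarrow> E z w \<in> g ` A \<Longrightarrow> \<exists>y'\<in>A. dist y y' < \<kappa> \<and> E z w = g y'"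
        using near_param[OF z(3) Dr(2) D(2) y(1) k] by metis
      let ?G = "G \<inter> ball 0 (r/2)"
      have val: "\<iota> (E z w) = ee z w" if w: "w \<in> ?G" "E z w \<in> g ` A" for w
      proof -
        obtain y' where y': "y' \<in> A" "dist y y' < \<kappa>" "E z w = g y'" using G(4) w by blast
        have "dist z y' < \<eta>/2" using dist_triangle[of z y' y] y'(2) unfolding \<kappa>_def by linarith
        then have "\<iota> (g y') = ee z (disp z y')" by (rule iv[OF z(1) y'(1)])
        moreover have "disp z y' = w" using disp_eqI[OF z(3) _ y'(3)] w(1) r_pos by simp
        ultimately show ?thesis using y'(3) by simp
      qed
      show "\<exists>G e e' a. open G \<and> a \<in> G \<and> e a = s \<and> tm R G (\<lambda>v. v) e \<and> inj_on e G \<and>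
        tm T G (\<lambda>v. v) e' \<and> (\<forall>w\<in>G. e w \<in> g ` A \<longrightarrow> \<iota> (e w) = e' w)"
      proof (intro exI conjI ballI impI)
        show "open ?G" using G by blast
        show "disp z y \<in> ?G" using G Dr by simp
        show "E z (disp z y) = s" using D y by simp
        show "tm R ?G (\<lambda>v. v) (E z)" using tm_subset[OF E_tm[OF z(3)]] G by blast
        show "inj_on (E z) ?G" using inj_on_subset[OF E_inj[OF z(3)]] G by blast
        show "tm T ?G (\<lambda>v. v) (ee z)" using tm_subset ee[OF z(1)] unfolding exp_ball_def by blast
        show "\<iota> (E z w) = ee z w" if "w \<in> ?G" "E z w \<in> g ` A" for w using val that .
      qed
    qed
  qed
qed

end

section \<open>Moving points of the plane\<close>

text \<open>Some injection of the plane, supported in \<open>W\<close>, moves \<open>a\<close> to \<open>b\<close> and is a translation near \<open>a\<close>. The last condition keeps the germ of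
  a tube at its end a translation when the tube is extended.\<close>

definition movable :: "plane set \<Rightarrow> plane \<Rightarrow> plane \<Rightarrow> bool" where
  "movable W a b \<longleftrightarrow> (\<exists>H. continuous_on UNIV H \<and> inj H \<and> (\<forall>x. x \<in> W \<longrightarrow> H x \<in> W) \<and> (\<forall>x. x \<notin> W \<longrightarrow> H x = x) \<and>
     (\<exists>d>0. \<forall>x. dist a x < d \<longrightarrow> H x = x + (b - a)))"

lemma movable_refl: "movable W a a"
  unfolding movable_def by (rule exI[of _ "\<lambda>x. x"]) (auto intro!: continuous_on_id exI[of _ 1])

lemma movable_trans:
  assumes "movable W a b" "movable W b c" shows "movable W a c"
proof -
  obtain H d where H: "continuous_on UNIV H" "inj H" "\<And>x. x \<in> W \<Longrightarrow> H x \<in> W" "\<And>x. x \<notin> W \<Longrightarrow> H x = x"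
    "0 < d" "\<And>x. dist a x < d \<Longrightarrow> H x = x + (b - a)" using assms(1) unfolding movable_def by metis
  obtain K d' where K: "continuous_on UNIV K" "inj K" "\<And>x. x \<in> W \<Longrightarrow> K x \<in> W" "\<And>x. x \<notin> W \<Longrightarrow> K x = x"
    "0 < d'" "\<And>x. dist b x < d' \<Longrightarrow> K x = x + (c - b)" using assms(2) unfolding movable_def by metis
  have 1: "continuous_on UNIV (K \<circ> H)"
    by (rule continuous_on_compose) (use H(1) K(1) continuous_on_subset in auto)
  have 2: "inj (K \<circ> H)" by (rule inj_compose[OF K(2) H(2)])
  have 3: "(K \<circ> H) x = x + (c - a)" if "dist a x < min d d'" for x
  proof -
    have "H x = x + (b - a)" using H(6) that by simp
    moreover have "dist b (x + (b - a)) = dist a x" by (simp add: dist_norm algebra_simps norm_minus_commute)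
    ultimately show ?thesis using K(6)[of "H x"] that by simp
  qed
  show ?thesis unfolding movable_def
  proof (intro exI[of _ "K \<circ> H"] conjI allI impI)
    show "\<exists>d>0. \<forall>x. dist a x < d \<longrightarrow> (K \<circ> H) x = x + (c - a)"
      by (rule exI[of _ "min d d'"]) (use 3 H(5) K(5) in simp)
  qed (use 1 2 H K in auto)
qed

text \<open>Move \<open>u\<close> by \<open>\<theta> u *\<^sub>R (y - x)\<close> with a bump function \<open>\<theta>\<close> that is one near \<open>x\<close>. Its Lipschitz constant is \<open>4 / d\<close> and
  \<open>norm (y - x) < d / 4\<close>, so the displacement is a strict contraction and the map is injective.\<close>

lemma movable_near:
  assumes z: "ball z d \<subseteq> W" "0 < d" and xy: "dist z x < d/8" "dist z y < d/8"
  shows "movable W x y"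
proof -
  define \<theta> :: "plane \<Rightarrow> real" where "\<theta> u = max 0 (min 1 (2 - 4 * norm (u - x) / d))" for u
  define H where "H u = u + \<theta> u *\<^sub>R (y - x)" for u
  have yx: "norm (y - x) < d/4"
    using dist_triangle2[of y x z] xy by (simp add: dist_norm norm_minus_commute)
  have lip: "\<bar>\<theta> u - \<theta> v\<bar> \<le> 4 / d * norm (u - v)" for u v
  proof -
    have "\<bar>\<theta> u - \<theta> v\<bar> \<le> \<bar>(2 - 4 * norm (u - x) / d) - (2 - 4 * norm (v - x) / d)\<bar>"
      unfolding \<theta>_def by (auto simp: max_def min_def)
    also have "\<dots> = \<bar>4 / d * (norm (v - x) - norm (u - x))\<bar>" by (simp add: algebra_simps)
    also have "\<dots> = \<bar>4 / d\<bar> * \<bar>norm (v - x) - norm (u - x)\<bar>" by (rule abs_mult)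
    also have "\<bar>4 / d\<bar> = 4 / d" using z(2) by simp
    also have "4 / d * \<bar>norm (v - x) - norm (u - x)\<bar> \<le> 4 / d * norm (u - v)"
      using norm_triangle_ineq3[of "v - x" "u - x"] z(2)
      by (intro mult_left_mono) (auto simp: norm_minus_commute)
    finally show ?thesis .
  qed
  have "continuous_on UNIV \<theta>" unfolding \<theta>_def by (intro continuous_intros) (use z in auto)
  then have c: "continuous_on UNIV H" unfolding H_def by (intro continuous_intros)
  have i: "inj H"
  proof (rule injI)
    fix u v assume "H u = H v"
    then have "u - v = (\<theta> v - \<theta> u) *\<^sub>R (y - x)" unfolding H_def by (simp add: algebra_simps)
    then have e: "norm (u - v) = \<bar>\<theta> v - \<theta> u\<bar> * norm (y - x)" by simp
    show "u = v"
    proof (rule ccontr)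
      assume "u \<noteq> v"
      then have p: "0 < norm (u - v)" by simp
      have "\<bar>\<theta> v - \<theta> u\<bar> * norm (y - x) \<le> (4 / d * norm (u - v)) * norm (y - x)"
        using lip[of v u] by (intro mult_right_mono) (auto simp: norm_minus_commute)
      also have "\<dots> < (4 / d * norm (u - v)) * (d/4)"
        using yx p z(2) by (intro mult_strict_left_mono) auto
      also have "\<dots> = norm (u - v)" using z(2) by simp
      finally show False using e by simp
    qed
  qed
  have l01: "0 \<le> \<theta> u" "\<theta> u \<le> 1" for u unfolding \<theta>_def by auto
  have far: "\<theta> u = 0" if "d/2 \<le> norm (u - x)" for u
    using that z(2) unfolding \<theta>_def by (auto simp: field_simps)
  have ins: "u \<in> W \<and> H u \<in> W" if "norm (u - x) < d/2" for u
  proof -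
    have "norm (H u - u) \<le> norm (y - x)"
      using l01[of u] unfolding H_def by (simp add: mult_left_le_one_le)
    then have "norm (H u - u) < d/4" using yx by simp
    moreover have "norm (x - z) < d/8" using xy by (simp add: dist_norm norm_minus_commute)
    moreover have "norm (H u - z) \<le> norm (H u - u) + norm (u - x) + norm (x - z)"
      using norm_triangle_ineq[of "H u - u" "u - x"] norm_triangle_ineq[of "H u - x" "x - z"] by simp
    moreover have "norm (u - z) \<le> norm (u - x) + norm (x - z)"
      using norm_triangle_ineq[of "u - x" "x - z"] by simp
    ultimately have "norm (H u - z) < d" "norm (u - z) < d" using that z(2) by linarith+
    then have "H u \<in> ball z d" "u \<in> ball z d" by (simp_all add: dist_norm norm_minus_commute)
    then show ?thesis using z(1) by blast
  qed
  have near: "H u = u + (y - x)" if "dist x u < d/4" for u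
  proof -
    have "\<theta> u = 1" using that z(2) unfolding \<theta>_def by (auto simp: dist_norm norm_minus_commute field_simps)
    then show ?thesis unfolding H_def by simp
  qed
  show ?thesis unfolding movable_def
  proof (intro exI[of _ H] conjI allI impI)
    show "H u \<in> W" if "u \<in> W" for u
      using ins[of u] far[of u] that by (cases "norm (u - x) < d/2") (auto simp: H_def)
    show "H u = u" if "u \<notin> W" for u
      using ins[of u] far[of u] that by (cases "norm (u - x) < d/2") (auto simp: H_def)
    show "\<exists>d'>0. \<forall>u. dist x u < d' \<longrightarrow> H u = u + (y - x)"
      by (rule exI[of _ "d/4"]) (use near z(2) in auto)
  qed (use c i in auto)
qed

lemma movable_connected:
  assumes W: "open W" "connected W" and ab: "a \<in> W" "b \<in> W"
  shows "movable W a b"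
proof (rule connected_induction_simple[OF W(2) ab movable_refl])
  fix z assume z: "z \<in> W"
  obtain d where d: "0 < d" "ball z d \<subseteq> W" using W(1) z open_contains_ball by blast
  show "\<exists>T. openin (top_of_set W) T \<and> z \<in> T \<and> (\<forall>x\<in>T. \<forall>y\<in>T. movable W a x \<longrightarrow> movable W a y)"
  proof (intro exI[of _ "ball z (d/8)"] conjI ballI impI)
    have "ball z (d/8) \<subseteq> W" using d subset_ball[of "d/8" d z] by auto
    then show "openin (top_of_set W) (ball z (d/8))" by (simp add: W(1) openin_open_eq)
    show "z \<in> ball z (d/8)" using d by simp
    fix x y assume "x \<in> ball z (d/8)" "y \<in> ball z (d/8)" "movable W a x"
    then show "movable W a y" using movable_near[OF d(2,1)] movable_trans by auto
  qed
qed

section \<open>Tubes\<close>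

text \<open>Local injectivity is all that is needed for \<open>F\<close> to be a chart, by invariance of domain.\<close>

definition linj :: "plane set \<Rightarrow> (plane \<Rightarrow> plane) \<Rightarrow> bool" where
  "linj J F \<longleftrightarrow> (\<forall>x\<in>J. \<exists>G. open G \<and> x \<in> G \<and> inj_on F (G \<inter> J))"

lemma linj_subset: "linj J F \<Longrightarrow> J' \<subseteq> J \<Longrightarrow> linj J' F"
  unfolding linj_def by (meson inf_mono inj_on_subset order_refl subsetD)

lemma linj_cong:
  assumes "linj J F" "\<And>x. x \<in> J \<Longrightarrow> F' x = F x + k"
  shows "linj J F'"
  unfolding linj_def
proof
  fix x assume "x \<in> J"
  then obtain G where G: "open G" "x \<in> G" "inj_on F (G \<inter> J)" using assms(1) unfolding linj_def by blast
  have "inj_on F' (G \<inter> J)"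
  proof (rule inj_onI)
    fix u v assume "u \<in> G \<inter> J" "v \<in> G \<inter> J" "F' u = F' v"
    then show "u = v" using assms(2) G(3) by (simp add: inj_on_def)
  qed
  then show "\<exists>G. open G \<and> x \<in> G \<and> inj_on F' (G \<inter> J)" using G by blast
qed

lemma linj_inj: "inj_on F J \<Longrightarrow> linj J F"
  unfolding linj_def by (auto intro!: exI[of _ UNIV])

lemma linj_Un:
  assumes J: "linj J F" "open J" and K: "linj K F" "open K"
  shows "linj (J \<union> K) F"
  unfolding linj_def
proof
  have *: "\<exists>G. open G \<and> x \<in> G \<and> inj_on F (G \<inter> (J \<union> K))" if x: "x \<in> L" "linj L F" "open L" "L \<subseteq> J \<union> K" for x L
  proof -
    obtain G where G: "open G" "x \<in> G" "inj_on F (G \<inter> L)" using x unfolding linj_def by blast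
    have "G \<inter> L \<inter> (J \<union> K) = G \<inter> L" using x(4) by blast
    then show ?thesis using G x by (intro exI[of _ "G \<inter> L"]) auto
  qed
  fix x assume "x \<in> J \<union> K"
  then show "\<exists>G. open G \<and> x \<in> G \<and> inj_on F (G \<inter> (J \<union> K))"
    using *[of x J] *[of x K] J K by blast
qed

definition rect :: "real \<Rightarrow> real \<Rightarrow> real \<Rightarrow> real \<Rightarrow> plane set" where
  "rect a b c d = box (vector [a, c]) (vector [b, d])"

lemma mem_rect [simp]: "x \<in> rect a b c d \<longleftrightarrow> a < x$1 \<and> x$1 < b \<and> c < x$2 \<and> x$2 < d"
  by (auto simp: rect_def mem_box_cart forall_2)

lemma open_rect [simp]: "open (rect a b c d)"
  by (simp add: rect_def open_box)

lemma convex_rect [simp]: "convex (rect a b c d)"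
  by (simp add: rect_def convex_box)

definition pt :: "real \<Rightarrow> plane" where "pt n = axis 1 n"

lemma pt_nth [simp]: "pt n $ 1 = n" "pt n $ 2 = 0"
  by (simp_all add: pt_def axis_def)

lemma pt_0 [simp]: "pt 0 = 0" by (simp add: pt_def vec_eq_iff axis_def)

lemma plane_norm_le: "norm (x :: plane) \<le> \<bar>x$1\<bar> + \<bar>x$2\<bar>"
  using norm_le_l1_cart[of x] by (simp add: sum_2)

lemma norm_pt: "norm (pt n) = \<bar>n\<bar>"
  using plane_norm_le[of "pt n"] component_le_norm_cart[of "pt n" 1] by simp

abbreviation strip :: "real \<Rightarrow> real \<Rightarrow> plane set" where
  "strip n \<mu> \<equiv> rect (- \<mu>) (n + \<mu>) (- \<mu>) \<mu>"

text \<open>A strip that follows the chain \<open>C\<close> on every surface on which \<open>C\<close> can be read. The strip is straight; the bends of the chain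
  are in \<open>F\<close>. It is normalised at its end, where \<open>F\<close> is the identity, so that \<open>F\<close> moves by a translation whenever the chain is
  extended, and the points near the end of the chain have the coordinates of the plane.\<close>

definition is_tube :: "chain \<Rightarrow> (plane \<Rightarrow> plane) \<Rightarrow> real \<Rightarrow> real \<Rightarrow> bool" where
  "is_tube C F n \<mu> \<longleftrightarrow> 0 \<le> n \<and> 0 < \<mu> \<and> continuous_on (strip n \<mu>) F \<and> linj (strip n \<mu>) F \<and>
     (\<forall>x\<in>strip n \<mu>. n - \<mu> < x$1 \<longrightarrow> F x = x) \<and>
     (\<forall>(Q :: epoint pointed_surface) q q'. pointed_translation_structure Q \<longrightarrow> dev Q q C q' \<longrightarrow>
        (\<exists>f. tm Q (strip n \<mu>) F f \<and> f 0 = q \<and> f (pt n) = q'))"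

lemma tube_base:
  assumes "0 < \<rho>" shows "is_tube [(0, \<rho>)] (\<lambda>x. x) 0 (\<rho>/2)"
proof -
  have sub: "strip 0 (\<rho>/2) \<subseteq> ball 0 \<rho>"
  proof
    fix x :: plane assume "x \<in> strip 0 (\<rho>/2)"
    then show "x \<in> ball 0 \<rho>" using plane_norm_le[of x] by auto
  qed
  have "\<exists>f. tm Q (strip 0 (\<rho>/2)) (\<lambda>x. x) f \<and> f 0 = q \<and> f (pt 0) = q'"
    if d: "dev Q q [(0, \<rho>)] q'" for Q :: "epoint pointed_surface" and q q'
  proof -
    obtain e where e: "exp_ball Q \<rho> q e" "e 0 = q'" using d by (auto simp: step_def)
    then have "tm Q (strip 0 (\<rho>/2)) (\<lambda>x. x) e" "e 0 = q"
      using tm_subset[OF _ sub] unfolding exp_ball_def by auto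
    then show ?thesis using e by auto
  qed
  moreover have "linj (strip 0 (\<rho>/2)) (\<lambda>x. x)" by (rule linj_inj) (simp add: inj_on_def)
  ultimately show ?thesis using assms by (simp add: is_tube_def continuous_on_id)
qed

text \<open>Lengthen the strip by \<open>L\<close>, the radius of the last ball halved, and let an injection \<open>H\<close> of the plane bend the new part. Here \<open>H\<close> fixes a neighbourhood of
  the old end \<open>c\<close>, maps the ball of radius \<open>\<rho>\<close> around \<open>c\<close> to itself, and moves the new end \<open>a\<close> to \<open>b = c + v\<close>.
  It exists since the annulus is connected. Injectivity of \<open>H\<close> is why the new map is locally injective. For \<open>v = 0\<close>, the old
  tube serves.\<close>

lemma tube_extend:
  assumes t: "is_tube C F n \<mu>" and v: "norm v < \<rho>"
  shows "\<exists>F' n' \<mu>'. is_tube (C @ [(v, \<rho>)]) F' n' \<mu>'"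
proof -
  have n: "0 \<le> n" and mu: "0 < \<mu>" and cF: "continuous_on (strip n \<mu>) F" and lF: "linj (strip n \<mu>) F"
    and gF: "\<And>x. x \<in> strip n \<mu> \<Longrightarrow> n - \<mu> < x$1 \<Longrightarrow> F x = x"
    and dF: "\<And>(Q :: epoint pointed_surface) q q'. pointed_translation_structure Q \<Longrightarrow> dev Q q C q' \<Longrightarrow>
        \<exists>f. tm Q (strip n \<mu>) F f \<and> f 0 = q \<and> f (pt n) = q'"
    using t unfolding is_tube_def by auto
  show ?thesis
  proof (cases "v = 0")
  case True
  have qq: "q' = q''" if "step Q \<rho> 0 q' q''" for Q :: "epoint pointed_surface" and q' q''
    using that unfolding step_def exp_ball_def by auto
  have dd: "dev Q q C q''" if "dev Q q (C @ [(v, \<rho>)]) q''" for Q :: "epoint pointed_surface" and q q''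
    using that True qq by (auto simp: dev_append)
  have "is_tube (C @ [(v, \<rho>)]) F n \<mu>"
    unfolding is_tube_def by (intro conjI ballI allI impI n mu cF lF gF dF dd)
  then show ?thesis by blast
next
  case False
  have v0: "0 < norm v" using False by simp
  have r: "0 < \<rho>" using v v0 by linarith
  define L where "L = \<rho>/2"
  define c where "c = pt n"
  define a where "a = pt (n + L)"
  define b where "b = c + v"
  define \<tau> where "\<tau> = min \<mu> (min L (norm v)) / 2"
  have L: "0 < L" "L < \<rho>" using r unfolding L_def by auto
  have "0 < min \<mu> (min L (norm v))" "min \<mu> (min L (norm v)) \<le> L"
    "min \<mu> (min L (norm v)) \<le> norm v" "min \<mu> (min L (norm v)) \<le> \<mu>"
    using L mu v0 by auto
  then have tau: "0 < \<tau>" "\<tau> < L" "\<tau> < norm v" "\<tau> < \<mu>" unfolding \<tau>_def by linarith+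
  have ac: "a - c = pt L" unfolding a_def c_def by (simp add: vec_eq_iff forall_2)
  define W where "W = {x :: plane. \<tau> < norm (x - c) \<and> norm (x - c) < \<rho>}"
  have oW: "open W" unfolding W_def by (intro open_Collect_conj open_Collect_less continuous_intros)
  have cW: "connected W" unfolding W_def by (rule connected_annulus) simp
  \<comment> \<open>\<open>W\<close> leaves out the ball of radius \<open>\<tau>\<close> around \<open>c\<close>, so that the old part of the tube is kept\<close>
  have "a \<in> W" "b \<in> W" using ac tau L v norm_pt[of L] unfolding W_def b_def by auto
  then have "movable W a b" by (rule movable_connected[OF oW cW])
  then obtain H d where H: "continuous_on UNIV H" "inj H" "\<And>x. x \<in> W \<Longrightarrow> H x \<in> W"
    "\<And>x. x \<notin> W \<Longrightarrow> H x = x" "0 < d" "\<And>x. dist a x < d \<Longrightarrow> H x = x + (b - a)"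
    unfolding movable_def by metis
  define \<mu>' where "\<mu>' = min (\<tau>/2) (min (d/2) (\<rho>/8))"
  have m: "0 < \<mu>'" "2 * \<mu>' \<le> \<tau>" "2 * \<mu>' \<le> d" "8 * \<mu>' \<le> \<rho>" "\<mu>' < \<mu>" "\<mu>' < L"
    using tau H(5) r unfolding \<mu>'_def by auto
  define n' where "n' = n + L"
  \<comment> \<open>translating by \<open>k\<close> restores the normalisation at the new end\<close>
  define k where "k = a - b"
  define F' where "F' x = (if x$1 \<le> n then F x else H x) + k" for x
  define J1 where "J1 = rect (- \<mu>') (n + \<mu>') (- \<mu>') \<mu>'"
  define J2 where "J2 = rect (n - \<mu>') (n' + \<mu>') (- \<mu>') \<mu>'"
  have J: "strip n' \<mu>' = J1 \<union> J2" unfolding J1_def J2_def n'_def using L m n by auto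
  have oJ: "open J1" "open J2" unfolding J1_def J2_def by auto
  have J1s: "J1 \<subseteq> strip n \<mu>" unfolding J1_def using m by auto
  have Hc: "H x = x" if "\<bar>x$1 - n\<bar> < \<mu>'" "\<bar>x$2\<bar> < \<mu>'" for x
  proof -
    have "norm (x - c) < \<tau>" using plane_norm_le[of "x - c"] that m(2) unfolding c_def by auto
    then show ?thesis using H(4) unfolding W_def by auto
  qed
  have F1: "F' x = F x + k" if x: "x \<in> J1" for x
  proof (cases "x$1 \<le> n")
    case False
    then have "F x = x" using gF[of x] x J1s mu by auto
    moreover have "H x = x" using Hc[of x] False x unfolding J1_def by auto
    ultimately show ?thesis using False unfolding F'_def by simp
  qed (simp add: F'_def)
  have F2: "F' x = H x + k" if x: "x \<in> J2" for x
  proof (cases "x$1 \<le> n")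
    case True
    then have "x \<in> strip n \<mu>" "n - \<mu> < x$1" using x m n unfolding J2_def by auto
    then have "F x = x" using gF by blast
    moreover have "H x = x" using Hc[of x] True x unfolding J2_def by auto
    ultimately show ?thesis using True unfolding F'_def by simp
  qed (simp add: F'_def)
  have "continuous_on J1 F'"
  proof -
    have "continuous_on J1 (\<lambda>x. F x + k)"
      using continuous_on_subset[OF cF J1s] by (intro continuous_intros)
    then show ?thesis by (rule continuous_on_eq) (simp add: F1)
  qed
  moreover have "continuous_on J2 F'"
  proof -
    have "continuous_on J2 (\<lambda>x. H x + k)"
      using continuous_on_subset[OF H(1)] by (intro continuous_intros) auto
    then show ?thesis by (rule continuous_on_eq) (simp add: F2)
  qed
  ultimately have cont: "continuous_on (strip n' \<mu>') F'"
    unfolding J using oJ continuous_on_open_Un by blast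
  have "linj J1 F'" by (rule linj_cong[OF linj_subset[OF lF J1s] F1])
  moreover have "linj J2 F'"
    by (rule linj_cong[OF linj_inj F2]) (use H(2) in \<open>auto intro: inj_on_subset\<close>)
  ultimately have lin: "linj (strip n' \<mu>') F'" unfolding J using oJ linj_Un by blast
  have germ: "F' x = x" if x: "x \<in> strip n' \<mu>'" "n' - \<mu>' < x$1" for x
  proof -
    have "x \<in> J2" using x L unfolding J2_def n'_def by auto
    moreover have "norm (x - a) < d"
      using plane_norm_le[of "x - a"] x m(3) unfolding a_def n'_def by auto
    then have "H x = x + (b - a)" using H(6) by (simp add: dist_norm norm_minus_commute)
    ultimately show ?thesis using F2 unfolding k_def by simp
  qed
  have live: "\<exists>f. tm Q (strip n' \<mu>') F' f \<and> f 0 = q \<and> f (pt n') = q''"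
    if Q: "pointed_translation_structure Q" and dv: "dev Q q (C @ [(v, \<rho>)]) q''"
    for Q :: "epoint pointed_surface" and q q''
  proof -
    obtain q' where q': "dev Q q C q'" "step Q \<rho> v q' q''" using dv by (auto simp: dev_append)
    obtain f where f: "tm Q (strip n \<mu>) F f" "f 0 = q" "f (pt n) = q'" using dF[OF Q q'(1)] by blast
    obtain e where e: "exp_ball Q \<rho> q' e" "e v = q''" using q'(2) unfolding step_def by blast
    define h where "h = (\<lambda>x. e (H x - c))"
    have f1: "tm Q J1 F' f"
      by (rule tm_cong[OF tm_subset[OF f(1) J1s], of f F' k]) (use F1 in auto)
    have HJ: "H x - c \<in> ball 0 \<rho>" if x: "x \<in> J2" for x
    proof -
      have "norm (x - c) < L + 2 * \<mu>'"
        using plane_norm_le[of "x - c"] x m L unfolding c_def J2_def n'_def by auto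
      also have "\<dots> < \<rho>" using m(4) r unfolding L_def by linarith
      finally have "norm (x - c) < \<rho>" .
      then have "norm (H x - c) < \<rho>" using H(3,4)[of x] unfolding W_def by (cases "\<tau> < norm (x - c)") auto
      then show ?thesis by simp
    qed
    have hc: "continuous_on J2 (\<lambda>x. H x - c)"
      using continuous_on_subset[OF H(1), of J2] by (intro continuous_intros) auto
    have hi: "(\<lambda>x. H x - c) ` J2 \<subseteq> ball 0 \<rho>" using HJ by blast
    have "tm Q (ball 0 \<rho>) (\<lambda>v. v) e" using e(1) unfolding exp_ball_def by blast
    from tm_compose[OF this hc hi] have "tm Q J2 (\<lambda>x. H x - c) h" unfolding h_def .
    then have h2: "tm Q J2 F' h"
      by (rule tm_cong[where c = "c + k"]) (use F2 in auto)
    have "f x = h x" if x: "x \<in> J1" "x \<in> J2" for x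
    proof (rule tm_unique[OF Q tm_subset[OF f1] tm_subset[OF h2], of "J1 \<inter> J2"])
      show "connected (J1 \<inter> J2)"
        unfolding J1_def J2_def by (intro convex_connected convex_Int) auto
      show "c \<in> J1 \<inter> J2" using m n L unfolding c_def J1_def J2_def n'_def by auto
      have "H c = c" using Hc[of c] m unfolding c_def by auto
      then show "f c = h c" using f(3) e(1) unfolding h_def c_def exp_ball_def by simp
    qed (use x in auto)
    then have "tm Q (J1 \<union> J2) F' (\<lambda>x. if x \<in> J1 then f x else h x)"
      by (rule tm_glue[OF f1 h2 oJ])
    moreover have "0 \<in> J1" using m n unfolding J1_def by auto
    moreover have "pt n' \<notin> J1" using m unfolding J1_def n'_def by auto
    moreover have "h (pt n') = q''"
      using H(5) H(6)[of a] e(2) unfolding h_def n'_def a_def[symmetric] b_def by simp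
    ultimately show ?thesis unfolding J using f(2) by (intro exI[of _ "\<lambda>x. if x \<in> J1 then f x else h x"]) simp
  qed
  have "is_tube (C @ [(v, \<rho>)]) F' n' \<mu>'"
    unfolding is_tube_def
    by (intro conjI ballI allI impI cont lin germ live) (use n L m n'_def in auto)
  then show ?thesis by blast
  qed
qed

lemma tube_exists:
  assumes "0 < \<rho>" "slack 0 C"
  shows "\<exists>F n \<mu>. is_tube ((0, \<rho>) # C) F n \<mu>"
  using assms(2)
proof (induction C rule: rev_induct)
  case Nil
  then show ?case using tube_base[OF assms(1)] by blast
next
  case (snoc x C)
  obtain v \<sigma> where x: "x = (v, \<sigma>)" by (cases x)
  obtain F n \<mu> where "is_tube ((0, \<rho>) # C) F n \<mu>" using snoc by auto
  from tube_extend[OF this, of v \<sigma>] show ?case using snoc.prems x by auto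
qed

section \<open>Bulbs\<close>

text \<open>The identity is not a chart here, \<open>F\<close> is: the plane set \<open>N\<close> only provides the topology of the surface. It is
  star-shaped with respect to some point, which need not be the basepoint \<open>0\<close>.\<close>

definition model :: "plane set \<Rightarrow> (plane \<Rightarrow> plane) \<Rightarrow> bool" where
  "model N F \<longleftrightarrow> open N \<and> starlike N \<and> 0 \<in> N \<and> continuous_on N F \<and> linj N F"

text \<open>The complement of a closed cone around the negative first axis, truncated at distance \<open>\<delta>\<close> from the apex. The incoming strip of a tube
  crosses the ball inside this cone.\<close>

definition unslit :: "real \<Rightarrow> real \<Rightarrow> plane set" where
  "unslit \<delta> \<kappa> = {w. - \<delta> < w$1 \<or> \<kappa> * (- w$1) < \<bar>w$2\<bar>}"

lemma open_unslit: "open (unslit \<delta> \<kappa>)"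
  unfolding unslit_def by (intro open_Collect_disj open_Collect_less continuous_intros)

lemma unslit_scale:
  assumes "w \<in> unslit \<delta> \<kappa>" "0 < \<delta>" "0 \<le> u" "u \<le> 1"
  shows "u *\<^sub>R w \<in> unslit \<delta> \<kappa>"
proof (cases "- \<delta> < w$1")
  case True
  have "- \<delta> < u * w$1"
  proof (cases "0 \<le> w$1")
    case True
    then have "0 \<le> u * w$1" using assms by simp
    then show ?thesis using assms by linarith
  next
    case False
    then have "1 * w$1 \<le> u * w$1" using assms by (intro mult_right_mono_neg) auto
    then show ?thesis using \<open>- \<delta> < w$1\<close> by simp
  qed
  then show ?thesis by (simp add: unslit_def)
next
  case False
  then have k: "\<kappa> * (- w$1) < \<bar>w$2\<bar>" using assms by (simp add: unslit_def)
  show ?thesis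
  proof (cases "u = 0")
    case True then show ?thesis using assms by (simp add: unslit_def)
  next
    case False
    then have "u * (\<kappa> * (- w$1)) < u * \<bar>w$2\<bar>" using k assms by (intro mult_strict_left_mono) auto
    then show ?thesis using assms by (simp add: unslit_def abs_mult algebra_simps)
  qed
qed

lemma tm_translate:
  assumes e: "tm Q K (\<lambda>v. v) e" and J: "\<And>x. x \<in> J \<Longrightarrow> x + a \<in> K" and F: "\<And>x. x \<in> J \<Longrightarrow> F x = x + b"
  shows "tm Q J F (\<lambda>x. e (x + a))"
proof -
  have c: "continuous_on J (\<lambda>x. x + a)" by (intro continuous_intros)
  have i: "(\<lambda>x. x + a) ` J \<subseteq> K" using J by blast
  from tm_compose[OF e c i] show ?thesis by (rule tm_cong[where c = "b - a"]) (use F in auto)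
qed

lemma closed_segment_pt: "x \<in> closed_segment 0 (pt n) \<Longrightarrow> 0 \<le> n \<Longrightarrow> 0 \<le> x$1 \<and> x$1 \<le> n \<and> x$2 = 0"
proof -
  assume x: "x \<in> closed_segment 0 (pt n)" and n: "0 \<le> n"
  obtain u where u: "0 \<le> u" "u \<le> 1" "x = u *\<^sub>R pt n" using x by (auto simp: in_segment)
  have "u * n \<le> n" using u n by (simp add: mult_left_le_one_le)
  then show ?thesis using u n by simp
qed

text \<open>The model is the strip up to the end \<open>c\<close> together with the ball of radius \<open>\<rho>\<close> around \<open>c - h\<close>, without a slit along the incoming strip. The
  two parts meet only within distance \<open>\<delta>\<close> of \<open>c\<close>, where the tube is still the identity, so a map of the strip and a map of the ball agree there, and their
  union is star-shaped with respect to \<open>c\<close>. Conversely, a map of the slightly smaller set \<open>M\<close> carries the segment along the chain, hence \<open>c\<close> to its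
  end, and gives the exponential map on a slightly more slit ball. The offset \<open>h\<close> makes it possible to reach the same ball from another apex.\<close>

lemma bulb_model:
  assumes t: "is_tube C F n \<mu>" and k': "0 < \<kappa>'" and r: "0 < \<rho>'" "\<rho>' < \<rho>" and h: "norm h < \<rho>'"
  obtains N F' M J where "model N F'" "compact J" "M \<subseteq> J" "J \<subseteq> N" "0 \<in> M"
    "\<And>(Q :: epoint pointed_surface) q q' e. pointed_translation_structure Q \<Longrightarrow> dev Q q C q' \<Longrightarrow>
       tm Q (ball (- h) \<rho>) (\<lambda>v. v) e \<Longrightarrow> e 0 = q' \<Longrightarrow> \<exists>f. tm Q N F' f \<and> f 0 = q"
    "\<And>(Q :: epoint pointed_surface) q q' f. pointed_translation_structure Q \<Longrightarrow> dev Q q C q' \<Longrightarrow>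
       tm Q M F' f \<Longrightarrow> f 0 = q \<Longrightarrow> \<exists>e. tm Q (ball (- h) \<rho>' \<inter> unslit (\<mu>/4) \<kappa>') (\<lambda>v. v) e \<and> e 0 = q'"
proof -
  have n: "0 \<le> n" and mu: "0 < \<mu>" and cF: "continuous_on (strip n \<mu>) F" and lF: "linj (strip n \<mu>) F"
    and gF: "\<And>x. x \<in> strip n \<mu> \<Longrightarrow> n - \<mu> < x$1 \<Longrightarrow> F x = x"
    and dF: "\<And>(Q :: epoint pointed_surface) q q'. pointed_translation_structure Q \<Longrightarrow> dev Q q C q' \<Longrightarrow>
        \<exists>f. tm Q (strip n \<mu>) F f \<and> f 0 = q \<and> f (pt n) = q'"
    using t unfolding is_tube_def by auto
  define c where "c = pt n"
  have c [simp]: "c$1 = n" "c$2 = 0" unfolding c_def by auto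
  define \<delta> where "\<delta> = \<mu>/2"
  define \<kappa> where "\<kappa> = \<kappa>'/2"
  define \<nu> where "\<nu> = min \<mu> (\<kappa> * \<delta>)"
  have d: "0 < \<delta>" "\<delta> < \<mu>" "0 < \<kappa>" "\<kappa> < \<kappa>'" using mu k' unfolding \<delta>_def \<kappa>_def by auto
  have nu: "0 < \<nu>" "\<nu> \<le> \<mu>" "\<nu> \<le> \<kappa> * \<delta>" using d mu unfolding \<nu>_def by auto
  define T where "T = rect (- \<nu>) n (- \<nu>) \<nu>"
  define B where "B = {x. x - c \<in> ball (- h) \<rho> \<inter> unslit \<delta> \<kappa>}"
  define N where "N = T \<union> B"
  define F' where "F' x = (if x$1 < n \<and> \<bar>x$2\<bar> < \<nu> then F x else x)" for x :: plane
  have TS: "T \<subseteq> strip n \<mu>" unfolding T_def using nu mu n by auto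
  have FT: "F' x = F x" if "x \<in> T" for x using that unfolding T_def F'_def by auto
  \<comment> \<open>to the left of \<open>c\<close> the strip meets the slit ball only within distance \<open>\<delta>\<close>, where \<open>F\<close> is the identity\<close>
  have close: "n - \<delta> < x$1" if x: "x \<in> B" "x$1 < n" "\<bar>x$2\<bar> < \<nu>" for x
  proof (rule ccontr)
    assume "\<not> n - \<delta> < x$1"
    then have "\<kappa> * \<delta> \<le> \<kappa> * (n - x$1)" using d by (intro mult_left_mono) auto
    then have "\<not> \<kappa> * (n - x$1) < \<bar>x$2\<bar>" using nu x by linarith
    then show False using x \<open>\<not> n - \<delta> < x$1\<close> unfolding B_def unslit_def by (auto simp: algebra_simps)
  qed
  have FB: "F' x = x" if x: "x \<in> B" for x
  proof (cases "x$1 < n \<and> \<bar>x$2\<bar> < \<nu>")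
    case True
    then have "n - \<delta> < x$1" using close x by blast
    then have "x \<in> strip n \<mu>" "n - \<mu> < x$1" using True nu d n by auto
    then show ?thesis using gF unfolding F'_def by simp
  qed (auto simp: F'_def)
  have oT: "open T" unfolding T_def by simp
  have oB: "open B"
    unfolding B_def unslit_def mem_ball dist_norm Int_iff mem_Collect_eq
    by (intro open_Collect_conj open_Collect_disj open_Collect_less continuous_intros)
  have cB: "c \<in> B" unfolding B_def unslit_def using h r d by (simp add: dist_norm)
  have seg: "closed_segment c x \<subseteq> N" if x: "x \<in> N" for x
  proof
    fix y assume "y \<in> closed_segment c x"
    then obtain u where u: "0 \<le> u" "u \<le> 1" "y = (1 - u) *\<^sub>R c + u *\<^sub>R x" by (auto simp: in_segment)
    have y: "y - c = u *\<^sub>R (x - c)" unfolding u(3) by (simp add: algebra_simps)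
    show "y \<in> N"
    proof (cases "x \<in> B")
      case True
      have b: "x - c \<in> ball (- h) \<rho>" "x - c \<in> unslit \<delta> \<kappa>" using True unfolding B_def by auto
      have "0 \<in> ball (- h) \<rho>" using h r by (simp add: dist_norm)
      from convexD[OF convex_ball this b(1), of "1 - u" u]
      have "u *\<^sub>R (x - c) \<in> ball (- h) \<rho>" using u by simp
      then have "y \<in> B" unfolding B_def mem_Collect_eq y using unslit_scale[OF b(2) d(1) u(1,2)] by blast
      then show ?thesis unfolding N_def by blast
    next
      case False
      then have x: "x \<in> T" using x unfolding N_def by blast
      show ?thesis
      proof (cases "u = 0")
        case True then show ?thesis using cB u(3) unfolding N_def by simp
      next
        case False
        then have u0: "0 < u" using u by simp
        have y1: "y$1 = n - u * (n - x$1)" unfolding u(3) by (simp add: algebra_simps)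
        have y2: "y$2 = u * x$2" unfolding u(3) by simp
        have xx: "- \<nu> < x$1" "x$1 < n" "\<bar>x$2\<bar> < \<nu>" using x unfolding T_def by auto
        have "0 < u * (n - x$1)" using u0 xx by simp
        then have 1: "y$1 < n" unfolding y1 by linarith
        define w where "w = n - x$1"
        have "u * w \<le> 1 * w" using u xx unfolding w_def by (intro mult_right_mono) auto
        then have "u * w \<le> w" by simp
        then have 2: "- \<nu> < y$1" unfolding y1 w_def[symmetric] using xx w_def by linarith
        have "\<bar>u * x$2\<bar> \<le> 1 * \<bar>x$2\<bar>" unfolding abs_mult using u by (intro mult_right_mono) auto
        then have "\<bar>y$2\<bar> < \<nu>" unfolding y2 using xx by linarith
        then have "y \<in> T" unfolding T_def mem_rect using 1 2 by linarith
        then show ?thesis unfolding N_def by blast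
      qed
    qed
  qed
  have "starlike N" unfolding starlike_def using cB seg unfolding N_def by blast
  moreover have "0 \<in> N"
  proof (cases "n = 0")
    case True then show ?thesis using cB unfolding N_def c_def by simp
  next
    case False then show ?thesis using n nu unfolding N_def T_def by auto
  qed
  moreover have "continuous_on N F'"
  proof -
    have "continuous_on T F'" using continuous_on_subset[OF cF TS] by (rule continuous_on_eq) (simp add: FT)
    moreover have "continuous_on B F'" using continuous_on_id by (rule continuous_on_eq) (simp add: FB)
    ultimately show ?thesis unfolding N_def using oT oB continuous_on_open_Un by blast
  qed
  moreover have "linj N F'"
  proof -
    have "linj T F'" by (rule linj_cong[OF linj_subset[OF lF TS], where k = 0]) (simp add: FT)
    moreover have "linj B F'" by (rule linj_inj) (use FB in \<open>simp add: inj_on_def\<close>)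
    ultimately show ?thesis unfolding N_def using oT oB linj_Un by blast
  qed
  ultimately have mod: "model N F'" unfolding model_def using oT oB unfolding N_def by blast
  let ?S = "closed_segment 0 c"
  have S: "0 \<le> x$1" "x$1 \<le> n" "x$2 = 0" if "x \<in> ?S" for x
    using closed_segment_pt[OF _ n] that unfolding c_def by auto
  define K where "K = {x. x - c \<in> cball (- h) \<rho>' \<and> (- (\<mu>/4) \<le> (x - c)$1 \<or> \<kappa>' * (- (x - c)$1) \<le> \<bar>(x - c)$2\<bar>)}"
  define K' where "K' = {x. x - c \<in> ball (- h) \<rho>' \<inter> unslit (\<mu>/4) \<kappa>'}"
  have "closed K"
    unfolding K_def mem_cball dist_norm
    by (intro closed_Collect_conj closed_Collect_disj closed_Collect_le continuous_intros)
  moreover have "K \<subseteq> cball (c - h) \<rho>'" unfolding K_def by (auto simp: dist_norm algebra_simps)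
  then have "bounded K" using bounded_cball bounded_subset by blast
  ultimately have "compact K" by (simp add: compact_eq_bounded_closed)
  then have J: "compact (?S \<union> K)" by (simp add: compact_Un)
  have KK: "K' \<subseteq> K"
  proof
    fix x assume x: "x \<in> K'"
    then have "- (\<mu>/4) < (x - c)$1 \<or> \<kappa>' * (- (x - c)$1) < \<bar>(x - c)$2\<bar>"
      unfolding K'_def unslit_def by blast
    then have "- (\<mu>/4) \<le> (x - c)$1 \<or> \<kappa>' * (- (x - c)$1) \<le> \<bar>(x - c)$2\<bar>" by linarith
    moreover have "x - c \<in> cball (- h) \<rho>'" using x unfolding K'_def by simp
    ultimately show "x \<in> K" unfolding K_def by blast
  qed
  have KB: "K \<subseteq> B"
  proof
    fix x assume x: "x \<in> K"
    then have "x - c \<in> ball (- h) \<rho>" using r unfolding K_def by simp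
    moreover have "x - c \<in> unslit \<delta> \<kappa>"
    proof (cases "- \<delta> < (x - c)$1")
      case False
      then have "\<not> - (\<mu>/4) \<le> (x - c)$1" using mu unfolding \<delta>_def by linarith
      then have "\<kappa>' * (- (x - c)$1) \<le> \<bar>(x - c)$2\<bar>" using x unfolding K_def by blast
      moreover have "\<kappa> * (- (x - c)$1) < \<kappa>' * (- (x - c)$1)"
        using False d by (intro mult_strict_right_mono) linarith+
      ultimately have "\<kappa> * (- (x - c)$1) < \<bar>(x - c)$2\<bar>" by linarith
      then show ?thesis unfolding unslit_def by blast
    qed (simp add: unslit_def)
    ultimately show "x \<in> B" unfolding B_def by blast
  qed
  have SN: "?S \<subseteq> N"
  proof
    fix x assume x: "x \<in> ?S"
    show "x \<in> N"
    proof (cases "x$1 < n")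
      case True then show ?thesis using S[OF x] nu unfolding N_def T_def by auto
    next
      case False
      then have "x = c" using S[OF x] by (simp add: vec_eq_iff forall_2)
      then show ?thesis using cB unfolding N_def by blast
    qed
  qed
  show ?thesis
  proof (rule that[OF mod J, of "?S \<union> K'"])
    show "?S \<union> K' \<subseteq> ?S \<union> K" using KK by blast
    show "?S \<union> K \<subseteq> N" using SN KB unfolding N_def by blast
    show "0 \<in> ?S \<union> K'" by simp
  next
    fix Q :: "epoint pointed_surface" and q q' e
    assume Q: "pointed_translation_structure Q" and dv: "dev Q q C q'"
      and e: "tm Q (ball (- h) \<rho>) (\<lambda>v. v) e" "e 0 = q'"
    obtain f where f: "tm Q (strip n \<mu>) F f" "f 0 = q" "f (pt n) = q'" using dF[OF Q dv] by blast
    have f1: "tm Q T F' f" by (rule tm_cong[OF tm_subset[OF f(1) TS], where c = 0]) (use FT in auto)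
    have e1: "tm Q B F' (\<lambda>x. e (x + - c))"
      by (rule tm_translate[OF e(1), where b = 0]) (use FB in \<open>auto simp: B_def\<close>)
    have "f x = e (x + - c)" if x: "x \<in> T" "x \<in> B" for x
    proof -
      define Z where "Z = rect (n - \<delta>) (n + \<delta>) (- \<nu>) \<nu> \<inter> ball (c - h) \<rho> \<inter> strip n \<mu>"
      have cz: "c \<in> Z" unfolding Z_def using d nu n mu h r by (auto simp: dist_norm)
      have "n - \<delta> < x$1" using close x unfolding T_def by auto
      then have xz: "x \<in> Z" using x TS d unfolding Z_def B_def T_def
        by (auto simp: dist_norm algebra_simps)
      have con: "connected Z" unfolding Z_def by (intro convex_connected convex_Int) auto
      have 1: "tm Q Z (\<lambda>x. x) f"
      proof (rule tm_cong[OF tm_subset[OF f(1)], where c = 0])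
        show "Z \<subseteq> strip n \<mu>" unfolding Z_def by blast
        show "z = F z + 0" if "z \<in> Z" for z
          using gF[of z] that d unfolding Z_def by simp
      qed auto
      have 2: "tm Q Z (\<lambda>x. x) (\<lambda>x. e (x + - c))"
        by (rule tm_translate[OF e(1), where b = 0]) (auto simp: Z_def dist_norm algebra_simps)
      show ?thesis by (rule tm_unique[OF Q 1 2 con cz _ xz]) (use f e in \<open>simp add: c_def\<close>)
    qed
    then have g: "tm Q (T \<union> B) F' (\<lambda>x. if x \<in> T then f x else e (x + - c))"
      by (rule tm_glue[OF f1 e1 oT oB])
    have "(if 0 \<in> T then f 0 else e (0 + - c)) = q"
    proof (cases "n = 0")
      case True then show ?thesis using f e unfolding c_def by simp
    next
      case False
      then have "0 \<in> T" using n nu unfolding T_def by auto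
      then show ?thesis using f by simp
    qed
    then show "\<exists>f. tm Q N F' f \<and> f 0 = q" using g unfolding N_def by blast
  next
    fix Q :: "epoint pointed_surface" and q q' f
    assume Q: "pointed_translation_structure Q" and dv: "dev Q q C q'"
      and f: "tm Q (?S \<union> K') F' f" "f 0 = q"
    obtain f0 where f0: "tm Q (strip n \<mu>) F f0" "f0 0 = q" "f0 (pt n) = q'" using dF[OF Q dv] by blast
    have SS: "?S \<subseteq> strip n \<mu>" using S n mu by force
    have FS: "F' x = F x" if x: "x \<in> ?S" for x
    proof (cases "x$1 < n")
      case True then show ?thesis using S[OF x] nu unfolding F'_def by simp
    next
      case False
      then have "F' x = x" unfolding F'_def by simp
      moreover have "F x = x" using gF[of x] SS x False mu by auto
      ultimately show ?thesis by simp
    qed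
    have 1: "tm Q ?S F' f0" by (rule tm_cong[OF tm_subset[OF f0(1) SS], where c = 0]) (use FS in auto)
    have 2: "tm Q ?S F' f" using tm_subset[OF f(1)] by blast
    have "f c = f0 c" by (rule tm_unique[OF Q 2 1, of 0]) (use f f0 in auto)
    then have fc: "f (0 + c) = q'" using f0 unfolding c_def by simp
    have "tm Q K' (\<lambda>x. x) f"
      by (rule tm_cong[OF tm_subset[OF f(1)], where c = 0]) (use FB KK KB in auto)
    then have "tm Q (ball (- h) \<rho>' \<inter> unslit (\<mu>/4) \<kappa>') (\<lambda>v. v) (\<lambda>x. f (x + c))"
      by (rule tm_translate[where b = 0]) (auto simp: K'_def)
    then show "\<exists>e. tm Q (ball (- h) \<rho>' \<inter> unslit (\<mu>/4) \<kappa>') (\<lambda>v. v) e \<and> e 0 = q'" using fc by blast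
  qed
qed

text \<open>Both slits open to the left, so every point can be pushed horizontally into the right half of the ball, which is convex.\<close>

lemma connected_two_slits:
  fixes p h :: plane
  assumes p: "p \<in> ball 0 \<rho>" "0 \<le> p$1" "0 \<le> \<kappa>" and d: "0 < \<delta>" "0 < \<delta>'" and hh: "h$1 = 0"
  shows "connected (ball 0 \<rho> \<inter> unslit \<delta> \<kappa> \<inter> {w. w - h \<in> unslit \<delta>' \<kappa>})" (is "connected ?D")
proof -
  let ?G = "ball 0 \<rho> \<inter> {w :: plane. 0 \<le> w$1}"
  have "convex {w :: plane. 0 \<le> w$1}"
    unfolding convex_def by auto
  then have G: "connected ?G" by (intro convex_connected convex_Int) auto
  have up: "y \<in> unslit \<delta> \<kappa>" if y: "x \<in> unslit \<delta> \<kappa>" "x$1 \<le> y$1" "y$2 = x$2" for x y :: plane and \<delta>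
  proof -
    have "\<kappa> * (- y$1) \<le> \<kappa> * (- x$1)" using y p(3) by (intro mult_left_mono) auto
    then show ?thesis using y unfolding unslit_def by auto
  qed
  have GD: "?G \<subseteq> ?D" using d hh by (auto simp: unslit_def)
  have pG: "p \<in> ?G" using p by simp
  have "connected_component ?D p w" if w: "w \<in> ?D" for w
  proof (cases "0 \<le> w$1")
    case True
    then have "w \<in> ?G" using w by blast
    then show ?thesis unfolding connected_component_def using G GD pG by blast
  next
    case False
    define w0 :: plane where "w0 = vector [0, w$2]"
    have w0: "w0$1 = 0" "w0$2 = w$2" unfolding w0_def by simp_all
    have "norm w0 \<le> norm w" using component_le_norm_cart[of w 2] plane_norm_le[of w0] w0 by simp
    then have w0G: "w0 \<in> ?G" using w w0 by simp
    have S: "closed_segment w w0 \<subseteq> ?D"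
    proof
      fix y assume y: "y \<in> closed_segment w w0"
      then obtain u where u: "0 \<le> u" "u \<le> 1" "y = (1 - u) *\<^sub>R w + u *\<^sub>R w0" by (auto simp: in_segment)
      have y1: "y$1 = (1 - u) * w$1" and y2: "y$2 = w$2" unfolding u(3) using w0 by (simp_all add: algebra_simps)
      have "1 * w$1 \<le> (1 - u) * w$1" using u False by (intro mult_right_mono_neg) auto
      then have le: "w$1 \<le> y$1" unfolding y1 by simp
      have "y \<in> ball 0 \<rho>" using closed_segment_subset[OF _ _ convex_ball, of w 0 \<rho> w0] y w w0G by blast
      moreover have "y \<in> unslit \<delta> \<kappa>" using up[of w \<delta> y] w le y2 by simp
      moreover have "y - h \<in> unslit \<delta>' \<kappa>" using up[of "w - h" \<delta>' "y - h"] w le y2 by simp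
      ultimately show "y \<in> ?D" by blast
    qed
    have 1: "connected_component ?D w w0" unfolding connected_component_def
      using S by (intro exI[of _ "closed_segment w w0"]) auto
    have 2: "connected_component ?D p w0" unfolding connected_component_def using G GD pG w0G by blast
    show ?thesis by (rule connected_component_trans[OF 2 connected_component_sym[OF 1]])
  qed
  note pw = this
  show ?thesis unfolding connected_iff_connected_component
    by (intro ballI connected_component_trans[OF connected_component_sym[OF pw] pw])
qed

text \<open>The second model belongs to the chain with a further small step \<open>h\<close> upwards, but its ball has the same centre as the first one. The slits have
  slope \<open>\<kappa>\<close> and their apexes differ by \<open>h\<close>. At the far end of the ball they are less than \<open>\<kappa> * \<rho>'\<close> wide to either side, which is half of the
  vertical distance of the apexes; hence they are disjoint and the two slit balls cover the ball. The maps on the slit balls agree on the intersection, which is connected.\<close>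

lemma two_models:
  assumes C: "slack 0 C" "0 < \<rho>0" and r: "0 < \<rho>'" "\<rho>' < \<rho>"
  obtains N1 F1 M1 J1 N2 F2 M2 J2 where
    "model N1 F1" "compact J1" "M1 \<subseteq> J1" "J1 \<subseteq> N1" "0 \<in> M1"
    "model N2 F2" "compact J2" "M2 \<subseteq> J2" "J2 \<subseteq> N2" "0 \<in> M2"
    "\<And>(Q :: epoint pointed_surface) q q' e. pointed_translation_structure Q \<Longrightarrow> dev Q q ((0, \<rho>0) # C) q' \<Longrightarrow>
       exp_ball Q \<rho> q' e \<Longrightarrow> (\<exists>f. tm Q N1 F1 f \<and> f 0 = q) \<and> (\<exists>f. tm Q N2 F2 f \<and> f 0 = q)"
    "\<And>(Q :: epoint pointed_surface) q q' f1 f2. pointed_translation_structure Q \<Longrightarrow> dev Q q ((0, \<rho>0) # C) q' \<Longrightarrow>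
       tm Q M1 F1 f1 \<Longrightarrow> f1 0 = q \<Longrightarrow> tm Q M2 F2 f2 \<Longrightarrow> f2 0 = q \<Longrightarrow> \<exists>e. exp_ball Q \<rho>' q' e"
proof -
  let ?C = "(0, \<rho>0) # C"
  obtain F n \<mu> where t1: "is_tube ?C F n \<mu>" using tube_exists[OF C(2,1)] by blast
  have mu: "0 < \<mu>" using t1 unfolding is_tube_def by blast
  define r1 where "r1 = min (\<mu>/4) \<rho>'"
  have r1: "0 < r1" "r1 \<le> \<mu>/4" "r1 \<le> \<rho>'" using mu r unfolding r1_def by auto
  define h :: plane where "h = axis 2 (r1/2)"
  have h: "h$1 = 0" "h$2 = r1/2" unfolding h_def by (simp_all add: axis_def)
  have nh: "norm h \<le> r1/2" using plane_norm_le[of h] h r1 by simp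
  have nh': "norm h < r1" "norm h < \<rho>'" using nh r1 by linarith+
  \<comment> \<open>the slope makes \<open>\<kappa> * \<rho>'\<close> equal to \<open>r1 / 4\<close>, half the length of \<open>h\<close>\<close>
  define \<kappa> where "\<kappa> = r1 / (4 * \<rho>')"
  have k: "0 < \<kappa>" using r1 r unfolding \<kappa>_def by simp
  have "slack 0 (C @ [(h, r1)])" using C nh' by simp
  from tube_exists[OF C(2) this] obtain F2 n2 \<mu>2 where t2: "is_tube (?C @ [(h, r1)]) F2 n2 \<mu>2" by auto
  have mu2: "0 < \<mu>2" using t2 unfolding is_tube_def by blast
  have n0: "norm (0 :: plane) < \<rho>'" using r by simp
  obtain N1 G1 M1 J1 where m1: "model N1 G1" "compact J1" "M1 \<subseteq> J1" "J1 \<subseteq> N1" "0 \<in> M1"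
    and f1: "\<And>(Q :: epoint pointed_surface) q q' e. pointed_translation_structure Q \<Longrightarrow> dev Q q ?C q' \<Longrightarrow>
       tm Q (ball (- 0) \<rho>) (\<lambda>v. v) e \<Longrightarrow> e 0 = q' \<Longrightarrow> \<exists>f. tm Q N1 G1 f \<and> f 0 = q"
    and b1: "\<And>(Q :: epoint pointed_surface) q q' f. pointed_translation_structure Q \<Longrightarrow> dev Q q ?C q' \<Longrightarrow>
       tm Q M1 G1 f \<Longrightarrow> f 0 = q \<Longrightarrow> \<exists>e. tm Q (ball (- 0) \<rho>' \<inter> unslit (\<mu>/4) \<kappa>) (\<lambda>v. v) e \<and> e 0 = q'"
    by (rule bulb_model[OF t1 k r n0]) blast
  obtain N2 G2 M2 J2 where m2: "model N2 G2" "compact J2" "M2 \<subseteq> J2" "J2 \<subseteq> N2" "0 \<in> M2"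
    and f2: "\<And>(Q :: epoint pointed_surface) q q' e. pointed_translation_structure Q \<Longrightarrow> dev Q q (?C @ [(h, r1)]) q' \<Longrightarrow>
       tm Q (ball (- h) \<rho>) (\<lambda>v. v) e \<Longrightarrow> e 0 = q' \<Longrightarrow> \<exists>f. tm Q N2 G2 f \<and> f 0 = q"
    and b2: "\<And>(Q :: epoint pointed_surface) q q' f. pointed_translation_structure Q \<Longrightarrow> dev Q q (?C @ [(h, r1)]) q' \<Longrightarrow>
       tm Q M2 G2 f \<Longrightarrow> f 0 = q \<Longrightarrow> \<exists>e. tm Q (ball (- h) \<rho>' \<inter> unslit (\<mu>2/4) \<kappa>) (\<lambda>v. v) e \<and> e 0 = q'"
    by (rule bulb_model[OF t2 k r nh'(2)]) blast
  show ?thesis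
  proof (rule that[OF m1 m2])
    fix Q :: "epoint pointed_surface" and q q' e
    assume Q: "pointed_translation_structure Q" and dv: "dev Q q ?C q'" and e: "exp_ball Q \<rho> q' e"
    have ee: "tm Q (ball (- 0) \<rho>) (\<lambda>v. v) e" "e 0 = q'" using e unfolding exp_ball_def by simp_all
    have 1: "\<exists>f. tm Q N1 G1 f \<and> f 0 = q" using f1[OF Q dv ee] .
    have "exp_ball Q r1 q' e" by (rule exp_ball_mono[OF e]) (use r1 r in auto)
    then have "step Q r1 h q' (e h)" using nh' unfolding step_def by blast
    then have dv2: "dev Q q (?C @ [(h, r1)]) (e h)" unfolding dev_append using dv by auto
    have "tm Q (ball (- h) \<rho>) (\<lambda>v. v) (\<lambda>x. e (x + h))"
      by (rule tm_translate[where K = "ball 0 \<rho>" and b = 0]) (use ee in \<open>auto simp: dist_norm add.commute norm_minus_commute\<close>)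
    from f2[OF Q dv2 this] have 2: "\<exists>f. tm Q N2 G2 f \<and> f 0 = q" by simp
    show "(\<exists>f. tm Q N1 G1 f \<and> f 0 = q) \<and> (\<exists>f. tm Q N2 G2 f \<and> f 0 = q)" using 1 2 by blast
  next
    fix Q :: "epoint pointed_surface" and q q' g1 g2
    assume Q: "pointed_translation_structure Q" and dv: "dev Q q ?C q'"
      and g1: "tm Q M1 G1 g1" "g1 0 = q" and g2: "tm Q M2 G2 g2" "g2 0 = q"
    let ?D1 = "ball 0 \<rho>' \<inter> unslit (\<mu>/4) \<kappa>"
    let ?D2 = "ball 0 \<rho>' \<inter> {w. w - h \<in> unslit (\<mu>2/4) \<kappa>}"
    obtain e1 where e1: "tm Q ?D1 (\<lambda>v. v) e1" "e1 0 = q'" using b1[OF Q dv g1] by auto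
    have "ball 0 r1 \<subseteq> ?D1"
    proof
      fix w :: plane assume "w \<in> ball 0 r1"
      then show "w \<in> ?D1" using component_le_norm_cart[of w 1] r1 by (auto simp: unslit_def)
    qed
    then have "exp_ball Q r1 q' e1" using tm_subset[OF e1(1)] e1(2) r1 unfolding exp_ball_def by blast
    then have "step Q r1 h q' (e1 h)" using nh' unfolding step_def by blast
    then have dv2: "dev Q q (?C @ [(h, r1)]) (e1 h)" unfolding dev_append using dv by auto
    obtain e2 where e2: "tm Q (ball (- h) \<rho>' \<inter> unslit (\<mu>2/4) \<kappa>) (\<lambda>v. v) e2" "e2 0 = e1 h"
      using b2[OF Q dv2 g2] by blast
    have e2': "tm Q ?D2 (\<lambda>v. v) (\<lambda>x. e2 (x + - h))"
      by (rule tm_translate[OF e2(1), where b = 0]) (auto simp: dist_norm)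
    have o: "open ?D1" "open ?D2"
    proof -
      show "open ?D1" using open_unslit by blast
      have "open ((\<lambda>w. w - h) -` unslit (\<mu>2/4) \<kappa>)"
        by (rule open_vimage[OF open_unslit]) (intro continuous_intros)
      then show "open ?D2" unfolding vimage_def by blast
    qed
    have hD: "h \<in> ?D1 \<inter> ?D2" using h nh' mu mu2 by (auto simp: unslit_def)
    have con: "connected (?D1 \<inter> ?D2)"
    proof -
      have "connected (ball 0 \<rho>' \<inter> unslit (\<mu>/4) \<kappa> \<inter> {w. w - h \<in> unslit (\<mu>2/4) \<kappa>})"
        by (rule connected_two_slits[of h]) (use h nh' k mu mu2 in auto)
      moreover have "?D1 \<inter> ?D2 = ball 0 \<rho>' \<inter> unslit (\<mu>/4) \<kappa> \<inter> {w. w - h \<in> unslit (\<mu>2/4) \<kappa>}" by blast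
      ultimately show ?thesis by simp
    qed
    have agree: "e1 w = e2 (w + - h)" if w: "w \<in> ?D1" "w \<in> ?D2" for w
      by (rule tm_unique[OF Q tm_subset[OF e1(1)] tm_subset[OF e2'] con hD]) (use w e2(2) in auto)
    have U: "?D1 \<union> ?D2 = ball 0 \<rho>'"
    proof -
      have "w \<in> ?D1 \<union> ?D2" if w: "w \<in> ball 0 \<rho>'" for w
      proof (rule ccontr)
        assume "w \<notin> ?D1 \<union> ?D2"
        then have a: "\<bar>w$2\<bar> \<le> \<kappa> * (- w$1)" "\<bar>w$2 - r1/2\<bar> \<le> \<kappa> * (- w$1)"
          using w h unfolding unslit_def by auto
        have "- w$1 < \<rho>'" using component_le_norm_cart[of w 1] w by auto
        then have "\<kappa> * (- w$1) < \<kappa> * \<rho>'" using k by (rule mult_strict_left_mono)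
        also have "\<dots> = r1/4" using r unfolding \<kappa>_def by simp
        finally show False using a by linarith
      qed
      then show ?thesis by blast
    qed
    have "tm Q (?D1 \<union> ?D2) (\<lambda>v. v) (\<lambda>x. if x \<in> ?D1 then e1 x else e2 (x + - h))"
      by (rule tm_glue[OF e1(1) e2' o agree])
    then have 1: "tm Q (ball 0 \<rho>') (\<lambda>v. v) (\<lambda>x. if x \<in> ?D1 then e1 x else e2 (x + - h))" unfolding U .
    have "0 \<in> ?D1" using r mu by (auto simp: unslit_def)
    then have "(if 0 \<in> ?D1 then e1 0 else e2 (0 + - h)) = q'" using e1(2) by simp
    then show "\<exists>e. exp_ball Q \<rho>' q' e" unfolding exp_ball_def using 1 r by blast
  qed
qed

lemma round_model:
  assumes r: "0 < \<rho>"
  shows "model (ball 0 \<rho>) (\<lambda>x. x)"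
proof -
  have "starlike (ball (0 :: plane) \<rho>)" using r by (intro convex_imp_starlike) auto
  moreover have "linj (ball 0 \<rho>) (\<lambda>x. x)" by (rule linj_inj) (simp add: inj_on_def)
  ultimately show ?thesis unfolding model_def using r by (auto intro: continuous_on_id)
qed

lemma tube_model:
  assumes t: "is_tube C F n \<mu>"
  shows "model (strip n \<mu>) F"
proof -
  have n: "0 \<le> n" "0 < \<mu>" "continuous_on (strip n \<mu>) F" "linj (strip n \<mu>) F"
    using t unfolding is_tube_def by auto
  then have z: "0 \<in> strip n \<mu>" by simp
  then have "strip n \<mu> \<noteq> {}" by blast
  then have "starlike (strip n \<mu>)" by (intro convex_imp_starlike convex_rect)
  then show ?thesis unfolding model_def using n z by auto
qed

section \<open>Models as translation surfaces\<close>

lemma homeomorphism_imp_homeomorphic_maps: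
  assumes "homeomorphism S T f g"
  shows "homeomorphic_maps (top_of_set S) (top_of_set T) f g"
  using assms unfolding homeomorphism_def homeomorphic_maps_def
  by (auto simp: continuous_map_subtopology_eu)

lemma plane_inj_real: "\<exists>h :: plane \<Rightarrow> real. inj h"
proof -
  obtain \<phi> :: "real \<Rightarrow> nat set" where \<phi>: "bij \<phi>"
    using nat_sets_eqpoll_reals eqpoll_sym unfolding eqpoll_def by blast
  define c :: "plane \<Rightarrow> nat set" where "c x = (\<lambda>k. 2 * k) ` \<phi> (x$1) \<union> (\<lambda>k. 2 * k + 1) ` \<phi> (x$2)" for x
  have "{k. 2 * k \<in> c x} = \<phi> (x$1)" "{k. 2 * k + 1 \<in> c x} = \<phi> (x$2)" for x
    unfolding c_def by (auto simp: image_iff) presburger+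
  then have eq: "\<phi> (x$1) = \<phi> (y$1)" "\<phi> (x$2) = \<phi> (y$2)" if "c x = c y" for x y using that by metis+
  have "inj c"
  proof (rule injI)
    fix x y assume "c x = c y"
    then have "x$1 = y$1" "x$2 = y$2" using eq[of x y] \<phi> by (auto simp: bij_def inj_eq)
    then show "x = y" by (simp add: vec_eq_iff forall_2)
  qed
  moreover have "inj (inv \<phi>)" using \<phi> by (simp add: bij_imp_bij_inv bij_is_inj)
  ultimately have "inj (inv \<phi> \<circ> c)" by (intro inj_compose)
  then show ?thesis by blast
qed

text \<open>The maximal atlas that contains the chart \<open>F\<close>.\<close>

definition plane_surface :: "plane set \<Rightarrow> (plane \<Rightarrow> plane) \<Rightarrow> plane pointed_surface" where
  "plane_surface N F = \<lparr>top_of = top_of_set N, basept = 0,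
     atlas = {c. is_chart (top_of_set N) c \<and> charts_compatible (top_of_set N) c (N, restrict F N)}\<rparr>"

lemma charts_compatible_trans:
  assumes c: "charts_compatible X (U, \<phi>) (N, F)" and d: "charts_compatible X (V, \<psi>) (N, F)"
    and UV: "U \<subseteq> N" "V \<subseteq> N"
  shows "charts_compatible X (U, \<phi>) (V, \<psi>)"
  unfolding charts_compatible_def split
proof
  fix p assume p: "p \<in> U \<inter> V"
  then have pU: "p \<in> U \<inter> N" and pV: "p \<in> V \<inter> N" using UV by auto
  obtain W where W: "openin X W" "p \<in> W" "W \<subseteq> U \<inter> N" "\<forall>q\<in>W. \<phi> q - F q = \<phi> p - F p"
    using bspec[OF c[unfolded charts_compatible_def split] pU] by (elim exE conjE)
  obtain W' where W': "openin X W'" "p \<in> W'" "W' \<subseteq> V \<inter> N" "\<forall>q\<in>W'. \<psi> q - F q = \<psi> p - F p"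
    using bspec[OF d[unfolded charts_compatible_def split] pV] by (elim exE conjE)
  have "\<phi> q - \<psi> q = \<phi> p - \<psi> p" if q: "q \<in> W \<inter> W'" for q
  proof -
    have 1: "\<phi> q - F q = \<phi> p - F p" using W(4) q by blast
    have 2: "\<psi> q - F q = \<psi> p - F p" using W'(4) q by blast
    have "\<phi> q - \<psi> q = (\<phi> q - F q) - (\<psi> q - F q)" by simp
    also have "\<dots> = \<phi> p - \<psi> p" unfolding 1 2 by simp
    finally show ?thesis .
  qed
  then show "\<exists>W. openin X W \<and> p \<in> W \<and> W \<subseteq> U \<inter> V \<and> (\<forall>q\<in>W. \<phi> q - \<psi> q = \<phi> p - \<psi> p)"
    using W(1-3) W'(1-3) by (intro exI[of _ "W \<inter> W'"]) blast
qed

lemma plane_surface: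
  assumes m: "model N F"
  shows "pointed_translation_structure (plane_surface N F)" "tm (plane_surface N F) N F (\<lambda>x. x)"
proof -
  let ?X = "top_of_set N" and ?c = "(N, restrict F N)"
  define A where "A = {c. is_chart ?X c \<and> charts_compatible ?X c ?c}"
  have o: "open N" and st: "starlike N" and z: "0 \<in> N" and c: "continuous_on N F" and l: "linj N F"
    using m unfolding model_def by auto
  have "\<exists>W. openin ?X W \<and> p \<in> W \<and> W \<subseteq> N \<and> open (restrict F N ` W) \<and>
        homeomorphic_map (subtopology ?X W) (top_of_set (restrict F N ` W)) (restrict F N)" if p: "p \<in> N" for p
  proof -
    obtain G where G: "open G" "p \<in> G" "inj_on F (G \<inter> N)" using l p unfolding linj_def by blast
    let ?W = "G \<inter> N"
    have oW: "open ?W" using G o by blast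
    have cW: "continuous_on ?W F" using continuous_on_subset[OF c] by blast
    have oF: "open (F ` ?W)" by (rule invariance_of_domain[OF cW oW G(3)])
    obtain g where "homeomorphism ?W (F ` ?W) F g"
      using invariance_of_domain_homeomorphism[OF oW cW _ G(3)] by auto
    then have "homeomorphic_map (top_of_set ?W) (top_of_set (F ` ?W)) F"
      using homeomorphism_imp_homeomorphic_maps homeomorphic_map_maps by blast
    then have h: "homeomorphic_map (top_of_set ?W) (top_of_set (F ` ?W)) (restrict F N)"
      by (rule homeomorphic_map_eq) auto
    have im: "restrict F N ` ?W = F ` ?W" by auto
    have st: "subtopology ?X ?W = top_of_set ?W" by (simp add: subtopology_subtopology Int_absorb1)
    show ?thesis
      by (rule exI[of _ ?W], unfold im st) (use oW oF h G p in \<open>auto simp: openin_open_eq o\<close>)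
  qed
  then have ch: "is_chart ?X ?c" unfolding is_chart_def by auto
  have self: "charts_compatible ?X ?c ?c" unfolding charts_compatible_def split
    by (intro ballI exI[of _ N]) simp
  have sub: "fst d \<subseteq> N" if "is_chart ?X d" for d
    using that openin_subset unfolding is_chart_def by (cases d) fastforce
  have at: "translation_atlas ?X A"
    unfolding translation_atlas_def
  proof (intro conjI ballI)
    show "is_chart ?X d" if "d \<in> A" for d using that unfolding A_def by blast
    have "?c \<in> A" using ch self unfolding A_def by blast
    then show "(\<Union>d\<in>A. fst d) = topspace ?X" using sub unfolding A_def by fastforce
    show "charts_compatible ?X d d'" if d: "d \<in> A" "d' \<in> A" for d d'
    proof -
      obtain U \<phi> V \<psi> where e: "d = (U, \<phi>)" "d' = (V, \<psi>)" by (cases d, cases d')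
      show ?thesis unfolding e
        by (rule charts_compatible_trans[of _ _ _ N "restrict F N"])
          (use d sub[of d] sub[of d'] in \<open>auto simp: A_def e\<close>)
    qed
  qed
  have mx: "B = A" if B: "translation_atlas ?X B" "A \<subseteq> B" for B
  proof -
    have "?c \<in> B" using ch self B unfolding A_def by blast
    then have "B \<subseteq> A" using B(1) unfolding translation_atlas_def A_def by blast
    then show ?thesis using B by blast
  qed
  have "second_countable (euclidean :: plane topology)"
  proof -
    obtain \<B> :: "plane set set" where b: "countable \<B>" "topological_basis \<B>" using ex_countable_basis by blast
    show ?thesis unfolding second_countable_def
    proof (intro exI[of _ \<B>] conjI ballI allI impI)
      show "openin euclidean V" if "V \<in> \<B>" for V using topological_basis_open[OF b(2) that] by simp
      show "\<exists>V\<in>\<B>. x \<in> V \<and> V \<subseteq> U" if "openin euclidean U \<and> x \<in> U" for U x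
        using topological_basisE[OF b(2), of U x] that by (metis open_openin)
    qed (rule b(1))
  qed
  then have sc: "second_countable ?X" using second_countable_subtopology by blast
  have loc: "\<exists>U V. openin ?X U \<and> p \<in> U \<and> open (V :: plane set) \<and> subtopology ?X U homeomorphic_space top_of_set V"
    if "p \<in> topspace ?X" for p
    by (rule exI[of _ N], rule exI[of _ N]) (use that o in \<open>auto simp: subtopology_subtopology homeomorphic_space_refl\<close>)
  have "surface ?X"
    unfolding surface_def using z sc loc starlike_imp_connected[OF st]
    by (auto simp: connected_space_subtopology Hausdorff_space_subtopology)
  then show P: "pointed_translation_structure (plane_surface N F)"
    unfolding pointed_translation_structure_def translation_structure_def plane_surface_def
    using at mx z unfolding A_def[symmetric] by simp
  show "tm (plane_surface N F) N F (\<lambda>x. x)"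
  proof (rule tmI)
    show "continuous_map (top_of_set N) (top_of (plane_surface N F)) (\<lambda>x. x)"
      unfolding plane_surface_def using continuous_map_id[of ?X] by (simp add: id_def)
    fix z assume "z \<in> N"
    show "\<exists>V \<psi> G. (V, \<psi>) \<in> atlas (plane_surface N F) \<and> open G \<and> z \<in> G \<and>
      (\<forall>z'. z' \<in> G \<longrightarrow> z' \<in> N \<longrightarrow> z' \<in> V \<and> \<psi> z' - F z' = \<psi> z - F z)"
      by (rule exI[of _ N], rule exI[of _ "restrict F N"], rule exI[of _ UNIV])
        (use ch self \<open>z \<in> N\<close> in \<open>auto simp: plane_surface_def\<close>)
  qed
qed

text \<open>Points of the moduli space are surfaces whose points are real numbers, so the plane is first embedded as a set into the real line and the structure
  is transported.\<close>

lemma model_moduli: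
  assumes m: "model N F"
  obtains R G where "R \<in> moduli" "homeomorphic_map (top_of_set N) (top_of (surface_over R)) G"
    "G 0 = basept (surface_over R)" "tm (surface_over R) N F G"
proof -
  let ?P0 = "plane_surface N F"
  note P0 = plane_surface[OF m]
  obtain h :: "plane \<Rightarrow> real" where h: "inj h" using plane_inj_real by blast
  define P where "P = transport h ?P0"
  have i1: "pointed_isomorphism ?P0 P h" unfolding P_def
    by (rule pointed_isomorphism_transport) (use h in \<open>auto intro: inj_on_subset\<close>)
  have P: "pointed_translation_structure P" by (rule pointed_translation_structure_iso[OF P0(1) i1])
  define R where "R = iso_class P"
  have R: "R \<in> moduli" unfolding R_def moduli_def using P by blast
  obtain P' where P': "P' \<in> R" "pointed_translation_structure P'"
    "pointed_isomorphism P' (surface_over R) (marked_class P')"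
    using surface_over_isomorphic[OF R] by metis
  obtain k where k: "pointed_isomorphism P P' k" using P'(1) unfolding R_def iso_class_def by blast
  define G where "G = marked_class P' \<circ> k \<circ> h"
  have "pointed_isomorphism ?P0 P' (k \<circ> h)" by (rule pointed_isomorphism_compose[OF P0(1) i1 k])
  from pointed_isomorphism_compose[OF P0(1) this P'(3)]
  have G: "pointed_isomorphism ?P0 (surface_over R) G" unfolding G_def by (simp add: comp_assoc)
  then have t: "translation_isomorphism (top_of ?P0) (atlas ?P0) (top_of (surface_over R)) (atlas (surface_over R)) G"
    and b: "G (basept ?P0) = basept (surface_over R)" unfolding pointed_isomorphism_def by auto
  show ?thesis
  proof (rule that[OF R])
    show "homeomorphic_map (top_of_set N) (top_of (surface_over R)) G"
      using t unfolding translation_isomorphism_def plane_surface_def by simp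
    show "G 0 = basept (surface_over R)" using b unfolding plane_surface_def by simp
    show "tm (surface_over R) N F G" using tm_isomorphism[OF t P0(1) P0(2)] .
  qed
qed

text \<open>The map \<open>f\<close> itself, read on the copy of the model.\<close>

lemma tm_model_immersion:
  assumes m: "model N F" and R: "pointed_translation_structure R" and S: "pointed_translation_structure S"
    and G: "homeomorphic_map (top_of_set N) (top_of R) G" "G 0 = basept R" "tm R N F G"
    and f: "tm S N F f" "f 0 = basept S" and A: "A \<in> PC R"
  obtains \<iota> where "is_immersion R A S (points S) \<iota>" "\<And>z. z \<in> N \<Longrightarrow> \<iota> (G z) = f z"
proof -
  have o: "open N" and z: "0 \<in> N" and c: "continuous_on N F" and l: "linj N F"
    using m unfolding model_def by auto
  have inj: "inj_on G N" and im: "G ` N = points R"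
    using homeomorphic_imp_injective_map[OF G(1)] homeomorphic_imp_surjective_map[OF G(1)] by auto
  define \<iota> where "\<iota> = (\<lambda>x. f (inv_into N G x))"
  have val: "\<iota> (G z) = f z" if "z \<in> N" for z using that inj unfolding \<iota>_def by simp
  have "is_immersion R A S (points S) \<iota>"
  proof (rule immersionI_tm[OF R S A])
    show "\<iota> (basept R) = basept S" using val[OF z] G(2) f(2) by simp
    fix s assume "s \<in> A"
    then have "s \<in> points R" using A unfolding PC_def path_connectedin_def by blast
    then obtain p where p: "p \<in> N" "s = G p" using im by blast
    obtain U where U: "open U" "p \<in> U" "inj_on F (U \<inter> N)" using l p unfolding linj_def by blast
    let ?W = "U \<inter> N"
    have oW: "open ?W" using U o by blast
    have cW: "continuous_on ?W F" using continuous_on_subset[OF c] by blast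
    obtain g where g: "homeomorphism ?W (F ` ?W) F g"
      using invariance_of_domain_homeomorphism[OF oW cW _ U(3)] by auto
    have gc: "continuous_on (F ` ?W) g" and gi: "g ` (F ` ?W) \<subseteq> N" and gF: "\<And>x. x \<in> ?W \<Longrightarrow> g (F x) = x"
      using g unfolding homeomorphism_def by auto
    have Fg: "F (g y) = y" if "y \<in> F ` ?W" for y using g that unfolding homeomorphism_def by auto
    have 1: "tm R (F ` ?W) (\<lambda>v. v) (\<lambda>y. G (g y))"
      by (rule tm_cong[OF tm_compose[OF G(3) gc gi], where c = 0]) (use Fg in auto)
    have 2: "tm S (F ` ?W) (\<lambda>v. v) (\<lambda>y. f (g y))"
      by (rule tm_cong[OF tm_compose[OF f(1) gc gi], where c = 0]) (use Fg in auto)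
    show "\<exists>G e e' a. open G \<and> a \<in> G \<and> e a = s \<and> tm R G (\<lambda>v. v) e \<and> inj_on e G \<and>
      tm S G (\<lambda>v. v) e' \<and> (\<forall>w\<in>G. e w \<in> A \<longrightarrow> \<iota> (e w) = e' w)"
    proof (intro exI conjI ballI impI)
      show "open (F ` ?W)" by (rule invariance_of_domain[OF cW oW U(3)])
      show "F p \<in> F ` ?W" using p U by blast
      show "G (g (F p)) = s" using gF[of p] p U by simp
      show "inj_on (\<lambda>y. G (g y)) (F ` ?W)"
      proof (rule inj_onI)
        fix x y assume a: "x \<in> F ` ?W" "y \<in> F ` ?W" "G (g x) = G (g y)"
        then have "g x = g y" using inj gi by (meson image_subset_iff inj_onD)
        then show "x = y" using Fg a by metis
      qed
      show "\<iota> (G (g w)) = f (g w)" if "w \<in> F ` ?W" for w using val gi that by blast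
    qed (rule 1 2)+
  qed
  then show ?thesis using that val by blast
qed

text \<open>Starlike sets are simply connected, so the Riemann mapping theorem applies.\<close>

lemma starlike_homeomorphic_ball:
  fixes N :: "plane set"
  assumes N: "open N" "starlike N"
  obtains f g where "homeomorphism (ball (0 :: plane) 1) N f g"
proof -
  define L :: "plane \<Rightarrow> complex" where "L x = Complex (x$1) (x$2)" for x
  define M :: "complex \<Rightarrow> plane" where "M w = Re w *\<^sub>R axis 1 1 + Im w *\<^sub>R axis 2 1" for w
  have L_M: "L (M w) = w" for w unfolding L_def M_def by (simp add: axis_def complex_eq_iff)
  have M_L: "M (L x) = x" for x unfolding L_def M_def by (simp add: vec_eq_iff forall_2 axis_def)
  have cL: "continuous_on S L" for S
    unfolding L_def Complex_eq by (intro continuous_intros)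
  have cM: "continuous_on S M" for S
    unfolding M_def by (intro continuous_intros)
  have hom: "S homeomorphic (L ` S)" for S
    unfolding homeomorphic_def homeomorphism_def
    by (rule exI[of _ L], rule exI[of _ M]) (auto simp: L_M M_L cL cM image_image)
  have "L ` ball 0 1 = ball 0 1"
  proof -
    have nL: "norm (L x) = norm x" for x
      unfolding L_def cmod_def norm_vec_def L2_set_def by (simp add: sum_2)
    have "w \<in> L ` ball 0 1" if "w \<in> ball 0 1" for w
      using that nL[of "M w"] L_M[of w] by (intro image_eqI[of _ _ "M w"]) auto
    then show ?thesis using nL by auto
  qed
  then have b: "ball (0 :: plane) 1 homeomorphic ball (0 :: complex) 1" using hom[of "ball 0 1"] by simp
  have "L ` N = M -` N"
  proof (intro subset_antisym subsetI)
    fix w assume "w \<in> M -` N"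
    then show "w \<in> L ` N" using L_M[of w] by (intro image_eqI[of _ _ "M w"]) auto
  qed (auto simp: M_L)
  then have oL: "open (L ` N)" using open_vimage[OF N(1) cM[of UNIV]] by simp
  have "simply_connected (L ` N)"
    using starlike_imp_simply_connected[OF N(2)] homeomorphic_simply_connected[OF hom] by blast
  moreover have "L ` N \<noteq> {}" using N(2) unfolding starlike_def by blast
  ultimately have "L ` N homeomorphic ball (0 :: complex) 1"
    using simply_connected_eq_homeomorphic_to_disc[OF oL] by blast
  then have "N homeomorphic ball (0 :: complex) 1" using hom homeomorphic_trans by blast
  then have "ball (0 :: plane) 1 homeomorphic N" using b homeomorphic_trans homeomorphic_sym by metis
  then show ?thesis using that unfolding homeomorphic_def by blast
qed

lemma homeomorphism_imp_homeomorphic_space: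
  assumes G: "homeomorphic_map (top_of_set N) X G" and D: "D \<subseteq> N" and h: "homeomorphism B D f g"
  shows "subtopology X (G ` D) homeomorphic_space top_of_set B"
proof -
  have "homeomorphic_map (subtopology (top_of_set N) D) (subtopology X (G ` D)) G"
    by (rule homeomorphic_map_subtopologies[OF G])
      (use D homeomorphic_imp_surjective_map[OF G] in \<open>auto simp: Int_absorb1\<close>)
  then have 1: "top_of_set D homeomorphic_space subtopology X (G ` D)"
    using D homeomorphic_map_imp_homeomorphic_space by (metis inf.absorb_iff2 subtopology_subtopology)
  have "top_of_set B homeomorphic_space top_of_set D"
    using homeomorphism_imp_homeomorphic_maps[OF h] unfolding homeomorphic_space_def by blast
  then show ?thesis using 1 homeomorphic_space_trans homeomorphic_space_sym by metis
qed

text \<open>In the coordinates of the unit disk, a concentric closed disk contains \<open>J\<close> and the basepoint.\<close>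

lemma model_disk:
  assumes m: "model N F" and G: "homeomorphic_map (top_of_set N) (top_of R) G" "G 0 = basept R"
    and J: "compact J" "J \<subseteq> N"
  obtains D where "closed_disk R D" "G ` J \<subseteq> D" "D \<in> PC R"
proof -
  have o: "open N" and z: "0 \<in> N" and st: "starlike N" using m unfolding model_def by auto
  obtain f g where h: "homeomorphism (ball (0 :: plane) 1) N f g" using starlike_homeomorphic_ball[OF o st] .
  have gc: "continuous_on N g" and gi: "g ` N = ball 0 1" and fg: "\<And>x. x \<in> N \<Longrightarrow> f (g x) = x"
    and fc: "continuous_on (ball 0 1) f" and fi: "f ` ball 0 1 = N" and gf: "\<And>x. x \<in> ball 0 1 \<Longrightarrow> g (f x) = x"
    using h unfolding homeomorphism_def by auto
  let ?K = "insert 0 J"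
  have K: "compact (g ` ?K)"
    by (rule compact_continuous_image) (use continuous_on_subset[OF gc] J z in \<open>auto simp: compact_insert\<close>)
  obtain t where t: "0 < t" "t < 1" "g ` ?K \<subseteq> ball 0 t"
  proof -
    obtain x where x: "x \<in> g ` ?K" "\<And>y. y \<in> g ` ?K \<Longrightarrow> norm y \<le> norm x"
      using continuous_attains_sup[OF K, of norm] by (auto intro: continuous_intros)
    have "g ` ?K \<subseteq> ball 0 1" unfolding gi[symmetric] using J z by blast
    then have n: "norm x < 1" using x(1) by auto
    have "g ` ?K \<subseteq> ball 0 ((1 + norm x) / 2)"
    proof
      fix y assume "y \<in> g ` ?K"
      then have "norm y \<le> norm x" by (rule x(2))
      then show "y \<in> ball 0 ((1 + norm x) / 2)" using n by simp
    qed
    moreover have "0 < (1 + norm x) / 2" by (simp add: add_pos_nonneg)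
    ultimately show ?thesis using that[of "(1 + norm x) / 2"] n by simp
  qed
  let ?D = "f ` cball 0 t"
  have cb: "cball (0::plane) t \<subseteq> ball 0 1" using t by auto
  have DN: "?D \<subseteq> N" using fi cb by blast
  have KD: "?K \<subseteq> f ` ball 0 t"
  proof
    fix x assume x: "x \<in> ?K"
    then have "g x \<in> ball 0 t" "f (g x) = x" using t(3) fg J z by auto
    then show "x \<in> f ` ball 0 t" by (metis imageI)
  qed
  have inj: "inj_on f (ball 0 1)" using gf by (metis inj_onI)
  have bb: "ball (0::plane) t \<subseteq> ball 0 1" using t by auto
  have opf: "open (f ` ball 0 t)"
    by (rule invariance_of_domain[OF continuous_on_subset[OF fc bb] open_ball inj_on_subset[OF inj bb]])
  have GD: "G ` ?D \<subseteq> points R" using homeomorphic_imp_surjective_map[OF G(1)] DN by auto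
  have "homeomorphism (cball 0 t) ?D f g"
    by (rule homeomorphism_of_subsets[OF h]) (use cb in auto)
  moreover have "cball (0::plane) 1 homeomorphic cball (0::plane) t"
    using homeomorphic_balls(2) t by (metis zero_less_one)
  then obtain a b where "homeomorphism (cball (0::plane) 1) (cball (0::plane) t) a b" unfolding homeomorphic_def by blast
  ultimately have h1: "homeomorphism (cball (0::plane) 1) ?D (f \<circ> a) (b \<circ> g)"
    using homeomorphism_compose by blast
  have "subtopology (top_of R) (G ` ?D) homeomorphic_space top_of_set (cball (0 :: plane) 1)"
    by (rule homeomorphism_imp_homeomorphic_space[OF G(1) DN h1])
  moreover have "basept R \<in> top_of R interior_of (G ` ?D)"
  proof -
    have bD: "f ` ball 0 t \<subseteq> ?D" by (intro image_mono ball_subset_cball)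
    have "openin (top_of_set N) (f ` ball 0 t)" using opf bD DN by (simp add: openin_open_eq o)
    then have "openin (top_of R) (G ` f ` ball 0 t)" using homeomorphic_map_openness_eq[OF G(1)] by blast
    moreover have "basept R \<in> G ` f ` ball 0 t" using KD G(2) by (metis imageI insertI1 subsetD)
    moreover have "G ` f ` ball 0 t \<subseteq> G ` ?D" using bD by blast
    ultimately show ?thesis unfolding interior_of_def by blast
  qed
  ultimately have cd: "closed_disk R (G ` ?D)" using GD unfolding closed_disk_def by blast
  moreover have "G ` J \<subseteq> G ` ?D" using KD ball_subset_cball by blast
  moreover have "G ` ?D \<in> PC R"
  proof -
    have "path_connected ?D"
      by (rule path_connected_continuous_image) (use continuous_on_subset[OF fc cb] in \<open>auto intro: convex_imp_path_connected\<close>)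
    then have "path_connectedin (top_of_set N) ?D" using DN by (simp add: path_connectedin_subtopology)
    then have "path_connectedin (top_of R) (G ` ?D)"
      using path_connectedin_continuous_map_image homeomorphic_imp_continuous_map[OF G(1)] by blast
    moreover have "f ` ball 0 t \<subseteq> ?D" by (intro image_mono ball_subset_cball)
    then have "0 \<in> ?D" using KD by blast
    then have "G 0 \<in> G ` ?D" by (rule imageI)
    then have "basept R \<in> G ` ?D" unfolding G(2) .
    ultimately show ?thesis unfolding PC_def by blast
  qed
  ultimately show ?thesis by (rule that)
qed

lemma model_open_disk:
  assumes m: "model N F" and G: "homeomorphic_map (top_of_set N) (top_of R) G" "G 0 = basept R"
  shows "open_disk R (G ` N)"
proof -
  have o: "open N" and z: "0 \<in> N" and st: "starlike N" using m unfolding model_def by auto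
  obtain f g where h: "homeomorphism (ball (0 :: plane) 1) N f g" using starlike_homeomorphic_ball[OF o st] .
  have "subtopology (top_of R) (G ` N) homeomorphic_space top_of_set (ball (0 :: plane) 1)"
    by (rule homeomorphism_imp_homeomorphic_space[OF G(1) subset_refl h])
  moreover have "path_connectedin (top_of_set N) N"
    using starlike_imp_path_connected[OF st] by (simp add: path_connectedin_subtopology)
  then have "path_connectedin (top_of R) (G ` N)"
    using path_connectedin_continuous_map_image homeomorphic_imp_continuous_map[OF G(1)] by blast
  moreover have "basept R \<in> G ` N" using z G(2) by (metis imageI)
  ultimately show ?thesis unfolding open_disk_def PC_def by blast
qed

section \<open>Open conditions on chains\<close>

abbreviation base :: "mpoint \<Rightarrow> epoint" where
  "base S \<equiv> basept (surface_over S)"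

lemma openin_generated: "A \<in> \<S> \<Longrightarrow> openin (topology_generated_by \<S>) A"
  using topology_generated_by_Basis .

lemma openin_M_disk:
  "R \<in> moduli \<Longrightarrow> closed_disk (surface_over R) D \<Longrightarrow> openin moduli_topology (M_disk R D)"
  unfolding moduli_topology_def by (rule openin_generated) blast

lemma openin_M_not_disk:
  "R \<in> moduli \<Longrightarrow> open_disk (surface_over R) U \<Longrightarrow> openin moduli_topology (M_not_disk R U)"
  unfolding moduli_topology_def by (rule openin_generated) blast

lemma openin_M_minus:
  "R \<in> moduli \<Longrightarrow> closed_disk (surface_over R) D \<Longrightarrow> closedin (top_of (surface_over R)) K \<Longrightarrow> K \<subseteq> D \<Longrightarrow>
    openin moduli_topology (M_minus R D K)"
  unfolding moduli_topology_def by (rule openin_generated) blast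

lemma topspace_moduli: "topspace moduli_topology = moduli"
  unfolding moduli_topology_def topology_generated_by_topspace
  by (auto simp: M_disk_def M_not_disk_def M_plus_def M_minus_def)

lemma openin_proj:
  "openin moduli_topology W \<Longrightarrow> openin universal_topology {e \<in> universal. proj e \<in> W}"
  unfolding universal_topology_def by (rule openin_generated) blast

lemma openin_E_plus:
  "R \<in> moduli \<Longrightarrow> closed_disk (surface_over R) D \<Longrightarrow> openin (top_of (surface_over R)) U \<Longrightarrow>
    U \<subseteq> top_of (surface_over R) interior_of D \<Longrightarrow> openin universal_topology (E_plus R D U)"
  unfolding universal_topology_def by (rule openin_generated) blast

lemma proj_moduli: "s \<in> universal \<Longrightarrow> proj s \<in> moduli"
  unfolding universal_def moduli_def by (auto simp: proj_marked_class)

lemma universal_point: "s \<in> universal \<Longrightarrow> s \<in> points (surface_over (proj s))"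
  using points_surface_over[OF proj_moduli] by (simp add: fiber_def)

lemma topspace_universal: "topspace universal_topology = universal"
proof
  show "topspace universal_topology \<subseteq> universal"
    unfolding universal_topology_def topology_generated_by_topspace by (auto simp: E_plus_def)
  have "openin moduli_topology moduli" using openin_topspace[of moduli_topology] topspace_moduli by simp
  from openin_subset[OF openin_proj[OF this]] show "universal \<subseteq> topspace universal_topology"
    using proj_moduli by blast
qed

lemma immersion_model_tm:
  assumes R: "pointed_translation_structure R" and S: "pointed_translation_structure S"
    and G: "G 0 = basept R" "tm R N F G" and i: "is_immersion R D S B \<iota>" and M: "M \<subseteq> N" "G ` M \<subseteq> D"
  shows "tm S M F (\<lambda>z. \<iota> (G z))" "\<iota> (G 0) = basept S"
  using immersion_tm[OF R S i tm_subset[OF G(2) M(1)] M(2)] i G(1) unfolding is_immersion_def by auto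

text \<open>A closed disk between \<open>J\<close> and \<open>N\<close> separates the two conditions: surfaces to which \<open>N\<close> maps belong to its open set, and all members of
  that set receive \<open>J\<close>.\<close>

lemma model_disk_nbhd:
  assumes m: "model N F" and J: "compact J" "M \<subseteq> J" "J \<subseteq> N"
  obtains W where "openin moduli_topology W"
    "\<And>S f. S \<in> moduli \<Longrightarrow> tm (surface_over S) N F f \<Longrightarrow> f 0 = base S \<Longrightarrow> S \<in> W"
    "\<And>S. S \<in> W \<Longrightarrow> S \<in> moduli \<and> (\<exists>f. tm (surface_over S) M F f \<and> f 0 = base S)"
proof -
  obtain R G where R: "R \<in> moduli" and G: "homeomorphic_map (top_of_set N) (top_of (surface_over R)) G"
    "G 0 = base R" "tm (surface_over R) N F G" by (rule model_moduli[OF m])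
  note PR = pointed_translation_structure_surface_over[OF R]
  obtain D where D: "closed_disk (surface_over R) D" "G ` J \<subseteq> D" "D \<in> PC (surface_over R)"
    using model_disk[OF m G(1,2) J(1,3)] .
  show ?thesis
  proof (rule that[OF openin_M_disk[OF R D(1)]])
    fix S f assume S: "S \<in> moduli" and f: "tm (surface_over S) N F f" "f 0 = base S"
    note PS = pointed_translation_structure_surface_over[OF S]
    obtain \<iota> where "is_immersion (surface_over R) D (surface_over S) (points (surface_over S)) \<iota>"
      using tm_model_immersion[OF m PR PS G f D(3)] by metis
    then show "S \<in> M_disk R D" using S unfolding M_disk_def by blast
  next
    fix S assume "S \<in> M_disk R D"
    then obtain \<iota> where S: "S \<in> moduli" and i: "immerses R D S \<iota>" unfolding M_disk_def by blast
    note PS = pointed_translation_structure_surface_over[OF S]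
    have MN: "M \<subseteq> N" "G ` M \<subseteq> D" using J D by auto
    show "S \<in> moduli \<and> (\<exists>f. tm (surface_over S) M F f \<and> f 0 = base S)"
      using S immersion_model_tm[OF PR PS G(2,3) i MN] by blast
  qed
qed

text \<open>The whole of \<open>N\<close> is an open disk, so nothing is lost here.\<close>

lemma model_not_nbhd:
  assumes m: "model N F"
  obtains W where "openin moduli_topology W"
    "\<And>S. S \<in> moduli \<Longrightarrow> \<not> (\<exists>f. tm (surface_over S) N F f \<and> f 0 = base S) \<Longrightarrow> S \<in> W"
    "\<And>S f. S \<in> W \<Longrightarrow> tm (surface_over S) N F f \<Longrightarrow> f 0 = base S \<Longrightarrow> False"
proof -
  obtain R G where R: "R \<in> moduli" and G: "homeomorphic_map (top_of_set N) (top_of (surface_over R)) G"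
    "G 0 = base R" "tm (surface_over R) N F G" by (rule model_moduli[OF m])
  note PR = pointed_translation_structure_surface_over[OF R]
  have U: "open_disk (surface_over R) (G ` N)" by (rule model_open_disk[OF m G(1,2)])
  then have PC: "G ` N \<in> PC (surface_over R)" unfolding open_disk_def by blast
  show ?thesis
  proof (rule that[OF openin_M_not_disk[OF R U]])
    fix S assume S: "S \<in> moduli" and n: "\<not> (\<exists>f. tm (surface_over S) N F f \<and> f 0 = base S)"
    note PS = pointed_translation_structure_surface_over[OF S]
    have "\<not> immerses R (G ` N) S \<iota>" for \<iota>
      using immersion_model_tm[OF PR PS G(2,3) _ subset_refl subset_refl] n by blast
    then show "S \<in> M_not_disk R (G ` N)" using S unfolding M_not_disk_def by blast
  next
    fix S f assume S: "S \<in> M_not_disk R (G ` N)" and f: "tm (surface_over S) N F f" "f 0 = base S"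
    then have Sm: "S \<in> moduli" unfolding M_not_disk_def by blast
    note PS = pointed_translation_structure_surface_over[OF Sm]
    obtain \<iota> where "immerses R (G ` N) S \<iota>"
      using tm_model_immersion[OF m PR PS G f PC] by metis
    then show False using S unfolding M_not_disk_def by blast
  qed
qed

lemma model_point_nbhd:
  assumes m: "model N F" and J: "compact J" "V \<subseteq> J" "J \<subseteq> N" and V: "open V"
  obtains X where "openin universal_topology X"
    "\<And>s f. s \<in> universal \<Longrightarrow> tm (surface_over (proj s)) N F f \<Longrightarrow> f 0 = base (proj s) \<Longrightarrow> s \<in> f ` V \<Longrightarrow> s \<in> X"
    "\<And>s. s \<in> X \<Longrightarrow> s \<in> universal \<and> (\<exists>f. tm (surface_over (proj s)) J F f \<and> f 0 = base (proj s) \<and> s \<in> f ` V)"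
proof -
  obtain R G where R: "R \<in> moduli" and G: "homeomorphic_map (top_of_set N) (top_of (surface_over R)) G"
    "G 0 = base R" "tm (surface_over R) N F G" by (rule model_moduli[OF m])
  note PR = pointed_translation_structure_surface_over[OF R]
  obtain D where D: "closed_disk (surface_over R) D" "G ` J \<subseteq> D" "D \<in> PC (surface_over R)"
    using model_disk[OF m G(1,2) J(1,3)] .
  have VN: "V \<subseteq> N" using J by blast
  have "openin (top_of_set N) V" using V VN m by (simp add: openin_open_eq model_def)
  then have oV: "openin (top_of (surface_over R)) (G ` V)"
    using homeomorphic_map_openness_eq[OF G(1)] by blast
  have "G ` V \<subseteq> D" using D J by blast
  then have VD: "G ` V \<subseteq> top_of (surface_over R) interior_of D" using oV interior_of_maximal by blast
  show ?thesis
  proof (rule that[OF openin_E_plus[OF R D(1) oV VD]])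
    fix s f assume s: "s \<in> universal" and f: "tm (surface_over (proj s)) N F f" "f 0 = base (proj s)" "s \<in> f ` V"
    note PS = pointed_translation_structure_surface_over[OF proj_moduli[OF s]]
    obtain \<iota> where i: "immerses R D (proj s) \<iota>" "\<And>z. z \<in> N \<Longrightarrow> \<iota> (G z) = f z"
      using tm_model_immersion[OF m PR PS G f(1,2) D(3)] by metis
    obtain z where z: "z \<in> V" "s = f z" using f(3) by blast
    then have "s = \<iota> (G z)" using i(2) VN by auto
    then have "s \<in> \<iota> ` G ` V" using z(1) by blast
    then show "s \<in> E_plus R D (G ` V)" using s i(1) unfolding E_plus_def by blast
  next
    fix s assume "s \<in> E_plus R D (G ` V)"
    then obtain \<iota> where s: "s \<in> universal" and i: "immerses R D (proj s) \<iota>" "s \<in> \<iota> ` G ` V"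
      unfolding E_plus_def by blast
    note PS = pointed_translation_structure_surface_over[OF proj_moduli[OF s]]
    note t = immersion_model_tm[OF PR PS G(2,3) i(1) J(3) D(2)]
    have "s \<in> (\<lambda>z. \<iota> (G z)) ` V" using i(2) by (simp add: image_image)
    then show "s \<in> universal \<and> (\<exists>f. tm (surface_over (proj s)) J F f \<and> f 0 = base (proj s) \<and> s \<in> f ` V)"
      using s t by blast
  qed
qed

lemma model_avoid_nbhd:
  assumes m: "model N F" and J: "compact J" "K \<subseteq> J" "J \<subseteq> N" and K: "compact K"
  obtains W where "openin moduli_topology W"
    "\<And>S f. S \<in> moduli \<Longrightarrow> tm (surface_over S) N F f \<Longrightarrow> f 0 = base S \<Longrightarrow> base S \<notin> f ` K \<Longrightarrow> S \<in> W"
    "\<And>S. S \<in> W \<Longrightarrow> S \<in> moduli \<and> (\<exists>f. tm (surface_over S) J F f \<and> f 0 = base S \<and> base S \<notin> f ` K)"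
proof -
  obtain R G where R: "R \<in> moduli" and G: "homeomorphic_map (top_of_set N) (top_of (surface_over R)) G"
    "G 0 = base R" "tm (surface_over R) N F G" by (rule model_moduli[OF m])
  note PR = pointed_translation_structure_surface_over[OF R]
  obtain D where D: "closed_disk (surface_over R) D" "G ` J \<subseteq> D" "D \<in> PC (surface_over R)"
    using model_disk[OF m G(1,2) J(1,3)] .
  have KN: "K \<subseteq> N" using J by blast
  have "compactin (top_of_set N) K" using K KN by (simp add: compactin_subtopology)
  then have "compactin (top_of (surface_over R)) (G ` K)"
    using image_compactin homeomorphic_imp_continuous_map[OF G(1)] by blast
  moreover have "Hausdorff_space (top_of (surface_over R))"
    using PR unfolding pointed_translation_structure_def translation_structure_def surface_def by blast
  ultimately have cK: "closedin (top_of (surface_over R)) (G ` K)" using compactin_imp_closedin by blast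
  have KD: "G ` K \<subseteq> D" using D J by blast
  show ?thesis
  proof (rule that[OF openin_M_minus[OF R D(1) cK KD]])
    fix S f assume S: "S \<in> moduli" and f: "tm (surface_over S) N F f" "f 0 = base S" "base S \<notin> f ` K"
    note PS = pointed_translation_structure_surface_over[OF S]
    obtain \<iota> where i: "immerses R D S \<iota>" "\<And>z. z \<in> N \<Longrightarrow> \<iota> (G z) = f z"
      using tm_model_immersion[OF m PR PS G f(1,2) D(3)] by metis
    have "\<iota> ` G ` K = f ` K" unfolding image_image by (rule image_cong) (use i(2) KN in auto)
    then have "base S \<notin> \<iota> ` G ` K" using f(3) by simp
    then show "S \<in> M_minus R D (G ` K)" using S i(1) unfolding M_minus_def by blast
  next
    fix S assume "S \<in> M_minus R D (G ` K)"
    then obtain \<iota> where S: "S \<in> moduli" and i: "immerses R D S \<iota>" "base S \<notin> \<iota> ` G ` K"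
      unfolding M_minus_def by blast
    note PS = pointed_translation_structure_surface_over[OF S]
    note t = immersion_model_tm[OF PR PS G(2,3) i(1) J(3) D(2)]
    have "base S \<notin> (\<lambda>z. \<iota> (G z)) ` K" using i(2) by (simp add: image_image)
    then show "S \<in> moduli \<and> (\<exists>f. tm (surface_over S) J F f \<and> f 0 = base S \<and> base S \<notin> f ` K)"
      using S t by blast
  qed
qed

text \<open>Induction on the length. Once the first part of the chain can be read on all nearby surfaces, the two models for its last ball detect whether
  this ball exists. The initial ball only provides the tube with its beginning.\<close>

lemma live_open_prefixed:
  assumes S: "S \<in> moduli" and d: "0 < \<delta>" "\<delta> < \<rho>0"
  shows "slack \<delta> C \<Longrightarrow> dev (surface_over S) (base S) ((0, \<rho>0) # C) q \<Longrightarrow>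
    \<exists>W. openin moduli_topology W \<and> S \<in> W \<and>
      (\<forall>S1\<in>W. S1 \<in> moduli \<and> (\<exists>q1. dev (surface_over S1) (base S1) (shrink \<delta> ((0, \<rho>0) # C)) q1))"
proof (induction C arbitrary: q rule: rev_induct)
  case Nil
  obtain e where e: "exp_ball (surface_over S) \<rho>0 (base S) e" using Nil(2) by (auto simp: step_def)
  have m: "model (ball 0 \<rho>0) (\<lambda>x. x)" using round_model[of \<rho>0] d by simp
  have J: "compact (cball (0::plane) (\<rho>0 - \<delta>))" "ball 0 (\<rho>0 - \<delta>) \<subseteq> cball (0::plane) (\<rho>0 - \<delta>)"
    "cball 0 (\<rho>0 - \<delta>) \<subseteq> ball (0::plane) \<rho>0" using d by auto
  obtain W where W: "openin moduli_topology W"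
    "\<And>S f. S \<in> moduli \<Longrightarrow> tm (surface_over S) (ball 0 \<rho>0) (\<lambda>x. x) f \<Longrightarrow> f 0 = base S \<Longrightarrow> S \<in> W"
    "\<And>S. S \<in> W \<Longrightarrow> S \<in> moduli \<and> (\<exists>f. tm (surface_over S) (ball 0 (\<rho>0 - \<delta>)) (\<lambda>x. x) f \<and> f 0 = base S)"
    using model_disk_nbhd[OF m J] by blast
  have "S \<in> W" using W(2)[OF S] e unfolding exp_ball_def by blast
  moreover have "\<exists>q1. dev (surface_over S1) (base S1) (shrink \<delta> [(0, \<rho>0)]) q1" if S1: "S1 \<in> W" for S1
  proof -
    obtain f where "exp_ball (surface_over S1) (\<rho>0 - \<delta>) (base S1) f"
      using W(3)[OF S1] d unfolding exp_ball_def by auto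
    then have "step (surface_over S1) (\<rho>0 - \<delta>) 0 (base S1) (f 0)" using d unfolding step_def by auto
    then show ?thesis by auto
  qed
  ultimately show ?case using W by blast
next
  case (snoc x C)
  obtain v \<rho> where x: "x = (v, \<rho>)" by (cases x)
  have sC: "slack \<delta> C" "norm v + \<delta> < \<rho>" using snoc.prems(1) x by auto
  obtain q' where q': "dev (surface_over S) (base S) ((0, \<rho>0) # C) q'" "step (surface_over S) \<rho> v q' q"
    using snoc.prems(2) x by (auto simp: dev_append)
  obtain W where W: "openin moduli_topology W" "S \<in> W"
    "\<And>S1. S1 \<in> W \<Longrightarrow> S1 \<in> moduli \<and> (\<exists>q1. dev (surface_over S1) (base S1) (shrink \<delta> ((0, \<rho>0) # C)) q1)"
    using snoc.IH[OF sC(1) q'(1)] by blast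
  obtain e where e: "exp_ball (surface_over S) \<rho> q' e" using q'(2) unfolding step_def by blast
  let ?C = "(0, \<rho>0 - \<delta>) # shrink \<delta> C"
  have p1: "slack 0 (shrink \<delta> C)" using sC(1) by (simp add: slack_shrink)
  have p2: "0 < \<rho>0 - \<delta>" using d by simp
  have p3: "0 < \<rho> - \<delta>" using sC(2) norm_ge_zero[of v] by linarith
  have p4: "\<rho> - \<delta> < \<rho>" using d by simp
  obtain N1 F1 M1 J1 N2 F2 M2 J2 where
    m1: "model N1 F1" "compact J1" "M1 \<subseteq> J1" "J1 \<subseteq> N1" "0 \<in> M1" and
    m2: "model N2 F2" "compact J2" "M2 \<subseteq> J2" "J2 \<subseteq> N2" "0 \<in> M2" and
    fwd: "\<And>(Q :: epoint pointed_surface) q q' e. pointed_translation_structure Q \<Longrightarrow> dev Q q ?C q' \<Longrightarrow>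
       exp_ball Q \<rho> q' e \<Longrightarrow> (\<exists>f. tm Q N1 F1 f \<and> f 0 = q) \<and> (\<exists>f. tm Q N2 F2 f \<and> f 0 = q)" and
    bwd: "\<And>(Q :: epoint pointed_surface) q q' f1 f2. pointed_translation_structure Q \<Longrightarrow> dev Q q ?C q' \<Longrightarrow>
       tm Q M1 F1 f1 \<Longrightarrow> f1 0 = q \<Longrightarrow> tm Q M2 F2 f2 \<Longrightarrow> f2 0 = q \<Longrightarrow> \<exists>e. exp_ball Q (\<rho> - \<delta>) q' e"
    by (rule two_models[OF p1 p2 p3 p4]) blast
  obtain W1 where W1: "openin moduli_topology W1"
    "\<And>S f. S \<in> moduli \<Longrightarrow> tm (surface_over S) N1 F1 f \<Longrightarrow> f 0 = base S \<Longrightarrow> S \<in> W1"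
    "\<And>S. S \<in> W1 \<Longrightarrow> S \<in> moduli \<and> (\<exists>f. tm (surface_over S) M1 F1 f \<and> f 0 = base S)"
    using model_disk_nbhd[OF m1(1-4)] by blast
  obtain W2 where W2: "openin moduli_topology W2"
    "\<And>S f. S \<in> moduli \<Longrightarrow> tm (surface_over S) N2 F2 f \<Longrightarrow> f 0 = base S \<Longrightarrow> S \<in> W2"
    "\<And>S. S \<in> W2 \<Longrightarrow> S \<in> moduli \<and> (\<exists>f. tm (surface_over S) M2 F2 f \<and> f 0 = base S)"
    using model_disk_nbhd[OF m2(1-4)] by blast
  note PS = pointed_translation_structure_surface_over
  have "slack \<delta> ((0, \<rho>0) # C)" using sC(1) d by simp
  from dev_shrink[OF q'(1) this] have dS: "dev (surface_over S) (base S) ?C q'" using d by simp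
  have SW: "S \<in> W1" "S \<in> W2" using fwd[OF PS[OF S] dS e] W1(2)[OF S] W2(2)[OF S] by blast+
  have "\<exists>q1. dev (surface_over S1) (base S1) (shrink \<delta> ((0, \<rho>0) # C @ [x])) q1"
    if S1: "S1 \<in> W \<inter> (W1 \<inter> W2)" for S1
  proof -
    have S1m: "S1 \<in> moduli" using W(3) S1 by blast
    obtain q1 where q1: "dev (surface_over S1) (base S1) ?C q1" using W(3)[of S1] S1 by auto
    obtain f1 f2 where "tm (surface_over S1) M1 F1 f1" "f1 0 = base S1"
      "tm (surface_over S1) M2 F2 f2" "f2 0 = base S1" using W1(3)[of S1] W2(3)[of S1] S1 by blast
    from bwd[OF PS[OF S1m] q1 this] obtain e where "exp_ball (surface_over S1) (\<rho> - \<delta>) q1 e" by blast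
    then have "step (surface_over S1) (\<rho> - \<delta>) v q1 (e v)" using sC(2) unfolding step_def by auto
    then have "dev (surface_over S1) (base S1) (?C @ [(v, \<rho> - \<delta>)]) (e v)" unfolding dev_append using q1 by auto
    then show ?thesis unfolding x by auto
  qed
  moreover have "openin moduli_topology (W \<inter> (W1 \<inter> W2))" using W(1) W1(1) W2(1) by blast
  ultimately show ?case using W(2,3) SW by (intro exI[of _ "W \<inter> (W1 \<inter> W2)"]) auto
qed

lemma prefix_ball:
  assumes Q: "pointed_translation_structure Q" and p: "p \<in> points Q"
  obtains \<rho> where "0 < \<rho>" "\<And>\<sigma> q C. 0 < \<sigma> \<Longrightarrow> \<sigma> \<le> \<rho> \<Longrightarrow> dev Q p C q \<Longrightarrow> dev Q p ((0, \<sigma>) # C) q"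
proof -
  obtain \<rho> e where e: "exp_ball Q \<rho> p e" using exp_ball_exists[OF Q p openin_topspace] by metis
  show ?thesis
  proof (rule that[of \<rho>])
    show "0 < \<rho>" using e unfolding exp_ball_def by blast
    fix \<sigma> q C assume s: "0 < \<sigma>" "\<sigma> \<le> \<rho>" and d: "dev Q p C q"
    have "exp_ball Q \<sigma> p e" by (rule exp_ball_mono[OF e s])
    then have "step Q \<sigma> 0 p p" using s unfolding step_def exp_ball_def by auto
    then show "dev Q p ((0, \<sigma>) # C) q" using d by auto
  qed
qed

text \<open>Every surface has some exponential ball at its basepoint, which can be put in front of the chain.\<close>

lemma live_open:
  assumes S: "S \<in> moduli" and d: "0 < \<delta>" and C: "slack \<delta> C" "dev (surface_over S) (base S) C q"
  obtains W where "openin moduli_topology W" "S \<in> W"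
    "\<And>S1. S1 \<in> W \<Longrightarrow> S1 \<in> moduli \<and> (\<exists>q1. dev (surface_over S1) (base S1) (shrink \<delta> C) q1)"
proof -
  note PS = pointed_translation_structure_surface_over
  obtain \<rho> where r: "0 < \<rho>" "\<And>\<sigma> q C. 0 < \<sigma> \<Longrightarrow> \<sigma> \<le> \<rho> \<Longrightarrow> dev (surface_over S) (base S) C q \<Longrightarrow>
      dev (surface_over S) (base S) ((0, \<sigma>) # C) q"
    using prefix_ball[OF PS[OF S] pts_basept[OF PS[OF S]]] by blast
  define \<epsilon> where "\<epsilon> = min \<delta> (\<rho>/2)"
  have e: "0 < \<epsilon>" "\<epsilon> < \<rho>" "\<epsilon> \<le> \<delta>" using d r(1) unfolding \<epsilon>_def by auto
  have sC: "slack \<epsilon> C" using slack_mono[OF C(1) e(3)] .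
  obtain W where W: "openin moduli_topology W" "S \<in> W"
    "\<And>S1. S1 \<in> W \<Longrightarrow> S1 \<in> moduli \<and> (\<exists>q1. dev (surface_over S1) (base S1) (shrink \<epsilon> ((0, \<rho>) # C)) q1)"
    using live_open_prefixed[OF S e(1,2) sC r(2)[OF r(1) order_refl C(2)]] by blast
  show ?thesis
  proof (rule that[OF W(1,2)])
    fix S1 assume S1: "S1 \<in> W"
    obtain q1 m where q1: "step (surface_over S1) (\<rho> - \<epsilon>) 0 (base S1) m" "dev (surface_over S1) m (shrink \<epsilon> C) q1"
      using W(3)[OF S1] by auto
    have "m = base S1" using q1(1) unfolding step_def exp_ball_def by auto
    then have "dev (surface_over S1) (base S1) (shrink \<epsilon> C) q1" using q1(2) by simp
    from dev_shrink[OF this, of "\<delta> - \<epsilon>"]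
    have "dev (surface_over S1) (base S1) (shrink \<delta> C) q1"
      using C(1) e by (simp add: slack_shrink shrink_shrink)
    then show "S1 \<in> moduli \<and> (\<exists>q1. dev (surface_over S1) (base S1) (shrink \<delta> C) q1)" using W(3)[OF S1] by blast
  qed
qed

text \<open>The segment carries \<open>f\<close> to the end of the chain by uniqueness of lifts, and near the end of the tube \<open>F\<close> is the identity.\<close>

lemma tube_core:
  assumes t: "is_tube C F n \<mu>" and Q: "pointed_translation_structure (Q :: epoint pointed_surface)"
    and d: "dev Q q C q'" and s: "0 < \<sigma>" "\<sigma> < \<mu>"
    and f: "tm Q (closed_segment 0 (pt n) \<union> cball (pt n) \<sigma>) F f" "f 0 = q"
  shows "exp_ball Q \<sigma> q' (\<lambda>w. f (w + pt n))"
proof -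
  have n: "0 \<le> n" "0 < \<mu>" and gF: "\<And>x. x \<in> strip n \<mu> \<Longrightarrow> n - \<mu> < x$1 \<Longrightarrow> F x = x"
    using t unfolding is_tube_def by auto
  obtain f0 where f0: "tm Q (strip n \<mu>) F f0" "f0 0 = q" "f0 (pt n) = q'"
    using t Q d unfolding is_tube_def by blast
  have S: "closed_segment 0 (pt n) \<subseteq> strip n \<mu>" using closed_segment_pt n by force
  have B: "x \<in> strip n \<mu> \<and> n - \<mu> < x$1" if "x \<in> cball (pt n) \<sigma>" for x
    using component_le_norm_cart[of "pt n - x" 1] component_le_norm_cart[of "pt n - x" 2] that n s
    by (auto simp: dist_norm)
  have "f (pt n) = f0 (pt n)"
    by (rule tm_unique[OF Q tm_subset[OF f(1)] tm_subset[OF f0(1) S], of 0]) (use f f0 in auto)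
  then have fe: "f (0 + pt n) = q'" using f0 by simp
  have "tm Q (cball (pt n) \<sigma>) (\<lambda>x. x) f"
    by (rule tm_cong[OF tm_subset[OF f(1)], where c = 0]) (use gF B in auto)
  then have "tm Q (ball 0 \<sigma>) (\<lambda>v. v) (\<lambda>w. f (w + pt n))"
    by (rule tm_translate[where b = 0]) (auto simp: dist_norm)
  then show ?thesis using fe s unfolding exp_ball_def by simp
qed

lemma tube_core_compact:
  assumes "is_tube C F n \<mu>" "0 < \<sigma>" "\<sigma> < \<mu>"
  shows "compact (closed_segment 0 (pt n) \<union> cball (pt n) \<sigma>)"
    "closed_segment 0 (pt n) \<union> cball (pt n) \<sigma> \<subseteq> strip n \<mu>"
proof -
  have n: "0 \<le> n" "0 < \<mu>" using assms(1) unfolding is_tube_def by auto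
  show "compact (closed_segment 0 (pt n) \<union> cball (pt n) \<sigma>)" by (intro compact_Un) auto
  have "x \<in> strip n \<mu>" if "x \<in> cball (pt n) \<sigma>" for x
    using component_le_norm_cart[of "pt n - x" 1] component_le_norm_cart[of "pt n - x" 2] that n assms(2,3)
    by (auto simp: dist_norm)
  moreover have "closed_segment 0 (pt n) \<subseteq> strip n \<mu>" using closed_segment_pt n by force
  ultimately show "closed_segment 0 (pt n) \<union> cball (pt n) \<sigma> \<subseteq> strip n \<mu>" by blast
qed

text \<open>A tube that follows the chain has its last part near the endpoint. That \<open>s\<^sub>1\<close> lies in this part is one of the defining open conditions of
  the universal family.\<close>

lemma end_open:
  assumes s: "s \<in> universal" and d: "0 < \<delta>" and C: "slack \<delta> C" "dev (surface_over (proj s)) (base (proj s)) C s"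
    and \<epsilon>: "0 < \<epsilon>"
  obtains X \<sigma> where "openin universal_topology X" "s \<in> X" "0 < \<sigma>" "\<sigma> \<le> \<epsilon>"
    "\<And>s1. s1 \<in> X \<Longrightarrow> s1 \<in> universal \<and> (\<exists>q1 w. dev (surface_over (proj s1)) (base (proj s1)) (shrink \<delta> C) q1 \<and>
       2 * norm w < \<sigma> \<and> step (surface_over (proj s1)) \<sigma> w q1 s1)"
proof -
  note PS = pointed_translation_structure_surface_over
  note S = proj_moduli[OF s]
  obtain \<rho> where r: "0 < \<rho>" "\<And>\<sigma> q C. 0 < \<sigma> \<Longrightarrow> \<sigma> \<le> \<rho> \<Longrightarrow> dev (surface_over (proj s)) (base (proj s)) C q \<Longrightarrow>
      dev (surface_over (proj s)) (base (proj s)) ((0, \<sigma>) # C) q"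
    using prefix_ball[OF PS[OF S] pts_basept[OF PS[OF S]]] by blast
  define \<gamma> where "\<gamma> = min \<delta> (\<rho>/2)"
  have g: "0 < \<gamma>" "\<gamma> < \<rho>" "\<gamma> \<le> \<delta>" using d r(1) unfolding \<gamma>_def by auto
  have sC: "slack \<gamma> ((0, \<rho>) # C)" using slack_mono[OF C(1) g(3)] g by simp
  let ?C = "shrink \<gamma> ((0, \<rho>) # C)"
  have dC: "dev (surface_over (proj s)) (base (proj s)) ((0, \<rho>) # C) s" using r(2)[OF r(1) order_refl C(2)] .
  obtain W where W: "openin moduli_topology W" "proj s \<in> W"
    "\<And>S1. S1 \<in> W \<Longrightarrow> S1 \<in> moduli \<and> (\<exists>q1. dev (surface_over S1) (base S1) ?C q1)"
    using live_open[OF S g(1) sC dC] by blast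
  obtain F n \<mu> where t: "is_tube ?C F n \<mu>"
    using tube_exists[of "\<rho> - \<gamma>" "shrink \<gamma> C"] g sC by (auto simp: slack_shrink)
  have mu: "0 < \<mu>" using t unfolding is_tube_def by blast
  define \<sigma> where "\<sigma> = min \<epsilon> (\<mu>/2)"
  have sg: "0 < \<sigma>" "\<sigma> < \<mu>" "\<sigma> \<le> \<epsilon>" using mu \<epsilon> unfolding \<sigma>_def by auto
  let ?J = "closed_segment 0 (pt n) \<union> cball (pt n) \<sigma>"
  let ?V = "ball (pt n) (\<sigma>/2)"
  have V: "?V \<subseteq> ?J" using sg by auto
  obtain X where X: "openin universal_topology X"
    "\<And>s f. s \<in> universal \<Longrightarrow> tm (surface_over (proj s)) (strip n \<mu>) F f \<Longrightarrow> f 0 = base (proj s) \<Longrightarrow> s \<in> f ` ?V \<Longrightarrow> s \<in> X"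
    "\<And>s. s \<in> X \<Longrightarrow> s \<in> universal \<and> (\<exists>f. tm (surface_over (proj s)) ?J F f \<and> f 0 = base (proj s) \<and> s \<in> f ` ?V)"
    using model_point_nbhd[OF tube_model[OF t] tube_core_compact(1)[OF t sg(1,2)] V
      tube_core_compact(2)[OF t sg(1,2)] open_ball] by blast
  have "dev (surface_over (proj s)) (base (proj s)) ?C s" by (rule dev_shrink[OF dC sC]) (use g in simp)
  then obtain f where f: "tm (surface_over (proj s)) (strip n \<mu>) F f" "f 0 = base (proj s)" "f (pt n) = s"
    using t PS[OF S] unfolding is_tube_def by blast
  have "s \<in> f ` ?V" using f(3) sg(1) by (intro image_eqI[of _ _ "pt n"]) auto
  then have sX: "s \<in> X" using X(2)[OF s f(1,2)] by blast
  show ?thesis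
  proof (rule that[of "X \<inter> {e \<in> universal. proj e \<in> W}" \<sigma>])
    show "openin universal_topology (X \<inter> {e \<in> universal. proj e \<in> W})"
      using X(1) openin_proj[OF W(1)] by blast
    show "s \<in> X \<inter> {e \<in> universal. proj e \<in> W}" using sX s W(2) by blast
    fix s1 assume s1: "s1 \<in> X \<inter> {e \<in> universal. proj e \<in> W}"
    then have u: "s1 \<in> universal" by blast
    let ?Q = "surface_over (proj s1)"
    have Q: "pointed_translation_structure ?Q" using PS[OF proj_moduli[OF u]] .
    obtain q1 where q1: "dev ?Q (base (proj s1)) ?C q1" using W(3)[of "proj s1"] s1 by blast
    obtain f where f: "tm ?Q ?J F f" "f 0 = base (proj s1)" "s1 \<in> f ` ?V" using X(3)[of s1] s1 by blast
    obtain x where x: "x \<in> ?V" "s1 = f x" using f(3) by blast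
    have e: "exp_ball ?Q \<sigma> q1 (\<lambda>w. f (w + pt n))" by (rule tube_core[OF t Q q1 sg(1,2) f(1,2)])
    have n: "2 * norm (x - pt n) < \<sigma>" using x(1) by (simp add: dist_norm norm_minus_commute)
    then have "norm (x - pt n) < \<sigma>" using norm_ge_zero[of "x - pt n"] by linarith
    moreover have "(\<lambda>w. f (w + pt n)) (x - pt n) = s1" using x(2) by simp
    ultimately have st: "step ?Q \<sigma> (x - pt n) q1 s1" using e unfolding step_def by blast
    obtain m where m: "step ?Q (\<rho> - \<gamma>) 0 (base (proj s1)) m" "dev ?Q m (shrink \<gamma> C) q1" using q1 by auto
    have "m = base (proj s1)" using m(1) unfolding step_def exp_ball_def by auto
    then have "dev ?Q (base (proj s1)) (shrink \<gamma> C) q1" using m(2) by simp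
    from dev_shrink[OF this, of "\<delta> - \<gamma>"] have "dev ?Q (base (proj s1)) (shrink \<delta> C) q1"
      using C(1) g by (simp add: slack_shrink shrink_shrink)
    then show "s1 \<in> universal \<and> (\<exists>q1 w. dev ?Q (base (proj s1)) (shrink \<delta> C) q1 \<and>
       2 * norm w < \<sigma> \<and> step ?Q \<sigma> w q1 s1)" using u n st by blast
  qed (use sg in auto)
qed

text \<open>A small closed ball around the end of the tube avoids the basepoint, which is an open condition of the kind \<^const>\<open>M_minus\<close>.\<close>

lemma not_closed_open:
  assumes S: "S \<in> moduli" and d: "0 < \<delta>" and C: "slack \<delta> C" "dev (surface_over S) (base S) C q"
    and q: "q \<noteq> base S" and \<epsilon>: "0 < \<epsilon>"
  obtains W \<sigma> where "openin moduli_topology W" "S \<in> W" "0 < \<sigma>" "\<sigma> \<le> \<epsilon>"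
    "\<And>S1 q1 w. S1 \<in> W \<Longrightarrow> dev (surface_over S1) (base S1) (shrink \<delta> C) q1 \<Longrightarrow>
       step (surface_over S1) \<sigma> w q1 (base S1) \<Longrightarrow> False"
proof -
  note PS = pointed_translation_structure_surface_over
  obtain \<rho> where r: "0 < \<rho>" "\<And>\<sigma> q C. 0 < \<sigma> \<Longrightarrow> \<sigma> \<le> \<rho> \<Longrightarrow> dev (surface_over S) (base S) C q \<Longrightarrow>
      dev (surface_over S) (base S) ((0, \<sigma>) # C) q"
    using prefix_ball[OF PS[OF S] pts_basept[OF PS[OF S]]] by blast
  have s0: "slack 0 (shrink \<delta> C)" using C(1) by (simp add: slack_shrink)
  define \<gamma> where "\<gamma> = \<rho>/2"
  have gp: "0 < \<gamma>" "\<gamma> < \<rho>" using r(1) unfolding \<gamma>_def by auto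
  obtain F n \<mu> where t: "is_tube ((0, \<gamma>) # shrink \<delta> C) F n \<mu>" using tube_exists[OF gp(1) s0] by blast
  have mu: "0 < \<mu>" using t unfolding is_tube_def by blast
  have "dev (surface_over S) (base S) (shrink \<delta> C) q" by (rule dev_shrink[OF C(2,1)]) (use d in simp)
  then have dS: "dev (surface_over S) (base S) ((0, \<gamma>) # shrink \<delta> C) q" using r(2) gp by auto
  obtain f where f: "tm (surface_over S) (strip n \<mu>) F f" "f 0 = base S" "f (pt n) = q"
    using t PS[OF S] dS unfolding is_tube_def by blast
  have nmu: "0 \<le> n" using t unfolding is_tube_def by blast
  have "Hausdorff_space (top_of (surface_over S))"
    using PS[OF S] unfolding pointed_translation_structure_def translation_structure_def surface_def by blast
  then have "closedin (top_of (surface_over S)) {base S}"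
    using pts_basept[OF PS[OF S]] closedin_Hausdorff_singleton by metis
  then have op: "openin (top_of (surface_over S)) (points (surface_over S) - {base S})" by blast
  obtain G where G: "open G" "{z \<in> strip n \<mu>. f z \<in> points (surface_over S) - {base S}} = G \<inter> strip n \<mu>"
    using tm_preimage[OF f(1) op] .
  have "pt n \<in> strip n \<mu>" using mu nmu by simp
  then have "pt n \<in> G \<inter> strip n \<mu>" using G(2) f(3) q tm_point[OF f(1), of "pt n"] by blast
  then obtain d1 where d1: "0 < d1" "cball (pt n) d1 \<subseteq> G \<inter> strip n \<mu>"
    using G(1) open_contains_cball[of "G \<inter> strip n \<mu>"] by (meson open_Int open_rect)
  define \<sigma> where "\<sigma> = min \<epsilon> (min d1 (\<mu>/2))"
  have sg: "0 < \<sigma>" "\<sigma> < \<mu>" "\<sigma> \<le> \<epsilon>" "\<sigma> \<le> d1" using mu \<epsilon> d1 unfolding \<sigma>_def by auto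
  let ?J = "closed_segment 0 (pt n) \<union> cball (pt n) \<sigma>"
  let ?K = "cball (pt n) \<sigma>"
  obtain W where W: "openin moduli_topology W"
    "\<And>S f. S \<in> moduli \<Longrightarrow> tm (surface_over S) (strip n \<mu>) F f \<Longrightarrow> f 0 = base S \<Longrightarrow> base S \<notin> f ` ?K \<Longrightarrow> S \<in> W"
    "\<And>S. S \<in> W \<Longrightarrow> S \<in> moduli \<and> (\<exists>f. tm (surface_over S) ?J F f \<and> f 0 = base S \<and> base S \<notin> f ` ?K)"
    using model_avoid_nbhd[OF tube_model[OF t] tube_core_compact(1)[OF t sg(1,2)] Un_upper2
      tube_core_compact(2)[OF t sg(1,2)] compact_cball] by blast
  have "cball (pt n) \<sigma> \<subseteq> cball (pt n) d1" using sg by auto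
  then have "f ` ?K \<subseteq> points (surface_over S) - {base S}" using d1(2) G(2) by blast
  then have SW: "S \<in> W" using W(2)[OF S f(1,2)] by blast
  obtain W' where W': "openin moduli_topology W'" "S \<in> W'"
    "\<And>S1. S1 \<in> W' \<Longrightarrow> S1 \<in> moduli \<and> (\<exists>q1. dev (surface_over S1) (base S1) (shrink (\<rho> - \<gamma>) [(0, \<rho>)]) q1)"
    using live_open[OF S, of "\<rho> - \<gamma>" "[(0, \<rho>)]" "base S"] r(2)[OF r(1) order_refl, of "[]"] gp by auto
  show ?thesis
  proof (rule that[of "W \<inter> W'" \<sigma>])
    show "openin moduli_topology (W \<inter> W')" using W(1) W'(1) by blast
    show "S \<in> W \<inter> W'" using SW W'(2) by blast
    fix S1 q1 w assume S1: "S1 \<in> W \<inter> W'" and dv: "dev (surface_over S1) (base S1) (shrink \<delta> C) q1"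
      and st: "step (surface_over S1) \<sigma> w q1 (base S1)"
    have Q: "pointed_translation_structure (surface_over S1)" using PS W(3) S1 by blast
    obtain f where f: "tm (surface_over S1) ?J F f" "f 0 = base S1" "base S1 \<notin> f ` ?K" using W(3) S1 by blast
    obtain m where m: "step (surface_over S1) \<gamma> 0 (base S1) m" using W'(3)[of S1] S1 by auto
    then have "m = base S1" unfolding step_def exp_ball_def by auto
    then have dv': "dev (surface_over S1) (base S1) ((0, \<gamma>) # shrink \<delta> C) q1" using m dv by auto
    have e: "exp_ball (surface_over S1) \<sigma> q1 (\<lambda>w. f (w + pt n))"
      by (rule tube_core[OF t Q dv' sg(1,2) f(1,2)])
    have nw: "norm w < \<sigma>" using st unfolding step_def by blast
    have "base S1 = f (w + pt n)" using step_value[OF Q e st nw] .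
    moreover have "w + pt n \<in> ?K" using nw by (simp add: dist_norm)
    ultimately show False using f(3) by blast
  qed (use sg in auto)
qed

text \<open>If a chain cannot be read then some ball along it is missing.\<close>

lemma first_failure:
  assumes "\<not> (\<exists>q. dev Q p (shrink \<delta> C) q)"
  shows "\<exists>P v \<rho> C' q. C = P @ (v, \<rho>) # C' \<and> dev Q p (shrink \<delta> P) q \<and> \<not> (\<exists>q'. step Q (\<rho> - \<delta>) v q q')"
  using assms
proof (induction C arbitrary: p)
  case (Cons a C)
  obtain v \<rho> where a: "a = (v, \<rho>)" by (cases a)
  show ?case
  proof (cases "\<exists>p'. step Q (\<rho> - \<delta>) v p p'")
    case True
    then obtain p' where p': "step Q (\<rho> - \<delta>) v p p'" by blast
    then have "\<not> (\<exists>q. dev Q p' (shrink \<delta> C) q)" using Cons.prems a by auto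
    from Cons.IH[OF this] obtain P u \<sigma> C' q where
      h: "C = P @ (u, \<sigma>) # C'" "dev Q p' (shrink \<delta> P) q" "\<not> (\<exists>q'. step Q (\<sigma> - \<delta>) u q q')" by blast
    have "dev Q p (shrink \<delta> (a # P)) q" using a p' h(2) by auto
    then show ?thesis using h by (intro exI[of _ "a # P"]) auto
  next
    case False
    then show ?thesis using a by (intro exI[of _ "[]"] exI[of _ v] exI[of _ \<rho>] exI[of _ C] exI[of _ p]) auto
  qed
qed auto

text \<open>At the first ball that is missing on \<open>S\<close>, one of its two models does not map to \<open>S\<close>: otherwise both would,
  and together they would provide the ball, up to \<open>\<delta>\<close>. Not receiving this model is an open condition, and a surface on which all of \<open>C\<close> can be read receives it.\<close>

lemma not_live_open:
  assumes S: "S \<in> moduli" and d: "0 < \<delta>" and C: "slack \<delta> C"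
    and nl: "\<not> (\<exists>q. dev (surface_over S) (base S) (shrink \<delta> C) q)"
  obtains W where "openin moduli_topology W" "S \<in> W"
    "\<And>S1 q1. S1 \<in> W \<Longrightarrow> dev (surface_over S1) (base S1) C q1 \<Longrightarrow> False"
proof -
  note PS = pointed_translation_structure_surface_over
  obtain P v \<rho> C' q where P: "C = P @ (v, \<rho>) # C'" "dev (surface_over S) (base S) (shrink \<delta> P) q"
    "\<not> (\<exists>q'. step (surface_over S) (\<rho> - \<delta>) v q q')"
    using first_failure[OF nl] by blast
  have sl: "slack \<delta> P" "norm v + \<delta> < \<rho>" using C P(1) by auto
  then have nb: "\<not> (\<exists>e. exp_ball (surface_over S) (\<rho> - \<delta>) q e)" using P(3) unfolding step_def by auto
  obtain \<rho>0 where r: "0 < \<rho>0" "\<And>\<sigma> q C. 0 < \<sigma> \<Longrightarrow> \<sigma> \<le> \<rho>0 \<Longrightarrow> dev (surface_over S) (base S) C q \<Longrightarrow>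
      dev (surface_over S) (base S) ((0, \<sigma>) # C) q"
    using prefix_ball[OF PS[OF S] pts_basept[OF PS[OF S]]] by blast
  have "C \<noteq> []" using P(1) by simp
  then obtain v1 \<rho>1 C1 where C1: "C = (v1, \<rho>1) # C1" by (metis list.exhaust surj_pair)
  have "norm v1 + \<delta> < \<rho>1" using C unfolding C1 by simp
  then have r1: "0 < \<rho>1" using d norm_ge_zero[of v1] by linarith
  define \<sigma> where "\<sigma> = min \<rho>0 \<rho>1"
  have sg: "0 < \<sigma>" "\<sigma> \<le> \<rho>0" "\<sigma> \<le> \<rho>1" using r(1) r1 unfolding \<sigma>_def by auto
  let ?C = "(0, \<sigma>) # shrink \<delta> P"
  have p1: "slack 0 (shrink \<delta> P)" using sl(1) by (simp add: slack_shrink)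
  have p3: "0 < \<rho> - \<delta>" using sl(2) norm_ge_zero[of v] by linarith
  have p4: "\<rho> - \<delta> < \<rho>" using d by simp
  obtain N1 F1 M1 J1 N2 F2 M2 J2 where
    m1: "model N1 F1" "compact J1" "M1 \<subseteq> J1" "J1 \<subseteq> N1" "0 \<in> M1" and
    m2: "model N2 F2" "compact J2" "M2 \<subseteq> J2" "J2 \<subseteq> N2" "0 \<in> M2" and
    fwd: "\<And>(Q :: epoint pointed_surface) q q' e. pointed_translation_structure Q \<Longrightarrow> dev Q q ?C q' \<Longrightarrow>
       exp_ball Q \<rho> q' e \<Longrightarrow> (\<exists>f. tm Q N1 F1 f \<and> f 0 = q) \<and> (\<exists>f. tm Q N2 F2 f \<and> f 0 = q)" and
    bwd: "\<And>(Q :: epoint pointed_surface) q q' f1 f2. pointed_translation_structure Q \<Longrightarrow> dev Q q ?C q' \<Longrightarrow>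
       tm Q M1 F1 f1 \<Longrightarrow> f1 0 = q \<Longrightarrow> tm Q M2 F2 f2 \<Longrightarrow> f2 0 = q \<Longrightarrow> \<exists>e. exp_ball Q (\<rho> - \<delta>) q' e"
    by (rule two_models[OF p1 sg(1) p3 p4]) blast
  have dS: "dev (surface_over S) (base S) ?C q" using r(2)[OF sg(1,2) P(2)] .
  have live: "(\<exists>f. tm (surface_over S1) N1 F1 f \<and> f 0 = base S1) \<and> (\<exists>f. tm (surface_over S1) N2 F2 f \<and> f 0 = base S1)"
    if S1: "S1 \<in> moduli" and dv: "dev (surface_over S1) (base S1) C q1" for S1 q1
  proof -
    obtain q' where q': "dev (surface_over S1) (base S1) P q'" "\<exists>q''. step (surface_over S1) \<rho> v q' q''"
      using dv unfolding P(1) by (auto simp: dev_append)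
    have dP: "dev (surface_over S1) (base S1) (shrink \<delta> P) q'" using dev_shrink[OF q'(1) sl(1)] d by simp
    obtain m where "step (surface_over S1) \<rho>1 v1 (base S1) m" using dv unfolding C1 by auto
    then obtain e where "exp_ball (surface_over S1) \<rho>1 (base S1) e" unfolding step_def by blast
    from exp_ball_mono[OF this sg(1,3)] have "step (surface_over S1) \<sigma> 0 (base S1) (base S1)"
      using sg(1) unfolding step_def exp_ball_def by auto
    then have d1: "dev (surface_over S1) (base S1) ?C q'" using dP by auto
    obtain e where "exp_ball (surface_over S1) \<rho> q' e" using q'(2) unfolding step_def by blast
    from fwd[OF PS[OF S1] d1 this] show ?thesis .
  qed
  have "\<not> (\<exists>f. tm (surface_over S) N1 F1 f \<and> f 0 = base S) \<or> \<not> (\<exists>f. tm (surface_over S) N2 F2 f \<and> f 0 = base S)"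
  proof (rule ccontr)
    assume "\<not> ?thesis"
    then obtain f1 f2 where "tm (surface_over S) N1 F1 f1" "f1 0 = base S"
      "tm (surface_over S) N2 F2 f2" "f2 0 = base S" by blast
    moreover have "M1 \<subseteq> N1" "M2 \<subseteq> N2" using m1 m2 by auto
    ultimately have "\<exists>e. exp_ball (surface_over S) (\<rho> - \<delta>) q e"
      using bwd[OF PS[OF S] dS] tm_subset by metis
    then show False using nb by blast
  qed
  then obtain N F where N: "model N F" "\<not> (\<exists>f. tm (surface_over S) N F f \<and> f 0 = base S)"
    "\<And>S1 q1. S1 \<in> moduli \<Longrightarrow> dev (surface_over S1) (base S1) C q1 \<Longrightarrow> \<exists>f. tm (surface_over S1) N F f \<and> f 0 = base S1"
    using m1(1) m2(1) live by metis
  obtain W where W: "openin moduli_topology W"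
    "\<And>S. S \<in> moduli \<Longrightarrow> \<not> (\<exists>f. tm (surface_over S) N F f \<and> f 0 = base S) \<Longrightarrow> S \<in> W"
    "\<And>S f. S \<in> W \<Longrightarrow> tm (surface_over S) N F f \<Longrightarrow> f 0 = base S \<Longrightarrow> False"
    using model_not_nbhd[OF N(1)] by blast
  show ?thesis
  proof (rule that[OF W(1) W(2)[OF S N(2)]])
    fix S1 q1 assume S1: "S1 \<in> W" and dv: "dev (surface_over S1) (base S1) C q1"
    have "S1 \<in> moduli" using openin_subset[OF W(1)] S1 topspace_moduli by blast
    then show False using N(3)[OF _ dv] W(3)[OF S1] by blast
  qed
qed

section \<open>Moving the basepoint\<close>

lemma tm_basept [simp]: "tm (Q\<lparr>basept := s\<rparr>) J F f \<longleftrightarrow> tm Q J F f"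
  by (simp add: tm_def)

lemma exp_ball_basept [simp]: "exp_ball (Q\<lparr>basept := s\<rparr>) \<rho> p e \<longleftrightarrow> exp_ball Q \<rho> p e"
  by (simp add: exp_ball_def)

lemma step_basept [simp]: "step (Q\<lparr>basept := s\<rparr>) \<rho> v p q \<longleftrightarrow> step Q \<rho> v p q"
  by (simp add: step_def)

lemma dev_basept [simp]: "dev (Q\<lparr>basept := s\<rparr>) p C q \<longleftrightarrow> dev Q p C q"
  by (induction C arbitrary: p) auto

lemma pts_basept_update:
  "pointed_translation_structure Q \<Longrightarrow> s \<in> points Q \<Longrightarrow> pointed_translation_structure (Q\<lparr>basept := s\<rparr>)"
  by (rule pointed_translation_structure_relocate)

lemma immersion_isomorphism:
  assumes P: "pointed_translation_structure P" and i: "is_immersion S A P (points P) \<iota>"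
    and h: "pointed_isomorphism P Q h"
  shows "is_immersion S A Q (points Q) (\<lambda>x. h (\<iota> x))"
proof -
  have hm: "homeomorphic_map (top_of P) (top_of Q) h" and at: "atlas Q = push_chart (points P) h ` atlas P"
    and b: "h (basept P) = basept Q"
    using h unfolding pointed_isomorphism_def translation_isomorphism_def by auto
  have inj: "inj_on h (points P)" using homeomorphic_imp_injective_map[OF hm] .
  have "continuous_map (subtopology (top_of S) A) (top_of P) \<iota>"
    using i unfolding is_immersion_def by (simp add: continuous_map_in_subtopology)
  from continuous_map_compose[OF this homeomorphic_imp_continuous_map[OF hm]]
  have c: "continuous_map (subtopology (top_of S) A) (top_of Q) (\<lambda>x. h (\<iota> x))" by (simp add: o_def)
  have "\<exists>(U, \<phi>) \<in> atlas S. \<exists>(V, \<psi>) \<in> atlas Q. \<exists>v.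
        s \<in> U \<and> (\<lambda>x. h (\<iota> x)) ` (U \<inter> A) \<subseteq> V \<and> (\<forall>s' \<in> U \<inter> A. \<psi> (h (\<iota> s')) = v + \<phi> s')" if s: "s \<in> A" for s
  proof -
    have "\<exists>(U, \<phi>) \<in> atlas S. \<exists>(V, \<psi>) \<in> atlas P. \<exists>v.
        s \<in> U \<and> \<iota> ` (U \<inter> A) \<subseteq> V \<and> (\<forall>s' \<in> U \<inter> A. \<psi> (\<iota> s') = v + \<phi> s')"
      using i s unfolding is_immersion_def by blast
    then obtain U \<phi> V \<psi> v where c: "(U, \<phi>) \<in> atlas S" "(V, \<psi>) \<in> atlas P" "s \<in> U"
      "\<iota> ` (U \<inter> A) \<subseteq> V" "\<forall>s' \<in> U \<inter> A. \<psi> (\<iota> s') = v + \<phi> s'"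
      by blast
    have sub: "V \<subseteq> points P" using openin_subset[OF pts_atlas_open[OF P c(2)]] .
    let ?\<psi> = "restrict (\<psi> \<circ> inv_into (points P) h) (h ` V)"
    have mem: "(h ` V, ?\<psi>) \<in> atlas Q" unfolding at using c(2) by (force simp: push_chart_def)
    have val: "?\<psi> (h (\<iota> s')) = v + \<phi> s'" if "s' \<in> U \<inter> A" for s'
    proof -
      have "\<iota> s' \<in> V" using c(4) that by blast
      from push_chart_value[OF inj sub this] have "?\<psi> (h (\<iota> s')) = \<psi> (\<iota> s')" .
      also have "\<psi> (\<iota> s') = v + \<phi> s'" using c(5) that by blast
      finally show ?thesis .
    qed
    show ?thesis
      by (rule bexI[OF _ c(1)], unfold split, rule bexI[OF _ mem], unfold split, rule exI[of _ v])
        (use c(3,4) val in blast)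
  qed
  then show ?thesis using i b c unfolding is_immersion_def
    by (auto simp: continuous_map_in_subtopology dest: continuous_map_image_subset_topspace)
qed

lemma pointed_isomorphism_cong:
  assumes P: "pointed_translation_structure P" and h: "pointed_isomorphism P Q h"
    and e: "\<And>x. x \<in> points P \<Longrightarrow> h' x = h x"
  shows "pointed_isomorphism P Q h'"
proof -
  have hm: "homeomorphic_map (top_of P) (top_of Q) h" and at: "atlas Q = push_chart (points P) h ` atlas P"
    and b: "h (basept P) = basept Q"
    using h unfolding pointed_isomorphism_def translation_isomorphism_def by auto
  have inj: "inj_on h (points P)" using homeomorphic_imp_injective_map[OF hm] .
  have hm': "homeomorphic_map (top_of P) (top_of Q) h'"
    by (rule homeomorphic_map_eq[OF hm]) (use e in simp)
  have inj': "inj_on h' (points P)" using homeomorphic_imp_injective_map[OF hm'] .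
  have "push_chart (points P) h c = push_chart (points P) h' c" if c: "c \<in> atlas P" for c
  proof -
    obtain U \<phi> where cc: "c = (U, \<phi>)" by (cases c)
    have U: "U \<subseteq> points P" using openin_subset[OF pts_atlas_open[OF P]] c cc by blast
    have im: "h ` U = h' ` U" by (rule image_cong) (use U e in auto)
    have "restrict (\<phi> \<circ> inv_into (points P) h) (h ` U) = restrict (\<phi> \<circ> inv_into (points P) h') (h ` U)"
    proof
      fix y show "restrict (\<phi> \<circ> inv_into (points P) h) (h ` U) y = restrict (\<phi> \<circ> inv_into (points P) h') (h ` U) y"
      proof (cases "y \<in> h ` U")
        case True
        then obtain x where x: "x \<in> U" "y = h x" by blast
        then have y': "y = h' x" using e U by auto
        have "inv_into (points P) h y = x" using x U inj by auto
        moreover have "inv_into (points P) h' y = x" unfolding y' using x U inj' by auto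
        ultimately show ?thesis by simp
      qed auto
    qed
    then show ?thesis unfolding cc push_chart_def using im by simp
  qed
  then have "atlas Q = push_chart (points P) h' ` atlas P" unfolding at by (rule image_cong[OF refl])
  moreover have "h' (basept P) = basept Q" using e[OF pts_basept[OF P]] b by simp
  ultimately show ?thesis using hm' unfolding pointed_isomorphism_def translation_isomorphism_def by blast
qed

text \<open>On a representative, \<open>basepoint_change\<close> is the identity between two structures that differ in the basepoint only.\<close>

lemma basepoint_change_isomorphism:
  assumes s: "s \<in> universal"
  shows "pointed_isomorphism ((surface_over (proj s))\<lparr>basept := s\<rparr>) (surface_over (relocate s)) (basepoint_change s)"
    and "relocate s \<in> moduli"
proof -
  let ?Q = "surface_over (proj s)"
  have S: "proj s \<in> moduli" using proj_moduli[OF s] .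
  obtain P where P: "P \<in> proj s" "pointed_translation_structure P" "proj s = iso_class P"
    "pointed_isomorphism P ?Q (marked_class P)" using surface_over_isomorphic[OF S] .
  obtain x where x: "x \<in> points P" "s = marked_class P x"
    using universal_point[OF s] pointed_isomorphism_points[OF P(4)] by blast
  let ?Px = "P\<lparr>basept := x\<rparr>"
  have Px: "pointed_translation_structure ?Px" using pointed_translation_structure_relocate[OF P(2) x(1)] .
  have rl: "relocate s = iso_class ?Px" unfolding x(2) by (rule relocate_marked_class[OF P(2) x(1)])
  show M: "relocate s \<in> moduli" unfolding rl moduli_def using Px by blast
  obtain P2 where P2: "P2 \<in> relocate s" "pointed_translation_structure P2"
    "pointed_isomorphism P2 (surface_over (relocate s)) (marked_class P2)"
    using surface_over_isomorphic[OF M] by metis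
  obtain k where k: "pointed_isomorphism ?Px P2 k" using P2(1) unfolding rl iso_class_def by blast
  have 1: "pointed_isomorphism ?Px (surface_over (relocate s)) (marked_class P2 \<circ> k)"
    by (rule pointed_isomorphism_compose[OF Px k P2(3)])
  have 2: "pointed_isomorphism ?Px (?Q\<lparr>basept := s\<rparr>) (marked_class P)"
    using pointed_isomorphism_relocate[OF P(4), of x] unfolding x(2) .
  let ?g = "inv_into (points ?Px) (marked_class P)"
  have 3: "pointed_isomorphism (?Q\<lparr>basept := s\<rparr>) ?Px ?g" by (rule pointed_isomorphism_inverse[OF Px 2])
  have Qs: "pointed_translation_structure (?Q\<lparr>basept := s\<rparr>)"
    by (rule pointed_translation_structure_iso[OF Px 2])
  have 4: "pointed_isomorphism (?Q\<lparr>basept := s\<rparr>) (surface_over (relocate s)) (marked_class P2 \<circ> k \<circ> ?g)"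
    by (rule pointed_isomorphism_compose[OF Qs 3 1])
  show "pointed_isomorphism (?Q\<lparr>basept := s\<rparr>) (surface_over (relocate s)) (basepoint_change s)"
  proof (rule pointed_isomorphism_cong[OF Qs 4])
    fix a assume "a \<in> points (?Q\<lparr>basept := s\<rparr>)"
    then obtain y where y: "y \<in> points P" "a = marked_class P y"
      using pointed_isomorphism_points[OF P(4)] by auto
    have g: "?g a = y" unfolding y(2) using y(1) inj_on_marked_class[OF P(2)] by simp
    have "basepoint_change s a = marked_class ?Px y"
      unfolding x(2) y(2) by (rule basepoint_change_marked_class[OF P(2) x(1) y(1)])
    also have "\<dots> = marked_class P2 (k y)"
      using marked_class_pointed_isomorphism[OF Px P2(2) k] y(1) by simp
    finally show "basepoint_change s a = (marked_class P2 \<circ> k \<circ> ?g) a" using g by simp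
  qed
qed

section \<open>Disks and chains in nearby surfaces\<close>

lemma closed_disk_param:
  assumes "closed_disk R D"
  obtains g b0 where "continuous_map (top_of_set (cball (0 :: plane) 1)) (top_of R) g" "inj_on g (cball 0 1)"
    "g ` cball 0 1 = D" "b0 \<in> cball 0 1" "g b0 = basept R"
proof -
  have "D \<subseteq> points R" and bi: "basept R \<in> top_of R interior_of D"
    and h: "subtopology (top_of R) D homeomorphic_space top_of_set (cball (0 :: plane) 1)"
    using assms unfolding closed_disk_def by auto
  then have D: "D \<subseteq> points R" "basept R \<in> D" using subsetD[OF interior_of_subset bi] by auto
  have "top_of_set (cball (0 :: plane) 1) homeomorphic_space subtopology (top_of R) D"
    by (subst homeomorphic_space_sym) (rule h)
  then obtain g where g: "homeomorphic_map (top_of_set (cball (0 :: plane) 1)) (subtopology (top_of R) D) g"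
    unfolding homeomorphic_space by blast
  have im: "g ` cball 0 1 = D"
    using homeomorphic_imp_surjective_map[OF g] D(1) by (simp add: Int_absorb1)
  have "basept R \<in> g ` cball 0 1" using D(2) im by simp
  then obtain b0 where b: "b0 \<in> cball 0 1" "g b0 = basept R" by (metis imageE)
  have c: "continuous_map (top_of_set (cball (0 :: plane) 1)) (top_of R) g"
    using homeomorphic_imp_continuous_map[OF g] by (simp add: continuous_map_in_subtopology)
  have i: "inj_on g (cball 0 1)" using homeomorphic_imp_injective_map[OF g] by simp
  show ?thesis by (rule that[OF c i im b])
qed

text \<open>The radius \<open>r\<close> is chosen to work in the domain and along the image at once; both are compact.\<close>

lemma immersed_disk_param:
  assumes R: "pointed_translation_structure R" and T: "pointed_translation_structure T"
    and A: "compact A" "convex A" and g: "continuous_map (top_of_set A) (top_of R) g" "inj_on g A"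
    and b0: "b0 \<in> A" "g b0 = basept R" and i: "is_immersion R (g ` A) T (points T) \<iota>"
  obtains r E where "disk_param R A g b0 r E" "\<And>y. y \<in> A \<Longrightarrow> \<exists>e. exp_ball T r (\<iota> (g y)) e"
proof -
  have gR: "g ` A \<subseteq> points R"
    using g(1) by (auto simp: continuous_map_def Pi_iff)
  obtain r1 where r1: "0 < r1" "\<And>y. y \<in> A \<Longrightarrow> \<exists>e. exp_ball R r1 (g y) e \<and> inj_on e (ball 0 r1)"
    using uniform_exp_ball[OF R A(1) g(1) gR openin_topspace] by metis
  have "continuous_map (subtopology (top_of R) (g ` A)) (top_of T) \<iota>"
    using i unfolding is_immersion_def by (simp add: continuous_map_in_subtopology)
  moreover have "continuous_map (top_of_set A) (subtopology (top_of R) (g ` A)) g"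
    using g(1) by (auto simp: continuous_map_in_subtopology)
  ultimately have c: "continuous_map (top_of_set A) (top_of T) (\<lambda>y. \<iota> (g y))"
    using continuous_map_compose[of "top_of_set A" "subtopology (top_of R) (g ` A)" g "top_of T" \<iota>]
    by (simp add: o_def)
  then have cT: "(\<lambda>y. \<iota> (g y)) ` A \<subseteq> points T" by (auto simp: continuous_map_def Pi_iff)
  obtain r2 where r2: "0 < r2" "\<And>y. y \<in> A \<Longrightarrow> \<exists>e. exp_ball T r2 (\<iota> (g y)) e"
    using uniform_exp_ball[OF T A(1) c cT openin_topspace] by metis
  define r where "r = min r1 r2"
  have r: "0 < r" "r \<le> r1" "r \<le> r2" using r1 r2 unfolding r_def by auto
  obtain E where E: "\<And>y. y \<in> A \<Longrightarrow> exp_ball R r1 (g y) (E y) \<and> inj_on (E y) (ball 0 r1)" using r1(2) by metis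
  have rr: "ball (0 :: plane) r \<subseteq> ball 0 r1" using r by (simp add: subset_ball)
  show ?thesis
  proof (rule that[of r E])
    show "disk_param R A g b0 r E"
      by unfold_locales (use R A g b0 E r in \<open>auto intro: exp_ball_mono inj_on_subset[OF _ rr]\<close>)
    fix y assume "y \<in> A"
    then obtain e where "exp_ball T r2 (\<iota> (g y)) e" using r2(2) by blast
    from exp_ball_mono[OF this r(1,3)] show "\<exists>e. exp_ball T r (\<iota> (g y)) e" by blast
  qed
qed

context disk_param
begin

lemma finite_net:
  obtains Y where "finite Y" "Y \<subseteq> A" "\<And>y. y \<in> A \<Longrightarrow> \<exists>z\<in>Y. dist z y < \<eta>/2"
proof -
  have "A \<subseteq> (\<Union>y\<in>A. ball y (\<eta>/2))" using \<eta>(1) by auto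
  then obtain C where "C \<subseteq> A" "finite C" "A \<subseteq> (\<Union>y\<in>C. ball y (\<eta>/2))"
    using compactE_image[OF A(1), of A "\<lambda>y. ball y (\<eta>/2)"] by auto
  then show ?thesis using that[of C] by fastforce
qed

text \<open>The step \<open>(0, r)\<close> appended to a chain moves nowhere, but it demands a ball at the end of the chain.\<close>

lemma chain_half:
  assumes z: "z \<in> A" and \<epsilon>: "\<epsilon> \<le> r/2" and d: "dev T p (shrink \<epsilon> (chain_to m z @ [(0, r)])) q"
  shows "dev T p (shrink (r/2) (chain_to m z)) q" "\<exists>e. exp_ball T (r/2) q e"
proof -
  obtain m' where m': "dev T p (shrink \<epsilon> (chain_to m z)) m'" "step T (r - \<epsilon>) 0 m' q"
    using d by (auto simp: dev_append)
  obtain e where e: "exp_ball T (r - \<epsilon>) m' e" "e 0 = q" using m'(2) unfolding step_def by blast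
  then have q: "m' = q" unfolding exp_ball_def by simp
  have "slack (r/2 - \<epsilon>) (shrink \<epsilon> (chain_to m z))"
    using slack_mono[OF chain_to_slack[OF z order_refl], of "r/2"] r_pos by (simp add: slack_shrink)
  from dev_shrink[OF m'(1) this] show "dev T p (shrink (r/2) (chain_to m z)) q"
    using \<epsilon> q by (simp add: shrink_shrink)
  show "\<exists>e. exp_ball T (r/2) q e" using exp_ball_mono[OF e(1), of "r/2"] \<epsilon> r_pos q by auto
qed

lemma immersion_live:
  assumes T: "pointed_translation_structure T" and i: "is_immersion R (g ` A) T B \<iota>"
    and e: "\<And>y. y \<in> A \<Longrightarrow> \<exists>e. exp_ball T r (\<iota> (g y)) e" and y: "y \<in> A"
  shows "dev T (basept T) (chain_to m y @ [(0, r)]) (\<iota> (g y))"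
proof -
  have "dev T (basept T) (chain_to m y) (\<iota> (g (node m y)))"
    by (rule immersion_chain[OF T i e y order_refl])
  moreover obtain e' where "exp_ball T r (\<iota> (g y)) e'" using e[OF y] by blast
  then have "step T r 0 (\<iota> (g y)) (\<iota> (g y))" using r_pos unfolding step_def exp_ball_def by auto
  ultimately show ?thesis by (auto simp: dev_append)
qed

lemma chain_end_slack:
  assumes "z \<in> A" "\<epsilon> \<le> r/2" shows "slack \<epsilon> (chain_to m z @ [(0, r)])"
proof -
  have "slack \<epsilon> (chain_to m z)"
    by (rule slack_mono[OF chain_to_slack[OF assms(1) order_refl]]) (use assms(2) r_pos in simp)
  moreover have "slack \<epsilon> [(0, r)]" using assms(2) r_pos by simp
  ultimately show ?thesis by simp
qed

text \<open>Near \<open>q\<close>, the image of the disk under \<open>\<iota>\<close> is the image of the exponential map at \<open>q\<close>. Since \<open>U\<close> is open, it contains all points at small distance from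
  \<open>g y\<close>. The bound \<open>\<epsilon>\<close> is independent of the target and therefore serves all nearby surfaces.\<close>

lemma realise:
  assumes y: "y \<in> A" and U: "openin (top_of R) U" "U \<subseteq> g ` A" "g y \<in> U"
  obtains \<epsilon> where "0 < \<epsilon>"
    "\<And>T \<iota> q x c \<tau>. pointed_translation_structure (T :: 'c pointed_surface) \<Longrightarrow>
      (\<And>y'. y' \<in> A \<Longrightarrow> dist y y' < \<eta>/2 \<Longrightarrow> step T (r/2) (disp y y') q (\<iota> (g y'))) \<Longrightarrow>
      step T \<tau> x q c \<Longrightarrow> norm x < \<epsilon> \<Longrightarrow> c \<in> \<iota> ` U"
proof -
  have e0: "E y 0 = g y" "norm (0::plane) < r" "0 < \<eta>/2" using E0[OF y] r_pos \<eta>(1) by auto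
  obtain G where G: "open G" "0 \<in> G" "G \<subseteq> ball 0 r"
    "\<And>w. w \<in> G \<Longrightarrow> E y w \<in> g ` A \<Longrightarrow> \<exists>y'\<in>A. dist y y' < \<eta>/2 \<and> E y w = g y'"
    using near_param[OF y e0(2,1) y e0(3)] by metis
  obtain G' where G': "open G'" "{w \<in> ball 0 r. E y w \<in> U} = G' \<inter> ball 0 r"
    using tm_preimage[OF E_tm[OF y] U(1)] .
  have "0 \<in> {w \<in> ball 0 r. E y w \<in> U}" using e0 U(3) by simp
  then have "0 \<in> G' \<inter> ball 0 r" unfolding G'(2) .
  then have "0 \<in> G \<inter> (G' \<inter> ball 0 r)" using G(2) by blast
  moreover have "open (G \<inter> (G' \<inter> ball 0 r))" using G(1) G'(1) by blast
  ultimately obtain \<epsilon> where \<epsilon>: "0 < \<epsilon>" "ball 0 \<epsilon> \<subseteq> G \<inter> (G' \<inter> ball 0 r)"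
    using open_contains_ball by blast
  show ?thesis
  proof (rule that[OF \<epsilon>(1)])
    fix T :: "'c pointed_surface" and \<iota> q x c \<tau>
    assume T: "pointed_translation_structure T"
      and st: "\<And>y'. y' \<in> A \<Longrightarrow> dist y y' < \<eta>/2 \<Longrightarrow> step T (r/2) (disp y y') q (\<iota> (g y'))"
      and x: "step T \<tau> x q c" "norm x < \<epsilon>"
    have xG: "x \<in> G" "x \<in> G' \<inter> ball 0 r" using \<epsilon>(2) x(2) by auto
    then have xU: "E y x \<in> U" using G'(2) by blast
    then obtain y' where y': "y' \<in> A" "dist y y' < \<eta>/2" "E y x = g y'" using G(4)[OF xG(1)] U(2) by blast
    have "disp y y' = x" using disp_eqI[OF y _ y'(3)] xG(2) by auto
    then have "step T (r/2) x q (\<iota> (g y'))" using st[OF y'(1,2)] by simp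
    then have "c = \<iota> (g y')" using step_det[OF T x(1)] by blast
    then show "c \<in> \<iota> ` U" using xU y'(3) by (metis imageI)
  qed
qed

end

text \<open>Chains that start at \<open>s\<close> persist at points near \<open>s\<close> in the universal family: approach \<open>s\<close> from
  the basepoint by a chain \<open>\<Gamma>\<close>, and displace the rest.\<close>

lemma relocated_live:
  assumes s: "s \<in> universal" and d: "0 < \<delta>"
    and \<Gamma>: "slack (2 * \<delta>) \<Gamma>" "dev (surface_over (proj s)) (base (proj s)) \<Gamma> s"
    and \<C>: "finite \<C>" "\<And>C. C \<in> \<C> \<Longrightarrow> slack (2 * \<delta>) C \<and> (\<exists>q. dev (surface_over (proj s)) s C q)"
    and \<epsilon>: "0 < \<epsilon>"
  obtains X \<sigma> where "openin universal_topology X" "s \<in> X" "0 < \<sigma>" "\<sigma> \<le> \<epsilon>" "\<sigma> \<le> \<delta>"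
    "\<And>s1. s1 \<in> X \<Longrightarrow> s1 \<in> universal \<and> (\<exists>q1 w. 2 * norm w < \<sigma> \<and>
       dev (surface_over (proj s1)) (base (proj s1)) (shrink \<delta> \<Gamma>) q1 \<and> step (surface_over (proj s1)) \<sigma> w q1 s1 \<and>
       (\<forall>C\<in>\<C>. \<exists>e q. dev (surface_over (proj s1)) q1 (shrink \<delta> C) e \<and> step (surface_over (proj s1)) \<sigma> w e q \<and>
          dev (surface_over (proj s1)) s1 (shrink (2 * \<delta>) C) q))"
proof -
  note PS = pointed_translation_structure_surface_over
  note S = proj_moduli[OF s]
  have sG: "slack \<delta> \<Gamma>" using slack_mono[OF \<Gamma>(1)] d by simp
  have "0 < min \<epsilon> \<delta>" using d \<epsilon> by simp
  then obtain X \<sigma> where X: "openin universal_topology X" "s \<in> X" "0 < \<sigma>" "\<sigma> \<le> min \<epsilon> \<delta>"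
    "\<And>s1. s1 \<in> X \<Longrightarrow> s1 \<in> universal \<and> (\<exists>q1 w. dev (surface_over (proj s1)) (base (proj s1)) (shrink \<delta> \<Gamma>) q1 \<and>
       2 * norm w < \<sigma> \<and> step (surface_over (proj s1)) \<sigma> w q1 s1)"
    using end_open[OF s d sG \<Gamma>(2)] by metis
  have "\<exists>W. openin moduli_topology W \<and> proj s \<in> W \<and>
     (\<forall>S1\<in>W. \<exists>q1. dev (surface_over S1) (base S1) (shrink \<delta> (\<Gamma> @ C)) q1)" if C: "C \<in> \<C>" for C
  proof -
    have sl: "slack \<delta> (\<Gamma> @ C)" using sG slack_mono[of "2 * \<delta>" C \<delta>] \<C>(2)[OF C] d by simp
    obtain q where "dev (surface_over (proj s)) s C q" using \<C>(2)[OF C] by blast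
    then have "dev (surface_over (proj s)) (base (proj s)) (\<Gamma> @ C) q" using \<Gamma>(2) by (auto simp: dev_append)
    from live_open[OF S d sl this] show ?thesis by metis
  qed
  then obtain W where W: "\<And>C. C \<in> \<C> \<Longrightarrow> openin moduli_topology (W C) \<and> proj s \<in> W C \<and>
     (\<forall>S1\<in>W C. \<exists>q1. dev (surface_over S1) (base S1) (shrink \<delta> (\<Gamma> @ C)) q1)" by metis
  let ?W = "topspace moduli_topology \<inter> \<Inter>(W ` \<C>)"
  have oW: "openin moduli_topology ?W"
  proof (cases "\<C> = {}")
    case False
    then have "openin moduli_topology (\<Inter>(W ` \<C>))" using \<C>(1) W by (intro openin_Inter) auto
    then show ?thesis by blast
  qed auto
  show ?thesis
  proof (rule that[of "X \<inter> {e \<in> universal. proj e \<in> ?W}" \<sigma>])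
    show "openin universal_topology (X \<inter> {e \<in> universal. proj e \<in> ?W})" using X(1) openin_proj[OF oW] by blast
    show "s \<in> X \<inter> {e \<in> universal. proj e \<in> ?W}" using X(2) s S W unfolding topspace_moduli by blast
    fix s1 assume s1: "s1 \<in> X \<inter> {e \<in> universal. proj e \<in> ?W}"
    then have u: "s1 \<in> universal" by blast
    let ?Q = "surface_over (proj s1)"
    have Q: "pointed_translation_structure ?Q" using PS[OF proj_moduli[OF u]] .
    obtain q1 w where q1: "dev ?Q (base (proj s1)) (shrink \<delta> \<Gamma>) q1" "2 * norm w < \<sigma>" "step ?Q \<sigma> w q1 s1"
      using X(5)[of s1] s1 by blast
    have "\<exists>e q. dev ?Q q1 (shrink \<delta> C) e \<and> step ?Q \<sigma> w e q \<and> dev ?Q s1 (shrink (2 * \<delta>) C) q" if C: "C \<in> \<C>" for C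
    proof -
      obtain q0 where "dev ?Q (base (proj s1)) (shrink \<delta> (\<Gamma> @ C)) q0" using W[OF C] s1 C by blast
      then obtain q2 where q2: "dev ?Q (base (proj s1)) (shrink \<delta> \<Gamma>) q2" "dev ?Q q2 (shrink \<delta> C) q0"
        by (auto simp: dev_append)
      have "q2 = q1" using dev_det[OF Q q2(1) q1(1)] .
      then have e: "dev ?Q q1 (shrink \<delta> C) q0" using q2 by simp
      have "slack (\<delta> + \<sigma>) C" using slack_mono[of "2 * \<delta>" C "\<delta> + \<sigma>"] \<C>(2)[OF C] X(4) by simp
      then have sl: "slack \<sigma> (shrink \<delta> C)" by (simp add: slack_shrink)
      obtain q where q: "dev ?Q s1 (shrink \<sigma> (shrink \<delta> C)) q" "step ?Q \<sigma> w q0 q"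
        using dev_perturb[OF Q e sl q1(3)] by blast
      have "slack (\<delta> - \<sigma>) (shrink (\<delta> + \<sigma>) C)" using \<C>(2)[OF C] by (simp add: slack_shrink)
      from dev_shrink[OF q(1)[unfolded shrink_shrink] this]
      have "dev ?Q s1 (shrink (2 * \<delta>) C) q" using X(4) by (simp add: shrink_shrink)
      then show ?thesis using e q(2) by blast
    qed
    then show "s1 \<in> universal \<and> (\<exists>q1 w. 2 * norm w < \<sigma> \<and>
       dev ?Q (base (proj s1)) (shrink \<delta> \<Gamma>) q1 \<and> step ?Q \<sigma> w q1 s1 \<and>
       (\<forall>C\<in>\<C>. \<exists>e q. dev ?Q q1 (shrink \<delta> C) e \<and> step ?Q \<sigma> w e q \<and> dev ?Q s1 (shrink (2 * \<delta>) C) q))"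
      using u q1 by blast
  qed (use X in auto)
qed

lemma small_slack:
  assumes "\<forall>(v, \<rho>)\<in>set \<Gamma>. 4 * norm v < \<rho>" "0 < \<epsilon>"
  obtains \<delta> where "0 < \<delta>" "\<delta> \<le> \<epsilon>" "\<forall>(v, \<rho>)\<in>set \<Gamma>. 3 * norm v + 8 * \<delta> < \<rho>"
proof -
  have "\<exists>\<delta>>0. \<forall>(v, \<rho>)\<in>set \<Gamma>. 3 * norm v + 8 * \<delta> < \<rho>"
    using assms(1)
  proof (induction \<Gamma>)
    case Nil
    show ?case by (rule exI[of _ 1]) simp
  next
    case (Cons a \<Gamma>)
    obtain v \<rho> where a: "a = (v, \<rho>)" by (cases a)
    obtain \<delta> where d: "0 < \<delta>" "\<forall>(v, \<rho>)\<in>set \<Gamma>. 3 * norm v + 8 * \<delta> < \<rho>" using Cons by auto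
    have "4 * norm v < \<rho>" using Cons.prems a by simp
    then have g: "0 < \<rho> - 3 * norm v" using norm_ge_zero[of v] by linarith
    define \<delta>' where "\<delta>' = min \<delta> ((\<rho> - 3 * norm v) / 16)"
    have d': "0 < \<delta>'" "\<delta>' \<le> \<delta>" "\<delta>' \<le> (\<rho> - 3 * norm v) / 16"
      using d g unfolding \<delta>'_def by (auto simp only: min_less_iff_conj min.cobounded1 min.cobounded2 zero_less_divide_iff zero_less_numeral)
    have "\<delta>' * 16 \<le> \<rho> - 3 * norm v" using d'(3) by (simp only: pos_le_divide_eq zero_less_numeral)
    then have "3 * norm v + 8 * \<delta>' < \<rho>" using d'(1) by linarith
    moreover have "3 * norm v + 8 * \<delta>' < \<rho>" if "(v, \<rho>) \<in> set \<Gamma>" for v \<rho>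
    proof -
      have "3 * norm v + 8 * \<delta> < \<rho>" using d(2) that by blast
      then show ?thesis using d'(2) by linarith
    qed
    ultimately show ?case using d'(1) unfolding a by (intro exI[of _ \<delta>']) auto
  qed
  then obtain \<delta> where d: "0 < \<delta>" "\<forall>(v, \<rho>)\<in>set \<Gamma>. 3 * norm v + 8 * \<delta> < \<rho>" by blast
  show ?thesis
  proof (rule that[of "min \<delta> \<epsilon>"])
    have "3 * norm v + 8 * min \<delta> \<epsilon> < \<rho>" if "(v, \<rho>) \<in> set \<Gamma>" for v \<rho>
    proof -
      have "3 * norm v + 8 * \<delta> < \<rho>" using d(2) that by blast
      then show ?thesis using min.cobounded1[of \<delta> \<epsilon>] by linarith
    qed
    then show "\<forall>(v, \<rho>)\<in>set \<Gamma>. 3 * norm v + 8 * min \<delta> \<epsilon> < \<rho>" by blast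
  qed (use d assms(2) in auto)
qed

lemma small_slack_slack:
  assumes "\<forall>(v, \<rho>)\<in>set \<Gamma>. 3 * norm v + 8 * \<delta> < \<rho>" "\<epsilon> \<le> 8 * \<delta>"
  shows "slack \<epsilon> \<Gamma>" "slack \<epsilon> (retrace \<Gamma>)"
proof -
  have *: "norm v + \<epsilon> < \<rho>" "norm v + \<epsilon> < \<rho> - norm v" if "(v, \<rho>) \<in> set \<Gamma>" for v \<rho>
  proof -
    have "3 * norm v + 8 * \<delta> < \<rho>" using assms(1) that by blast
    then show "norm v + \<epsilon> < \<rho>" "norm v + \<epsilon> < \<rho> - norm v"
      using assms(2) norm_ge_zero[of v] by linarith+
  qed
  show "slack \<epsilon> \<Gamma>" unfolding slack_def using *(1) by blast
  have "norm v' + \<epsilon> < \<rho>'" if "(v', \<rho>') \<in> set (retrace \<Gamma>)" for v' \<rho>'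
  proof -
    obtain v \<rho> where v: "(v, \<rho>) \<in> set \<Gamma>" "v' = - v" "\<rho>' = \<rho> - norm v"
      using \<open>(v', \<rho>') \<in> set (retrace \<Gamma>)\<close> unfolding retrace_def by auto
    show ?thesis using *(2)[OF v(1)] unfolding v(2,3) norm_minus_cancel .
  qed
  then show "slack \<epsilon> (retrace \<Gamma>)" unfolding slack_def by blast
qed

lemma retrace_shrink: "retrace (shrink \<delta> C) = shrink \<delta> (retrace C)"
proof (induction C)
  case Nil
  show ?case by (simp add: retrace_def)
next
  case (Cons a C)
  then show ?case by (cases a) (simp add: retrace_Cons diff_right_commute)
qed

lemma chain_to_point:
  assumes "s \<in> universal"
  obtains \<Gamma> where "dev (surface_over (proj s)) (base (proj s)) \<Gamma> s" "\<forall>(v, \<rho>)\<in>set \<Gamma>. 4 * norm v < \<rho>"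
proof -
  note P = pointed_translation_structure_surface_over[OF proj_moduli[OF assms]]
  from chain_exists[OF P pts_basept[OF P] universal_point[OF assms]]
  obtain \<Gamma> where "dev (surface_over (proj s)) (base (proj s)) \<Gamma> s" "\<forall>(v, \<rho>)\<in>set \<Gamma>. 4 * norm v < \<rho>"
    by (elim exE conjE)
  then show ?thesis by (rule that)
qed

lemma (in disk_param) relocated_immersion:
  assumes Y: "Y \<subseteq> A" "b0 \<in> Y" and net: "\<And>y. y \<in> A \<Longrightarrow> \<exists>z\<in>Y. dist z y < \<eta>/2"
    and T: "pointed_translation_structure T" and e: "\<epsilon> \<le> r/2"
    and q: "\<And>z. z \<in> Y \<Longrightarrow> dev T (basept T) (shrink \<epsilon> (chain_to m z @ [(0, r)])) (q z)"
  obtains \<iota> where "is_immersion R (g ` A) T (points T) \<iota>"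
    "\<And>z y. z \<in> Y \<Longrightarrow> y \<in> A \<Longrightarrow> dist z y < \<eta>/2 \<Longrightarrow> step T (r/2) (disp z y) (q z) (\<iota> (g y))"
proof (rule chains_immersion[OF T Y net])
  fix z assume z: "z \<in> Y"
  then have zA: "z \<in> A" using Y by blast
  show "dev T (basept T) (shrink (r/2) (chain_to m z)) (q z)" by (rule chain_half(1)[OF zA e q[OF z]])
  show "\<exists>e. exp_ball T (r/2) (q z) e" by (rule chain_half(2)[OF zA e q[OF z]])
next
  fix \<iota> assume i: "is_immersion R (g ` A) T (points T) \<iota>"
    and s: "\<And>z y. z \<in> Y \<Longrightarrow> y \<in> A \<Longrightarrow> dist z y < \<eta>/2 \<Longrightarrow> step T (r/2) (disp z y) (q z) (\<iota> (g y))"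
  show thesis by (rule that[OF i s])
qed

text \<open>For the disk to immerse at \<open>s\<^sub>1\<close>, its finitely many chains have to be read from there (\<open>relocated_live\<close>). To catch the second point, one of these chains
  is chosen to end at \<open>s'\<close>. Put after \<open>\<Gamma>\<close> it ends near \<open>s'\<^sub>1\<close> (\<open>end_open\<close>) and, read from \<open>s\<^sub>1\<close>, it ends near the same
  point; the immersed disk then covers \<open>s'\<^sub>1\<close> by \<open>realise\<close>.\<close>

lemma relocate_plus:
  assumes s: "s \<in> universal" "s' \<in> universal" "proj s' = proj s" and R: "R \<in> moduli"
    and D: "closed_disk (surface_over R) D" and U: "openin (top_of (surface_over R)) U" "U \<subseteq> D"
    and i: "is_immersion (surface_over R) D ((surface_over (proj s))\<lparr>basept := s\<rparr>) (points (surface_over (proj s))) \<iota>"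
    and sU: "s' \<in> \<iota> ` U"
  obtains X X' where "openin universal_topology X" "s \<in> X" "openin universal_topology X'" "s' \<in> X'"
    "\<And>s1 s1'. s1 \<in> X \<Longrightarrow> s1' \<in> X' \<Longrightarrow> proj s1' = proj s1 \<Longrightarrow>
      \<exists>\<iota>1. is_immersion (surface_over R) D ((surface_over (proj s1))\<lparr>basept := s1\<rparr>) (points (surface_over (proj s1))) \<iota>1 \<and>
        s1' \<in> \<iota>1 ` U"
proof -
  note PS = pointed_translation_structure_surface_over
  let ?R = "surface_over R" and ?Q = "surface_over (proj s)" and ?A = "cball (0 :: plane) 1"
  let ?T = "?Q\<lparr>basept := s\<rparr>"
  note Q = PS[OF proj_moduli[OF s(1)]]
  have T: "pointed_translation_structure ?T" by (rule pts_basept_update[OF Q universal_point[OF s(1)]])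
  obtain g b0 where gg: "continuous_map (top_of_set ?A) (top_of ?R) g" "inj_on g ?A"
    "g ` ?A = D" "b0 \<in> ?A" "g b0 = basept ?R" using closed_disk_param[OF D] by blast
  have i': "is_immersion ?R (g ` ?A) ?T (points ?T) \<iota>" using i gg(3) by simp
  obtain r E where dp: "disk_param ?R ?A g b0 r E" and rT: "\<And>y. y \<in> ?A \<Longrightarrow> \<exists>e. exp_ball ?T r (\<iota> (g y)) e"
    using immersed_disk_param[OF PS[OF R] T compact_cball convex_cball gg(1,2,4,5) i'] by blast
  interpret disk_param ?R ?A g b0 r E by (rule dp)
  obtain u where u: "u \<in> U" "s' = \<iota> u" using sU by blast
  have "u \<in> g ` ?A" using u(1) U(2) gg(3) by blast
  then obtain y where y: "y \<in> ?A" "u = g y" by blast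
  obtain \<Gamma> where G: "dev ?Q (base (proj s)) \<Gamma> s" "\<forall>(v, \<rho>)\<in>set \<Gamma>. 4 * norm v < \<rho>"
    using chain_to_point[OF s(1)] .
  obtain Y0 where Y0: "finite Y0" "Y0 \<subseteq> ?A" "\<And>y. y \<in> ?A \<Longrightarrow> \<exists>z\<in>Y0. dist z y < \<eta>/2" using finite_net by blast
  \<comment> \<open>the net contains \<open>b0\<close>, where the chains start, and \<open>y\<close>, whose chain leads to the second point\<close>
  define Y where "Y = insert b0 (insert y Y0)"
  have Y: "finite Y" "Y \<subseteq> ?A" "b0 \<in> Y" "y \<in> Y" "\<And>y. y \<in> ?A \<Longrightarrow> \<exists>z\<in>Y. dist z y < \<eta>/2"
    using Y0 y(1) b0(1) unfolding Y_def by auto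
  have UA: "U \<subseteq> g ` ?A" "g y \<in> U" using U(2) gg(3) u(1) y(2) by auto
  obtain \<epsilon> where \<epsilon>: "0 < \<epsilon>" "\<And>T \<iota> q x c \<tau>. pointed_translation_structure (T :: epoint pointed_surface) \<Longrightarrow>
      (\<And>y'. y' \<in> ?A \<Longrightarrow> dist y y' < \<eta>/2 \<Longrightarrow> step T (r/2) (disp y y') q (\<iota> (g y'))) \<Longrightarrow>
      step T \<tau> x q c \<Longrightarrow> norm x < \<epsilon> \<Longrightarrow> c \<in> \<iota> ` U"
    using realise[OF y(1) U(1) UA] by blast
  have r8: "0 < r/8" using r_pos by simp
  obtain \<delta> where d: "0 < \<delta>" "\<delta> \<le> r/8" "\<forall>(v, \<rho>)\<in>set \<Gamma>. 3 * norm v + 8 * \<delta> < \<rho>"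
    using small_slack[OF G(2) r8] by blast
  define C where "C z = chain_to m z @ [(0, r)]" for z
  have sG: "slack (2 * \<delta>) \<Gamma>" by (rule small_slack_slack(1)[OF d(3)]) (use d(1) in simp)
  have sC: "slack (2 * \<delta>) (C z)" if "z \<in> ?A" for z
    unfolding C_def by (rule chain_end_slack[OF that]) (use d(1,2) in simp)
  have lC: "dev ?Q s (C z) (\<iota> (g z))" if "z \<in> ?A" for z
    using immersion_live[OF T i' rT that] unfolding C_def by simp
  have "finite (C ` Y)" using Y(1) by blast
  moreover have "slack (2 * \<delta>) C' \<and> (\<exists>q. dev ?Q s C' q)" if "C' \<in> C ` Y" for C'
    using that sC lC Y(2) by blast
  moreover have "0 < min (\<epsilon>/2) (r/8)" using \<epsilon>(1) r8 by simp
  ultimately obtain X \<sigma> where X: "openin universal_topology X" "s \<in> X" "0 < \<sigma>" "\<sigma> \<le> min (\<epsilon>/2) (r/8)"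
    "\<And>s1. s1 \<in> X \<Longrightarrow> s1 \<in> universal \<and> (\<exists>q1 w. 2 * norm w < \<sigma> \<and>
       dev (surface_over (proj s1)) (base (proj s1)) (shrink \<delta> \<Gamma>) q1 \<and> step (surface_over (proj s1)) \<sigma> w q1 s1 \<and>
       (\<forall>C'\<in>C ` Y. \<exists>e q. dev (surface_over (proj s1)) q1 (shrink \<delta> C') e \<and> step (surface_over (proj s1)) \<sigma> w e q \<and>
          dev (surface_over (proj s1)) s1 (shrink (2 * \<delta>) C') q))"
    using relocated_live[OF s(1) d(1) sG G(1), of "C ` Y" "min (\<epsilon>/2) (r/8)"] by metis
  have sGC: "slack \<delta> (\<Gamma> @ C y)" using slack_mono[OF sG] slack_mono[OF sC[OF y(1)]] d(1) by simp
  have "dev ?Q s (C y) s'" using lC[OF y(1)] u(2) y(2) by simp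
  then have "dev ?Q (base (proj s)) (\<Gamma> @ C y) s'" using G(1) unfolding dev_append by blast
  then have "dev (surface_over (proj s')) (base (proj s')) (\<Gamma> @ C y) s'" unfolding s(3) .
  moreover have "0 < min (\<epsilon>/2) (r/8)" using \<epsilon>(1) r8 by simp
  ultimately obtain X' \<sigma>' where X': "openin universal_topology X'" "s' \<in> X'" "0 < \<sigma>'" "\<sigma>' \<le> min (\<epsilon>/2) (r/8)"
    "\<And>s1. s1 \<in> X' \<Longrightarrow> s1 \<in> universal \<and> (\<exists>q1 w. dev (surface_over (proj s1)) (base (proj s1)) (shrink \<delta> (\<Gamma> @ C y)) q1 \<and>
       2 * norm w < \<sigma>' \<and> step (surface_over (proj s1)) \<sigma>' w q1 s1)"
    using end_open[OF s(2) d(1) sGC, of "min (\<epsilon>/2) (r/8)"] by metis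
  show ?thesis
  proof (rule that[OF X(1,2) X'(1,2)])
    fix s1 s1' assume s1: "s1 \<in> X" and s1': "s1' \<in> X'" and pr: "proj s1' = proj s1"
    let ?Q1 = "surface_over (proj s1)"
    have u1: "s1 \<in> universal" using X(5)[OF s1] by blast
    note Q1 = PS[OF proj_moduli[OF u1]]
    let ?T1 = "?Q1\<lparr>basept := s1\<rparr>"
    have T1: "pointed_translation_structure ?T1" by (rule pts_basept_update[OF Q1 universal_point[OF u1]])
    obtain q1 w where q1: "2 * norm w < \<sigma>" "dev ?Q1 (base (proj s1)) (shrink \<delta> \<Gamma>) q1"
      and live: "\<forall>C'\<in>C ` Y. \<exists>e q. dev ?Q1 q1 (shrink \<delta> C') e \<and> step ?Q1 \<sigma> w e q \<and> dev ?Q1 s1 (shrink (2 * \<delta>) C') q"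
      using X(5)[OF s1] by blast
    then have "\<forall>z\<in>Y. \<exists>e q. dev ?Q1 q1 (shrink \<delta> (C z)) e \<and> step ?Q1 \<sigma> w e q \<and> dev ?Q1 s1 (shrink (2 * \<delta>) (C z)) q"
      by blast
    then obtain e q where eq: "\<And>z. z \<in> Y \<Longrightarrow> dev ?Q1 q1 (shrink \<delta> (C z)) (e z) \<and> step ?Q1 \<sigma> w (e z) (q z) \<and>
        dev ?Q1 s1 (shrink (2 * \<delta>) (C z)) (q z)" by metis
    have dq: "dev ?T1 (basept ?T1) (shrink (2 * \<delta>) (chain_to m z @ [(0, r)])) (q z)" if "z \<in> Y" for z
      using eq[OF that] unfolding C_def by simp
    have d2: "2 * \<delta> \<le> r/2" using d(1,2) by simp
    obtain \<iota>1 where i1: "is_immersion ?R (g ` ?A) ?T1 (points ?T1) \<iota>1"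
      "\<And>z y. z \<in> Y \<Longrightarrow> y \<in> ?A \<Longrightarrow> dist z y < \<eta>/2 \<Longrightarrow> step ?T1 (r/2) (disp z y) (q z) (\<iota>1 (g y))"
      using relocated_immersion[OF Y(2,3,5) T1 d2 dq] by blast
    obtain q1' w' where q1': "dev ?Q1 (base (proj s1)) (shrink \<delta> (\<Gamma> @ C y)) q1'" "2 * norm w' < \<sigma>'"
      "step ?Q1 \<sigma>' w' q1' s1'" using X'(5)[OF s1'] unfolding pr by blast
    have "q1' = e y"
    proof -
      have "dev ?Q1 (base (proj s1)) (shrink \<delta> (\<Gamma> @ C y)) (e y)"
        using q1(2) eq[OF Y(4)] by (auto simp: dev_append)
      then show ?thesis using dev_det[OF Q1 q1'(1)] by blast
    qed
    note q1' = q1'[unfolded this]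
    obtain e0 where e0: "exp_ball ?Q1 (r/2) (e y) e0"
      using chain_half(2)[OF y(1) _ eq[OF Y(4), THEN conjunct1, unfolded C_def]] d(2) r_pos by auto
    have nw: "norm w < r/8" "norm w' < r/8" "norm w < \<epsilon>/2" "norm w' < \<epsilon>/2"
      using q1(1) q1'(2) X(4) X'(4) norm_ge_zero[of w] norm_ge_zero[of w'] by linarith+
    have n: "norm (w' - w) < r/4" "norm (w' - w) < \<epsilon>"
      using norm_triangle_ineq4[of w' w] nw by linarith+
    have qe: "q y = e0 w"
      by (rule step_value[OF Q1 e0]) (use eq[OF Y(4)] nw r_pos in auto)
    have se: "s1' = e0 w'"
      by (rule step_value[OF Q1 e0 q1'(3)]) (use nw r_pos in auto)
    have "step ?Q1 (r/4) (w' - w) (e0 w) (e0 (w + (w' - w)))"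
      by (rule step_add[OF e0]) (use nw n r_pos in auto)
    then have st: "step ?T1 (r/4) (w' - w) (q y) s1'" using qe se by simp
    have "s1' \<in> \<iota>1 ` U"
      by (rule \<epsilon>(2)[OF T1 i1(2)[OF Y(4)] st n(2)])
    then show "\<exists>\<iota>1. is_immersion ?R D ?T1 (points ?Q1) \<iota>1 \<and> s1' \<in> \<iota>1 ` U"
      using i1(1) gg(3) by auto
  qed
qed

text \<open>The point \<open>t\<close> lies on the surface based at \<open>s\<close>, so its neighbourhoods are described by chains from \<open>s\<close>. Such a chain, run from \<open>s\<close> back to the
  old basepoint along \<open>\<Gamma>\<close> and then along the disk, ends at \<open>t\<close>. From a point \<open>s\<^sub>1\<close> near \<open>s\<close> it arrives next to the old basepoint of the nearby surface,
  with the same displacement \<open>w\<close> that separates \<open>s\<^sub>1\<close> from the end of \<open>\<Gamma>\<close>; this error stays the same up to the end and is small.\<close>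

lemma unrelocate_plus:
  assumes s: "s \<in> universal" and t: "t \<in> universal" "proj t = relocate s" and R: "R \<in> moduli"
    and D: "closed_disk (surface_over R) D" and U: "openin (top_of (surface_over R)) U" "U \<subseteq> D"
    and i: "immerses R D (proj s) \<iota>" and t0: "t0 \<in> \<iota> ` U" "basepoint_change s t0 = t"
  obtains X X' where "openin universal_topology X" "s \<in> X" "openin universal_topology X'" "t \<in> X'"
    "\<And>s1 t1 t1'. s1 \<in> X \<Longrightarrow> t1 \<in> X' \<Longrightarrow> proj t1 = relocate s1 \<Longrightarrow> t1' \<in> points (surface_over (proj s1)) \<Longrightarrow>
      basepoint_change s1 t1' = t1 \<Longrightarrow> \<exists>\<iota>1. immerses R D (proj s1) \<iota>1 \<and> t1' \<in> \<iota>1 ` U"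
proof -
  note PS = pointed_translation_structure_surface_over
  let ?R = "surface_over R" and ?Q = "surface_over (proj s)" and ?A = "cball (0 :: plane) 1"
  note Q = PS[OF proj_moduli[OF s]]
  obtain g b0 where gg: "continuous_map (top_of_set ?A) (top_of ?R) g" "inj_on g ?A"
    "g ` ?A = D" "b0 \<in> ?A" "g b0 = basept ?R" using closed_disk_param[OF D] by blast
  have i': "is_immersion ?R (g ` ?A) ?Q (points ?Q) \<iota>" using i gg(3) by simp
  obtain r E where dp: "disk_param ?R ?A g b0 r E" and rT: "\<And>y. y \<in> ?A \<Longrightarrow> \<exists>e. exp_ball ?Q r (\<iota> (g y)) e"
    using immersed_disk_param[OF PS[OF R] Q compact_cball convex_cball gg(1,2,4,5) i'] by blast
  interpret disk_param ?R ?A g b0 r E by (rule dp)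
  obtain u where u: "u \<in> U" "t0 = \<iota> u" using t0(1) by blast
  have "u \<in> g ` ?A" using u(1) U(2) gg(3) by blast
  then obtain y where y: "y \<in> ?A" "u = g y" by blast
  obtain \<Gamma> where G: "dev ?Q (base (proj s)) \<Gamma> s" "\<forall>(v, \<rho>)\<in>set \<Gamma>. 4 * norm v < \<rho>"
    using chain_to_point[OF s] .
  obtain Y0 where Y0: "finite Y0" "Y0 \<subseteq> ?A" "\<And>y. y \<in> ?A \<Longrightarrow> \<exists>z\<in>Y0. dist z y < \<eta>/2" using finite_net by blast
  \<comment> \<open>the net contains \<open>b0\<close>, where the chains start, and \<open>y\<close>, whose chain leads to the second point\<close>
  define Y where "Y = insert b0 (insert y Y0)"
  have Y: "finite Y" "Y \<subseteq> ?A" "b0 \<in> Y" "y \<in> Y" "\<And>y. y \<in> ?A \<Longrightarrow> \<exists>z\<in>Y. dist z y < \<eta>/2"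
    using Y0 y(1) b0(1) unfolding Y_def by auto
  have UA: "U \<subseteq> g ` ?A" "g y \<in> U" using U(2) gg(3) u(1) y(2) by auto
  obtain \<epsilon> where \<epsilon>: "0 < \<epsilon>" "\<And>T \<iota> q x c \<tau>. pointed_translation_structure (T :: epoint pointed_surface) \<Longrightarrow>
      (\<And>y'. y' \<in> ?A \<Longrightarrow> dist y y' < \<eta>/2 \<Longrightarrow> step T (r/2) (disp y y') q (\<iota> (g y'))) \<Longrightarrow>
      step T \<tau> x q c \<Longrightarrow> norm x < \<epsilon> \<Longrightarrow> c \<in> \<iota> ` U"
    using realise[OF y(1) U(1) UA] by blast
  have r8: "0 < r/8" using r_pos by simp
  obtain \<delta> where d: "0 < \<delta>" "\<delta> \<le> r/8" "\<forall>(v, \<rho>)\<in>set \<Gamma>. 3 * norm v + 8 * \<delta> < \<rho>"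
    using small_slack[OF G(2) r8] by blast
  define C where "C z = retrace \<Gamma> @ chain_to m z @ [(0, r)]" for z
  have sG: "slack (2 * \<delta>) \<Gamma>" by (rule small_slack_slack(1)[OF d(3)]) (use d(1) in simp)
  have sG': "slack (2 * \<delta>) (retrace \<Gamma>)" by (rule small_slack_slack(2)[OF d(3)]) (use d(1) in simp)
  have sC0: "slack (2 * \<delta>) (chain_to m z @ [(0, r)])" if "z \<in> ?A" for z
    by (rule chain_end_slack[OF that]) (use d(1,2) in simp)
  have sC: "slack (2 * \<delta>) (C z)" if "z \<in> ?A" for z
    using sG' sC0[OF that] unfolding C_def by simp
  have two: "\<forall>(v, \<rho>)\<in>set \<Gamma>. 2 * norm v < \<rho>"
  proof -
    have "2 * norm v < \<rho>" if "(v, \<rho>) \<in> set \<Gamma>" for v \<rho>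
    proof -
      have "4 * norm v < \<rho>" using G(2) that by blast
      then show ?thesis using norm_ge_zero[of v] by linarith
    qed
    then show ?thesis by blast
  qed
  have lC: "dev ?Q s (C z) (\<iota> (g z))" if "z \<in> ?A" for z
    using dev_back[OF G(1) two] immersion_live[OF Q i' rT that] unfolding C_def dev_append by blast
  have "finite (C ` Y)" using Y(1) by blast
  moreover have "slack (2 * \<delta>) C' \<and> (\<exists>q. dev ?Q s C' q)" if "C' \<in> C ` Y" for C'
    using that sC lC Y(2) by blast
  moreover have "0 < min (\<epsilon>/2) (r/8)" using \<epsilon>(1) r8 by simp
  ultimately obtain X \<sigma> where X: "openin universal_topology X" "s \<in> X" "0 < \<sigma>" "\<sigma> \<le> min (\<epsilon>/2) (r/8)"
    "\<And>s1. s1 \<in> X \<Longrightarrow> s1 \<in> universal \<and> (\<exists>q1 w. 2 * norm w < \<sigma> \<and>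
       dev (surface_over (proj s1)) (base (proj s1)) (shrink \<delta> \<Gamma>) q1 \<and> step (surface_over (proj s1)) \<sigma> w q1 s1 \<and>
       (\<forall>C'\<in>C ` Y. \<exists>e q. dev (surface_over (proj s1)) q1 (shrink \<delta> C') e \<and> step (surface_over (proj s1)) \<sigma> w e q \<and>
          dev (surface_over (proj s1)) s1 (shrink (2 * \<delta>) C') q))"
    using relocated_live[OF s d(1) sG G(1), of "C ` Y" "min (\<epsilon>/2) (r/8)"] by metis
  have sCd: "slack \<delta> (C y)" using slack_mono[OF sC[OF y(1)]] d(1) by simp
  have bc: "pointed_isomorphism (?Q\<lparr>basept := s\<rparr>) (surface_over (relocate s)) (basepoint_change s)"
    using basepoint_change_isomorphism(1)[OF s] .
  have Qs: "pointed_translation_structure (?Q\<lparr>basept := s\<rparr>)" by (rule pts_basept_update[OF Q universal_point[OF s]])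
  have "dev (surface_over (relocate s)) (basepoint_change s s) (C y) (basepoint_change s t0)"
    by (rule dev_isomorphism[of "?Q\<lparr>basept := s\<rparr>"])
      (use bc Qs lC[OF y(1)] u(2) y(2) in \<open>auto simp: pointed_isomorphism_def\<close>)
  then have "dev (surface_over (proj t)) (base (proj t)) (C y) t"
    using bc t(2) t0(2) unfolding pointed_isomorphism_def by simp
  moreover have "0 < min (\<epsilon>/2) (r/8)" using \<epsilon>(1) r8 by simp
  ultimately obtain X' \<sigma>' where X': "openin universal_topology X'" "t \<in> X'" "0 < \<sigma>'" "\<sigma>' \<le> min (\<epsilon>/2) (r/8)"
    "\<And>s1. s1 \<in> X' \<Longrightarrow> s1 \<in> universal \<and> (\<exists>q1 w. dev (surface_over (proj s1)) (base (proj s1)) (shrink \<delta> (C y)) q1 \<and>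
       2 * norm w < \<sigma>' \<and> step (surface_over (proj s1)) \<sigma>' w q1 s1)"
    using end_open[OF t(1) d(1) sCd, of "min (\<epsilon>/2) (r/8)"] by metis
  show ?thesis
  proof (rule that[OF X(1,2) X'(1,2)])
    fix s1 t1 t1' assume s1: "s1 \<in> X" and t1: "t1 \<in> X'" "proj t1 = relocate s1"
      and t1': "t1' \<in> points (surface_over (proj s1))" "basepoint_change s1 t1' = t1"
    let ?Q1 = "surface_over (proj s1)"
    have u1: "s1 \<in> universal" using X(5)[OF s1] by blast
    note Q1 = PS[OF proj_moduli[OF u1]]
    obtain q1 w where q1: "2 * norm w < \<sigma>" "dev ?Q1 (base (proj s1)) (shrink \<delta> \<Gamma>) q1"
      and live: "\<forall>C'\<in>C ` Y. \<exists>e q. dev ?Q1 q1 (shrink \<delta> C') e \<and> step ?Q1 \<sigma> w e q \<and> dev ?Q1 s1 (shrink (2 * \<delta>) C') q"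
      using X(5)[OF s1] by blast
    then have "\<forall>z\<in>Y. \<exists>e q. dev ?Q1 q1 (shrink \<delta> (C z)) e \<and> step ?Q1 \<sigma> w e q \<and> dev ?Q1 s1 (shrink (2 * \<delta>) (C z)) q"
      by blast
    then obtain e q where eq: "\<And>z. z \<in> Y \<Longrightarrow> dev ?Q1 q1 (shrink \<delta> (C z)) (e z) \<and> step ?Q1 \<sigma> w (e z) (q z) \<and>
        dev ?Q1 s1 (shrink (2 * \<delta>) (C z)) (q z)" by metis
    have "2 * norm v < \<rho>" if "(v, \<rho>) \<in> set (shrink \<delta> \<Gamma>)" for v \<rho>
    proof -
      obtain \<rho>' where "(v, \<rho>') \<in> set \<Gamma>" "\<rho> = \<rho>' - \<delta>" using \<open>(v, \<rho>) \<in> set (shrink \<delta> \<Gamma>)\<close> unfolding shrink_def by auto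
      moreover from this have "3 * norm v + 8 * \<delta> < \<rho>'" using d(3) by blast
      ultimately show ?thesis using d(1) norm_ge_zero[of v] by linarith
    qed
    then have "dev ?Q1 q1 (retrace (shrink \<delta> \<Gamma>)) (base (proj s1))" by (intro dev_back[OF q1(2)]) blast
    then have bk: "dev ?Q1 q1 (shrink \<delta> (retrace \<Gamma>)) (base (proj s1))" unfolding retrace_shrink .
    have dq: "dev ?Q1 (basept ?Q1) (shrink \<delta> (chain_to m z @ [(0, r)])) (e z)" if z: "z \<in> Y" for z
    proof -
      obtain p where p: "dev ?Q1 q1 (shrink \<delta> (retrace \<Gamma>)) p" "dev ?Q1 p (shrink \<delta> (chain_to m z @ [(0, r)])) (e z)"
        using eq[OF z] unfolding C_def shrink_simps(3) dev_append by blast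
      have "p = base (proj s1)" using dev_det[OF Q1 p(1) bk] .
      then show ?thesis using p(2) by simp
    qed
    have d1: "\<delta> \<le> r/2" using d(2) r_pos by simp
    obtain \<iota>1 where i1: "is_immersion ?R (g ` ?A) ?Q1 (points ?Q1) \<iota>1"
      "\<And>z y. z \<in> Y \<Longrightarrow> y \<in> ?A \<Longrightarrow> dist z y < \<eta>/2 \<Longrightarrow> step ?Q1 (r/2) (disp z y) (e z) (\<iota>1 (g y))"
      using relocated_immersion[OF Y(2,3,5) Q1 d1 dq] by blast
    obtain q1' w' where q1': "dev (surface_over (relocate s1)) (base (relocate s1)) (shrink \<delta> (C y)) q1'" "2 * norm w' < \<sigma>'"
      "step (surface_over (relocate s1)) \<sigma>' w' q1' t1" using X'(5)[OF t1(1)] unfolding t1(2) by blast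
    have Qs1: "pointed_translation_structure (?Q1\<lparr>basept := s1\<rparr>)"
      by (rule pts_basept_update[OF Q1 universal_point[OF u1]])
    note bc1 = basepoint_change_isomorphism(1)[OF u1]
    let ?h = "inv_into (points (?Q1\<lparr>basept := s1\<rparr>)) (basepoint_change s1)"
    have hi: "pointed_isomorphism (surface_over (relocate s1)) (?Q1\<lparr>basept := s1\<rparr>) ?h"
      by (rule pointed_isomorphism_inverse[OF Qs1 bc1])
    have ht: "?h t1 = t1'" unfolding t1'(2)[symmetric]
      using t1'(1) pointed_isomorphism_inj[OF bc1] by simp
    have hb: "?h (base (relocate s1)) = s1" using hi unfolding pointed_isomorphism_def by simp
    have rm: "pointed_translation_structure (surface_over (relocate s1))"
      by (rule PS[OF basepoint_change_isomorphism(2)[OF u1]])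
    have tr: "dev ?Q1 (?h a) C' (?h b)" if "dev (surface_over (relocate s1)) a C' b" for a b C'
      using dev_isomorphism[of "surface_over (relocate s1)" "?Q1\<lparr>basept := s1\<rparr>" ?h, OF _ rm that] hi
      unfolding pointed_isomorphism_def by simp
    have dh: "dev ?Q1 s1 (shrink \<delta> (C y)) (?h q1')" using tr[OF q1'(1)] unfolding hb .
    have "dev (surface_over (relocate s1)) q1' [(w', \<sigma>')] t1" using q1'(3) by simp
    from tr[OF this] have sh: "step ?Q1 \<sigma>' w' (?h q1') t1'" unfolding ht by simp
    have "slack \<delta> (shrink \<delta> (C y))" using sC[OF y(1)] by (simp add: slack_shrink)
    from dev_shrink[OF dh this] have "dev ?Q1 s1 (shrink (2 * \<delta>) (C y)) (?h q1')"
      using d(1) by (simp add: shrink_shrink)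
    then have "q y = ?h q1'" using dev_det[OF Q1] eq[OF Y(4)] by blast
    then have sh: "step ?Q1 \<sigma>' w' (q y) t1'" using sh by simp
    obtain e0 where e0: "exp_ball ?Q1 (r/2) (e y) e0"
      using chain_half(2)[OF y(1) d1 dq[OF Y(4)]] by blast
    have nw: "norm w < r/8" "norm w' < r/8" "norm w < \<epsilon>/2" "norm w' < \<epsilon>/2"
      using q1(1) q1'(2) X(4) X'(4) norm_ge_zero[of w] norm_ge_zero[of w'] by linarith+
    have n: "norm (w + w') < r/2" "norm (w + w') < \<epsilon>"
      using norm_triangle_ineq[of w w'] nw r_pos by linarith+
    have qe: "q y = e0 w"
      by (rule step_value[OF Q1 e0]) (use eq[OF Y(4)] nw r_pos in auto)
    have "step ?Q1 (r/4) w' (e0 w) (e0 (w + w'))"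
      by (rule step_add[OF e0]) (use nw r_pos in auto)
    then have "t1' = e0 (w + w')" using step_det[OF Q1 sh] qe by simp
    then have st: "step ?Q1 (r/2) (w + w') (e y) t1'" using e0 n(1) unfolding step_def by blast
    have "t1' \<in> \<iota>1 ` U"
      by (rule \<epsilon>(2)[OF Q1 i1(2)[OF Y(4)] st n(2)])
    then show "\<exists>\<iota>1. immerses R D (proj s1) \<iota>1 \<and> t1' \<in> \<iota>1 ` U"
      using i1(1) gg(3) by auto
  qed
qed

text \<open>The end of a chain depends on its vectors only; the radii decide whether it exists.\<close>

lemma dev_vectors_det:
  assumes Q: "pointed_translation_structure Q"
  shows "map fst C = map fst C' \<Longrightarrow> dev Q p C q \<Longrightarrow> dev Q p C' q' \<Longrightarrow> q = q'"
proof (induction C arbitrary: p C')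
  case (Cons a C)
  obtain v \<rho> where a: "a = (v, \<rho>)" by (cases a)
  obtain \<rho>' C2 where C': "C' = (v, \<rho>') # C2" "map fst C = map fst C2"
    using Cons.prems(1) a by (cases C') auto
  obtain m m' where "step Q \<rho> v p m" "dev Q m C q" "step Q \<rho>' v p m'" "dev Q m' C2 q'"
    using Cons.prems(2,3) a C' by auto
  then show ?case using Cons.IH[OF C'(2)] step_det[OF Q] by blast
qed simp

lemma map_fst_shrink: "map fst (shrink \<delta> C) = map fst C"
  unfolding shrink_def by (simp add: split_beta)

lemma map_fst_retrace: "map fst (retrace C) = rev (map (\<lambda>v. - v) (map fst C))"
  unfolding retrace_def by (simp add: split_beta rev_map)

text \<open>Retracing \<open>\<Gamma>\<close> from \<open>b\<close> led to \<open>p\<close>; hence \<open>\<Gamma>\<close> read from \<open>p\<close> leads to \<open>b\<close>, but it leads to \<open>s\<close>.\<close>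

lemma retrace_closes:
  assumes Q: "pointed_translation_structure Q" and G: "dev Q p \<Gamma> s" and b: "dev Q b (shrink \<delta> (retrace \<Gamma>)) p"
    and n: "\<forall>(v, \<rho>)\<in>set \<Gamma>. 3 * norm v + \<delta> < \<rho>"
  shows "b = s"
proof -
  have "2 * norm v' < \<rho>'" if mem: "(v', \<rho>') \<in> set (shrink \<delta> (retrace \<Gamma>))" for v' \<rho>'
  proof -
    obtain v \<rho> where v: "(v, \<rho>) \<in> set \<Gamma>" "v' = - v" "\<rho>' = \<rho> - norm v - \<delta>"
      using mem unfolding shrink_def retrace_def by auto
    have "3 * norm v + \<delta> < \<rho>" using n v(1) by blast
    then show ?thesis unfolding v(2,3) norm_minus_cancel by linarith
  qed
  then have "dev Q p (retrace (shrink \<delta> (retrace \<Gamma>))) b" by (intro dev_back[OF b]) blast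
  moreover have "map fst (retrace (shrink \<delta> (retrace \<Gamma>))) = map fst \<Gamma>"
    unfolding map_fst_retrace map_fst_shrink by (simp add: rev_map o_def)
  ultimately show ?thesis using dev_vectors_det[OF Q _ _ G] by blast
qed

text \<open>If \<open>\<iota> (g k) \<noteq> s\<close>, then no point near \<open>s\<close> is the image of a point near \<open>g k\<close>: follow the disk from
  \<open>s\<close> to \<open>\<iota> (g k)\<close> and then the way from \<open>s\<close> back to the basepoint. Either this loop cannot be
  developed, or it does not close up at the basepoint, and both are open conditions.\<close>

lemma avoid_point:
  assumes s: "s \<in> universal" and dp: "disk_param R A g b0 r E" and k: "k \<in> A"
    and G: "dev (surface_over (proj s)) (base (proj s)) \<Gamma> s" "\<forall>(v, \<rho>)\<in>set \<Gamma>. 4 * norm v < \<rho>"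
    and lk: "dev (surface_over (proj s)) s (disk_param.chain_to A g b0 r E (disk_param.m A g b0 r E) k @ [(0, r)]) p"
    and ps: "p \<noteq> s"
  shows "\<exists>X \<epsilon>. openin universal_topology X \<and> s \<in> X \<and> 0 < \<epsilon> \<and>
    (\<forall>s1\<in>X. \<forall>q w. dev (surface_over (proj s1)) s1 (shrink (r/2) (disk_param.chain_to A g b0 r E (disk_param.m A g b0 r E) k)) q \<longrightarrow>
       norm w < \<epsilon> \<longrightarrow> step (surface_over (proj s1)) (r/2) w q s1 \<longrightarrow> False)"
proof -
  interpret disk_param R A g b0 r E by (rule dp)
  note PS = pointed_translation_structure_surface_over
  let ?Q = "surface_over (proj s)"
  note Q = PS[OF proj_moduli[OF s]]
  have r64: "0 < r/64" using r_pos by simp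
  obtain \<delta> where d: "0 < \<delta>" "\<delta> \<le> r/64" "\<forall>(v, \<rho>)\<in>set \<Gamma>. 3 * norm v + 8 * \<delta> < \<rho>"
    using small_slack[OF G(2) r64] by blast
  define C where "C = chain_to m k @ [(0, r)]"
  define L where "L = \<Gamma> @ C @ retrace \<Gamma>"
  have sG: "slack \<epsilon> \<Gamma>" "slack \<epsilon> (retrace \<Gamma>)" if "\<epsilon> \<le> 8 * \<delta>" for \<epsilon>
    using small_slack_slack[OF d(3) that] by auto
  have sC: "slack \<epsilon> C" if "\<epsilon> \<le> 8 * \<delta>" for \<epsilon>
    unfolding C_def by (rule chain_end_slack[OF k]) (use that d(2) r_pos in linarith)
  have sL: "slack \<epsilon> L" if "\<epsilon> \<le> 8 * \<delta>" for \<epsilon>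
    unfolding L_def using sG[OF that] sC[OF that] by simp
  have s2: "slack (2 * \<delta>) \<Gamma>" using sG(1) d(1) by simp
  have lC: "dev ?Q s C p" using lk unfolding C_def .
  have "finite {C}" by simp
  moreover have "slack (2 * \<delta>) C' \<and> (\<exists>q. dev ?Q s C' q)" if "C' \<in> {C}" for C'
    using that sC[of "2 * \<delta>"] lC d(1) by auto
  ultimately obtain X \<sigma> where X: "openin universal_topology X" "s \<in> X" "0 < \<sigma>" "\<sigma> \<le> \<delta>"
    "\<And>s1. s1 \<in> X \<Longrightarrow> s1 \<in> universal \<and> (\<exists>q1 w. 2 * norm w < \<sigma> \<and>
       dev (surface_over (proj s1)) (base (proj s1)) (shrink \<delta> \<Gamma>) q1 \<and> step (surface_over (proj s1)) \<sigma> w q1 s1 \<and>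
       (\<forall>C'\<in>{C}. \<exists>e q. dev (surface_over (proj s1)) q1 (shrink \<delta> C') e \<and> step (surface_over (proj s1)) \<sigma> w e q \<and>
          dev (surface_over (proj s1)) s1 (shrink (2 * \<delta>) C') q))"
    using relocated_live[OF s d(1) s2 G(1), of "{C}" \<delta>] d(1) by metis
  \<comment> \<open>the loop \<open>L\<close> develops near \<open>s\<close> and ends close to the basepoint if a forbidden coincidence occurs\<close>
  have loop: "\<exists>x. dev (surface_over (proj s1)) (base (proj s1)) (shrink (2 * \<delta>) L) x \<and>
      step (surface_over (proj s1)) \<delta> (- w) (base (proj s1)) x"
    if s1: "s1 \<in> X" and q: "dev (surface_over (proj s1)) s1 (shrink (r/2) (chain_to m k)) q"
      and w: "norm w < \<delta>" and st: "step (surface_over (proj s1)) (r/2) w q s1" for s1 q w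
  proof -
    let ?Q1 = "surface_over (proj s1)"
    have u1: "s1 \<in> universal" using X(5)[OF s1] by blast
    note Q1 = PS[OF proj_moduli[OF u1]]
    obtain q1 w0 e qk where q1: "2 * norm w0 < \<sigma>" "dev ?Q1 (base (proj s1)) (shrink \<delta> \<Gamma>) q1" "step ?Q1 \<sigma> w0 q1 s1"
      and e: "dev ?Q1 q1 (shrink \<delta> C) e" "step ?Q1 \<sigma> w0 e qk" "dev ?Q1 s1 (shrink (2 * \<delta>) C) qk"
      using X(5)[OF s1] by blast
    have d2: "2 * \<delta> \<le> r/2" "\<delta> \<le> r/2" using d(1,2) r_pos by linarith+
    have "qk = q" using dev_det[OF Q1 chain_half(1)[OF k d2(1) e(3)[unfolded C_def]] q] .
    note e = e[unfolded this]
    obtain e0 where e0: "exp_ball ?Q1 (r/2) e e0" using chain_half(2)[OF k d2(2) e(1)[unfolded C_def]] by blast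
    have e00: "e0 0 = e" using e0 unfolding exp_ball_def by blast
    have nw: "norm w0 < r/64" "norm w < r/64" using q1(1) X(4) w d(2) norm_ge_zero[of w0] by linarith+
    have nw0: "norm (w0 + w) < r/32" using norm_triangle_ineq[of w0 w] nw by linarith
    have qe: "q = e0 w0" by (rule step_value[OF Q1 e0 e(2)]) (use nw r_pos in linarith)
    have "step ?Q1 (r/4) w (e0 w0) (e0 (w0 + w))"
      by (rule step_add[OF e0]) (use nw r_pos in linarith)+
    then have se: "s1 = e0 (w0 + w)" using step_det[OF Q1 st] qe by simp
    have b1: "step ?Q1 (\<sigma> - norm w0) (- w0) s1 q1" by (rule step_back[OF q1(3,1)])
    have "step ?Q1 (r/8) (- w0) (e0 (w0 + w)) (e0 ((w0 + w) + - w0))"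
      by (rule step_add[OF e0]) (use nw nw0 r_pos norm_minus_cancel[of w0] in linarith)+
    then have qe1: "q1 = e0 w" using step_det[OF Q1 b1] se by simp
    have "step ?Q1 \<delta> (- w) (e0 w) (e0 (w + - w))"
      by (rule step_add[OF e0]) (use nw w d(2) r_pos norm_minus_cancel[of w] in linarith)+
    then have b2: "step ?Q1 \<delta> (- w) q1 e" using qe1 e00 by simp
    have "2 * norm v < \<rho>" if "(v, \<rho>) \<in> set (shrink \<delta> \<Gamma>)" for v \<rho>
    proof -
      obtain \<rho>' where "(v, \<rho>') \<in> set \<Gamma>" "\<rho> = \<rho>' - \<delta>" using \<open>(v, \<rho>) \<in> set (shrink \<delta> \<Gamma>)\<close> unfolding shrink_def by auto
      moreover from this have "3 * norm v + 8 * \<delta> < \<rho>'" using d(3) by blast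
      ultimately show ?thesis using d(1) norm_ge_zero[of v] by linarith
    qed
    then have "dev ?Q1 q1 (retrace (shrink \<delta> \<Gamma>)) (base (proj s1))" by (intro dev_back[OF q1(2)]) blast
    then have bk: "dev ?Q1 q1 (shrink \<delta> (retrace \<Gamma>)) (base (proj s1))" unfolding retrace_shrink .
    have "slack \<delta> (shrink \<delta> (retrace \<Gamma>))" using sG(2)[of "2 * \<delta>"] d(1) by (simp add: slack_shrink)
    then obtain x where x: "dev ?Q1 e (shrink \<delta> (shrink \<delta> (retrace \<Gamma>))) x" "step ?Q1 \<delta> (- w) (base (proj s1)) x"
      using dev_perturb[OF Q1 bk _ b2] by blast
    have x': "dev ?Q1 e (shrink (2 * \<delta>) (retrace \<Gamma>)) x" using x(1) by (simp add: shrink_shrink)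
    have "slack \<delta> (shrink \<delta> \<Gamma>)" "slack \<delta> (shrink \<delta> C)" using sG(1)[of "2 * \<delta>"] sC[of "2 * \<delta>"] d(1) by (simp_all add: slack_shrink)
    from dev_shrink[OF q1(2) this(1)] dev_shrink[OF e(1) this(2)]
    have "dev ?Q1 (base (proj s1)) (shrink (2 * \<delta>) \<Gamma>) q1" "dev ?Q1 q1 (shrink (2 * \<delta>) C) e"
      using d(1) by (simp_all add: shrink_shrink)
    then have "dev ?Q1 (base (proj s1)) (shrink (2 * \<delta>) L) x"
      using x' unfolding L_def shrink_simps(3) dev_append by blast
    then show ?thesis using x(2) by blast
  qed
  note S = proj_moduli[OF s]
  show ?thesis
  proof (cases "\<exists>x. dev ?Q (base (proj s)) (shrink (3 * \<delta>) L) x")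
    case False
    then have nl: "\<not> (\<exists>x. dev ?Q (base (proj s)) (shrink \<delta> (shrink (2 * \<delta>) L)) x)" by (simp add: shrink_shrink)
    have sl: "slack \<delta> (shrink (2 * \<delta>) L)" using sL[of "3 * \<delta>"] d(1) by (simp add: slack_shrink)
    obtain W where W: "openin moduli_topology W" "proj s \<in> W"
      "\<And>S1 x. S1 \<in> W \<Longrightarrow> dev (surface_over S1) (base S1) (shrink (2 * \<delta>) L) x \<Longrightarrow> False"
      using not_live_open[OF S d(1) sl nl] by blast
    show ?thesis
    proof (intro exI[of _ "X \<inter> {e \<in> universal. proj e \<in> W}"] exI[of _ \<delta>] conjI ballI allI impI)
      show "openin universal_topology (X \<inter> {e \<in> universal. proj e \<in> W})" using X(1) openin_proj[OF W(1)] by blast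
      show "s \<in> X \<inter> {e \<in> universal. proj e \<in> W}" using X(2) s W(2) by blast
      fix s1 q w assume s1: "s1 \<in> X \<inter> {e \<in> universal. proj e \<in> W}"
        and h: "dev (surface_over (proj s1)) s1 (shrink (r/2) (chain_to m k)) q" "norm w < \<delta>"
          "step (surface_over (proj s1)) (r/2) w q s1"
      then show False using loop[OF _ h] W(3)[of "proj s1"] by blast
    qed (rule d(1))
  next
    case True
    then obtain x0 where x0: "dev ?Q (base (proj s)) (shrink (3 * \<delta>) L) x0" by blast
    have "x0 \<noteq> base (proj s)"
    proof
      assume eq: "x0 = base (proj s)"
      obtain a b where ab: "dev ?Q (base (proj s)) (shrink (3 * \<delta>) \<Gamma>) a" "dev ?Q a (shrink (3 * \<delta>) C) b"
        "dev ?Q b (shrink (3 * \<delta>) (retrace \<Gamma>)) x0"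
        using x0 unfolding L_def shrink_simps(3) dev_append by blast
      have d0: "0 \<le> 3 * \<delta>" "3 * \<delta> \<le> 8 * \<delta>" using d(1) by auto
      have "a = s" using dev_det[OF Q ab(1) dev_shrink[OF G(1) sG(1)[OF d0(2)] d0(1)]] .
      then have "b = p" using dev_det[OF Q ab(2)[unfolded \<open>a = s\<close>] dev_shrink[OF lC sC[OF d0(2)] d0(1)]] by simp
      have "3 * norm v + 3 * \<delta> < \<rho>" if "(v, \<rho>) \<in> set \<Gamma>" for v \<rho>
      proof -
        have "3 * norm v + 8 * \<delta> < \<rho>" using d(3) that by blast
        then show ?thesis using d(1) by linarith
      qed
      then have "\<forall>(v, \<rho>)\<in>set \<Gamma>. 3 * norm v + 3 * \<delta> < \<rho>" by blast
      from retrace_closes[OF Q G(1) ab(3)[unfolded eq] this] have "b = s" .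
      then show False using \<open>b = p\<close> ps by simp
    qed
    moreover have sl: "slack \<delta> (shrink (3 * \<delta>) L)" using sL[of "4 * \<delta>"] d(1) by (simp add: slack_shrink)
    moreover have "0 < \<delta>/2" using d(1) by simp
    ultimately obtain W \<tau> where W: "openin moduli_topology W" "proj s \<in> W" "0 < \<tau>" "\<tau> \<le> \<delta>/2"
      "\<And>S1 q1 w. S1 \<in> W \<Longrightarrow> dev (surface_over S1) (base S1) (shrink \<delta> (shrink (3 * \<delta>) L)) q1 \<Longrightarrow>
       step (surface_over S1) \<tau> w q1 (base S1) \<Longrightarrow> False"
      using not_closed_open[OF S d(1) _ x0] by metis
    show ?thesis
    proof (intro exI[of _ "X \<inter> {e \<in> universal. proj e \<in> W}"] exI[of _ \<tau>] conjI ballI allI impI)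
      show "openin universal_topology (X \<inter> {e \<in> universal. proj e \<in> W})" using X(1) openin_proj[OF W(1)] by blast
      show "s \<in> X \<inter> {e \<in> universal. proj e \<in> W}" using X(2) s W(2) by blast
      fix s1 q w assume s1: "s1 \<in> X \<inter> {e \<in> universal. proj e \<in> W}"
        and h: "dev (surface_over (proj s1)) s1 (shrink (r/2) (chain_to m k)) q" "norm w < \<tau>"
          "step (surface_over (proj s1)) (r/2) w q s1"
      have nw: "norm w < \<delta>" "2 * norm w < \<delta>" "\<tau> \<le> \<delta> - norm w" using h(2) W(4) norm_ge_zero[of w] by linarith+
      obtain x where x: "dev (surface_over (proj s1)) (base (proj s1)) (shrink (2 * \<delta>) L) x"
        "step (surface_over (proj s1)) \<delta> (- w) (base (proj s1)) x"
        using loop[OF _ h(1) nw(1) h(3)] s1 by blast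
      have "slack (2 * \<delta>) (shrink (2 * \<delta>) L)" using sL[of "4 * \<delta>"] d(1) by (simp add: slack_shrink)
      from dev_shrink[OF x(1) this] have dx: "dev (surface_over (proj s1)) (base (proj s1)) (shrink \<delta> (shrink (3 * \<delta>) L)) x"
        using d(1) by (simp add: shrink_shrink)
      have "step (surface_over (proj s1)) (\<delta> - norm (- w)) (- (- w)) x (base (proj s1))"
        by (rule step_back[OF x(2)]) (use nw in simp)
      then have "step (surface_over (proj s1)) (\<delta> - norm w) w x (base (proj s1))" by simp
      from step_mono[OF this h(2) nw(3)] show False using W(5)[OF _ dx] s1 by blast
    qed (rule W(3))
  qed
qed

text \<open>The compact set \<open>K\<close> is covered by finitely many of the small neighbourhoods that \<open>avoid_point\<close> provides.\<close>

lemma relocate_minus: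
  assumes s: "s \<in> universal" and Rm: "R \<in> moduli"
    and D: "closed_disk (surface_over R) D" and K: "closedin (top_of (surface_over R)) K" "K \<subseteq> D"
    and i: "is_immersion (surface_over R) D ((surface_over (proj s))\<lparr>basept := s\<rparr>) (points (surface_over (proj s))) \<iota>"
    and sK: "s \<notin> \<iota> ` K"
  obtains X where "openin universal_topology X" "s \<in> X"
    "\<And>s1. s1 \<in> X \<Longrightarrow> \<exists>\<iota>1. is_immersion (surface_over R) D ((surface_over (proj s1))\<lparr>basept := s1\<rparr>)
       (points (surface_over (proj s1))) \<iota>1 \<and> s1 \<notin> \<iota>1 ` K"
proof -
  note PS = pointed_translation_structure_surface_over
  let ?R = "surface_over R" and ?Q = "surface_over (proj s)" and ?A = "cball (0 :: plane) 1"
  let ?T = "?Q\<lparr>basept := s\<rparr>"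
  note Q = PS[OF proj_moduli[OF s]]
  have T: "pointed_translation_structure ?T" by (rule pts_basept_update[OF Q universal_point[OF s]])
  obtain g b0 where gg: "continuous_map (top_of_set ?A) (top_of ?R) g" "inj_on g ?A"
    "g ` ?A = D" "b0 \<in> ?A" "g b0 = basept ?R" using closed_disk_param[OF D] by blast
  have i': "is_immersion ?R (g ` ?A) ?T (points ?T) \<iota>" using i gg(3) by simp
  obtain r E where dp: "disk_param ?R ?A g b0 r E" and rT: "\<And>y. y \<in> ?A \<Longrightarrow> \<exists>e. exp_ball ?T r (\<iota> (g y)) e"
    using immersed_disk_param[OF PS[OF Rm] T compact_cball convex_cball gg(1,2,4,5) i'] by blast
  interpret disk_param ?R ?A g b0 r E by (rule dp)
  obtain \<Gamma> where G: "dev ?Q (base (proj s)) \<Gamma> s" "\<forall>(v, \<rho>)\<in>set \<Gamma>. 4 * norm v < \<rho>"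
    using chain_to_point[OF s] .
  define C where "C z = chain_to m z @ [(0, r)]" for z
  have lC: "dev ?Q s (C z) (\<iota> (g z))" if "z \<in> ?A" for z
    using immersion_live[OF T i' rT that] unfolding C_def by simp
  define K' where "K' = {y \<in> ?A. g y \<in> K}"
  have "closedin (top_of_set ?A) K'"
    using closedin_continuous_map_preimage[OF gg(1) K(1)] unfolding K'_def by simp
  then have cK: "compact K'" using closedin_compact[OF compact_cball] by blast
  have pt: "\<exists>X \<kappa>. openin universal_topology X \<and> s \<in> X \<and> 0 < \<kappa> \<and> \<kappa> \<le> \<eta>/2 \<and>
    (\<forall>s1\<in>X. \<forall>q y'. dev (surface_over (proj s1)) s1 (shrink (r/2) (chain_to m k)) q \<longrightarrow>
       y' \<in> ?A \<longrightarrow> dist k y' < \<kappa> \<longrightarrow> step (surface_over (proj s1)) (r/2) (disp k y') q s1 \<longrightarrow> False)" if k: "k \<in> K'" for k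
  proof -
    have kA: "k \<in> ?A" "\<iota> (g k) \<noteq> s" using k sK unfolding K'_def by auto
    obtain X \<epsilon> where X: "openin universal_topology X" "s \<in> X" "0 < \<epsilon>"
      "\<And>s1 q w. s1 \<in> X \<Longrightarrow> dev (surface_over (proj s1)) s1 (shrink (r/2) (chain_to m k)) q \<Longrightarrow>
       norm w < \<epsilon> \<Longrightarrow> step (surface_over (proj s1)) (r/2) w q s1 \<Longrightarrow> False"
      using avoid_point[OF s dp kA(1) G lC[OF kA(1), unfolded C_def] kA(2)] by metis
    obtain \<kappa> where kp: "0 < \<kappa>" "\<And>y'. y' \<in> ?A \<Longrightarrow> dist k y' < \<kappa> \<Longrightarrow> norm (disp k y') < \<epsilon>"
      using disp_small[OF kA(1) X(3)] by blast
    show ?thesis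
    proof (intro exI[of _ X] exI[of _ "min \<kappa> (\<eta>/2)"] conjI ballI allI impI)
      fix s1 q y' assume h: "s1 \<in> X" "dev (surface_over (proj s1)) s1 (shrink (r/2) (chain_to m k)) q"
        "y' \<in> ?A" "dist k y' < min \<kappa> (\<eta>/2)" "step (surface_over (proj s1)) (r/2) (disp k y') q s1"
      have "norm (disp k y') < \<epsilon>" using kp(2)[OF h(3)] h(4) by simp
      then show False using X(4)[OF h(1,2) _ h(5)] by blast
    qed (use X(1,2) kp(1) \<eta>(1) in auto)
  qed
  obtain XX \<kappa> where XX: "\<And>k. k \<in> K' \<Longrightarrow> openin universal_topology (XX k) \<and> s \<in> XX k \<and> 0 < \<kappa> k \<and> \<kappa> k \<le> \<eta>/2 \<and>
    (\<forall>s1\<in>XX k. \<forall>q y'. dev (surface_over (proj s1)) s1 (shrink (r/2) (chain_to m k)) q \<longrightarrow>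
       y' \<in> ?A \<longrightarrow> dist k y' < \<kappa> k \<longrightarrow> step (surface_over (proj s1)) (r/2) (disp k y') q s1 \<longrightarrow> False)"
    using pt by metis
  have "K' \<subseteq> (\<Union>k\<in>K'. ball k (\<kappa> k))" using XX by fastforce
  then obtain F where F: "F \<subseteq> K'" "finite F" "K' \<subseteq> (\<Union>k\<in>F. ball k (\<kappa> k))"
    using compactE_image[OF cK, of K' "\<lambda>k. ball k (\<kappa> k)"] by auto
  obtain Y0 where Y0: "finite Y0" "Y0 \<subseteq> ?A" "\<And>y. y \<in> ?A \<Longrightarrow> \<exists>z\<in>Y0. dist z y < \<eta>/2" using finite_net by blast
  define Y where "Y = insert b0 (Y0 \<union> F)"
  have "F \<subseteq> ?A" using F(1) unfolding K'_def by blast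
  then have Y: "finite Y" "Y \<subseteq> ?A" "b0 \<in> Y" "F \<subseteq> Y" "\<And>y. y \<in> ?A \<Longrightarrow> \<exists>z\<in>Y. dist z y < \<eta>/2"
    using Y0 F(2) b0(1) unfolding Y_def by auto
  have r8: "0 < r/8" using r_pos by simp
  obtain \<delta> where d: "0 < \<delta>" "\<delta> \<le> r/8" "\<forall>(v, \<rho>)\<in>set \<Gamma>. 3 * norm v + 8 * \<delta> < \<rho>"
    using small_slack[OF G(2) r8] by blast
  have sG: "slack (2 * \<delta>) \<Gamma>" by (rule small_slack_slack(1)[OF d(3)]) (use d(1) in simp)
  have sC: "slack (2 * \<delta>) (C z)" if "z \<in> ?A" for z
    unfolding C_def by (rule chain_end_slack[OF that]) (use d(1,2) in simp)
  have "finite (C ` Y)" using Y(1) by blast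
  moreover have "slack (2 * \<delta>) C' \<and> (\<exists>q. dev ?Q s C' q)" if "C' \<in> C ` Y" for C'
    using that sC lC Y(2) by blast
  ultimately obtain X \<sigma> where X: "openin universal_topology X" "s \<in> X" "0 < \<sigma>"
    "\<And>s1. s1 \<in> X \<Longrightarrow> s1 \<in> universal \<and> (\<exists>q1 w. 2 * norm w < \<sigma> \<and>
       dev (surface_over (proj s1)) (base (proj s1)) (shrink \<delta> \<Gamma>) q1 \<and> step (surface_over (proj s1)) \<sigma> w q1 s1 \<and>
       (\<forall>C'\<in>C ` Y. \<exists>e q. dev (surface_over (proj s1)) q1 (shrink \<delta> C') e \<and> step (surface_over (proj s1)) \<sigma> w e q \<and>
          dev (surface_over (proj s1)) s1 (shrink (2 * \<delta>) C') q))"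
    using relocated_live[OF s d(1) sG G(1), of "C ` Y" 1] zero_less_one by metis
  let ?X = "X \<inter> (topspace universal_topology \<inter> \<Inter>(XX ` F))"
  have oX: "openin universal_topology (topspace universal_topology \<inter> \<Inter>(XX ` F))"
  proof (cases "F = {}")
    case False
    then have "openin universal_topology (\<Inter>(XX ` F))" using F(1,2) XX by (intro openin_Inter) auto
    then show ?thesis by blast
  qed auto
  show ?thesis
  proof (rule that[of ?X])
    show "openin universal_topology ?X" using X(1) oX by blast
    show "s \<in> ?X" using X(2) XX F(1) s topspace_universal by auto
    fix s1 assume s1: "s1 \<in> ?X"
    let ?Q1 = "surface_over (proj s1)"
    have u1: "s1 \<in> universal" using X(4) s1 by blast
    note Q1 = PS[OF proj_moduli[OF u1]]
    let ?T1 = "?Q1\<lparr>basept := s1\<rparr>"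
    have T1: "pointed_translation_structure ?T1" by (rule pts_basept_update[OF Q1 universal_point[OF u1]])
    have "\<forall>C'\<in>C ` Y. \<exists>q. dev ?Q1 s1 (shrink (2 * \<delta>) C') q" using X(4)[of s1] s1 by blast
    then have "\<forall>z\<in>Y. \<exists>q. dev ?Q1 s1 (shrink (2 * \<delta>) (C z)) q" by simp
    from bchoice[OF this] obtain q where q: "\<And>z. z \<in> Y \<Longrightarrow> dev ?Q1 s1 (shrink (2 * \<delta>) (C z)) (q z)" by blast
    have dq: "dev ?T1 (basept ?T1) (shrink (2 * \<delta>) (chain_to m z @ [(0, r)])) (q z)" if "z \<in> Y" for z
      using q[OF that] unfolding C_def by simp
    have d2: "2 * \<delta> \<le> r/2" using d(1,2) by simp
    obtain \<iota>1 where i1: "is_immersion ?R (g ` ?A) ?T1 (points ?T1) \<iota>1"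
      "\<And>z y. z \<in> Y \<Longrightarrow> y \<in> ?A \<Longrightarrow> dist z y < \<eta>/2 \<Longrightarrow> step ?T1 (r/2) (disp z y) (q z) (\<iota>1 (g y))"
      using relocated_immersion[OF Y(2,3,5) T1 d2 dq] by blast
    have "s1 \<notin> \<iota>1 ` K"
    proof
      assume "s1 \<in> \<iota>1 ` K"
      then obtain x where x: "x \<in> K" "s1 = \<iota>1 x" by blast
      have "x \<in> g ` ?A" using x(1) K(2) gg(3) by blast
      then obtain y where y: "y \<in> ?A" "x = g y" by blast
      then have "y \<in> K'" using x(1) unfolding K'_def by blast
      then obtain k where k: "k \<in> F" "dist k y < \<kappa> k" using F(3) by auto
      have kK: "k \<in> K'" "k \<in> Y" "k \<in> ?A" using k(1) F(1) Y(2,4) by auto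
      have "dist k y < \<eta>/2" using k(2) XX[OF kK(1)] by linarith
      then have st: "step ?Q1 (r/2) (disp k y) (q k) s1" using i1(2)[OF kK(2) y(1)] x(2) y(2) by simp
      have "dev ?Q1 s1 (shrink (r/2) (chain_to m k)) (q k)"
        using chain_half(1)[OF kK(3) d2 dq[OF kK(2)]] by simp
      moreover have "s1 \<in> XX k" using s1 k(1) by blast
      ultimately show False using XX[OF kK(1)] y(1) k(2) st by blast
    qed
    then show "\<exists>\<iota>1. is_immersion ?R D ?T1 (points ?Q1) \<iota>1 \<and> s1 \<notin> \<iota>1 ` K"
      using i1(1) gg(3) by auto
  qed
qed

section \<open>Open disks that do not immerse\<close>

text \<open>The chain to \<open>y\<close> determines the image of \<open>g y\<close>.\<close>

lemma immersion_unique_disk: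
  assumes R: "pointed_translation_structure R" and T: "pointed_translation_structure T"
    and A: "compact A" "convex (A :: plane set)" and g: "continuous_map (top_of_set A) (top_of R) g" "inj_on g A"
    and b0: "b0 \<in> A" "g b0 = basept R"
    and i: "is_immersion R (g ` A) T (points T) \<iota>" "is_immersion R (g ` A) T (points T) \<iota>'" and y: "y \<in> A"
  shows "\<iota> (g y) = \<iota>' (g y)"
proof -
  obtain r E where dp: "disk_param R A g b0 r E" and rT: "\<And>y. y \<in> A \<Longrightarrow> \<exists>e. exp_ball T r (\<iota> (g y)) e"
    using immersed_disk_param[OF R T A g b0 i(1)] by blast
  obtain r' E' where dp': "disk_param R A g b0 r' E'" and rT': "\<And>y. y \<in> A \<Longrightarrow> \<exists>e. exp_ball T r' (\<iota>' (g y)) e"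
    using immersed_disk_param[OF R T A g b0 i(2)] by blast
  define r0 where "r0 = min r r'"
  have r0: "0 < r0" "r0 \<le> r" "r0 \<le> r'"
    using disk_param.r_pos[OF dp] disk_param.r_pos[OF dp'] unfolding r0_def by auto
  have rr: "ball (0 :: plane) r0 \<subseteq> ball 0 r" using r0 by (simp add: subset_ball)
  interpret D: disk_param R A g b0 r0 E
  proof unfold_locales
    show "exp_ball R r0 (g y) (E y)" if "y \<in> A" for y
      using exp_ball_mono[OF disk_param.E[OF dp that] r0(1,2)] .
    show "inj_on (E y) (ball 0 r0)" if "y \<in> A" for y
      using inj_on_subset[OF disk_param.E_inj[OF dp that] rr] .
  qed (use R A g b0 in auto)
  have 1: "\<exists>e. exp_ball T r0 (\<iota> (g y)) e" if y: "y \<in> A" for y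
  proof -
    obtain e where "exp_ball T r (\<iota> (g y)) e" using rT[OF y] by blast
    from exp_ball_mono[OF this r0(1,2)] show ?thesis by blast
  qed
  have 2: "\<exists>e. exp_ball T r0 (\<iota>' (g y)) e" if y: "y \<in> A" for y
  proof -
    obtain e where "exp_ball T r' (\<iota>' (g y)) e" using rT'[OF y] by blast
    from exp_ball_mono[OF this r0(1,3)] show ?thesis by blast
  qed
  show ?thesis
    using dev_det[OF T D.immersion_live[OF T i(1) 1 y] D.immersion_live[OF T i(2) 2 y]] .
qed

text \<open>Invariance of domain, read in the charts of the surface.\<close>

lemma injective_image_open:
  assumes R: "pointed_translation_structure R" and B: "open (B :: plane set)"
    and g: "continuous_map (top_of_set B) (top_of R) g" "inj_on g B"
  shows "openin (top_of R) (g ` B)"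
proof (subst openin_subopen, intro ballI)
  fix x assume "x \<in> g ` B"
  then obtain y where y: "y \<in> B" "x = g y" by blast
  have xR: "x \<in> points R" using g(1) y by (auto simp: continuous_map_def Pi_iff)
  obtain \<rho> e where e: "exp_ball R \<rho> x e" "inj_on e (ball 0 \<rho>)"
    using exp_ball_exists[OF R xR openin_topspace] by metis
  have et: "tm R (ball 0 \<rho>) (\<lambda>v. v) e" "e 0 = x" "0 < \<rho>" using e unfolding exp_ball_def by auto
  have oe: "openin (top_of R) (e ` ball 0 \<rho>)" by (rule tm_open[OF R et(1) open_ball])
  let ?W = "{z \<in> B. g z \<in> e ` ball 0 \<rho>}"
  have "openin (top_of_set B) ?W" using openin_continuous_map_preimage[OF g(1) oe] by simp
  then have oW: "open ?W" using B openin_open_trans by blast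
  let ?\<zeta> = "\<lambda>z. inv_into (ball 0 \<rho>) e (g z)"
  have cg: "continuous_map (top_of_set ?W) (top_of R) g"
    by (rule continuous_map_from_subtopology_mono[OF g(1)]) blast
  have cz: "continuous_on ?W ?\<zeta>" by (rule lift_continuous[OF R et(1) open_ball e(2) cg]) blast
  have ez: "e (?\<zeta> z) = g z" "?\<zeta> z \<in> ball 0 \<rho>" if "z \<in> ?W" for z
  proof -
    have "g z \<in> e ` ball 0 \<rho>" using that by blast
    then show "e (?\<zeta> z) = g z" "?\<zeta> z \<in> ball 0 \<rho>" by (rule f_inv_into_f, rule inv_into_into)
  qed
  have iz: "inj_on ?\<zeta> ?W"
  proof (rule inj_onI)
    fix a b assume ab: "a \<in> ?W" "b \<in> ?W" "?\<zeta> a = ?\<zeta> b"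
    have "g a = e (?\<zeta> a)" by (rule ez(1)[OF ab(1), symmetric])
    also have "\<dots> = e (?\<zeta> b)" by (rule arg_cong[OF ab(3)])
    also have "\<dots> = g b" by (rule ez(1)[OF ab(2)])
    finally show "a = b" by (rule inj_onD[OF g(2)]) (use ab(1,2) in blast)+
  qed
  have oz: "open (?\<zeta> ` ?W)" by (rule invariance_of_domain[OF cz oW iz])
  have zs: "?\<zeta> ` ?W \<subseteq> ball 0 \<rho>" using ez(2) by blast
  have "openin (top_of R) (e ` ?\<zeta> ` ?W)" by (rule tm_open[OF R tm_subset[OF et(1) zs] oz])
  moreover have "e ` ?\<zeta> ` ?W = g ` ?W" unfolding image_image by (rule image_cong[OF refl ez(1)])
  moreover have "g y \<in> e ` ball 0 \<rho>" by (rule image_eqI[of _ _ 0]) (use y(2) et(2,3) in auto)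
  ultimately show "\<exists>T. openin (top_of R) T \<and> x \<in> T \<and> T \<subseteq> g ` B"
    using y by (intro exI[of _ "g ` ?W"]) auto
qed

text \<open>An open disk is exhausted by closed disks, so if it does not immerse in \<open>T\<close> then one of them
  does not, and hence one of finitely many chains in it does not live on \<open>T\<close>.\<close>

lemma open_disk_chain:
  assumes R: "pointed_translation_structure R" and U: "open_disk R U" and T: "pointed_translation_structure (T :: 'c pointed_surface)"
    and no: "\<not> (\<exists>\<iota>. is_immersion R U T (points T) \<iota>)"
  obtains C r where "0 < r" "slack (3/4 * r) C"
    "\<And>T1 \<iota>. pointed_translation_structure (T1 :: 'c pointed_surface) \<Longrightarrow> is_immersion R U T1 (points T1) \<iota> \<Longrightarrow>
       \<exists>q. dev T1 (basept T1) C q"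
    "\<not> (\<exists>q. dev T (basept T) (shrink (r/2) C) q)"
proof -
  have UP: "U \<in> PC R" and h: "subtopology (top_of R) U homeomorphic_space top_of_set (ball (0 :: plane) 1)"
    using U unfolding open_disk_def by auto
  have UR: "U \<subseteq> points R" "basept R \<in> U" using UP unfolding PC_def path_connectedin_def by auto
  have "top_of_set (ball (0 :: plane) 1) homeomorphic_space subtopology (top_of R) U"
    by (subst homeomorphic_space_sym) (rule h)
  then obtain g where g: "homeomorphic_map (top_of_set (ball (0 :: plane) 1)) (subtopology (top_of R) U) g"
    unfolding homeomorphic_space by blast
  have im: "g ` ball 0 1 = U" using homeomorphic_imp_surjective_map[OF g] UR(1) by (simp add: Int_absorb1)
  have cg: "continuous_map (top_of_set (ball (0 :: plane) 1)) (top_of R) g"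
    using homeomorphic_imp_continuous_map[OF g] by (simp add: continuous_map_in_subtopology)
  have ig: "inj_on g (ball 0 1)" using homeomorphic_imp_injective_map[OF g] by simp
  have "basept R \<in> g ` ball 0 1" using UR(2) im by simp
  then obtain b0 where b0: "norm b0 < 1" "g b0 = basept R" by (metis imageE mem_ball_0)
  have sub: "cball (0::plane) t \<subseteq> ball 0 1" if "t < 1" for t using that by auto
  have cgt: "continuous_map (top_of_set (cball 0 t)) (top_of R) g" if "t < 1" for t
    by (rule continuous_map_from_subtopology_mono[OF cg sub[OF that]])
  have igt: "inj_on g (cball 0 t)" if "t < 1" for t by (rule inj_on_subset[OF ig sub[OF that]])
  have oU: "openin (top_of R) U" using injective_image_open[OF R open_ball cg ig] unfolding im .
  have pcD: "g ` cball 0 t \<in> PC R" if t: "norm b0 \<le> t" "t < 1" for t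
  proof -
    have "path_connectedin (top_of_set (cball (0::plane) t)) (cball 0 t)"
      by (simp add: path_connectedin_subtopology convex_imp_path_connected)
    then have "path_connectedin (top_of R) (g ` cball 0 t)"
      using path_connectedin_continuous_map_image[OF cgt[OF t(2)]] by blast
    moreover have "basept R \<in> g ` cball 0 t" using b0(2) t(1) by (metis imageI mem_cball_0)
    ultimately show ?thesis unfolding PC_def by blast
  qed
  have b0t: "b0 \<in> cball 0 t" if "norm b0 \<le> t" for t using that by simp
  show ?thesis
  proof (cases "\<exists>t. norm b0 \<le> t \<and> t < 1 \<and> \<not> (\<exists>\<iota>. is_immersion R (g ` cball 0 t) T (points T) \<iota>)")
    case True
    then obtain t where t: "norm b0 \<le> t" "t < 1" "\<not> (\<exists>\<iota>. is_immersion R (g ` cball 0 t) T (points T) \<iota>)" by blast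
    let ?A = "cball (0::plane) t"
    have gAU: "g ` ?A \<subseteq> U" using im sub[OF t(2)] by blast
    obtain r where r: "0 < r" "\<And>y. y \<in> ?A \<Longrightarrow> \<exists>e. exp_ball R r (g y) e \<and> inj_on e (ball 0 r) \<and> e ` ball 0 r \<subseteq> U"
      using uniform_exp_ball[OF R compact_cball cgt[OF t(2)] gAU oU] by blast
    obtain E where EU: "\<And>y. y \<in> ?A \<Longrightarrow> exp_ball R r (g y) (E y) \<and> inj_on (E y) (ball 0 r) \<and> E y ` ball 0 r \<subseteq> U"
      using r(2) by metis
    interpret disk_param R ?A g b0 r E
      by unfold_locales (use R cgt[OF t(2)] igt[OF t(2)] b0(2) t(1) EU in auto)
    obtain Y0 where Y0: "finite Y0" "Y0 \<subseteq> ?A" "\<And>y. y \<in> ?A \<Longrightarrow> \<exists>z\<in>Y0. dist z y < \<eta>/2" using finite_net by blast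
    define Y where "Y = insert b0 Y0"
    have Y: "Y \<subseteq> ?A" "b0 \<in> Y" "\<And>y. y \<in> ?A \<Longrightarrow> \<exists>z\<in>Y. dist z y < \<eta>/2"
      using Y0 b0t[OF t(1)] unfolding Y_def by auto
    have "\<exists>z\<in>Y. \<not> (\<exists>q. dev T (basept T) (shrink (r/2) (chain_to m z @ [(0, r)])) q)"
    proof (rule ccontr)
      assume "\<not> ?thesis"
      then have "\<forall>z\<in>Y. \<exists>q. dev T (basept T) (shrink (r/2) (chain_to m z @ [(0, r)])) q" by blast
      then obtain q where q: "\<And>z. z \<in> Y \<Longrightarrow> dev T (basept T) (shrink (r/2) (chain_to m z @ [(0, r)])) (q z)" by metis
      show False using relocated_immersion[OF Y T order_refl q] t(3) by metis
    qed
    then obtain z where z: "z \<in> Y" "\<not> (\<exists>q. dev T (basept T) (shrink (r/2) (chain_to m z @ [(0, r)])) q)" by blast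
    have zA: "z \<in> ?A" using z(1) Y(1) by blast
    show ?thesis
    proof (rule that[OF r(1) _ _ z(2)])
      have "slack (3/4 * r) (chain_to m z)"
        by (rule slack_mono[OF chain_to_slack[OF zA order_refl]]) (use r(1) in simp)
      then show "slack (3/4 * r) (chain_to m z @ [(0, r)])" using r(1) by simp
      fix T1 :: "'c pointed_surface" and \<iota> assume T1: "pointed_translation_structure T1" and i: "is_immersion R U T1 (points T1) \<iota>"
      have i': "is_immersion R (g ` ?A) T1 (points T1) \<iota>" by (rule immersion_subset[OF i pcD[OF t(1,2)] gAU])
      have "exp_ball T1 r (\<iota> (g y)) (\<lambda>v. \<iota> (E y v))" if y: "y \<in> ?A" for y
      proof -
        have e: "tm R (ball 0 r) (\<lambda>v. v) (E y)" "E y 0 = g y"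
          using EU[OF y] unfolding exp_ball_def by blast+
        have eU: "E y ` ball 0 r \<subseteq> U" by (rule conjunct2[OF conjunct2[OF EU[OF y]]])
        show ?thesis unfolding exp_ball_def using immersion_tm[OF R T1 i e(1) eU] r(1) e(2) by simp
      qed
      then show "\<exists>q. dev T1 (basept T1) (chain_to m z @ [(0, r)]) q" using immersion_live[OF T1 i' _ zA] by blast
    qed
  next
    case False
    then have ex: "\<exists>\<iota>. is_immersion R (g ` cball 0 t) T (points T) \<iota>" if "norm b0 \<le> t" "t < 1" for t
      using that by blast
    define I where "I t = (SOME \<iota>. is_immersion R (g ` cball 0 t) T (points T) \<iota>)" for t
    have I: "is_immersion R (g ` cball 0 t) T (points T) (I t)" if "norm b0 \<le> t" "t < 1" for t
      unfolding I_def by (rule someI_ex[OF ex[OF that]])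
    have mono: "I t (g y) = I t' (g y)" if t: "norm b0 \<le> t" "t \<le> t'" "t' < 1" "y \<in> cball 0 t" for t t' y
    proof -
      have t1: "t < 1" "norm b0 \<le> t'" using t by auto
      have "g ` cball 0 t \<subseteq> g ` cball 0 t'" by (intro image_mono subset_cball t(2))
      from immersion_subset[OF I[OF t1(2) t(3)] pcD[OF t(1) t1(1)] this]
      show ?thesis
        using immersion_unique_disk[OF R T compact_cball convex_cball cgt[OF t1(1)] igt[OF t1(1)] b0t[OF t(1)] b0(2)
            I[OF t(1) t1(1)] _ t(4)] by blast
    qed
    \<comment> \<open>the radius of a closed disk with \<open>b0\<close> in it and \<open>y\<close> in its interior\<close>
    define \<tau> where "\<tau> y = (1 + max (norm b0) (norm y)) / 2" for y :: plane
    have tau: "norm b0 \<le> \<tau> y" "norm y < \<tau> y" "\<tau> y < 1" if "norm y < 1" for y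
    proof -
      obtain M where M: "M = max (norm b0) (norm y)" by blast
      have b: "norm b0 \<le> M" "norm y \<le> M" "M < 1" "\<tau> y = (1 + M) / 2"
        using that b0(1) unfolding M \<tau>_def by simp_all
      show "norm b0 \<le> \<tau> y" using b unfolding b(4) by argo
      show "norm y < \<tau> y" using b unfolding b(4) by argo
      show "\<tau> y < 1" using b unfolding b(4) by argo
    qed
    define \<iota> where "\<iota> x = (let y = inv_into (ball 0 1) g x in I (\<tau> y) (g y))" for x
    have val: "\<iota> (g y) = I t (g y)" if t: "norm b0 \<le> t" "t < 1" "norm y \<le> t" for y t
    proof -
      have y1: "norm y < 1" using t by simp
      have v: "\<iota> (g y) = I (\<tau> y) (g y)" unfolding \<iota>_def using ig y1 by (simp add: Let_def)
      show ?thesis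
      proof (cases "t \<le> \<tau> y")
        case True
        then show ?thesis using mono[of t "\<tau> y" y] t tau[OF y1] v by simp
      next
        case False
        then show ?thesis using mono[of "\<tau> y" t y] t tau[OF y1] v by simp
      qed
    qed
    have "is_immersion R U T (points T) \<iota>"
    proof (rule immersionI_tm[OF R T UP])
      have "\<iota> (g b0) = I (norm b0) (g b0)" by (rule val) (use b0(1) in auto)
      also have "\<dots> = basept T" using I[OF order_refl b0(1)] b0(2) unfolding is_immersion_def by simp
      finally show "\<iota> (basept R) = basept T" using b0(2) by simp
      fix s assume "s \<in> U"
      then have "s \<in> g ` ball 0 1" using im by simp
      then obtain y where y: "norm y < 1" "s = g y" by (metis imageE mem_ball_0)
      let ?B = "ball (0::plane) (\<tau> y)"
      have B: "?B \<subseteq> ball 0 1" using tau(3)[OF y(1)] by auto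
      have oB: "openin (top_of R) (g ` ?B)"
        by (rule injective_image_open[OF R open_ball continuous_map_from_subtopology_mono[OF cg B] inj_on_subset[OF ig B]])
      have "s \<in> g ` ?B" using y tau(2)[OF y(1)] by simp
      then obtain \<rho> e where e: "exp_ball R \<rho> s e" "e ` ball 0 \<rho> \<subseteq> g ` ?B" "inj_on e (ball 0 \<rho>)"
        using exp_ball_exists[OF R _ oB] by metis
      have et: "tm R (ball 0 \<rho>) (\<lambda>v. v) e" "e 0 = s" "0 < \<rho>" using e(1) unfolding exp_ball_def by auto
      have "g ` ?B \<subseteq> g ` cball 0 (\<tau> y)" by (intro image_mono ball_subset_cball)
      then have ec: "e ` ball 0 \<rho> \<subseteq> g ` cball 0 (\<tau> y)" using e(2) by blast
      have t2: "tm T (ball 0 \<rho>) (\<lambda>v. v) (\<lambda>v. I (\<tau> y) (e v))"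
        by (rule immersion_tm[OF R T I[OF tau(1,3)[OF y(1)]] et(1) ec])
      have v: "\<iota> (e w) = I (\<tau> y) (e w)" if w: "w \<in> ball 0 \<rho>" for w
      proof -
        have "e w \<in> g ` ?B" by (rule subsetD[OF e(2) imageI[OF w]])
        then obtain y' where y': "e w = g y'" "y' \<in> ?B" by (rule imageE)
        have "norm y' \<le> \<tau> y" using y'(2) by simp
        from val[OF tau(1,3)[OF y(1)] this] show ?thesis unfolding y'(1) .
      qed
      show "\<exists>G e e' a. open G \<and> a \<in> G \<and> e a = s \<and> tm R G (\<lambda>v. v) e \<and> inj_on e G \<and>
        tm T G (\<lambda>v. v) e' \<and> (\<forall>w\<in>G. e w \<in> U \<longrightarrow> \<iota> (e w) = e' w)"
      proof (intro exI conjI ballI impI)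
        show "0 \<in> ball (0::plane) \<rho>" using et(3) by simp
        show "\<iota> (e w) = I (\<tau> y) (e w)" if "w \<in> ball 0 \<rho>" for w using v[OF that] .
      qed (use et e(3) t2 in auto)
    qed
    then show ?thesis using no by blast
  qed
qed

text \<open>On the surface at \<open>s\<close>, the way \<open>\<Gamma>\<close> to \<open>s\<close> followed by a chain that does not live there cannot be read. This
  persists on nearby surfaces, while an immersion at \<open>s\<^sub>1\<close> would allow the chain to be read at \<open>s\<^sub>1\<close> and so, after a small displacement, at the end of \<open>\<Gamma>\<close>.\<close>

lemma relocate_not:
  assumes s: "s \<in> universal" and R: "R \<in> moduli" and U: "open_disk (surface_over R) U"
    and no: "\<not> (\<exists>\<iota>. is_immersion (surface_over R) U ((surface_over (proj s))\<lparr>basept := s\<rparr>)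
       (points (surface_over (proj s))) \<iota>)"
  obtains X where "openin universal_topology X" "s \<in> X"
    "\<And>s1 \<iota>1. s1 \<in> X \<Longrightarrow> is_immersion (surface_over R) U ((surface_over (proj s1))\<lparr>basept := s1\<rparr>)
       (points (surface_over (proj s1))) \<iota>1 \<Longrightarrow> False"
proof -
  note PS = pointed_translation_structure_surface_over
  let ?R = "surface_over R" and ?Q = "surface_over (proj s)"
  let ?T = "?Q\<lparr>basept := s\<rparr>"
  note S = proj_moduli[OF s]
  note Q = PS[OF S]
  have T: "pointed_translation_structure ?T" by (rule pts_basept_update[OF Q universal_point[OF s]])
  have no': "\<not> (\<exists>\<iota>. is_immersion ?R U ?T (points ?T) \<iota>)" using no by simp
  obtain C r where C: "0 < r" "slack (3/4 * r) C"
    "\<And>T1 \<iota>. pointed_translation_structure (T1 :: epoint pointed_surface) \<Longrightarrow> is_immersion ?R U T1 (points T1) \<iota> \<Longrightarrow>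
       \<exists>q. dev T1 (basept T1) C q"
    "\<not> (\<exists>q. dev ?T (basept ?T) (shrink (r/2) C) q)"
    using open_disk_chain[OF PS[OF R] U T no'] by metis
  obtain \<Gamma> where G: "dev ?Q (base (proj s)) \<Gamma> s" "\<forall>(v, \<rho>)\<in>set \<Gamma>. 4 * norm v < \<rho>"
    using chain_to_point[OF s] .
  have r8: "0 < r/8" using C(1) by simp
  obtain \<delta> where d: "0 < \<delta>" "\<delta> \<le> r/8" "\<forall>(v, \<rho>)\<in>set \<Gamma>. 3 * norm v + 8 * \<delta> < \<rho>"
    using small_slack[OF G(2) r8] by blast
  have sG: "slack (2 * \<delta>) \<Gamma>" "slack \<delta> \<Gamma>" using small_slack_slack(1)[OF d(3)] d(1) by auto
  \<comment> \<open>radii between those of \<open>C\<close>, which the immersion provides, and \<open>shrink (r/2) C\<close>, which fails at \<open>s\<close>\<close>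
  define L where "L = shrink \<delta> \<Gamma> @ shrink (r/2 - \<delta>) C"
  have "slack (r/2) C" by (rule slack_mono[OF C(2)]) (use C(1) in simp)
  then have sL: "slack \<delta> L" using sG(1) unfolding L_def by (simp add: slack_shrink)
  have "\<not> (\<exists>q. dev ?Q (base (proj s)) (shrink \<delta> L) q)"
  proof
    assume "\<exists>q. dev ?Q (base (proj s)) (shrink \<delta> L) q"
    then obtain a q where a: "dev ?Q (base (proj s)) (shrink (2 * \<delta>) \<Gamma>) a" "dev ?Q a (shrink (r/2) C) q"
      unfolding L_def by (auto simp: dev_append shrink_shrink)
    have "a = s" using dev_det[OF Q a(1) dev_shrink[OF G(1) sG(1)]] d(1) by simp
    then show False using a(2) C(4) by auto
  qed
  then obtain W where W: "openin moduli_topology W" "proj s \<in> W"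
    "\<And>S1 q1. S1 \<in> W \<Longrightarrow> dev (surface_over S1) (base S1) L q1 \<Longrightarrow> False"
    using not_live_open[OF S d(1) sL] by blast
  obtain X \<sigma> where X: "openin universal_topology X" "s \<in> X" "0 < \<sigma>" "\<sigma> \<le> \<delta>"
    "\<And>s1. s1 \<in> X \<Longrightarrow> s1 \<in> universal \<and> (\<exists>q1 w. dev (surface_over (proj s1)) (base (proj s1)) (shrink \<delta> \<Gamma>) q1 \<and>
       2 * norm w < \<sigma> \<and> step (surface_over (proj s1)) \<sigma> w q1 s1)"
    using end_open[OF s d(1) sG(2) G(1) d(1)] by metis
  show ?thesis
  proof (rule that[of "X \<inter> {e \<in> universal. proj e \<in> W}"])
    show "openin universal_topology (X \<inter> {e \<in> universal. proj e \<in> W})" using X(1) openin_proj[OF W(1)] by blast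
    show "s \<in> X \<inter> {e \<in> universal. proj e \<in> W}" using X(2) s W(2) by blast
    fix s1 \<iota>1 assume s1: "s1 \<in> X \<inter> {e \<in> universal. proj e \<in> W}"
      and i: "is_immersion ?R U ((surface_over (proj s1))\<lparr>basept := s1\<rparr>) (points (surface_over (proj s1))) \<iota>1"
    let ?Q1 = "surface_over (proj s1)"
    have u1: "s1 \<in> universal" using s1 by blast
    note Q1 = PS[OF proj_moduli[OF u1]]
    have T1: "pointed_translation_structure (?Q1\<lparr>basept := s1\<rparr>)" by (rule pts_basept_update[OF Q1 universal_point[OF u1]])
    have "is_immersion ?R U (?Q1\<lparr>basept := s1\<rparr>) (points (?Q1\<lparr>basept := s1\<rparr>)) \<iota>1" using i by simp
    from C(3)[OF T1 this] obtain q where q: "dev ?Q1 s1 C q" by auto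
    obtain q1 w where q1: "dev ?Q1 (base (proj s1)) (shrink \<delta> \<Gamma>) q1" "2 * norm w < \<sigma>" "step ?Q1 \<sigma> w q1 s1"
      using X(5) s1 by blast
    define \<tau> where "\<tau> = \<sigma> - norm w"
    have tt: "0 \<le> \<tau>" "\<tau> \<le> \<delta>" using q1(2) X(4) norm_ge_zero[of w] unfolding \<tau>_def by linarith+
    have b: "step ?Q1 \<tau> (- w) s1 q1" unfolding \<tau>_def by (rule step_back[OF q1(3,2)])
    have "slack \<tau> C" by (rule slack_mono[OF C(2)]) (use tt d(2) C(1) in linarith)
    then obtain q' where q': "dev ?Q1 q1 (shrink \<tau> C) q'" using dev_perturb[OF Q1 q _ b] by blast
    have "slack (r/2 - \<delta> - \<tau>) (shrink \<tau> C)"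
      unfolding slack_shrink by (rule slack_mono[OF C(2)]) (use d(1) C(1) in simp)
    from dev_shrink[OF q' this] have "dev ?Q1 q1 (shrink (r/2 - \<delta>) C) q'"
      using tt d(2) C(1) by (simp add: shrink_shrink)
    then have "dev ?Q1 (base (proj s1)) L q'" using q1(1) unfolding L_def dev_append by blast
    then show False using W(3)[of "proj s1"] s1 by blast
  qed
qed

section \<open>Continuity of the change of basepoint\<close>

lemma basepoint_change_self:
  assumes s: "s \<in> universal"
  shows "basepoint_change s s = base (relocate s)"
  using basepoint_change_isomorphism(1)[OF s] unfolding pointed_isomorphism_def by simp

lemma basepoint_change_inj:
  assumes s: "s \<in> universal" and "x \<in> points (surface_over (proj s))" "y \<in> points (surface_over (proj s))"
    and "basepoint_change s x = basepoint_change s y"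
  shows "x = y"
proof -
  have "inj_on (basepoint_change s) (points (surface_over (proj s)))"
    using pointed_isomorphism_inj[OF basepoint_change_isomorphism(1)[OF s]] by simp
  from inj_onD[OF this assms(4,2,3)] show ?thesis .
qed

lemma immersion_points: "is_immersion S A T B \<iota> \<Longrightarrow> x \<in> A \<Longrightarrow> \<iota> x \<in> B"
proof -
  assume i: "is_immersion S A T B \<iota>" and x: "x \<in> A"
  have c: "continuous_map (subtopology (top_of S) A) (subtopology (top_of T) B) \<iota>" and "A \<subseteq> points S"
    using i unfolding is_immersion_def PC_def path_connectedin_def by auto
  then have "x \<in> topspace (subtopology (top_of S) A)" using x by auto
  from funcset_mem[OF continuous_map_funspace[OF c] this] show "\<iota> x \<in> B" by simp
qed

text \<open>The map \<open>\<beta>\<^sub>s\<close> identifies the fiber of \<open>s\<close>, based at \<open>s\<close>, with the surface \<open>relocate s\<close>. Immersions can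
  therefore be taken into the former, where all basepoints live on the same surface.\<close>

lemma immerses_relocate:
  assumes s: "s \<in> universal"
    and i: "is_immersion (surface_over R) D ((surface_over (proj s))\<lparr>basept := s\<rparr>) (points (surface_over (proj s))) \<iota>"
  shows "immerses R D (relocate s) (\<lambda>x. basepoint_change s (\<iota> x))"
proof -
  have T: "pointed_translation_structure ((surface_over (proj s))\<lparr>basept := s\<rparr>)"
    by (rule pts_basept_update[OF pointed_translation_structure_surface_over[OF proj_moduli[OF s]] universal_point[OF s]])
  have i': "is_immersion (surface_over R) D ((surface_over (proj s))\<lparr>basept := s\<rparr>)
    (points ((surface_over (proj s))\<lparr>basept := s\<rparr>)) \<iota>" using i by simp
  show ?thesis by (rule immersion_isomorphism[OF T i' basepoint_change_isomorphism(1)[OF s]])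
qed

lemma immerses_relocateE:
  assumes s: "s \<in> universal" and i: "immerses R D (relocate s) \<iota>"
  obtains \<iota>0 where
    "is_immersion (surface_over R) D ((surface_over (proj s))\<lparr>basept := s\<rparr>) (points (surface_over (proj s))) \<iota>0"
    "\<And>x. x \<in> D \<Longrightarrow> \<iota> x = basepoint_change s (\<iota>0 x)"
proof -
  let ?T = "(surface_over (proj s))\<lparr>basept := s\<rparr>"
  let ?h = "inv_into (points ?T) (basepoint_change s)"
  have T: "pointed_translation_structure ?T"
    by (rule pts_basept_update[OF pointed_translation_structure_surface_over[OF proj_moduli[OF s]] universal_point[OF s]])
  note b = basepoint_change_isomorphism(1)[OF s]
  have Q: "pointed_translation_structure (surface_over (relocate s))"
    by (rule pointed_translation_structure_surface_over[OF basepoint_change_isomorphism(2)[OF s]])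
  have "is_immersion (surface_over R) D ?T (points ?T) (\<lambda>x. ?h (\<iota> x))"
    by (rule immersion_isomorphism[OF Q i pointed_isomorphism_inverse[OF T b]])
  moreover have "\<iota> x = basepoint_change s (?h (\<iota> x))" if "x \<in> D" for x
  proof -
    have "\<iota> x \<in> basepoint_change s ` points ?T"
      using immersion_points[OF i that] pointed_isomorphism_points[OF b] by simp
    then show ?thesis by (simp add: f_inv_into_f)
  qed
  ultimately show thesis using that[of "\<lambda>x. ?h (\<iota> x)"] by simp
qed

lemma basepoint_change_image_iff:
  assumes s: "s \<in> universal" and x: "x \<in> points (surface_over (proj s))"
    and i: "is_immersion (surface_over R) D ((surface_over (proj s))\<lparr>basept := s\<rparr>) (points (surface_over (proj s))) \<iota>0"
    and e: "\<And>x. x \<in> D \<Longrightarrow> \<iota> x = basepoint_change s (\<iota>0 x)" and U: "U \<subseteq> D"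
  shows "basepoint_change s x \<in> \<iota> ` U \<longleftrightarrow> x \<in> \<iota>0 ` U"
proof
  assume "basepoint_change s x \<in> \<iota> ` U"
  then obtain u where u: "u \<in> U" "basepoint_change s x = \<iota> u" by blast
  have uD: "u \<in> D" using u(1) U by blast
  have "basepoint_change s x = basepoint_change s (\<iota>0 u)" using u(2) e[OF uD] by simp
  from basepoint_change_inj[OF s x immersion_points[OF i uD] this] show "x \<in> \<iota>0 ` U" using u(1) by blast
next
  assume "x \<in> \<iota>0 ` U"
  then obtain u where u: "u \<in> U" "x = \<iota>0 u" by blast
  then have "\<iota> u = basepoint_change s x" using e[of u] U by blast
  then show "basepoint_change s x \<in> \<iota> ` U" using u(1) by (metis imageI)
qed

text \<open>The preimage of each defining open set of the moduli space is open by one of the preceding lemmas. A surface receives a closed disk precisely if its basepoint is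
  in the image of the interior of the disk, as the basepoint goes to the basepoint.\<close>

lemma continuous_map_relocate: "continuous_map universal_topology moduli_topology relocate"
proof -
  have op: "openin universal_topology {s \<in> universal. relocate s \<in> W}"
    if loc: "\<And>s. s \<in> universal \<Longrightarrow> relocate s \<in> W \<Longrightarrow>
      \<exists>X. openin universal_topology X \<and> s \<in> X \<and> (\<forall>s1\<in>X. s1 \<in> universal \<longrightarrow> relocate s1 \<in> W)" for W
  proof (subst openin_subopen, intro ballI)
    fix s assume "s \<in> {s \<in> universal. relocate s \<in> W}"
    then obtain X where X: "openin universal_topology X" "s \<in> X" "\<forall>s1\<in>X. s1 \<in> universal \<longrightarrow> relocate s1 \<in> W"
      using loc by blast
    have "X \<subseteq> universal" using openin_subset[OF X(1)] topspace_universal by simp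
    then show "\<exists>T. openin universal_topology T \<and> s \<in> T \<and> T \<subseteq> {s \<in> universal. relocate s \<in> W}" using X by blast
  qed
  have md: "relocate s \<in> moduli" if "s \<in> universal" for s by (rule basepoint_change_isomorphism(2)[OF that])
  have 1: "openin universal_topology {s \<in> universal. relocate s \<in> moduli}"
    using openin_topspace[of universal_topology] topspace_universal md by (simp cong: conj_cong)
  have plus: "\<exists>X. openin universal_topology X \<and> s \<in> X \<and>
      (\<forall>s1\<in>X. s1 \<in> universal \<longrightarrow> (\<exists>\<iota>1. immerses R D (relocate s1) \<iota>1 \<and> base (relocate s1) \<in> \<iota>1 ` U))"
    if s: "s \<in> universal" and R: "R \<in> moduli" and D: "closed_disk (surface_over R) D"
      and U: "openin (top_of (surface_over R)) U" "U \<subseteq> D"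
      and i: "immerses R D (relocate s) \<iota>" "base (relocate s) \<in> \<iota> ` U" for s R D U \<iota>
  proof -
    obtain \<iota>0 where i0: "is_immersion (surface_over R) D ((surface_over (proj s))\<lparr>basept := s\<rparr>) (points (surface_over (proj s))) \<iota>0"
      "\<And>x. x \<in> D \<Longrightarrow> \<iota> x = basepoint_change s (\<iota>0 x)" using immerses_relocateE[OF s i(1)] by blast
    have "s \<in> \<iota>0 ` U"
      using basepoint_change_image_iff[OF s universal_point[OF s] i0 U(2)] i(2) basepoint_change_self[OF s] by simp
    from relocate_plus[OF s s refl R D U i0(1) this] obtain X X' where X: "openin universal_topology X" "s \<in> X"
      "openin universal_topology X'" "s \<in> X'"
      "\<And>s1 s1'. s1 \<in> X \<Longrightarrow> s1' \<in> X' \<Longrightarrow> proj s1' = proj s1 \<Longrightarrow>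
        \<exists>\<iota>1. is_immersion (surface_over R) D ((surface_over (proj s1))\<lparr>basept := s1\<rparr>) (points (surface_over (proj s1))) \<iota>1 \<and>
          s1' \<in> \<iota>1 ` U" by blast
    show ?thesis
    proof (intro exI[of _ "X \<inter> X'"] conjI ballI impI)
      show "openin universal_topology (X \<inter> X')" using X(1,3) by blast
      show "s \<in> X \<inter> X'" using X(2,4) by (rule IntI)
      fix s1 assume s1: "s1 \<in> X \<inter> X'" "s1 \<in> universal"
      then obtain \<iota>1 where i1: "is_immersion (surface_over R) D ((surface_over (proj s1))\<lparr>basept := s1\<rparr>) (points (surface_over (proj s1))) \<iota>1"
          "s1 \<in> \<iota>1 ` U" using X(5)[of s1 s1] by blast
      have "base (relocate s1) \<in> (\<lambda>x. basepoint_change s1 (\<iota>1 x)) ` U"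
        using basepoint_change_image_iff[OF s1(2) universal_point[OF s1(2)] i1(1) refl U(2)] i1(2)
          basepoint_change_self[OF s1(2)] by simp
      then show "\<exists>\<iota>1. immerses R D (relocate s1) \<iota>1 \<and> base (relocate s1) \<in> \<iota>1 ` U"
        using immerses_relocate[OF s1(2) i1(1)] by blast
    qed
  qed
  have 2: "openin universal_topology {s \<in> universal. relocate s \<in> M_plus R D U}"
    if "R \<in> moduli" "closed_disk (surface_over R) D" "openin (top_of (surface_over R)) U" "U \<subseteq> D" for R D U
  proof (rule op)
    fix s assume s: "s \<in> universal" and "relocate s \<in> M_plus R D U"
    then obtain \<iota> where i: "immerses R D (relocate s) \<iota>" "base (relocate s) \<in> \<iota> ` U" unfolding M_plus_def by blast
    from plus[OF s that i] show "\<exists>X. openin universal_topology X \<and> s \<in> X \<and> (\<forall>s1\<in>X. s1 \<in> universal \<longrightarrow> relocate s1 \<in> M_plus R D U)"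
      using md unfolding M_plus_def by blast
  qed
  have 3: "openin universal_topology {s \<in> universal. relocate s \<in> M_disk R D}"
    if R: "R \<in> moduli" and D: "closed_disk (surface_over R) D" for R D
  proof -
    let ?U = "top_of (surface_over R) interior_of D"
    have "M_disk R D = M_plus R D ?U"
    proof (intro set_eqI iffI)
      fix S assume "S \<in> M_disk R D"
      then obtain \<iota> where i: "S \<in> moduli" "immerses R D S \<iota>" unfolding M_disk_def by blast
      have "basept (surface_over R) \<in> ?U" using D unfolding closed_disk_def by blast
      moreover have "\<iota> (basept (surface_over R)) = base S" using i(2) unfolding is_immersion_def by blast
      ultimately have "base S \<in> \<iota> ` ?U" by (metis imageI)
      then show "S \<in> M_plus R D ?U" using i unfolding M_plus_def by blast
    qed (auto simp: M_plus_def M_disk_def)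
    then show ?thesis using 2[OF R D openin_interior_of interior_of_subset] by simp
  qed
  have 4: "openin universal_topology {s \<in> universal. relocate s \<in> M_not_disk R U}"
    if R: "R \<in> moduli" and U: "open_disk (surface_over R) U" for R U
  proof (rule op)
    fix s assume s: "s \<in> universal" and "relocate s \<in> M_not_disk R U"
    then have "\<not> (\<exists>\<iota>. is_immersion (surface_over R) U ((surface_over (proj s))\<lparr>basept := s\<rparr>) (points (surface_over (proj s))) \<iota>)"
      using immerses_relocate[OF s] unfolding M_not_disk_def by blast
    from relocate_not[OF s R U this] obtain X where X: "openin universal_topology X" "s \<in> X"
      "\<And>s1 \<iota>1. s1 \<in> X \<Longrightarrow> is_immersion (surface_over R) U ((surface_over (proj s1))\<lparr>basept := s1\<rparr>)
         (points (surface_over (proj s1))) \<iota>1 \<Longrightarrow> False" by metis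
    show "\<exists>X. openin universal_topology X \<and> s \<in> X \<and> (\<forall>s1\<in>X. s1 \<in> universal \<longrightarrow> relocate s1 \<in> M_not_disk R U)"
    proof (intro exI[of _ X] conjI ballI impI)
      fix s1 assume s1: "s1 \<in> X" "s1 \<in> universal"
      have False if "immerses R U (relocate s1) \<iota>" for \<iota>
        using immerses_relocateE[OF s1(2) that] X(3)[OF s1(1)] by metis
      then show "relocate s1 \<in> M_not_disk R U" using md[OF s1(2)] unfolding M_not_disk_def by blast
    qed (rule X)+
  qed
  have 5: "openin universal_topology {s \<in> universal. relocate s \<in> M_minus R D K}"
    if R: "R \<in> moduli" and D: "closed_disk (surface_over R) D" and K: "closedin (top_of (surface_over R)) K" "K \<subseteq> D" for R D K
  proof (rule op)
    fix s assume s: "s \<in> universal" and "relocate s \<in> M_minus R D K"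
    then obtain \<iota> where i: "immerses R D (relocate s) \<iota>" "base (relocate s) \<notin> \<iota> ` K" unfolding M_minus_def by blast
    obtain \<iota>0 where i0: "is_immersion (surface_over R) D ((surface_over (proj s))\<lparr>basept := s\<rparr>) (points (surface_over (proj s))) \<iota>0"
      "\<And>x. x \<in> D \<Longrightarrow> \<iota> x = basepoint_change s (\<iota>0 x)" using immerses_relocateE[OF s i(1)] by blast
    have "s \<notin> \<iota>0 ` K"
      using basepoint_change_image_iff[OF s universal_point[OF s] i0 K(2)] i(2) basepoint_change_self[OF s] by simp
    from relocate_minus[OF s R D K i0(1) this] obtain X where X: "openin universal_topology X" "s \<in> X"
      "\<And>s1. s1 \<in> X \<Longrightarrow> \<exists>\<iota>1. is_immersion (surface_over R) D ((surface_over (proj s1))\<lparr>basept := s1\<rparr>)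
         (points (surface_over (proj s1))) \<iota>1 \<and> s1 \<notin> \<iota>1 ` K" by blast
    show "\<exists>X. openin universal_topology X \<and> s \<in> X \<and> (\<forall>s1\<in>X. s1 \<in> universal \<longrightarrow> relocate s1 \<in> M_minus R D K)"
    proof (intro exI[of _ X] conjI ballI impI)
      fix s1 assume s1: "s1 \<in> X" "s1 \<in> universal"
      obtain \<iota>1 where i1: "is_immersion (surface_over R) D ((surface_over (proj s1))\<lparr>basept := s1\<rparr>)
         (points (surface_over (proj s1))) \<iota>1" "s1 \<notin> \<iota>1 ` K" using X(3)[OF s1(1)] by blast
      have "base (relocate s1) \<notin> (\<lambda>x. basepoint_change s1 (\<iota>1 x)) ` K"
        using basepoint_change_image_iff[OF s1(2) universal_point[OF s1(2)] i1(1) refl K(2)] i1(2)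
          basepoint_change_self[OF s1(2)] by simp
      then show "relocate s1 \<in> M_minus R D K"
        using immerses_relocate[OF s1(2) i1(1)] md[OF s1(2)] unfolding M_minus_def by blast
    qed (rule X)+
  qed
  have eq: "relocate -` W \<inter> topspace universal_topology = {s \<in> universal. relocate s \<in> W}" for W
    using topspace_universal by blast
  have int: "U \<subseteq> D" if "U \<subseteq> top_of (surface_over R) interior_of D" for U D R
    using order_trans[OF that interior_of_subset] .
  show ?thesis
    unfolding moduli_topology_def continuous_on_generated_topo_iff eq
  proof (intro conjI allI impI)
    show "relocate ` topspace universal_topology \<subseteq> \<Union> (insert moduli
       ({M_disk R D |R D. R \<in> moduli \<and> closed_disk (surface_over R) D} \<union>
        {M_not_disk R U |R U. R \<in> moduli \<and> open_disk (surface_over R) U} \<union>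
        {M_plus R D U |R D U. R \<in> moduli \<and> closed_disk (surface_over R) D \<and>
           openin (top_of (surface_over R)) U \<and> U \<subseteq> top_of (surface_over R) interior_of D} \<union>
        {M_minus R D K |R D K. R \<in> moduli \<and> closed_disk (surface_over R) D \<and>
           closedin (top_of (surface_over R)) K \<and> K \<subseteq> D}))"
      using md topspace_universal by auto
  qed (elim insertE UnE, use 1 2[OF _ _ _ int] 3 4 5 in \<open>auto simp del: mem_Collect_eq elim!: CollectE\<close>)
qed

lemma openin_fibered_product:
  assumes PT: "\<And>s t. s \<in> universal \<Longrightarrow> t \<in> universal \<Longrightarrow> Z s t \<Longrightarrow> B s t \<Longrightarrow>
    \<exists>X Y. openin universal_topology X \<and> s \<in> X \<and> openin universal_topology Y \<and> t \<in> Y \<and>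
      (\<forall>s1\<in>X. \<forall>t1\<in>Y. s1 \<in> universal \<longrightarrow> t1 \<in> universal \<longrightarrow> Z s1 t1 \<longrightarrow> B s1 t1)"
  shows "openin (subtopology (prod_topology universal_topology universal_topology)
      {(s, t). s \<in> universal \<and> t \<in> universal \<and> Z s t}) {(s, t). s \<in> universal \<and> t \<in> universal \<and> Z s t \<and> B s t}"
proof (subst openin_subopen, intro ballI)
  fix p assume "p \<in> {(s, t). s \<in> universal \<and> t \<in> universal \<and> Z s t \<and> B s t}"
  then obtain s t where p: "p = (s, t)" "s \<in> universal" "t \<in> universal" "Z s t" "B s t" by blast
  obtain X Y where X: "openin universal_topology X" "s \<in> X" "openin universal_topology Y" "t \<in> Y"
    "\<forall>s1\<in>X. \<forall>t1\<in>Y. s1 \<in> universal \<longrightarrow> t1 \<in> universal \<longrightarrow> Z s1 t1 \<longrightarrow> B s1 t1" using PT[OF p(2-5)] by blast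
  let ?F = "{(s, t). s \<in> universal \<and> t \<in> universal \<and> Z s t}"
  have "openin (prod_topology universal_topology universal_topology) (X \<times> Y)"
    using X(1,3) by (simp add: openin_prod_Times_iff)
  then have "openin (subtopology (prod_topology universal_topology universal_topology) ?F) (X \<times> Y \<inter> ?F)"
    by (rule openin_subtopology_Int)
  moreover have "p \<in> X \<times> Y \<inter> ?F" using p X(2,4) by simp
  moreover have "X \<times> Y \<inter> ?F \<subseteq> {(s, t). s \<in> universal \<and> t \<in> universal \<and> Z s t \<and> B s t}" using X(5) by blast
  ultimately show "\<exists>T. openin (subtopology (prod_topology universal_topology universal_topology) ?F) T \<and> p \<in> T \<and>
    T \<subseteq> {(s, t). s \<in> universal \<and> t \<in> universal \<and> Z s t \<and> B s t}" by blast
qed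

text \<open>For a map \<open>f\<close> into \<open>universal\<close> it remains, once \<open>proj \<circ> f\<close> is known to be continuous, to follow the sets
  \<^const>\<open>E_plus\<close>.\<close>

lemma continuous_map_fibered_product:
  assumes fu: "\<And>s t. s \<in> universal \<Longrightarrow> t \<in> universal \<Longrightarrow> Z s t \<Longrightarrow> f s t \<in> universal"
    and fp: "\<And>s t. s \<in> universal \<Longrightarrow> t \<in> universal \<Longrightarrow> Z s t \<Longrightarrow> proj (f s t) = p s"
    and p: "continuous_map universal_topology moduli_topology p"
    and E: "\<And>s t R D U \<iota>. s \<in> universal \<Longrightarrow> t \<in> universal \<Longrightarrow> Z s t \<Longrightarrow> R \<in> moduli \<Longrightarrow> closed_disk (surface_over R) D \<Longrightarrow>
      openin (top_of (surface_over R)) U \<Longrightarrow> U \<subseteq> D \<Longrightarrow> immerses R D (p s) \<iota> \<Longrightarrow> f s t \<in> \<iota> ` U \<Longrightarrow>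
      \<exists>X Y. openin universal_topology X \<and> s \<in> X \<and> openin universal_topology Y \<and> t \<in> Y \<and>
      (\<forall>s1\<in>X. \<forall>t1\<in>Y. s1 \<in> universal \<longrightarrow> t1 \<in> universal \<longrightarrow> Z s1 t1 \<longrightarrow>
         (\<exists>\<iota>1. immerses R D (p s1) \<iota>1 \<and> f s1 t1 \<in> \<iota>1 ` U))"
  shows "continuous_map (subtopology (prod_topology universal_topology universal_topology)
      {(s, t). s \<in> universal \<and> t \<in> universal \<and> Z s t}) universal_topology (\<lambda>(s, t). f s t)"
proof -
  let ?F = "{(s, t). s \<in> universal \<and> t \<in> universal \<and> Z s t}"
  let ?T = "subtopology (prod_topology universal_topology universal_topology) ?F"
  have tF: "topspace ?T = ?F" using topspace_universal by auto
  have eq: "(\<lambda>(s, t). f s t) -` W \<inter> topspace ?T = {(s, t). s \<in> universal \<and> t \<in> universal \<and> Z s t \<and> f s t \<in> W}" for W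
    unfolding tF by auto
  have pr: "openin ?T {(s, t). s \<in> universal \<and> t \<in> universal \<and> Z s t \<and> f s t \<in> {e \<in> universal. proj e \<in> W}}"
    if W: "openin moduli_topology W" for W
  proof (rule openin_fibered_product)
    fix s t assume st: "s \<in> universal" "t \<in> universal" "Z s t" "f s t \<in> {e \<in> universal. proj e \<in> W}"
    have "openin universal_topology {s \<in> topspace universal_topology. p s \<in> W}"
      by (rule openin_continuous_map_preimage[OF p W])
    then have "openin universal_topology {s \<in> universal. p s \<in> W}" unfolding topspace_universal .
    moreover have "openin universal_topology universal" using openin_topspace[of universal_topology] topspace_universal by simp
    moreover have "s \<in> {s \<in> universal. p s \<in> W}" using st fp[OF st(1-3)] by simp
    moreover have "\<forall>s1\<in>{s \<in> universal. p s \<in> W}. \<forall>t1\<in>universal. s1 \<in> universal \<longrightarrow> t1 \<in> universal \<longrightarrow> Z s1 t1 \<longrightarrow>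
      f s1 t1 \<in> {e \<in> universal. proj e \<in> W}" using fu fp by simp
    ultimately show "\<exists>X Y. openin universal_topology X \<and> s \<in> X \<and> openin universal_topology Y \<and> t \<in> Y \<and>
      (\<forall>s1\<in>X. \<forall>t1\<in>Y. s1 \<in> universal \<longrightarrow> t1 \<in> universal \<longrightarrow> Z s1 t1 \<longrightarrow> f s1 t1 \<in> {e \<in> universal. proj e \<in> W})"
      using st(2) by blast
  qed
  have pl: "openin ?T {(s, t). s \<in> universal \<and> t \<in> universal \<and> Z s t \<and> f s t \<in> E_plus R D U}"
    if R: "R \<in> moduli" and D: "closed_disk (surface_over R) D" and U: "openin (top_of (surface_over R)) U"
      "U \<subseteq> top_of (surface_over R) interior_of D" for R D U
  proof (rule openin_fibered_product)
    fix s t assume st: "s \<in> universal" "t \<in> universal" "Z s t" "f s t \<in> E_plus R D U"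
    have UD: "U \<subseteq> D" using order_trans[OF U(2) interior_of_subset] .
    obtain \<iota> where i: "immerses R D (p s) \<iota>" "f s t \<in> \<iota> ` U"
      using st(4) unfolding E_plus_def fp[OF st(1-3), symmetric] by blast
    from E[OF st(1-3) R D U(1) UD i]
    show "\<exists>X Y. openin universal_topology X \<and> s \<in> X \<and> openin universal_topology Y \<and> t \<in> Y \<and>
      (\<forall>s1\<in>X. \<forall>t1\<in>Y. s1 \<in> universal \<longrightarrow> t1 \<in> universal \<longrightarrow> Z s1 t1 \<longrightarrow> f s1 t1 \<in> E_plus R D U)"
    proof (elim exE conjE)
      fix X Y assume X: "openin universal_topology X" "s \<in> X" "openin universal_topology Y" "t \<in> Y"
        "\<forall>s1\<in>X. \<forall>t1\<in>Y. s1 \<in> universal \<longrightarrow> t1 \<in> universal \<longrightarrow> Z s1 t1 \<longrightarrow> (\<exists>\<iota>1. immerses R D (p s1) \<iota>1 \<and> f s1 t1 \<in> \<iota>1 ` U)"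
      show ?thesis
      proof (rule exI[of _ X], rule exI[of _ Y], intro conjI ballI impI)
        fix s1 t1 assume h: "s1 \<in> X" "t1 \<in> Y" "s1 \<in> universal" "t1 \<in> universal" "Z s1 t1"
        from X(5)[rule_format, OF h] have "\<exists>\<iota>1. immerses R D (proj (f s1 t1)) \<iota>1 \<and> f s1 t1 \<in> \<iota>1 ` U"
          unfolding fp[OF h(3-5)] .
        with fu[OF h(3-5)] show "f s1 t1 \<in> E_plus R D U" unfolding E_plus_def by (intro CollectI conjI)
      qed (rule X)+
    qed
  qed
  have "(\<lambda>(s, t). f s t) ` topspace ?T \<subseteq> topspace universal_topology"
    unfolding tF topspace_universal using fu by auto
  moreover have "openin ?T ((\<lambda>(s, t). f s t) -` W \<inter> topspace ?T)"
    if "W \<in> {{e \<in> universal. proj e \<in> W} |W. openin moduli_topology W} \<union>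
      {E_plus R D U |R D U. R \<in> moduli \<and> closed_disk (surface_over R) D \<and>
         openin (top_of (surface_over R)) U \<and> U \<subseteq> top_of (surface_over R) interior_of D}" for W
    using that unfolding eq
  proof
    assume "W \<in> {{e \<in> universal. proj e \<in> W} |W. openin moduli_topology W}"
    then obtain V where V: "W = {e \<in> universal. proj e \<in> V}" "openin moduli_topology V" by (elim CollectE exE conjE)
    show "openin ?T {(s, t). s \<in> universal \<and> t \<in> universal \<and> Z s t \<and> f s t \<in> W}" unfolding V(1) by (rule pr[OF V(2)])
  next
    assume "W \<in> {E_plus R D U |R D U. R \<in> moduli \<and> closed_disk (surface_over R) D \<and>
         openin (top_of (surface_over R)) U \<and> U \<subseteq> top_of (surface_over R) interior_of D}"
    then obtain R D U where V: "W = E_plus R D U" "R \<in> moduli" "closed_disk (surface_over R) D"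
      "openin (top_of (surface_over R)) U" "U \<subseteq> top_of (surface_over R) interior_of D" by (elim CollectE exE conjE)
    show "openin ?T {(s, t). s \<in> universal \<and> t \<in> universal \<and> Z s t \<and> f s t \<in> W}" unfolding V(1) by (rule pl[OF V(2-5)])
  qed
  ultimately show ?thesis
    unfolding universal_topology_def continuous_on_generated_topo_iff topology_generated_by_topspace by blast
qed

lemma continuous_map_proj: "continuous_map universal_topology moduli_topology proj"
  unfolding continuous_map_alt
proof (intro conjI allI impI)
  fix W assume "openin moduli_topology W"
  then show "openin universal_topology (proj -` W \<inter> topspace universal_topology)"
    unfolding topspace_universal using openin_proj[of W] by (simp add: Collect_conj_eq Int_commute vimage_def)
qed (use proj_moduli topspace_universal topspace_moduli in auto)

theorem theorem11:
  shows "continuous_map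
           (subtopology (prod_topology universal_topology universal_topology)
              {(s, s'). s \<in> universal \<and> s' \<in> universal \<and> proj s = proj s'})
           universal_topology
           (\<lambda>(s, s'). basepoint_change s s')
       \<and> continuous_map
           (subtopology (prod_topology universal_topology universal_topology)
              {(s, t). s \<in> universal \<and> t \<in> universal \<and> proj t = relocate s})
           universal_topology
           (\<lambda>(s, t). basepoint_change_inv s t)"
proof
  have bc: "basepoint_change s s' \<in> universal" "proj (basepoint_change s s') = relocate s"
    if "s \<in> universal" "s' \<in> universal" "proj s = proj s'" for s s'
  proof -
    have "s' \<in> fiber (proj s)" using that unfolding fiber_def by simp
    then have "basepoint_change s s' \<in> fiber (relocate s)"
      by (rule bij_betw_apply[OF basepoint_change_bij[OF that(1)]])
    then show "basepoint_change s s' \<in> universal" "proj (basepoint_change s s') = relocate s"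
      unfolding fiber_def by simp_all
  qed
  show "continuous_map
           (subtopology (prod_topology universal_topology universal_topology)
              {(s, s'). s \<in> universal \<and> s' \<in> universal \<and> proj s = proj s'})
           universal_topology
           (\<lambda>(s, s'). basepoint_change s s')"
  proof (rule continuous_map_fibered_product[OF bc continuous_map_relocate])
    fix s s' R D U \<iota> assume s: "s \<in> universal" "s' \<in> universal" "proj s = proj s'"
      and R: "R \<in> moduli" and D: "closed_disk (surface_over R) D"
      and U: "openin (top_of (surface_over R)) U" "U \<subseteq> D"
      and i: "immerses R D (relocate s) \<iota>" "basepoint_change s s' \<in> \<iota> ` U"
    obtain \<iota>0 where i0: "is_immersion (surface_over R) D ((surface_over (proj s))\<lparr>basept := s\<rparr>) (points (surface_over (proj s))) \<iota>0"
      "\<And>x. x \<in> D \<Longrightarrow> \<iota> x = basepoint_change s (\<iota>0 x)" using immerses_relocateE[OF s(1) i(1)] by blast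
    have "s' \<in> points (surface_over (proj s))" using universal_point[OF s(2)] s(3) by simp
    then have "s' \<in> \<iota>0 ` U" using basepoint_change_image_iff[OF s(1) _ i0 U(2)] i(2) by blast
    from relocate_plus[OF s(1,2) s(3)[symmetric] R D U i0(1) this] obtain X X' where X: "openin universal_topology X" "s \<in> X"
      "openin universal_topology X'" "s' \<in> X'"
      "\<And>s1 s1'. s1 \<in> X \<Longrightarrow> s1' \<in> X' \<Longrightarrow> proj s1' = proj s1 \<Longrightarrow>
        \<exists>\<iota>1. is_immersion (surface_over R) D ((surface_over (proj s1))\<lparr>basept := s1\<rparr>) (points (surface_over (proj s1))) \<iota>1 \<and>
          s1' \<in> \<iota>1 ` U" by blast
    have key: "\<exists>\<iota>1. immerses R D (relocate s1) \<iota>1 \<and> basepoint_change s1 t1 \<in> \<iota>1 ` U"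
      if h: "s1 \<in> X" "t1 \<in> X'" "s1 \<in> universal" "proj s1 = proj t1" for s1 t1
    proof -
      obtain \<iota>1 where i1: "is_immersion (surface_over R) D ((surface_over (proj s1))\<lparr>basept := s1\<rparr>) (points (surface_over (proj s1))) \<iota>1"
        "t1 \<in> \<iota>1 ` U" using X(5)[OF h(1,2) h(4)[symmetric]] by blast
      have "basepoint_change s1 t1 \<in> (\<lambda>x. basepoint_change s1 (\<iota>1 x)) ` U" using i1(2) by blast
      then show ?thesis using immerses_relocate[OF h(3) i1(1)] by blast
    qed
    show "\<exists>X Y. openin universal_topology X \<and> s \<in> X \<and> openin universal_topology Y \<and> s' \<in> Y \<and>
      (\<forall>s1\<in>X. \<forall>t1\<in>Y. s1 \<in> universal \<longrightarrow> t1 \<in> universal \<longrightarrow> proj s1 = proj t1 \<longrightarrow>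
         (\<exists>\<iota>1. immerses R D (relocate s1) \<iota>1 \<and> basepoint_change s1 t1 \<in> \<iota>1 ` U))"
    proof (rule exI[of _ X], rule exI[of _ X'], intro conjI ballI impI)
      fix s1 t1 assume h: "s1 \<in> X" "t1 \<in> X'" "s1 \<in> universal" "t1 \<in> universal" "proj s1 = proj t1"
      show "\<exists>\<iota>1. immerses R D (relocate s1) \<iota>1 \<and> basepoint_change s1 t1 \<in> \<iota>1 ` U" by (rule key[OF h(1,2,3,5)])
    qed (rule X)+
  qed
  have bi: "basepoint_change_inv s t \<in> universal" "proj (basepoint_change_inv s t) = proj s"
      "basepoint_change s (basepoint_change_inv s t) = t"
    if "s \<in> universal" "t \<in> universal" "proj t = relocate s" for s t
  proof -
    have t: "t \<in> basepoint_change s ` fiber (proj s)"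
      using that basepoint_change_bij[OF that(1)] unfolding bij_betw_def by (simp add: fiber_def)
    show "basepoint_change s (basepoint_change_inv s t) = t"
      unfolding basepoint_change_inv_def by (rule f_inv_into_f[OF t])
    have "basepoint_change_inv s t \<in> fiber (proj s)"
      unfolding basepoint_change_inv_def by (rule inv_into_into[OF t])
    then show "basepoint_change_inv s t \<in> universal" "proj (basepoint_change_inv s t) = proj s"
      unfolding fiber_def by simp_all
  qed
  show "continuous_map
           (subtopology (prod_topology universal_topology universal_topology)
              {(s, t). s \<in> universal \<and> t \<in> universal \<and> proj t = relocate s})
           universal_topology
           (\<lambda>(s, t). basepoint_change_inv s t)"
  proof (rule continuous_map_fibered_product[OF bi(1,2) continuous_map_proj])
    fix s t R D U \<iota> assume s: "s \<in> universal" "t \<in> universal" "proj t = relocate s"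
      and R: "R \<in> moduli" and D: "closed_disk (surface_over R) D"
      and U: "openin (top_of (surface_over R)) U" "U \<subseteq> D"
      and i: "immerses R D (proj s) \<iota>" "basepoint_change_inv s t \<in> \<iota> ` U"
    from unrelocate_plus[OF s R D U i bi(3)[OF s]] obtain X X' where X: "openin universal_topology X" "s \<in> X"
      "openin universal_topology X'" "t \<in> X'"
      "\<And>s1 t1 t1'. s1 \<in> X \<Longrightarrow> t1 \<in> X' \<Longrightarrow> proj t1 = relocate s1 \<Longrightarrow> t1' \<in> points (surface_over (proj s1)) \<Longrightarrow>
        basepoint_change s1 t1' = t1 \<Longrightarrow> \<exists>\<iota>1. immerses R D (proj s1) \<iota>1 \<and> t1' \<in> \<iota>1 ` U" by blast
    have key: "\<exists>\<iota>1. immerses R D (proj s1) \<iota>1 \<and> basepoint_change_inv s1 t1 \<in> \<iota>1 ` U"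
      if h: "s1 \<in> X" "t1 \<in> X'" "s1 \<in> universal" "t1 \<in> universal" "proj t1 = relocate s1" for s1 t1
    proof -
      have "basepoint_change_inv s1 t1 \<in> points (surface_over (proj s1))"
        using universal_point[OF bi(1)[OF h(3-5)]] bi(2)[OF h(3-5)] by simp
      from X(5)[OF h(1,2,5) this bi(3)[OF h(3-5)]] show ?thesis .
    qed
    show "\<exists>X Y. openin universal_topology X \<and> s \<in> X \<and> openin universal_topology Y \<and> t \<in> Y \<and>
      (\<forall>s1\<in>X. \<forall>t1\<in>Y. s1 \<in> universal \<longrightarrow> t1 \<in> universal \<longrightarrow> proj t1 = relocate s1 \<longrightarrow>
         (\<exists>\<iota>1. immerses R D (proj s1) \<iota>1 \<and> basepoint_change_inv s1 t1 \<in> \<iota>1 ` U))"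
    proof (rule exI[of _ X], rule exI[of _ X'], intro conjI ballI impI)
      fix s1 t1 assume h: "s1 \<in> X" "t1 \<in> X'" "s1 \<in> universal" "t1 \<in> universal" "proj t1 = relocate s1"
      show "\<exists>\<iota>1. immerses R D (proj s1) \<iota>1 \<and> basepoint_change_inv s1 t1 \<in> \<iota>1 ` U" by (rule key[OF h])
    qed (rule X)+
  qed
qed

end
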